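(* Let $\psi,\psi_1,\psi_2,\ldots\in\Psi$ with pseudo-inverses $\varphi,\varphi_1,\varphi_2,\ldots$, let $A,A_1,A_2,\ldots\in\mathcal{A}\setminus\{A_M\}$, let $C_{\psi,A},C_{\psi_1,A_1},C_{\psi_2,A_2},\ldots\in\mathcal{C}_{am}$ be the corresponding Archimax copulas, and let $\tau_A,\tau_{A_1},\tau_{A_2},\ldots$ be the Kendall's $\tau$s of the extreme-value copulas $C_A,C_{A_1},C_{A_2},\ldots$. Then the following assertions are equivalent: (i) $(\psi_n)_{1-\tau_{A_n}}\to(\psi)_{1-\tau_A}$ uniformly on $[0,\infty)$ and $(A_n)_{1-\tau_{A_n}}\to(A)_{1-\tau_A}$ uniformly on $\mathbb{I}$ as $n\to\infty$; (ii) $(\varphi_n)_{1-\tau_{A_n}}\to(\varphi)_{1-\tau_A}$ pointwise on $(0,1]$ and $(A_n)_{1-\tau_{A_n}}\to(A)_{1-\tau_A}$ uniformly on $\mathbb{I}$; (iii) $d_\infty(C_{\psi_n,A_n},C_{\psi,A})\to0$; (iv) $D_p(C_{\psi_n,A_n},C_{\psi,A})\to0$ for every $p\in[1,\infty]$; (v) $C_{\psi_n,A_n}\to C_{\psi,A}$ weakly conditional.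
   Context: Write $\mathbb{I}=[0,1]$, $\lambda,\lambda_2$ for Lebesgue measure on $\mathbb{I},\mathbb{I}^2$. $\Psi$ denotes the set of convex normalized (Archimedean) generators: continuous, non-increasing, convex $\psi:[0,\infty)\to\mathbb{I}$ with $\psi(0)=1$, $\lim_{z\to\infty}\psi(z)=0$, $\psi$ strictly decreasing on $[0,\inf\{x:\psi(x)=0\})$ (with $\inf\emptyset=\infty$), and $\psi(1)=\frac12$. The pseudo-inverse of $\psi$ is $\varphi:\mathbb{I}\to[0,\infty]$, $\varphi(y)=\inf\{z\in[0,\infty]:\psi(z)=y\}$ (with $\psi(\infty)=0$). $\mathcal{A}$ denotes the set of Pickands dependence functions, i.e. convex $A:\mathbb{I}\to\mathbb{I}$ with $\max\{1-x,x\}\le A(x)\le1$ for all $x$; $A_M(t)=\max\{t,1-t\}$. The extreme-value copula of $A$ is $C_A(x,y)=(xy)^{A(\log x/\log(xy))}$ on $(0,1)^2$, extended continuously to a copula on $\mathbb{I}^2$. Kendall's $\tau$ of a copula $C$ with associated measure $\mu_C$ is $\tau(C)=4\int_{\mathbb{I}^2}C\,d\mu_C-1$; $\tau_A:=\tau(C_A)\in[0,1]$, and $\tau_A<1$ if $A\ne A_M$. For $\psi\in\Psi$ with pseudo-inverse $\varphi$ and $A\in\mathcal{A}$ the Archimax copula $C_{\psi,A}$ is given by $C_{\psi,A}(x,y)=\psi\big((\varphi(x)+\varphi(y))A\big(\frac{\varphi(x)}{\varphi(x)+\varphi(y)}\big)\big)$ on $(0,1)^2$, extended continuously to a copula on $\mathbb{I}^2$;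 $\mathcal{C}_{am}$ is the class of all Archimax copulas. For $\alpha\in(0,\infty)$: $(\psi)_\alpha(z):=\psi(z^\alpha)$ for $z\in[0,\infty)$, $(\varphi)_\alpha(x):=\varphi(x)^{1/\alpha}$ for $x\in\mathbb{I}$, and $(A)_\alpha(t):=(t^\alpha+(1-t)^\alpha)^{1/\alpha}\Big[A\Big(\frac{t^\alpha}{t^\alpha+(1-t)^\alpha}\Big)\Big]^{1/\alpha}$ for $t\in\mathbb{I}$. For a copula $C$ and $(X,Y)\sim C$, $K_C(x,E)$ denotes (a version of) the regular conditional distribution (Markov kernel) of $Y$ given $X=x$. For bivariate copulas: $d_\infty(C_1,C_2)=\max_{\mathbb{I}^2}|C_1-C_2|$; $D_p(C_1,C_2)=\big(\int_{\mathbb{I}^2}|K_{C_1}(x,[0,y])-K_{C_2}(x,[0,y])|^p\,d\lambda_2(x,y)\big)^{1/p}$ for $p\in[1,\infty)$ and $D_\infty(C_1,C_2)=\sup_{y\in\mathbb{I}}\int_{\mathbb{I}}|K_{C_1}(x,[0,y])-K_{C_2}(x,[0,y])|\,d\lambda(x)$. A sequence $(C_n)$ of copulas converges weakly conditional to $C$ if there is a Borel set $\Lambda\subseteq\mathbb{I}$ with $\lambda(\Lambda)=1$ such that for every $x\in\Lambda$ the probability measures $K_{C_n}(x,\cdot)$ converge weakly to $K_C(x,\cdot)$. *)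

theory Defs
  imports "HOL-Probability.Probability"
begin

text \<open>
  Functions on the unit interval, on its square or on \<open>[0,\<infinity>)\<close> are total functions on the
  reals whose values elsewhere are never used.
\<close>

section \<open>Generators, Pickands dependence functions, Archimax copulas\<close>

definition generator :: "(real \<Rightarrow> real) \<Rightarrow> bool" where
  "generator \<psi> \<longleftrightarrow>
     \<psi> ` {0..} \<subseteq> {0..1} \<and>
     continuous_on {0..} \<psi> \<and> antimono_on {0..} \<psi> \<and> convex_on {0..} \<psi> \<and>
     \<psi> 0 = 1 \<and> (\<psi> \<longlongrightarrow> 0) at_top \<and>
     strict_antimono_on {z. 0 \<le> z \<and> ereal z < Inf (ereal ` {x. 0 \<le> x \<and> \<psi> x = 0})} \<psi> \<and>
     \<psi> 1 = 1 / 2"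

text \<open>The extension of \<open>\<psi>\<close> to \<open>[0,\<infinity>]\<close> by \<open>\<psi>(\<infinity>) = 0\<close>.\<close>

definition gen_ext :: "(real \<Rightarrow> real) \<Rightarrow> ennreal \<Rightarrow> real" where
  "gen_ext \<psi> z = (if z = \<infinity> then 0 else \<psi> (enn2real z))"

definition pseudo_inv :: "(real \<Rightarrow> real) \<Rightarrow> real \<Rightarrow> ennreal" where
  "pseudo_inv \<psi> y = Inf {z. gen_ext \<psi> z = y}"

definition pickands :: "(real \<Rightarrow> real) \<Rightarrow> bool" where
  "pickands A \<longleftrightarrow>
     convex_on {0..1} A \<and> (\<forall>x\<in>{0..1}. max (1 - x) x \<le> A x \<and> A x \<le> 1)"

definition pickands_M :: "real \<Rightarrow> real" where
  "pickands_M t = max t (1 - t)"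

text \<open>
  On the boundary of the unit square every copula takes the value \<open>min x y\<close>, so this is the
  only possible extension of the formulas on the open square to a copula.
\<close>

definition ev_copula :: "(real \<Rightarrow> real) \<Rightarrow> real \<Rightarrow> real \<Rightarrow> real" where
  "ev_copula A x y =
     (if 0 < x \<and> x < 1 \<and> 0 < y \<and> y < 1
      then (x * y) powr A (ln x / ln (x * y))
      else min x y)"

text \<open>For a generator, \<open>pseudo_inv \<psi> x\<close> is finite and positive for \<open>0 < x < 1\<close>.\<close>

definition archimax :: "(real \<Rightarrow> real) \<Rightarrow> (real \<Rightarrow> real) \<Rightarrow> real \<Rightarrow> real \<Rightarrow> real" where
  "archimax \<psi> A x y =
     (if 0 < x \<and> x < 1 \<and> 0 < y \<and> y < 1
      then let s = enn2real (pseudo_inv \<psi> x); t = enn2real (pseudo_inv \<psi> y)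
           in \<psi> ((s + t) * A (s / (s + t)))
      else min x y)"

definition gen_pow :: "real \<Rightarrow> (real \<Rightarrow> real) \<Rightarrow> real \<Rightarrow> real" where
  "gen_pow \<alpha> \<psi> z = \<psi> (z powr \<alpha>)"

definition inv_pow :: "real \<Rightarrow> (real \<Rightarrow> ennreal) \<Rightarrow> real \<Rightarrow> ennreal" where
  "inv_pow \<alpha> \<phi> x = (if \<phi> x = \<infinity> then \<infinity> else ennreal (enn2real (\<phi> x) powr (1 / \<alpha>)))"

definition pick_pow :: "real \<Rightarrow> (real \<Rightarrow> real) \<Rightarrow> real \<Rightarrow> real" where
  "pick_pow \<alpha> A t =
     (t powr \<alpha> + (1 - t) powr \<alpha>) powr (1 / \<alpha>) *
     A (t powr \<alpha> / (t powr \<alpha> + (1 - t) powr \<alpha>)) powr (1 / \<alpha>)"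

section \<open>Measure, Kendall's tau and Markov kernel of a copula\<close>

text \<open>
  The measure lives on the Borel sets of the plane; the values of \<open>C\<close> determine it, and it is
  concentrated on the unit square because \<open>C 1 1 = 1\<close>.
\<close>

definition copula_measure :: "(real \<Rightarrow> real \<Rightarrow> real) \<Rightarrow> (real \<times> real) measure" where
  "copula_measure C =
     (THE M. sets M = sets borel \<and> prob_space M \<and>
             (\<forall>x\<in>{0..1}. \<forall>y\<in>{0..1}. measure M ({0..x} \<times> {0..y}) = C x y))"

definition kendall_tau :: "(real \<Rightarrow> real \<Rightarrow> real) \<Rightarrow> real" where
  "kendall_tau C =
     4 * (LINT z:{0..1} \<times> {0..1}|copula_measure C. C (fst z) (snd z)) - 1"

text \<open>
  \<open>(X, Y)\<close> is realised by the projections on the plane under \<open>copula_measure C\<close>, so that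
  \<open>vimage_algebra UNIV fst borel\<close> is the sigma-algebra generated by \<open>X\<close>.
\<close>

definition is_markov_kernel :: "(real \<Rightarrow> real \<Rightarrow> real) \<Rightarrow> (real \<Rightarrow> real measure) \<Rightarrow> bool" where
  "is_markov_kernel C K \<longleftrightarrow>
     K \<in> restrict_space borel {0..1} \<rightarrow>\<^sub>M prob_algebra borel \<and>
     (\<forall>x\<in>{0..1}. measure (K x) {0..1} = 1) \<and>
     (\<forall>E\<in>sets borel. AE z in copula_measure C.
        measure (K (fst z)) E =
        real_cond_exp (copula_measure C) (vimage_algebra UNIV fst borel)
          (\<lambda>w. indicator E (snd w)) z)"

text \<open>
  An arbitrary version. Two versions agree for almost every \<open>x\<close>, hence the notions below do
  not depend on the choice.
\<close>

definition markov_kernel :: "(real \<Rightarrow> real \<Rightarrow> real) \<Rightarrow> real \<Rightarrow> real measure" where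
  "markov_kernel C = (SOME K. is_markov_kernel C K)"

section \<open>Modes of convergence\<close>

definition d_sup :: "(real \<Rightarrow> real \<Rightarrow> real) \<Rightarrow> (real \<Rightarrow> real \<Rightarrow> real) \<Rightarrow> real" where
  "d_sup C1 C2 = (SUP (x, y)\<in>{0..1} \<times> {0..1}. \<bar>C1 x y - C2 x y\<bar>)"

definition D_fin :: "real \<Rightarrow> (real \<Rightarrow> real \<Rightarrow> real) \<Rightarrow> (real \<Rightarrow> real \<Rightarrow> real) \<Rightarrow> real" where
  "D_fin p C1 C2 =
     (LINT z:{0..1} \<times> {0..1}|lborel.
        \<bar>measure (markov_kernel C1 (fst z)) {0..snd z}
          - measure (markov_kernel C2 (fst z)) {0..snd z}\<bar> powr p) powr (1 / p)"

definition D_inf :: "(real \<Rightarrow> real \<Rightarrow> real) \<Rightarrow> (real \<Rightarrow> real \<Rightarrow> real) \<Rightarrow> real" where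
  "D_inf C1 C2 =
     (SUP y\<in>{0..1}. LINT x:{0..1}|lborel.
        \<bar>measure (markov_kernel C1 x) {0..y} - measure (markov_kernel C2 x) {0..y}\<bar>)"

definition D_dist :: "ereal \<Rightarrow> (real \<Rightarrow> real \<Rightarrow> real) \<Rightarrow> (real \<Rightarrow> real \<Rightarrow> real) \<Rightarrow> real" where
  "D_dist p C1 C2 = (if p = \<infinity> then D_inf C1 C2 else D_fin (real_of_ereal p) C1 C2)"

definition weak_cond_conv ::
  "(nat \<Rightarrow> real \<Rightarrow> real \<Rightarrow> real) \<Rightarrow> (real \<Rightarrow> real \<Rightarrow> real) \<Rightarrow> bool" where
  "weak_cond_conv Cs C \<longleftrightarrow>
     (\<exists>\<Lambda>\<in>sets borel. \<Lambda> \<subseteq> {0..1} \<and> emeasure lborel \<Lambda> = 1 \<and>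
        (\<forall>x\<in>\<Lambda>. weak_conv_m (\<lambda>n. markov_kernel (Cs n) x) (markov_kernel C x)))"

end

theory Submission
  imports Defs
begin

text \<open>
  Let \<open>L(s, t) = (s + t) A(s / (s + t))\<close>, so that \<open>C(x, y) = \<psi>(L(\<phi> x, \<phi> y))\<close>. Replacing \<open>\<psi>\<close> by
  \<open>\<psi>(z\<^sup>\<alpha>)\<close> and \<open>L(s, t)\<close> by \<open>L(s\<^sup>\<alpha>, t\<^sup>\<alpha>)\<^bsup>1/\<alpha>\<^esup>\<close> does not change \<open>C\<close>; the choice \<open>\<alpha> = 1 - \<tau>\<^sub>A\<close> makes this
  representation continuous in \<open>C\<close>.

  To recover \<open>\<psi>\<close> from \<open>C\<close>, write the distribution function of \<open>C(X, Y)\<close> in polar coordinates: it is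
  \<open>c - \<alpha> \<phi>(c) \<psi>'(\<phi>(c))\<close>. Uniform convergence of the copulas gives convergence of these distribution
  functions, hence of the integrals of \<open>\<phi>' / (\<alpha> \<phi>)\<close>, that is, of \<open>ln \<phi> / \<alpha>\<close> up to a constant fixed by
  \<open>\<psi> 1 = 1 / 2\<close>. The limit of \<open>L\<close> is then read off from \<open>C\<close> at points where \<open>C \<ge> 1 / 2\<close>.

  Conversely, the conditional distribution function \<open>\<partial>C / \<partial>x\<close> is a product of slopes of convex functions
  of the normalised data (the normalised generator itself need not be convex, but it lies above the
  tangents inherited from \<open>\<psi>\<close>), and slopes converge wherever the limit is differentiable. For fixed \<open>y\<close>
  outside a countable set this fails only for countably many \<open>x\<close>.
\<close>

text \<open>The exponent \<open>1 - \<tau>\<close> enters through an identity without second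
  derivatives: the mean of \<open>min C z\<close> under the copula measure plus the integral of the
  product of both partial derivatives over \<open>{C < z}\<close> equals the integral of
  \<open>min x z\<close>. Singular parts of the measure are thus included. For an Archimax copula,
  \<open>x = \<psi> s\<close>, \<open>y = \<psi> t\<close> and polar coordinates split the double
  integral into \<open>pick_alpha A\<close> and the integral of \<open>- (phi * slope)\<close> below
  \<open>z\<close>. For \<open>\<psi> z = 2 powr (- z)\<close> and \<open>z = 1\<close> this reads
  \<open>pick_alpha A / 4 = 1 / 2 - (\<tau> + 1) / 4\<close>, so
  \<open>pick_alpha A = 1 - \<tau>\<close>; excluding \<open>pickands_M\<close> makes it positive.

  The obstacle is the lack of smoothness. \<open>\<psi>\<close> and \<open>A\<close> are merely
  convex, and a kink of \<open>\<psi>\<close> at \<open>phi \<psi> y\<close> can be met by a whole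
  interval of \<open>x\<close>. Hence derivatives are replaced by measurable subgradients, and the
  fundamental theorem of calculus is needed with countable exceptional sets. The kernel is an
  arbitrary version, known only up to null sets that depend on \<open>y\<close>; monotonicity in
  \<open>y\<close> and a countable dense set of levels remove this dependence.\<close>

section \<open>Calculus with countable exceptional sets\<close>

text \<open>If the bound fails, tilting \<open>f\<close> by a slope slightly above \<open>B\<close>
  gives \<open>g\<close> with \<open>g a < g b\<close>. The image of \<open>S\<close> under
  \<open>g\<close> is countable, so some level \<open>v\<close> strictly between avoids it. At the
  last point where \<open>g\<close> is at most \<open>v\<close> the derivative exists and is
  negative, which contradicts being last.\<close>

lemma increment_le_derivative_bound:
  fixes f h :: "real \<Rightarrow> real"
  assumes "a \<le> b" and cont: "continuous_on {a..b} f" and "countable S"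
    and deriv: "\<And>x. x \<in> {a<..<b} - S \<Longrightarrow> (f has_real_derivative h x) (at x)"
    and bound: "\<And>x. x \<in> {a<..<b} \<Longrightarrow> h x \<le> B"
  shows "f b - f a \<le> B * (b - a)"
proof (rule ccontr)
  assume neg: "\<not> f b - f a \<le> B * (b - a)"
  then have "a < b"
    using \<open>a \<le> b\<close> by (cases "a = b") auto
  have half: "X / (2 * d) * d = X / 2" if "d \<noteq> 0" for X d :: real
    using that by simp
  \<comment> \<open>Half of the excess mean slope: enough tilt to force a negative derivative,
    little enough to keep \<open>g a < g b\<close>.\<close>
  define e where "e = (f b - f a - B * (b - a)) / (2 * (b - a))"
  have "e > 0"
    using neg \<open>a < b\<close> by (auto simp: e_def field_simps)
  define g where "g x = f x - (B + e) * x" for x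
  have "e * (b - a) = (f b - f a - B * (b - a)) / 2"
    unfolding e_def using \<open>a < b\<close> half[of "b - a"] by simp
  then have "g b - g a = (f b - f a - B * (b - a)) / 2"
    by (simp add: g_def algebra_simps)
  then have "g a < g b"
    using neg by simp
  then have "uncountable {g a<..<g b}"
    by (rule uncountable_open_interval[THEN iffD2])
  then have "\<not> {g a<..<g b} \<subseteq> g ` S"
    using \<open>countable S\<close> countable_subset by blast
  then obtain v where "v \<in> {g a<..<g b}" and vS: "v \<notin> g ` S"
    by blast
  then have v: "g a < v" "v < g b"
    by auto
  have contg: "continuous_on {a..b} g"
    unfolding g_def by (intro continuous_intros cont)
  define X where "X = {x \<in> {a..b}. g x \<le> v}"
  have "closed X"
    unfolding X_def using contg by (intro continuous_on_closed_Collect_le[of "{a..b}" g "\<lambda>_. v"] continuous_intros) auto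
  have "a \<in> X"
    using v \<open>a < b\<close> by (auto simp: X_def)
  have "bdd_above X"
    by (auto simp: X_def bdd_above_def)
  define x0 where "x0 = Sup X"
  have "x0 \<in> X"
    unfolding x0_def using \<open>closed X\<close> \<open>a \<in> X\<close> \<open>bdd_above X\<close> by (intro closed_contains_Sup) auto
  have upper: "x \<le> x0" if "x \<in> X" for x
    unfolding x0_def using that \<open>bdd_above X\<close> by (rule cSup_upper)
  have x0: "a \<le> x0" "x0 \<le> b" "g x0 \<le> v"
    using \<open>x0 \<in> X\<close> by (auto simp: X_def)
  have "\<exists>x\<ge>x0. x \<le> b \<and> g x = v"
    using x0 v contg by (intro IVT') (auto intro: continuous_on_subset)
  then obtain x where x: "x0 \<le> x" "x \<le> b" "g x = v"
    by auto
  then have "x = x0"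
    using upper[of x] x0 by (auto simp: X_def)
  with x have gx0: "g x0 = v"
    by simp
  have "x0 \<in> {a<..<b} - S"
    using gx0 v vS x0 by (auto simp: less_le)
  then have "(g has_real_derivative h x0 - (B + e)) (at x0)"
    unfolding g_def by (auto intro!: derivative_eq_intros deriv)
  moreover have "h x0 - (B + e) < 0"
    using bound[of x0] \<open>x0 \<in> {a<..<b} - S\<close> \<open>e > 0\<close> by simp
  ultimately obtain d where d: "d > 0" "\<And>h. 0 < h \<Longrightarrow> h < d \<Longrightarrow> g x0 > g (x0 + h)"
    using DERIV_neg_dec_right by blast
  define k where "k = min (d / 2) (b - x0)"
  have k: "0 < k" "k < d" "x0 + k \<le> b"
    using d \<open>x0 \<in> {a<..<b} - S\<close> by (auto simp: k_def)
  then have "x0 + k \<in> X"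
    using d(2)[of k] gx0 x0 by (auto simp: X_def)
  then show False
    using upper[of "x0 + k"] k by simp
qed

text \<open>\<open>f\<close> is Lipschitz, so its difference quotients are dominated by
  \<open>B\<close>. Their integrals are differences of averages of \<open>f\<close> near the two
  ends and tend to \<open>f b - f a\<close>; pointwise they tend to \<open>h\<close> off a countable
  set.\<close>

lemma nn_integral_FTC_countable:
  fixes f h :: "real \<Rightarrow> real"
  assumes "a \<le> b" and cont: "continuous_on {a..b} f" and "countable S"
    and deriv: "\<And>x. x \<in> {a<..<b} - S \<Longrightarrow> (f has_real_derivative h x) (at x)"
    and bound: "\<And>x. x \<in> {a<..<b} \<Longrightarrow> 0 \<le> h x \<and> h x \<le> B"
    and [measurable]: "h \<in> borel_measurable borel"
  shows "(\<integral>\<^sup>+x. ennreal (h x) * indicator {a..b} x \<partial>lborel) = ennreal (f b - f a)"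
proof (cases "a < b")
  case False
  with \<open>a \<le> b\<close> have "a = b" by simp
  have "(\<integral>\<^sup>+x. ennreal (h x) * indicator {b..b} x \<partial>lborel) = 0"
    by (intro nn_integral_null_set) (simp add: null_sets_def)
  then show ?thesis
    using \<open>a = b\<close> by (simp del: atLeastAtMost_singleton)
next
  case True
  \<comment> \<open>Constant continuation makes forward difference quotients available at the right
    end without changing \<open>f\<close> on the interval.\<close>
  define F where "F x = f (max a (min b x))" for x
  have incr: "0 \<le> f y - f x \<and> f y - f x \<le> B * (y - x)" if "a \<le> x" "x \<le> y" "y \<le> b" for x y
  proof
    have c: "continuous_on {x..y} f"
      using cont that by (auto intro: continuous_on_subset)
    show "f y - f x \<le> B * (y - x)"
      using that deriv bound
      by (intro increment_le_derivative_bound[OF _ c \<open>countable S\<close>, where h = h]) auto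
    have "- f y - (- f x) \<le> 0 * (y - x)"
    proof (rule increment_le_derivative_bound[OF _ _ \<open>countable S\<close>, where h = "\<lambda>x. - h x"])
      show "((\<lambda>x. - f x) has_real_derivative - h z) (at z)" if "z \<in> {x<..<y} - S" for z
        using that \<open>a \<le> x\<close> \<open>y \<le> b\<close> by (intro DERIV_minus deriv) auto
    qed (use that bound in \<open>auto intro: continuous_on_minus c\<close>)
    then show "0 \<le> f y - f x" by simp
  qed
  have "0 \<le> B"
    using bound[of "(a + b) / 2"] True by auto
  have incrF: "0 \<le> F y - F x \<and> F y - F x \<le> B * (y - x)" if "x \<le> y" for x y
  proof -
    have "max a (min b x) \<le> max a (min b y)" "max a (min b y) - max a (min b x) \<le> y - x"
      using that \<open>a \<le> b\<close> by auto
    moreover have "B * (max a (min b y) - max a (min b x)) \<le> B * (y - x)"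
      using calculation \<open>0 \<le> B\<close> by (intro mult_left_mono)
    ultimately show ?thesis
      unfolding F_def using incr[of "max a (min b x)" "max a (min b y)"] \<open>a \<le> b\<close> by linarith
  qed
  have contF: "continuous_on UNIV F"
    unfolding F_def using \<open>a \<le> b\<close>
    by (intro continuous_on_compose2[OF cont]) (auto intro!: continuous_intros)
  have [measurable]: "F \<in> borel_measurable borel"
    using contF by (rule borel_measurable_continuous_onI)
  \<comment> \<open>The primitive starts at \<open>a - 1\<close> so that it is differentiable from
    both sides at \<open>a\<close>; steps \<open>\<delta> n \<le> 1\<close> beyond \<open>b\<close>
    stay inside the upper limit \<open>b + 2\<close>.\<close>
  define P where "P y = integral {a - 1..y} F" for y
  have P: "(P has_real_derivative F x) (at x)" if "a - 1 < x" "x < b + 2" for x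
  proof -
    have "(P has_vector_derivative F x) (at x within {a - 1..b + 2})"
      unfolding P_def using that
      by (intro integral_has_vector_derivative continuous_on_subset[OF contF]) auto
    moreover have "at x within {a - 1..b + 2} = at x"
      using that by (intro at_within_interior) auto
    ultimately show ?thesis
      by (simp add: has_real_derivative_iff_has_vector_derivative)
  qed
  define \<delta> where "\<delta> n = 1 / (real n + 1)" for n :: nat
  have \<delta>: "0 < \<delta> n" "\<delta> n \<le> 1" for n
    by (auto simp: \<delta>_def)
  have \<delta>0: "filterlim \<delta> (at 0) sequentially"
  proof -
    have "\<delta> \<longlonglongrightarrow> 0"
      unfolding \<delta>_def using LIMSEQ_inverse_real_of_nat by (simp add: inverse_eq_divide add.commute)
    then show ?thesis
      using \<delta>(1) by (intro filterlim_atI always_eventually) (auto simp: less_imp_neq[symmetric])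
  qed
  define s where "s n x = (F (x + \<delta> n) - F x) / \<delta> n" for n x
  have [measurable]: "s n \<in> borel_measurable borel" for n
    unfolding s_def by measurable
  have s_bound: "0 \<le> s n x" "s n x \<le> B" for n x
    using incrF[of x "x + \<delta> n"] \<delta>(1)[of n] by (auto simp: s_def field_simps)
  have int_s: "(\<integral>x. s n x * indicator {a..b} x \<partial>lborel)
      = (P (b + \<delta> n) - P b) / \<delta> n - (P (a + \<delta> n) - P a) / \<delta> n" for n
  proof (rule integral_FTC_Icc_real[OF \<open>a \<le> b\<close>])
    fix x assume x: "a \<le> x" "x \<le> b"
    have "((\<lambda>x. P (x + \<delta> n)) has_real_derivative F (x + \<delta> n)) (at x)"
      using P[of "x + \<delta> n"] x \<delta>[of n] by (simp add: DERIV_shift)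
    then show "((\<lambda>x. (P (x + \<delta> n) - P x) / \<delta> n) has_real_derivative s n x) (at x)"
      unfolding s_def using P[of x] x by (intro DERIV_cdivide DERIV_diff) auto
    have "isCont F y" for y
      using contF by (simp add: continuous_on_eq_continuous_at)
    then have "isCont (\<lambda>x. F (x + \<delta> n)) x"
      by (rule isCont_o2[of x "\<lambda>x. x + \<delta> n" F, rotated]) simp
    then show "isCont (s n) x"
      unfolding s_def using \<open>\<And>y. isCont F y\<close> \<delta>(1)[of n] by (intro continuous_divide continuous_diff) auto
  qed
  have Flim: "(\<lambda>n. (P (x + \<delta> n) - P x) / \<delta> n) \<longlonglongrightarrow> F x" if "a \<le> x" "x \<le> b" for x
    using filterlim_compose[OF P[of x, unfolded DERIV_def] \<delta>0] that by simp
  have lim1: "(\<lambda>n. \<integral>x. s n x * indicator {a..b} x \<partial>lborel) \<longlonglongrightarrow> F b - F a"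
    unfolding int_s using \<open>a \<le> b\<close> by (intro tendsto_diff Flim) auto
  have AEs: "AE x in lborel. x \<notin> insert a (insert b S)"
    using \<open>countable S\<close> by (intro AE_not_in countable_imp_null_set_lborel) auto
  \<comment> \<open>Nothing is known about \<open>h\<close> at the two ends, so it is cut to the
    open interval.\<close>
  define g where "g x = h x * indicator {a<..<b} x" for x :: real
  have [measurable]: "g \<in> borel_measurable borel"
    unfolding g_def by measurable
  have lim2: "(\<lambda>n. \<integral>x. s n x * indicator {a..b} x \<partial>lborel) \<longlonglongrightarrow> (\<integral>x. g x \<partial>lborel)"
  proof (rule integral_dominated_convergence[where w = "\<lambda>x. B * indicator {a..b} x"])
    show "integrable lborel (\<lambda>x. B * indicator {a..b} x)"
      using \<open>a \<le> b\<close> by (intro integrable_mult_right integrable_real_indicator) simp_all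
    show "AE x in lborel. (\<lambda>n. s n x * indicator {a..b} x) \<longlonglongrightarrow> g x"
    proof (rule AE_mp[OF AEs], rule AE_I2, rule impI)
      fix x assume x: "x \<notin> insert a (insert b S)"
      show "(\<lambda>n. s n x * indicator {a..b} x) \<longlonglongrightarrow> g x"
      proof (cases "x \<in> {a<..<b}")
        case False
        then show ?thesis
          using x by (auto simp: g_def indicator_def)
      next
        case True
        have "(F has_real_derivative h x) (at x)"
        proof (rule has_field_derivative_transform_within_open[where S = "{a<..<b}"])
          show "(f has_real_derivative h x) (at x)"
            using x True by (intro deriv) auto
        qed (use True in \<open>auto simp: F_def max_def min_def\<close>)
        then have "(\<lambda>n. s n x) \<longlonglongrightarrow> h x"
          unfolding s_def DERIV_def by (rule filterlim_compose[OF _ \<delta>0])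
        then show ?thesis
          using True by (simp add: g_def)
      qed
    qed
    show "AE x in lborel. norm (s n x * indicator {a..b} x) \<le> B * indicator {a..b} x" for n
      using s_bound by (intro AE_I2) (auto simp: indicator_def)
  qed measurable
  have eq: "(\<integral>x. g x \<partial>lborel) = f b - f a"
    using LIMSEQ_unique[OF lim1 lim2] \<open>a \<le> b\<close> by (simp add: F_def)
  have "integrable lborel g"
  proof (rule Bochner_Integration.integrable_bound)
    show "integrable lborel (\<lambda>x. B * indicator {a..b} x)"
      using \<open>a \<le> b\<close> by (intro integrable_mult_right integrable_real_indicator) simp_all
    show "AE x in lborel. norm (g x) \<le> norm (B * indicator {a..b} x)"
      using bound \<open>0 \<le> B\<close> by (intro AE_I2) (auto simp: g_def indicator_def abs_le_iff)
  qed measurable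
  moreover have "0 \<le> g x" for x
    using bound by (simp add: g_def indicator_def)
  ultimately have "(\<integral>\<^sup>+x. ennreal (g x) \<partial>lborel) = ennreal (f b - f a)"
    unfolding eq[symmetric] by (intro nn_integral_eq_integral AE_I2)
  moreover have "(\<integral>\<^sup>+x. ennreal (g x) \<partial>lborel) = (\<integral>\<^sup>+x. ennreal (h x) * indicator {a..b} x \<partial>lborel)"
    by (intro nn_integral_cong_AE, rule AE_mp[OF AEs]) (auto simp: g_def indicator_def)
  ultimately show ?thesis by simp
qed

section \<open>Subgradients and their convergence\<close>

text \<open>Supporting lines at points of \<open>I\<close>, tested on \<open>J\<close>. The two sets
  are kept apart because a generator is given slopes only at positive arguments, while their lines
  must also be compared at 0.\<close>

definition subgrad :: "real set \<Rightarrow> real set \<Rightarrow> (real \<Rightarrow> real) \<Rightarrow> (real \<Rightarrow> real) \<Rightarrow> bool" where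
  "subgrad I J f c \<longleftrightarrow> (\<forall>x\<in>I. \<forall>y\<in>J. f x + c x * (y - x) \<le> f y)"

lemma subgradD: "subgrad I J f c \<Longrightarrow> x \<in> I \<Longrightarrow> y \<in> J \<Longrightarrow> f x + c x * (y - x) \<le> f y"
  by (simp add: subgrad_def)

lemma subgrad_subset: "subgrad I J f c \<Longrightarrow> I' \<subseteq> I \<Longrightarrow> J' \<subseteq> J \<Longrightarrow> subgrad I' J' f c"
  by (auto simp: subgrad_def)

lemma convex_on_subgrad:
  assumes "convex_on {0..} f"
  shows "\<exists>c. subgrad {0<..} {0..} f c"
proof -
  let ?c = "\<lambda>x. Inf ((\<lambda>t. (f x - f t) / (x - t)) ` ({x<..} \<inter> {0..}))"
  have "f x + ?c x * (y - x) \<le> f y" if "x \<in> {0<..}" "y \<in> {0..}" for x y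
    using that by (intro convex_le_Inf_differential[OF assms]) auto
  then have "subgrad {0<..} {0..} f ?c"
    by (simp add: subgrad_def)
  then show ?thesis
    by (rule exI[where x = ?c])
qed

lemma subgrad_mono:
  assumes "subgrad I I f c"
  shows "mono_on I c"
proof (rule mono_onI)
  fix x y assume xy: "x \<in> I" "y \<in> I" "x \<le> y"
  have "(c x - c y) * (y - x) \<le> 0"
    using subgradD[OF assms xy(1,2)] subgradD[OF assms xy(2,1)] by (simp add: algebra_simps)
  then show "c x \<le> c y"
    using xy by (cases "x = y") (auto simp: mult_le_0_iff)
qed

text \<open>The supporting lines at \<open>x\<close> and at \<open>y\<close> trap the difference
  quotient between \<open>c x\<close> and \<open>c y\<close>, whichever side \<open>y\<close> is on;
  continuity of \<open>c\<close> then squeezes it.\<close>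

lemma subgrad_deriv_at_cont:
  assumes sg: "subgrad I I f c" and "open I" "x \<in> I" and cont: "isCont c x"
  shows "(f has_real_derivative c x) (at x)"
  unfolding has_field_derivative_iff
proof (rule tendsto_sandwich)
  have ev: "\<forall>\<^sub>F y in at x. y \<in> I"
    using \<open>open I\<close> \<open>x \<in> I\<close> by (rule eventually_at_in_open')
  have *: "min (c x) (c y) \<le> (f y - f x) / (y - x) \<and> (f y - f x) / (y - x) \<le> max (c x) (c y)"
    if "y \<in> I" "y \<noteq> x" for y
  proof -
    have 1: "c x * (y - x) \<le> f y - f x" "f y - f x \<le> c y * (y - x)"
      using subgradD[OF sg \<open>x \<in> I\<close> \<open>y \<in> I\<close>] subgradD[OF sg \<open>y \<in> I\<close> \<open>x \<in> I\<close>] by (simp_all add: algebra_simps)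
    show ?thesis
    proof (cases "x < y")
      case True
      then have "c x \<le> (f y - f x) / (y - x)" "(f y - f x) / (y - x) \<le> c y"
        using 1 by (simp_all add: field_simps)
      then show ?thesis by auto
    next
      case False
      then have "c y \<le> (f y - f x) / (y - x)" "(f y - f x) / (y - x) \<le> c x"
        using 1 that by (simp_all add: field_simps)
      then show ?thesis by auto
    qed
  qed
  show "\<forall>\<^sub>F y in at x. min (c x) (c y) \<le> (f y - f x) / (y - x)"
    using ev eventually_neq_at_within[of x x UNIV] by eventually_elim (use * in blast)
  show "\<forall>\<^sub>F y in at x. (f y - f x) / (y - x) \<le> max (c x) (c y)"
    using ev eventually_neq_at_within[of x x UNIV] by eventually_elim (use * in blast)
  have c: "(c \<longlongrightarrow> c x) (at x)"
    using cont by (simp add: isCont_def)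
  show "((\<lambda>y. min (c x) (c y)) \<longlongrightarrow> c x) (at x)" "((\<lambda>y. max (c x) (c y)) \<longlongrightarrow> c x) (at x)"
    using tendsto_min[OF tendsto_const c, of "c x"] tendsto_max[OF tendsto_const c, of "c x"] by simp_all
qed

text \<open>A subgradient is monotone, hence has only countably many discontinuities.\<close>

lemma subgrad_deriv_countable:
  assumes "subgrad I I f c" and "open I"
  shows "\<exists>S. countable S \<and> S \<subseteq> I \<and> (\<forall>x\<in>I - S. (f has_real_derivative c x) (at x))"
proof (intro exI conjI ballI)
  show "countable {x\<in>I. \<not> isCont c x}"
    by (intro mono_on_ctble_discont_open subgrad_mono[OF assms(1)] \<open>open I\<close>)
  show "(f has_real_derivative c x) (at x)" if "x \<in> I - {x\<in>I. \<not> isCont c x}" for x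
    using that assms by (intro subgrad_deriv_at_cont) auto
qed auto

text \<open>Only the supporting line at \<open>xs n\<close> is used, which suits normalised
  generators that are not convex. Tested at a fixed \<open>y\<close> on either side of
  \<open>x\<close>, the line bounds \<open>cs n\<close> by a chord slope, and chord slopes of the
  limit near \<open>x\<close> are close to \<open>d\<close>.\<close>

lemma subgrad_converge:
  fixes f :: "real \<Rightarrow> real" and fs :: "nat \<Rightarrow> real \<Rightarrow> real"
  assumes "open I" "x \<in> I" and deriv: "(f has_real_derivative d) (at x)"
    and conv: "\<And>y. y \<in> I \<Longrightarrow> (\<lambda>n. fs n y) \<longlonglongrightarrow> f y"
    and xs: "xs \<longlonglongrightarrow> x" and fxs: "(\<lambda>n. fs n (xs n)) \<longlonglongrightarrow> f x"
    and sub: "\<forall>\<^sub>F n in sequentially. \<forall>y\<in>I. fs n (xs n) + cs n * (y - xs n) \<le> fs n y"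
  shows "cs \<longlonglongrightarrow> d"
proof -
  have q: "(\<lambda>n. (fs n y - fs n (xs n)) / (y - xs n)) \<longlonglongrightarrow> (f y - f x) / (y - x)" if "y \<in> I" "y \<noteq> x" for y
    using that by (intro tendsto_divide tendsto_diff conv fxs tendsto_const xs) auto
  have ev: "\<forall>\<^sub>F y in at x. y \<in> I"
    using \<open>open I\<close> \<open>x \<in> I\<close> by (rule eventually_at_in_open')
  have d: "((\<lambda>y. (f y - f x) / (y - x)) \<longlongrightarrow> d) (at x)"
    using deriv by (simp add: has_field_derivative_iff)
  show ?thesis
  proof (rule order_tendstoI)
    fix a assume "a < d"
    then have "\<forall>\<^sub>F y in at x. a < (f y - f x) / (y - x) \<and> y \<in> I"
      using order_tendstoD(1)[OF d] ev by (intro eventually_conj)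
    then have "\<forall>\<^sub>F y in at_left x. a < (f y - f x) / (y - x) \<and> y \<in> I"
      by (simp add: eventually_at_split)
    moreover have "\<forall>\<^sub>F y in at_left x. y < x"
      by (simp add: eventually_at_filter)
    ultimately have "\<forall>\<^sub>F y in at_left x. a < (f y - f x) / (y - x) \<and> y \<in> I \<and> y < x"
      by eventually_elim auto
    \<comment> \<open>A fixed point left of \<open>x\<close> whose limiting chord slope already
      exceeds \<open>a\<close>; its chords are lower bounds of \<open>cs n\<close> for large
      \<open>n\<close>.\<close>
    then obtain y where y: "a < (f y - f x) / (y - x)" "y \<in> I" "y < x"
      using eventually_happens'[OF trivial_limit_at_left_real] by blast
    have "\<forall>\<^sub>F n in sequentially. a < (fs n y - fs n (xs n)) / (y - xs n)"
      using order_tendstoD(1)[OF q y(1)] y by auto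
    moreover have "\<forall>\<^sub>F n in sequentially. y < xs n"
      using order_tendstoD(1)[OF xs y(3)] .
    ultimately show "\<forall>\<^sub>F n in sequentially. a < cs n"
      using sub
    proof eventually_elim
      case (elim n)
      then have "cs n * (y - xs n) \<le> fs n y - fs n (xs n)"
        using y(2) by fastforce
      then have "(fs n y - fs n (xs n)) / (y - xs n) \<le> cs n"
        using elim by (simp add: divide_le_eq)
      then show ?case using elim by linarith
    qed
  next
    fix a assume "d < a"
    then have "\<forall>\<^sub>F y in at x. (f y - f x) / (y - x) < a \<and> y \<in> I"
      using order_tendstoD(2)[OF d] ev by (intro eventually_conj)
    then have "\<forall>\<^sub>F y in at_right x. (f y - f x) / (y - x) < a \<and> y \<in> I"
      by (simp add: eventually_at_split)
    moreover have "\<forall>\<^sub>F y in at_right x. x < y"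
      by (simp add: eventually_at_filter)
    ultimately have "\<forall>\<^sub>F y in at_right x. (f y - f x) / (y - x) < a \<and> y \<in> I \<and> x < y"
      by eventually_elim auto
    then obtain y where y: "(f y - f x) / (y - x) < a" "y \<in> I" "x < y"
      using eventually_happens'[OF trivial_limit_at_right_real] by blast
    have "\<forall>\<^sub>F n in sequentially. (fs n y - fs n (xs n)) / (y - xs n) < a"
      using order_tendstoD(2)[OF q y(1)] y by auto
    moreover have "\<forall>\<^sub>F n in sequentially. xs n < y"
      using order_tendstoD(2)[OF xs y(3)] .
    ultimately show "\<forall>\<^sub>F n in sequentially. cs n < a"
      using sub
    proof eventually_elim
      case (elim n)
      then have "cs n * (y - xs n) \<le> fs n y - fs n (xs n)"
        using y(2) by fastforce
      then have "cs n \<le> (fs n y - fs n (xs n)) / (y - xs n)"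
        using elim by (simp add: le_divide_eq)
      then show ?case using elim by linarith
    qed
  qed
qed

text \<open>The convergence statement applied to constant sequences: a constant that tends to
  \<open>d\<close> equals \<open>d\<close>.\<close>

lemma subgrad_eq_deriv:
  assumes "subgrad I I f c" "open I" "x \<in> I" "(f has_real_derivative d) (at x)"
  shows "c x = d"
proof -
  have "(\<lambda>n. c x) \<longlonglongrightarrow> d"
  proof (rule subgrad_converge)
    show "open I" "x \<in> I" "(f has_real_derivative d) (at x)" by fact+
    show "(\<lambda>n. f y) \<longlonglongrightarrow> f y" "(\<lambda>n::nat. x) \<longlonglongrightarrow> x" for y
      by simp_all
    show "\<forall>\<^sub>F n in sequentially. \<forall>y\<in>I. f x + c x * (y - x) \<le> f y"
      using assms by (simp add: subgrad_def)
  qed simp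
  then show ?thesis
    by (simp add: LIMSEQ_const_iff)
qed

section \<open>Joint laws built from kernels\<close>

text \<open>A measure on the whole line, so that kernels may be total functions of \<open>x\<close>
  while only their values on the unit interval count.\<close>

definition unif :: "real measure" where
  "unif = density lborel (indicator {0..1})"

lemma sets_unif [simp, measurable_cong]: "sets unif = sets borel"
  by (simp add: unif_def)

lemma space_unif [simp]: "space unif = UNIV"
  by (simp add: unif_def)

lemma nn_integral_unif:
  assumes [measurable]: "f \<in> borel_measurable borel"
  shows "(\<integral>\<^sup>+x. f x \<partial>unif) = (\<integral>\<^sup>+x. f x * indicator {0..1} x \<partial>lborel)"
  unfolding unif_def by (subst nn_integral_density) (simp_all add: mult.commute)

lemma AE_unif: "(AE x in unif. P x) \<longleftrightarrow> (AE x in lborel. x \<in> {0..1} \<longrightarrow> P x)"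
proof -
  have "0 < (indicator {0..1} x :: ennreal) \<longleftrightarrow> x \<in> {0..1}" for x :: real
    by (simp add: indicator_def)
  then show ?thesis
    unfolding unif_def by (subst AE_density) simp_all
qed

text \<open>Joint law of a pair whose first component is uniform and whose second has conditional
  law \<open>K x\<close>. The copula measures at hand are produced in this form, so their
  disintegration is available by construction.\<close>

definition kernel_prod :: "(real \<Rightarrow> real measure) \<Rightarrow> (real \<times> real) measure" where
  "kernel_prod K = unif \<bind> (\<lambda>x. distr (K x) borel (Pair x))"

context
  fixes K :: "real \<Rightarrow> real measure"
  assumes K: "K \<in> borel \<rightarrow>\<^sub>M prob_algebra borel"
begin

lemma kernel_subprob: "K \<in> borel \<rightarrow>\<^sub>M subprob_algebra borel"
  using K by (rule measurable_prob_algebraD)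

lemma kernel_sets: "sets (K x) = sets borel"
  using measurable_space[OF K, of x] by (simp add: space_prob_algebra)

lemma kernel_space: "space (K x) = UNIV"
  using sets_eq_imp_space_eq[OF kernel_sets] by simp

lemma kernel_prob: "prob_space (K x)"
  using measurable_space[OF K, of x] by (simp add: space_prob_algebra)

lemma kernel_prod_measurable:
  "(\<lambda>x. distr (K x) borel (Pair x)) \<in> unif \<rightarrow>\<^sub>M subprob_algebra borel"
proof (rule measurable_distr2)
  show "case_prod Pair \<in> unif \<Otimes>\<^sub>M borel \<rightarrow>\<^sub>M (borel :: (real \<times> real) measure)"
    by (simp add: borel_prod[symmetric] cong: measurable_cong_sets)
  show "K \<in> unif \<rightarrow>\<^sub>M subprob_algebra borel"
    using kernel_subprob by (simp cong: measurable_cong_sets)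
qed

lemma sets_kernel_prod: "sets (kernel_prod K) = sets borel"
  unfolding kernel_prod_def by (rule sets_bind) simp_all

lemma space_kernel_prod: "space (kernel_prod K) = UNIV"
  using sets_eq_imp_space_eq[OF sets_kernel_prod] by simp

lemma measurable_Pair_kernel: "Pair x \<in> K x \<rightarrow>\<^sub>M borel"
proof -
  have "Pair x \<in> borel \<rightarrow>\<^sub>M (borel :: (real \<times> real) measure)"
    by (simp add: borel_prod[symmetric])
  then show ?thesis
    by (simp cong: measurable_cong_sets add: kernel_sets)
qed

lemma measurable_nn_integral_kernel:
  assumes [measurable]: "f \<in> borel_measurable (borel :: (real \<times> real) measure)"
  shows "(\<lambda>x. \<integral>\<^sup>+y. f (x, y) \<partial>K x) \<in> borel_measurable borel"
proof -
  have "case_prod (\<lambda>x y. f (x, y)) \<in> borel_measurable (borel \<Otimes>\<^sub>M borel)"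
    by (simp add: borel_prod case_prod_eta)
  then show ?thesis
    by (intro nn_integral_measurable_subprob_algebra2[where N = borel] kernel_subprob) simp_all
qed

lemma nn_integral_kernel_prod:
  assumes f[measurable]: "f \<in> borel_measurable (borel :: (real \<times> real) measure)"
  shows "(\<integral>\<^sup>+z. f z \<partial>kernel_prod K) = (\<integral>\<^sup>+x. (\<integral>\<^sup>+y. f (x, y) \<partial>K x) * indicator {0..1} x \<partial>lborel)"
proof -
  have "(\<integral>\<^sup>+z. f z \<partial>kernel_prod K) = (\<integral>\<^sup>+x. \<integral>\<^sup>+z. f z \<partial>distr (K x) borel (Pair x) \<partial>unif)"
    unfolding kernel_prod_def by (rule nn_integral_bind[OF f kernel_prod_measurable])
  also have "\<dots> = (\<integral>\<^sup>+x. \<integral>\<^sup>+y. f (x, y) \<partial>K x \<partial>unif)"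
    by (intro nn_integral_cong nn_integral_distr measurable_Pair_kernel) simp
  finally show ?thesis
    using measurable_nn_integral_kernel[OF f] by (simp add: nn_integral_unif)
qed

lemma prob_space_kernel_prod: "prob_space (kernel_prod K)"
proof
  have "emeasure (kernel_prod K) (space (kernel_prod K)) = (\<integral>\<^sup>+z. 1 \<partial>kernel_prod K)"
    by simp
  also have "\<dots> = (\<integral>\<^sup>+x. (\<integral>\<^sup>+y. 1 \<partial>K x) * indicator {0..1} (x::real) \<partial>lborel)"
    by (rule nn_integral_kernel_prod) simp
  also have "\<dots> = (\<integral>\<^sup>+x. indicator {0..1} (x::real) \<partial>lborel)"
    by (intro nn_integral_cong) (simp add: prob_space.emeasure_space_1[OF kernel_prob])
  finally show "emeasure (kernel_prod K) (space (kernel_prod K)) = 1"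
    by simp
qed

lemma emeasure_kernel_prod_Times:
  assumes [measurable]: "A \<in> sets borel" "B \<in> sets borel"
  shows "emeasure (kernel_prod K) (A \<times> B)
    = (\<integral>\<^sup>+x. emeasure (K x) B * indicator A x * indicator {0..1} x \<partial>lborel)"
proof -
  have AB[measurable]: "A \<times> B \<in> sets (borel :: (real \<times> real) measure)"
    by (simp add: borel_prod[symmetric])
  have "emeasure (kernel_prod K) (A \<times> B) = (\<integral>\<^sup>+z. indicator (A \<times> B) z \<partial>kernel_prod K)"
    by (simp add: sets_kernel_prod)
  also have "\<dots> = (\<integral>\<^sup>+x. (\<integral>\<^sup>+y. indicator (A \<times> B) (x, y) \<partial>K x) * indicator {0..1} x \<partial>lborel)"
    by (rule nn_integral_kernel_prod) simp
  also have "\<dots> = (\<integral>\<^sup>+x. emeasure (K x) B * indicator A x * indicator {0..1} x \<partial>lborel)"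
    by (intro nn_integral_cong arg_cong2[where f = "(*)"] refl)
       (simp add: indicator_times nn_integral_cmult_indicator kernel_sets mult.commute)
  finally show ?thesis .
qed

lemma distr_fst_kernel_prod: "distr (kernel_prod K) borel fst = unif"
proof (rule measure_eqI)
  fix A assume "A \<in> sets (distr (kernel_prod K) borel fst)"
  then have [measurable]: "A \<in> sets borel" by simp
  have "fst -` A = A \<times> (UNIV :: real set)"
    by auto
  moreover have "fst \<in> kernel_prod K \<rightarrow>\<^sub>M borel"
    by (simp add: sets_kernel_prod borel_prod[symmetric] cong: measurable_cong_sets)
  ultimately have "emeasure (distr (kernel_prod K) borel fst) A = emeasure (kernel_prod K) (A \<times> UNIV)"
    by (subst emeasure_distr) (simp_all add: space_kernel_prod)
  also have "\<dots> = (\<integral>\<^sup>+x. indicator A x * indicator {0..1} x \<partial>lborel)"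
    using prob_space.emeasure_space_1[OF kernel_prob]
    by (subst emeasure_kernel_prod_Times) (simp_all add: kernel_space)
  also have "\<dots> = emeasure unif A"
    by (subst nn_integral_unif[symmetric]) simp_all
  finally show "emeasure (distr (kernel_prod K) borel fst) A = emeasure unif A" .
qed simp

text \<open>The sigma-algebra of the first coordinate consists of the preimages of Borel sets
  \<open>B\<close>, and over such a preimage both integrals equal the mass of
  \<open>B \<times> E\<close>.\<close>

lemma real_cond_exp_kernel_prod:
  assumes [measurable]: "E \<in> sets borel"
  shows "AE z in kernel_prod K. real_cond_exp (kernel_prod K) (vimage_algebra UNIV fst borel)
      (\<lambda>w. indicator E (snd w)) z = measure (K (fst z)) E"
proof -
  let ?M = "kernel_prod K" and ?F = "vimage_algebra (UNIV :: (real \<times> real) set) fst (borel :: real measure)"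
  interpret M: prob_space ?M by (rule prob_space_kernel_prod)
  have setsF: "sets ?F = {fst -` A |A. A \<in> sets borel}"
    by (subst sets_vimage_algebra2) auto
  have fstM[measurable]: "fst \<in> ?M \<rightarrow>\<^sub>M borel" and sndM[measurable]: "snd \<in> ?M \<rightarrow>\<^sub>M borel"
    by (simp_all add: sets_kernel_prod borel_prod[symmetric] cong: measurable_cong_sets)
  have "subalgebra ?M ?F"
    using measurable_sets[OF fstM] by (auto simp: subalgebra_def setsF space_kernel_prod)
  then interpret finite_measure_subalgebra ?M ?F
    by unfold_locales
  have Kmeas[measurable]: "(\<lambda>x. measure (K x) E) \<in> borel_measurable borel"
    by (rule measurable_compose[OF kernel_subprob measurable_measure_subprob_algebra]) simp
  have Kle: "measure (K x) E \<le> 1" for x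
    by (rule prob_space.prob_le_1[OF kernel_prob])
  have emK: "emeasure (K x) E = ennreal (measure (K x) E)" for x
    using kernel_prob[of x] by (simp add: prob_space_def finite_measure.emeasure_eq_measure)
  show ?thesis
  proof (rule real_cond_exp_charact)
    have fstF: "fst \<in> ?F \<rightarrow>\<^sub>M (borel :: real measure)"
      by (rule measurable_vimage_algebra1) simp
    show "(\<lambda>z. measure (K (fst z)) E) \<in> borel_measurable ?F"
      by (rule measurable_compose[OF fstF Kmeas])
    show i1: "integrable ?M (\<lambda>w. indicator E (snd w) :: real)"
      by (rule M.integrable_const_bound[where B = 1]) (auto simp: indicator_def)
    show i2: "integrable ?M (\<lambda>z. measure (K (fst z)) E)"
      by (rule M.integrable_const_bound[where B = 1]) (auto simp: Kle)
    fix A assume "A \<in> sets ?F"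
    then obtain B where A: "A = fst -` B" and [measurable]: "B \<in> sets borel"
      unfolding setsF by blast
    have "emeasure ?M (B \<times> E) = (\<integral>\<^sup>+x. emeasure (K x) E * indicator B x * indicator {0..1} x \<partial>lborel)"
      by (rule emeasure_kernel_prod_Times) simp_all
    also have "\<dots> = (\<integral>\<^sup>+x. emeasure (K x) E * indicator B x \<partial>unif)"
      by (subst nn_integral_unif) (simp_all add: emK)
    also have "\<dots> = (\<integral>\<^sup>+z. ennreal (measure (K (fst z)) E * indicator B (fst z)) \<partial>?M)"
      unfolding distr_fst_kernel_prod[symmetric]
      by (subst nn_integral_distr) (simp_all add: emK ennreal_mult ennreal_indicator)
    finally have eq: "emeasure ?M (B \<times> E) = (\<integral>\<^sup>+z. ennreal (measure (K (fst z)) E * indicator B (fst z)) \<partial>?M)" .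
    have "(\<integral>w\<in>A. indicator E (snd w) \<partial>?M) = (\<integral>w. indicator (B \<times> E) w \<partial>?M)"
      unfolding set_lebesgue_integral_def A
      by (intro Bochner_Integration.integral_cong) (auto simp: indicator_def)
    also have "\<dots> = measure ?M (B \<times> E)"
      by (simp add: space_kernel_prod)
    also have "\<dots> = (\<integral>z. measure (K (fst z)) E * indicator B (fst z) \<partial>?M)"
      unfolding measure_def[of ?M] eq by (rule integral_eq_nn_integral[symmetric]) auto
    also have "\<dots> = (\<integral>w\<in>A. measure (K (fst w)) E \<partial>?M)"
      unfolding set_lebesgue_integral_def A
      by (intro Bochner_Integration.integral_cong) (auto simp: indicator_def)
    finally show "(\<integral>w\<in>A. indicator E (snd w) \<partial>?M) = (\<integral>w\<in>A. measure (K (fst w)) E \<partial>?M)" .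
  qed
qed

lemma is_markov_kernel_kernel_prod:
  assumes "copula_measure C = kernel_prod K" and "\<And>x. measure (K x) {0..1} = 1"
  shows "is_markov_kernel C K"
  unfolding is_markov_kernel_def assms(1)
proof (intro conjI ballI)
  show "K \<in> restrict_space borel {0..1} \<rightarrow>\<^sub>M prob_algebra borel"
    using K by (rule measurable_restrict_space1)
  show "AE z in kernel_prod K. measure (K (fst z)) E = real_cond_exp (kernel_prod K)
      (vimage_algebra UNIV fst borel) (\<lambda>w. indicator E (snd w)) z" if "E \<in> sets borel" for E
    using real_cond_exp_kernel_prod[OF that] by eventually_elim simp
qed (rule assms)

text \<open>Both kernels represent the same conditional expectation, and the first marginal is
  uniform, so an almost sure statement on the plane becomes one for \<open>x\<close>. The null set
  depends on \<open>E\<close>; this is harmless as long as countably many \<open>E\<close> are used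
  at a time.\<close>

lemma is_markov_kernel_unique:
  assumes C: "copula_measure C = kernel_prod K" and K': "is_markov_kernel C K'"
    and E[measurable]: "E \<in> sets borel"
  shows "AE x in unif. measure (K' x) E = measure (K x) E"
proof -
  have "AE z in kernel_prod K. measure (K' (fst z)) E = real_cond_exp (kernel_prod K)
      (vimage_algebra UNIV fst borel) (\<lambda>w. indicator E (snd w)) z"
    using K' E unfolding is_markov_kernel_def C by blast
  with real_cond_exp_kernel_prod[OF E]
  have AE: "AE z in kernel_prod K. measure (K' (fst z)) E = measure (K (fst z)) E"
    by eventually_elim simp
  \<comment> \<open>Passing along \<open>fst\<close> requires a measurable set; \<open>K'\<close> is
    measurable on the unit interval alone, hence the restriction to it.\<close>
  define D where "D = {x \<in> {0..1}. measure (K' x) E \<noteq> measure (K x) E}"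
  have "K' \<in> restrict_space borel {0..1} \<rightarrow>\<^sub>M prob_algebra borel"
    using K' by (simp add: is_markov_kernel_def)
  then have "(\<lambda>x. measure (K' x) E) \<in> borel_measurable (restrict_space borel {0..1})"
    by (rule measurable_compose[OF measurable_prob_algebraD measurable_measure_subprob_algebra[OF E]])
  moreover have "(\<lambda>x. measure (K x) E) \<in> borel_measurable (restrict_space borel {0..1})"
    by (intro measurable_restrict_space1 measurable_compose[OF kernel_subprob measurable_measure_subprob_algebra]) simp
  ultimately have "{x \<in> space (restrict_space borel {0..1}). measure (K' x) E \<noteq> measure (K x) E}
      \<in> sets (restrict_space borel {0..1})"
    by measurable
  then have D[measurable]: "D \<in> sets borel"
    by (simp add: space_restrict_space sets_restrict_space_iff D_def)
  have "AE z in kernel_prod K. fst z \<notin> D"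
    using AE by eventually_elim (simp add: D_def)
  then have "AE x in unif. x \<notin> D"
    unfolding distr_fst_kernel_prod[symmetric]
    by (subst AE_distr_iff) (simp_all add: sets_kernel_prod borel_prod[symmetric] cong: measurable_cong_sets)
  then show ?thesis
    unfolding AE_unif by eventually_elim (auto simp: D_def)
qed

end

text \<open>\<open>C 1 1 = 1\<close> puts all mass on the unit square, so the value on every
  quadrant is fixed by \<open>C\<close>, and quadrants form an intersection-stable generator of the
  Borel sets of the plane.\<close>

lemma copula_measure_eqI:
  assumes M: "sets M = sets borel" "prob_space M"
    and C: "\<And>x y. x \<in> {0..1} \<Longrightarrow> y \<in> {0..1} \<Longrightarrow> measure M ({0..x} \<times> {0..y}) = C x y"
    and C11: "C 1 1 = 1"
  shows "copula_measure C = M"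
  unfolding copula_measure_def
proof (rule the_equality)
  show "sets M = sets borel \<and> prob_space M \<and>
      (\<forall>x\<in>{0..1}. \<forall>y\<in>{0..1}. measure M ({0..x} \<times> {0..y}) = C x y)"
    using M C by blast
  have Times: "A \<times> B \<in> sets (borel :: (real \<times> real) measure)"
    if "A \<in> sets borel" "B \<in> sets borel" for A B
    using that by (simp add: borel_prod[symmetric])
  have quadrant: "emeasure N ({..a} \<times> {..b})
      = ennreal (if 0 \<le> a \<and> 0 \<le> b then C (min a 1) (min b 1) else 0)"
    if N: "sets N = sets borel" "prob_space N"
      "\<And>x y. x \<in> {0..1} \<Longrightarrow> y \<in> {0..1} \<Longrightarrow> measure N ({0..x} \<times> {0..y}) = C x y"
    for N :: "(real \<times> real) measure" and a b :: real
  proof -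
    interpret N: prob_space N by fact
    have Q: "{0..1} \<times> {0..1} \<in> sets N" and L: "{..a} \<times> {..b} \<in> sets N"
      using N(1) by (auto intro!: Times)
    have "N.prob ({0..1} \<times> {0..1}) = 1"
      using N(3)[of 1 1] C11 by simp
    then have "AE z in N. z \<in> {0..1} \<times> {0..1}"
      using Q by (subst (asm) N.prob_eq_1) auto
    then have "measure N ({..a} \<times> {..b}) = measure N (({..a} \<times> {..b}) \<inter> ({0..1} \<times> {0..1}))"
      using Q L by (intro measure_eq_AE) auto
    also have "({..a} \<times> {..b}) \<inter> ({0..1} \<times> {0..1})
        = (if 0 \<le> a \<and> 0 \<le> b then {0..min a 1} \<times> {0..min b 1} else {})"
      by auto
    finally show ?thesis
      using N(3)[of "min a 1" "min b 1"] by (auto simp: N.emeasure_eq_measure)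
  qed
  fix N assume N: "sets N = sets borel \<and> prob_space N \<and>
      (\<forall>x\<in>{0..1}. \<forall>y\<in>{0..1}. measure N ({0..x} \<times> {0..y}) = C x y)"
  let ?E = "range (\<lambda>(a, b). {..a} \<times> {..b}) :: (real \<times> real) set set"
  have "{..z} = {..fst z} \<times> {..snd z}" for z :: "real \<times> real"
    by (auto simp: less_eq_prod_def)
  then have E: "range atMost = ?E"
    unfolding case_prod_beta by (intro image_cong) simp_all
  have gen: "sets borel = sigma_sets UNIV ?E"
    unfolding E[symmetric] borel_eq_atMost by (simp add: atMost_def)
  show "N = M"
  proof (rule measure_eqI_generator_eq[where E = ?E and \<Omega> = UNIV and A = "\<lambda>i::nat. {..real i} \<times> {..real i}"])
    show "Int_stable ?E"
      by (rule Int_stableI) (auto simp: Times_Int_Times image_iff, blast)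
    show "sets N = sigma_sets UNIV ?E" "sets M = sigma_sets UNIV ?E"
      using N M gen by simp_all
    show "emeasure N X = emeasure M X" if "X \<in> ?E" for X
      using that quadrant[of N] quadrant[OF M C] N by auto
    show "(\<Union>i::nat. {..real i} \<times> {..real i}) = UNIV"
    proof (intro set_eqI iffI UNIV_I)
      fix z :: "real \<times> real"
      obtain n :: nat where "max (fst z) (snd z) \<le> real n"
        using real_arch_simple by blast
      then show "z \<in> (\<Union>i::nat. {..real i} \<times> {..real i})"
        by (cases z) auto
    qed
    show "emeasure N ({..real i} \<times> {..real i}) \<noteq> \<infinity>" for i
      using quadrant[of N] N by simp
  qed auto
qed

lemma ex_between_not_in_countable:
  fixes a b :: real
  assumes "a < b" "countable S"
  obtains d where "a < d" "d < b" "d \<notin> S"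
proof -
  have "\<not> {a<..<b} \<subseteq> S"
    using uncountable_open_interval[of a b] assms countable_subset by blast
  then obtain d where "d \<in> {a<..<b}" "d \<notin> S"
    by blast
  then show thesis
    by (intro that[of d]) simp_all
qed

section \<open>Copula measure and kernel from a partial derivative\<close>

text \<open>\<open>H\<close> is the candidate for the partial derivative in \<open>x\<close>. For
  \<open>y\<close> in \<open>Y0\<close> nothing is claimed about derivatives, for other
  \<open>y\<close> a countable set of \<open>x\<close> may fail. Monotonicity of \<open>H x\<close>
  takes the role of the 2-increasing property and makes \<open>H x\<close> a conditional
  distribution function up to right-continuity.\<close>

locale copula_kernel =
  fixes C H :: "real \<Rightarrow> real \<Rightarrow> real" and Y0 :: "real set"
  assumes C_0_right: "x \<in> {0..1} \<Longrightarrow> C x 0 = 0" and C_0_left: "y \<in> {0..1} \<Longrightarrow> C 0 y = 0"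
    and C_1_right: "x \<in> {0..1} \<Longrightarrow> C x 1 = x" and C_1_left: "y \<in> {0..1} \<Longrightarrow> C 1 y = y"
    and C_nonneg: "x \<in> {0..1} \<Longrightarrow> y \<in> {0..1} \<Longrightarrow> 0 \<le> C x y"
    and cont_left: "y \<in> {0..1} \<Longrightarrow> continuous_on {0..1} (\<lambda>x. C x y)"
    and cont_right: "x \<in> {0..1} \<Longrightarrow> continuous_on {0..1} (C x)"
    and H_measurable [measurable]: "case_prod H \<in> borel_measurable (borel \<Otimes>\<^sub>M borel)"
    and H_bounds: "x \<in> {0<..<1} \<Longrightarrow> y \<in> {0<..<1} \<Longrightarrow> 0 \<le> H x y \<and> H x y \<le> 1"
    and H_mono: "x \<in> {0<..<1} \<Longrightarrow> mono_on {0<..<1} (H x)"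
    and countable_Y0: "countable Y0"
    and H_deriv: "y \<in> {0<..<1} - Y0 \<Longrightarrow>
      \<exists>S. countable S \<and> (\<forall>x\<in>{0<..<1} - S. ((\<lambda>x. C x y) has_real_derivative H x y) (at x))"
begin

lemma nn_integral_H:
  assumes y: "y \<in> {0<..<1} - Y0" and x: "x \<in> {0..1}"
  shows "(\<integral>\<^sup>+u. ennreal (H u y) * indicator {0..x} u \<partial>lborel) = ennreal (C x y)"
proof -
  obtain S where S: "countable S" "\<And>x. x \<in> {0<..<1} - S \<Longrightarrow> ((\<lambda>x. C x y) has_real_derivative H x y) (at x)"
    using H_deriv[OF y] by blast
  have "(\<integral>\<^sup>+u. ennreal (H u y) * indicator {0..x} u \<partial>lborel) = ennreal (C x y - C 0 y)"
  proof (rule nn_integral_FTC_countable[OF _ _ S(1)])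
    show "continuous_on {0..x} (\<lambda>x. C x y)"
      using cont_left[of y] x y by (auto intro: continuous_on_subset)
    show "((\<lambda>x. C x y) has_real_derivative H z y) (at z)" if "z \<in> {0<..<x} - S" for z
      using that x by (intro S(2)) auto
    show "0 \<le> H z y \<and> H z y \<le> 1" if "z \<in> {0<..<x}" for z
      using that x y by (intro H_bounds) auto
  qed (use x in auto)
  then show ?thesis
    using C_0_left[of y] y by simp
qed

text \<open>Right-continuous version of \<open>H x\<close>: the infimum over larger rationals is a
  countable one, which gives measurability in \<open>x\<close>. For \<open>x\<close> outside the
  open unit interval it is the distribution function of a point mass at 1, so that
  \<open>G x\<close> is a distribution function for every real \<open>x\<close>.\<close>

definition G :: "real \<Rightarrow> real \<Rightarrow> real" where
  "G x y = (if y < 0 then 0 else if 1 \<le> y then 1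
    else INF q\<in>{y<..<1} \<inter> \<rat>. indicator {0<..<1} x * H x q)"

lemma indicator_H_nonneg: "q \<in> {0<..<1} \<Longrightarrow> 0 \<le> indicator {0<..<1} x * H x q"
  using H_bounds[of x q] by (auto simp: indicator_def)

lemma G_measurable [measurable]: "(\<lambda>x. G x y) \<in> borel_measurable borel"
proof (cases "0 \<le> y \<and> y < 1")
  case True
  have "(\<lambda>x. INF q\<in>{y<..<1} \<inter> \<rat>. indicator {0<..<1} x * H x q) \<in> borel_measurable borel"
  proof (rule borel_measurable_cINF)
    show "countable ({y<..<1} \<inter> \<rat>)"
      by (intro countable_Int2 countable_rat)
    show "bdd_below ((\<lambda>q. indicator {0<..<1} x * H x q) ` ({y<..<1} \<inter> \<rat>))" for x
      using True by (intro bdd_belowI2[where m = 0] indicator_H_nonneg) auto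
  qed measurable
  then show ?thesis
    using True by (simp add: G_def)
qed (auto simp: G_def)

lemma G_le:
  assumes "0 \<le> y" "y < d" "d < 1"
  shows "G x y \<le> indicator {0<..<1} x * H x d"
proof -
  obtain q where q: "q \<in> \<rat>" "y < q" "q < d"
    using Rats_dense_in_real[OF \<open>y < d\<close>] by blast
  have "G x y \<le> indicator {0<..<1} x * H x q"
    unfolding G_def using assms q
    by (auto intro!: cINF_lower bdd_belowI2[where m = 0] indicator_H_nonneg)
  also have "\<dots> \<le> indicator {0<..<1} x * H x d"
    using mono_onD[OF H_mono, of x q d] assms q by (auto simp: indicator_def)
  finally show ?thesis .
qed

lemma G_nonneg: "0 \<le> G x y"
proof (cases "0 \<le> y \<and> y < 1")
  case True
  moreover obtain q where "q \<in> \<rat>" "y < q" "q < 1"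
    using Rats_dense_in_real[of y 1] True by blast
  ultimately show ?thesis
    unfolding G_def by (auto intro!: cINF_greatest indicator_H_nonneg)
qed (auto simp: G_def)

lemma G_ge:
  assumes "x \<in> {0<..<1}" "y \<in> {0<..<1}"
  shows "H x y \<le> G x y"
proof -
  obtain q where "q \<in> \<rat>" "y < q" "q < 1"
    using Rats_dense_in_real[of y 1] assms by auto
  then have "H x y \<le> (INF q\<in>{y<..<1} \<inter> \<rat>. indicator {0<..<1} x * H x q)"
    using assms by (intro cINF_greatest) (auto intro!: mono_onD[OF H_mono])
  then show ?thesis
    using assms by (simp add: G_def)
qed

lemma G_le_1: "G x y \<le> 1"
proof (cases "0 \<le> y \<and> y < 1")
  case True
  then have "G x y \<le> indicator {0<..<1} x * H x ((y + 1) / 2)"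
    by (intro G_le) auto
  also have "\<dots> \<le> 1"
    using H_bounds[of x "(y + 1) / 2"] True by (auto simp: indicator_def)
  finally show ?thesis .
qed (auto simp: G_def)

lemma G_mono: "y \<le> y' \<Longrightarrow> G x y \<le> G x y'"
proof (cases "0 \<le> y \<and> y' < 1")
  case True
  assume "y \<le> y'"
  obtain q where "q \<in> \<rat>" "y' < q" "q < 1"
    using Rats_dense_in_real[of y' 1] True by blast
  then have "G x y \<le> (INF q\<in>{y'<..<1} \<inter> \<rat>. indicator {0<..<1} x * H x q)"
    using True \<open>y \<le> y'\<close> by (intro cINF_greatest) (auto intro!: G_le)
  then show ?thesis
    using True \<open>y \<le> y'\<close> by (simp add: G_def)
next
  case False
  moreover assume "y \<le> y'"
  ultimately show ?thesis
    using G_nonneg[of x y'] G_le_1[of x y] by (cases "0 \<le> y") (auto simp: G_def)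
qed

lemma G_right_cont: "continuous (at_right y) (G x)"
proof (subst continuous_at_right_real_increasing)
  show "\<forall>e>0. \<exists>d>0. G x (y + d) - G x y < e"
  proof (intro allI impI)
    fix e :: real assume "e > 0"
    consider "y < 0" | "1 \<le> y" | "0 \<le> y" "y < 1" by linarith
    then show "\<exists>d>0. G x (y + d) - G x y < e"
    proof cases
      case 1
      then show ?thesis
        using \<open>e > 0\<close> by (intro exI[of _ "- y / 2"]) (auto simp: G_def)
    next
      case 2
      then show ?thesis
        using \<open>e > 0\<close> by (intro exI[of _ 1]) (auto simp: G_def)
    next
      case 3
      obtain q0 where "q0 \<in> \<rat>" "y < q0" "q0 < 1"
        using Rats_dense_in_real[of y 1] 3 by blast
      then have ne: "{y<..<1} \<inter> \<rat> \<noteq> {}"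
        by auto
      have lt: "(INF q\<in>{y<..<1} \<inter> \<rat>. indicator {0<..<1} x * H x q) < G x y + e"
        using 3 \<open>e > 0\<close> by (simp add: G_def)
      have bdd: "bdd_below ((\<lambda>q. indicator {0<..<1} x * H x q) ` ({y<..<1} \<inter> \<rat>))"
        using 3 by (intro bdd_belowI2[where m = 0] indicator_H_nonneg) auto
      obtain q where q: "q \<in> {y<..<1} \<inter> \<rat>" "indicator {0<..<1} x * H x q < G x y + e"
        using lt unfolding cINF_less_iff[OF ne bdd] by blast
      have "G x (y + (q - y) / 2) \<le> indicator {0<..<1} x * H x q"
        using q 3 by (intro G_le) (auto simp: field_simps)
      with q show ?thesis
        by (intro exI[of _ "(q - y) / 2"]) auto
    qed
  qed
qed (rule G_mono)

text \<open>\<open>G\<close> is squeezed between \<open>H\<close> at levels just below and just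
  above \<open>y\<close>. Levels outside \<open>Y0\<close> are dense, there the integral of
  \<open>H\<close> is a value of \<open>C x\<close>, and continuity of \<open>C x\<close> closes the
  gap.\<close>

lemma nn_integral_G:
  assumes y: "y \<in> {0..1}" and x: "x \<in> {0..1}"
  shows "(\<integral>\<^sup>+u. ennreal (G u y) * indicator {0..x} u \<partial>lborel) = ennreal (C x y)"
proof (cases "y = 1")
  case True
  then show ?thesis
    using x by (simp add: G_def C_1_right)
next
  case False
  with y have y: "0 \<le> y" "y < 1" by auto
  show ?thesis
  proof (rule antisym)
    show "(\<integral>\<^sup>+u. ennreal (G u y) * indicator {0..x} u \<partial>lborel) \<le> ennreal (C x y)"
    proof (rule ennreal_le_epsilon)
      fix e :: real assume "0 < e"
      then obtain \<delta> where \<delta>: "\<delta> > 0" "\<And>z. z \<in> {0..1} \<Longrightarrow> dist z y < \<delta> \<Longrightarrow> dist (C x z) (C x y) < e"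
        using cont_right[OF x, unfolded continuous_on_iff] y by fastforce
      obtain d where d: "y < d" "d < min (y + \<delta>) 1" "d \<notin> Y0"
        using ex_between_not_in_countable[OF _ countable_Y0, of y "min (y + \<delta>) 1"] \<delta> y by auto
      have "(\<integral>\<^sup>+u. ennreal (G u y) * indicator {0..x} u \<partial>lborel)
          \<le> (\<integral>\<^sup>+u. ennreal (H u d) * indicator {0..x} u \<partial>lborel)"
      proof (intro nn_integral_mono mult_right_mono)
        fix u
        have "G u y \<le> indicator {0<..<1} u * H u d"
          using d y by (intro G_le) auto
        then show "ennreal (G u y) \<le> ennreal (H u d)"
          using G_nonneg[of u y] by (cases "u \<in> {0<..<1}") (auto intro: ennreal_leI)
      qed simp
      also have "\<dots> = ennreal (C x d)"
        using d y x by (intro nn_integral_H) auto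
      also have "\<dots> \<le> ennreal (C x y + e)"
        using \<delta>(2)[of d] d y by (intro ennreal_leI) (auto simp: dist_real_def)
      also have "\<dots> \<le> ennreal (C x y) + ennreal e"
        using \<open>0 < e\<close> by (cases "0 \<le> C x y") (auto simp: ennreal_neg intro!: ennreal_leI add_increasing)
      finally show "(\<integral>\<^sup>+u. ennreal (G u y) * indicator {0..x} u \<partial>lborel) \<le> ennreal (C x y) + ennreal e" .
    qed
    show "ennreal (C x y) \<le> (\<integral>\<^sup>+u. ennreal (G u y) * indicator {0..x} u \<partial>lborel)"
    proof (cases "y = 0")
      case True
      then show ?thesis using C_0_right[OF x] by simp
    next
      case False
      show ?thesis
      proof (rule ennreal_le_epsilon)
        fix e :: real assume "0 < e"
        then obtain \<delta> where \<delta>: "\<delta> > 0" "\<And>z. z \<in> {0..1} \<Longrightarrow> dist z y < \<delta> \<Longrightarrow> dist (C x z) (C x y) < e"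
          using cont_right[OF x, unfolded continuous_on_iff] y by fastforce
        obtain d where d: "max (y - \<delta>) 0 < d" "d < y" "d \<notin> Y0"
          using ex_between_not_in_countable[OF _ countable_Y0, of "max (y - \<delta>) 0" y] \<delta> y False by auto
        have "ennreal (C x y) \<le> ennreal (C x d + e)"
          using \<delta>(2)[of d] d y by (intro ennreal_leI) (auto simp: dist_real_def)
        also have "\<dots> \<le> ennreal (C x d) + ennreal e"
          using \<open>0 < e\<close> by (cases "0 \<le> C x d") (auto simp: ennreal_neg intro!: ennreal_leI add_increasing)
        also have "ennreal (C x d) = (\<integral>\<^sup>+u. ennreal (H u d) * indicator {0..x} u \<partial>lborel)"
          using d y x by (intro nn_integral_H[symmetric]) auto
        also have "\<dots> \<le> (\<integral>\<^sup>+u. ennreal (G u y) * indicator {0..x} u \<partial>lborel)"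
        proof (rule nn_integral_mono_AE, rule AE_mp[OF AE_lborel_singleton[of 0]],
            rule AE_mp[OF AE_lborel_singleton[of 1]], intro AE_I2 impI)
          fix u :: real assume "u \<noteq> 0" "u \<noteq> 1"
          show "ennreal (H u d) * indicator {0..x} u \<le> ennreal (G u y) * indicator {0..x} u"
          proof (cases "u \<in> {0<..<1}")
            case True
            have "H u d \<le> G u d" using True d y by (intro G_ge) auto
            also have "\<dots> \<le> G u y" using d by (intro G_mono) simp
            finally show ?thesis by (intro mult_right_mono ennreal_leI) auto
          qed (use x \<open>u \<noteq> 0\<close> \<open>u \<noteq> 1\<close> in auto)
        qed
        finally show "ennreal (C x y) \<le> (\<integral>\<^sup>+u. ennreal (G u y) * indicator {0..x} u \<partial>lborel) + ennreal e"
          by (simp add: add_right_mono)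
      qed
    qed
  qed
qed

text \<open>\<open>H \<le> G\<close>, and both have the finite integral \<open>C 1 y\<close> over
  the unit interval; hence they agree almost everywhere.\<close>

lemma G_eq_H:
  assumes "y \<in> {0<..<1} - Y0"
  shows "AE x in lborel. x \<in> {0<..<1} \<longrightarrow> G x y = H x y"
proof -
  let ?g = "\<lambda>u. ennreal (G u y) * indicator {0..1} u" and ?h = "\<lambda>u. ennreal (H u y) * indicator {0<..<1} u"
  have "(\<integral>\<^sup>+u. ?h u \<partial>lborel) = (\<integral>\<^sup>+u. ennreal (H u y) * indicator {0..1} u \<partial>lborel)"
    by (intro nn_integral_cong_AE, rule AE_mp[OF AE_lborel_singleton[of 0]],
        rule AE_mp[OF AE_lborel_singleton[of 1]]) (auto simp: indicator_def)
  also have "\<dots> = ennreal (C 1 y)"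
    using assms by (intro nn_integral_H) auto
  finally have h: "(\<integral>\<^sup>+u. ?h u \<partial>lborel) = ennreal (C 1 y)" .
  have g: "(\<integral>\<^sup>+u. ?g u \<partial>lborel) = ennreal (C 1 y)"
    using assms by (intro nn_integral_G) auto
  have le: "?h u \<le> ?g u" for u
    using G_ge[of u y] assms by (auto simp: indicator_def intro!: ennreal_leI)
  have "(\<integral>\<^sup>+u. ?g u - ?h u \<partial>lborel) = 0"
    using h g le by (subst nn_integral_diff) auto
  then have "AE u in lborel. ?g u - ?h u = 0"
    by (subst (asm) nn_integral_0_iff_AE) auto
  then show ?thesis
  proof (rule AE_mp, intro AE_I2 impI)
    fix u assume *: "?g u - ?h u = 0" "u \<in> {0<..<1}"
    then have "ennreal (G u y) \<le> ennreal (H u y)"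
      by (auto simp: diff_eq_0_iff_ennreal)
    then have "G u y \<le> H u y"
      using H_bounds[of u y] * assms by (simp add: ennreal_le_iff)
    then show "G u y = H u y"
      using G_ge[of u y] * assms by simp
  qed
qed

definition K :: "real \<Rightarrow> real measure" where
  "K x = interval_measure (G x)"

lemma G_at_bot: "(G x \<longlongrightarrow> 0) at_bot"
  by (rule tendsto_eventually) (auto simp: G_def eventually_at_bot_linorder intro!: exI[of _ "-1"])

lemma G_at_top: "(G x \<longlongrightarrow> 1) at_top"
  by (rule tendsto_eventually) (auto simp: G_def eventually_at_top_linorder intro!: exI[of _ 1])

lemma real_distribution_K: "real_distribution (K x)"
  unfolding K_def
  by (intro real_distribution_interval_measure G_mono G_right_cont G_at_bot G_at_top)

lemma emeasure_K_atMost: "emeasure (K x) {..y} = ennreal (G x y)"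
  unfolding K_def by (intro emeasure_interval_measure_Iic G_mono G_right_cont G_at_bot)

lemma K_measurable: "K \<in> borel \<rightarrow>\<^sub>M prob_algebra borel"
proof (rule measurable_prob_algebra_generated)
  show "sets borel = sigma_sets UNIV (range (\<lambda>y::real. {..y}))"
    unfolding borel_eq_atMost by simp
  show "Int_stable (range (\<lambda>y::real. {..y}))"
    by (rule Int_stableI) auto
  show "prob_space (K x)" "sets (K x) = sets borel" for x
    using real_distribution_K[of x] by (auto simp: real_distribution_def real_distribution_axioms_def)
  show "(\<lambda>x. emeasure (K x) A) \<in> borel_measurable borel" if "A \<in> range (\<lambda>y. {..y})" for A
    using that by (auto simp: emeasure_K_atMost)
qed simp

lemma measure_K_lessThan_0: "measure (K x) {..<0} = 0"
proof -
  interpret real_distribution "K x"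
    by (rule real_distribution_K)
  have "((\<lambda>y. 0) \<longlongrightarrow> measure (K x) {..<0}) (at_left (0::real))"
  proof (rule Lim_transform_eventually[OF cdf_at_left])
    show "\<forall>\<^sub>F y in at_left 0. cdf (K x) y = 0"
      by (simp add: eventually_at_filter cdf_def2 measure_def emeasure_K_atMost G_def)
  qed
  then show ?thesis
    by (simp add: tendsto_const_iff)
qed

lemma measure_K: "0 \<le> y \<Longrightarrow> measure (K x) {0..y} = G x y"
proof -
  interpret real_distribution "K x"
    by (rule real_distribution_K)
  assume "0 \<le> y"
  then have "{..y} = {..<0} \<union> {0..y}"
    by auto
  also have "measure (K x) \<dots> = measure (K x) {..<0} + measure (K x) {0..y}"
    by (rule finite_measure_Union) auto
  finally have "measure (K x) {..y} = measure (K x) {..<0} + measure (K x) {0..y}" .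
  moreover have "measure (K x) {..y} = G x y"
    by (simp add: measure_def emeasure_K_atMost G_nonneg)
  ultimately show ?thesis
    by (simp add: measure_K_lessThan_0)
qed

lemma measure_kernel_prod_rectangle:
  assumes xy: "x \<in> {0..1}" "y \<in> {0..1}"
  shows "measure (kernel_prod K) ({0..x} \<times> {0..y}) = C x y"
proof -
  have "emeasure (K u) {0..y} = ennreal (G u y)" for u
    using measure_K[of y u] xy real_distribution_K[of u]
    by (simp add: real_distribution_def prob_space_def finite_measure.emeasure_eq_measure)
  then have "emeasure (kernel_prod K) ({0..x} \<times> {0..y})
      = (\<integral>\<^sup>+u. ennreal (G u y) * indicator {0..x} u * indicator {0..1} u \<partial>lborel)"
    by (subst emeasure_kernel_prod_Times[OF K_measurable]) simp_all
  also have "\<dots> = (\<integral>\<^sup>+u. ennreal (G u y) * indicator {0..x} u \<partial>lborel)"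
    using xy by (intro nn_integral_cong) (auto simp: indicator_def)
  also have "\<dots> = ennreal (C x y)"
    using xy by (intro nn_integral_G)
  finally show ?thesis
    using C_nonneg xy by (simp add: measure_def)
qed

lemma copula_measure_eq: "copula_measure C = kernel_prod K"
  by (intro copula_measure_eqI sets_kernel_prod prob_space_kernel_prod K_measurable measure_kernel_prod_rectangle)
     (simp_all add: C_1_right)

lemma prob_space_copula_measure: "prob_space (copula_measure C)"
  unfolding copula_measure_eq by (rule prob_space_kernel_prod[OF K_measurable])

lemma sets_copula_measure: "sets (copula_measure C) = sets borel"
  unfolding copula_measure_eq by (rule sets_kernel_prod[OF K_measurable])

lemma AE_copula_measure: "AE w in copula_measure C. w \<in> {0..1} \<times> {0..1}"
proof -
  interpret prob_space "copula_measure C" by (rule prob_space_copula_measure)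
  have "prob ({0..1} \<times> {0..1}) = 1"
    unfolding copula_measure_eq by (subst measure_kernel_prod_rectangle) (simp_all add: C_1_right)
  moreover have "{0..1} \<times> {0..1} \<in> sets (copula_measure C)"
    unfolding sets_copula_measure by (simp add: borel_prod[symmetric])
  ultimately show ?thesis
    by (subst (asm) prob_eq_1) auto
qed

text \<open>\<open>K\<close> shows that a version exists, so the choice in
  \<open>markov_kernel\<close> really selects one.\<close>

lemma is_markov_kernel_markov_kernel: "is_markov_kernel C (markov_kernel C)"
proof -
  have "is_markov_kernel C K"
    by (rule is_markov_kernel_kernel_prod[OF K_measurable copula_measure_eq])
       (simp add: measure_K G_def)
  then show ?thesis
    unfolding markov_kernel_def by (rule someI[of "is_markov_kernel C"])
qed

lemma markov_kernel_eq_G: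
  assumes "y \<in> {0..1}"
  shows "AE x in lborel. x \<in> {0..1} \<longrightarrow> measure (markov_kernel C x) {0..y} = G x y"
  using is_markov_kernel_unique[OF K_measurable copula_measure_eq is_markov_kernel_markov_kernel, of "{0..y}"]
    assms by (simp add: AE_unif measure_K)

text \<open>The link between the abstract kernel and the explicit partial derivative; the
  exceptional null set of \<open>x\<close> depends on \<open>y\<close>.\<close>

lemma markov_kernel_eq_H:
  assumes "y \<in> {0<..<1} - Y0"
  shows "AE x in lborel. x \<in> {0<..<1} \<longrightarrow> measure (markov_kernel C x) {0..y} = H x y"
proof -
  have "AE x in lborel. x \<in> {0..1} \<longrightarrow> measure (markov_kernel C x) {0..y} = G x y"
    using assms by (intro markov_kernel_eq_G) auto
  with G_eq_H[OF assms] show ?thesis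
    by eventually_elim auto
qed

lemma nn_integral_markov_kernel:
  assumes "x \<in> {0..1}" "y \<in> {0..1}"
  shows "(\<integral>\<^sup>+u. ennreal (measure (markov_kernel C u) {0..y}) * indicator {0..x} u \<partial>lborel) = ennreal (C x y)"
proof -
  have "(\<integral>\<^sup>+u. ennreal (measure (markov_kernel C u) {0..y}) * indicator {0..x} u \<partial>lborel)
      = (\<integral>\<^sup>+u. ennreal (G u y) * indicator {0..x} u \<partial>lborel)"
    using markov_kernel_eq_G[OF assms(2)]
    by (intro nn_integral_cong_AE, elim AE_mp) (use assms in \<open>auto simp: indicator_def\<close>)
  then show ?thesis
    using assms by (simp add: nn_integral_G)
qed

end

section \<open>Conditional distribution functions\<close>

definition cond_cdf :: "(real \<Rightarrow> real \<Rightarrow> real) \<Rightarrow> real \<Rightarrow> real \<Rightarrow> real" where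
  "cond_cdf C x y = measure (markov_kernel C x) {0..y}"

lemma integrable_indicator_Icc: "integrable lborel (\<lambda>x. indicator {a..b} x :: real)" for a b :: real
  by (intro integrable_real_indicator) (simp_all add: emeasure_lborel_Icc_eq)

lemma markov_kernel_facts:
  assumes K: "is_markov_kernel C K" and x: "x \<in> {0..1}"
  shows "real_distribution (K x)" "measure (K x) {0..1} = 1"
    and "cdf (K x) y = measure (K x) {0..y}"
    and "0 \<le> y \<Longrightarrow> isCont (cdf (K x)) y \<longleftrightarrow> measure (K x) {y} = 0"
proof -
  have "K \<in> restrict_space borel {0..1} \<rightarrow>\<^sub>M prob_algebra borel"
    using K by (simp add: is_markov_kernel_def)
  from measurable_space[OF this, of x] have p: "prob_space (K x)" "sets (K x) = sets borel"
    using x by (auto simp: space_restrict_space space_prob_algebra)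
  show rd: "real_distribution (K x)"
    using p by (simp add: real_distribution_def real_distribution_axioms_def)
  interpret real_distribution "K x" by fact
  show one: "measure (K x) {0..1} = 1"
    using K x by (simp add: is_markov_kernel_def)
  then have "AE y in K x. y \<in> {0..1}"
    by (subst (asm) prob_eq_1) auto
  then show "cdf (K x) y = measure (K x) {0..y}"
    unfolding cdf_def2 by (intro measure_eq_AE) auto
  show "isCont (cdf (K x)) y \<longleftrightarrow> measure (K x) {y} = 0"
    by (rule isCont_cdf)
qed

text \<open>\<open>K\<close> is measurable only on the unit interval; the indicator extends the
  measures of sections by 0 to a function on the whole plane.\<close>

lemma measurable_kernel_pair:
  assumes K: "K \<in> restrict_space borel {0..1::real} \<rightarrow>\<^sub>M prob_algebra (borel :: real measure)"
    and S: "\<And>z. S z \<in> sets borel" and S2: "Measurable.pred (borel \<Otimes>\<^sub>M borel \<Otimes>\<^sub>M borel) (\<lambda>(x, y, w). w \<in> S (x, y :: real))"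
  shows "(\<lambda>(x, y). indicator {0..1} x * measure (K x) (S (x, y))) \<in> borel_measurable (borel \<Otimes>\<^sub>M borel)"
proof -
  let ?R = "restrict_space (borel \<Otimes>\<^sub>M borel) ({0..1} \<times> UNIV) :: (real \<times> real) measure"
  have R: "{0..1} \<times> UNIV \<inter> space (borel \<Otimes>\<^sub>M borel) \<in> sets (borel \<Otimes>\<^sub>M borel :: (real \<times> real) measure)"
    by simp
  have sp: "space ?R = {0..1} \<times> UNIV"
    by (simp add: space_restrict_space space_pair_measure)
  have "fst \<in> ?R \<rightarrow>\<^sub>M restrict_space borel {0..1}"
    by (intro measurable_restrict_space3 measurable_fst) auto
  from measurable_compose[OF this K] have L: "(\<lambda>z. K (fst z)) \<in> ?R \<rightarrow>\<^sub>M subprob_algebra borel"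
    by (rule measurable_prob_algebraD)
  have "{v \<in> space (?R \<Otimes>\<^sub>M borel). snd v \<in> S (fst v)} \<in> sets (?R \<Otimes>\<^sub>M borel)"
  proof -
    have "(\<lambda>v. (fst (fst v), snd (fst v), snd v)) \<in> (?R \<Otimes>\<^sub>M borel) \<rightarrow>\<^sub>M (borel \<Otimes>\<^sub>M borel \<Otimes>\<^sub>M borel)"
      by (intro measurable_Pair measurable_compose[OF measurable_fst measurable_restrict_space1]) auto
    from measurable_compose[OF this S2] show ?thesis
      by (simp add: pred_def)
  qed
  also have "{v \<in> space (?R \<Otimes>\<^sub>M borel). snd v \<in> S (fst v)} = (SIGMA z:space ?R. S z)"
    by (auto simp: space_pair_measure)
  finally have "(\<lambda>z. measure (K (fst z)) (S z)) \<in> borel_measurable ?R"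
    using L by (rule measure_measurable_subprob_algebra2)
  then have "(\<lambda>z. indicator ({0..1} \<times> UNIV) z *\<^sub>R measure (K (fst z)) (S z)) \<in> borel_measurable (borel \<Otimes>\<^sub>M borel)"
    by (subst (asm) borel_measurable_restrict_space_iff[OF R])
  also have "(\<lambda>z. indicator ({0..1} \<times> UNIV) z *\<^sub>R measure (K (fst z)) (S z))
      = (\<lambda>(x, y). indicator {0..1} x * measure (K x) (S (x, y)))"
    by (auto simp: fun_eq_iff indicator_def)
  finally show ?thesis .
qed

context copula_kernel
begin

lemma kernel_measurable: "markov_kernel C \<in> restrict_space borel {0..1} \<rightarrow>\<^sub>M prob_algebra borel"
  using is_markov_kernel_markov_kernel by (simp add: is_markov_kernel_def)

lemma cond_cdf_measurable_pair:
  "(\<lambda>(x, y). indicator {0..1} x * cond_cdf C x y) \<in> borel_measurable (borel \<Otimes>\<^sub>M borel)"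
  unfolding cond_cdf_def
  using measurable_kernel_pair[OF kernel_measurable, of "\<lambda>z. {0..snd z}"] by simp

lemma cond_cdf_measurable:
  "(\<lambda>x. indicator {0..1} x * cond_cdf C x y) \<in> borel_measurable borel"
  using measurable_compose[OF _ cond_cdf_measurable_pair, of "\<lambda>x. (x, y)" borel] by simp

lemma cond_cdf_bounds: "x \<in> {0..1} \<Longrightarrow> 0 \<le> cond_cdf C x y \<and> cond_cdf C x y \<le> 1"
  using markov_kernel_facts(1)[OF is_markov_kernel_markov_kernel]
  by (auto simp: cond_cdf_def real_distribution_def intro: prob_space.prob_le_1)

lemma cond_cdf_mono: "x \<in> {0..1} \<Longrightarrow> y \<le> y' \<Longrightarrow> cond_cdf C x y \<le> cond_cdf C x y'"
proof -
  assume x: "x \<in> {0..1}" and "y \<le> y'"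
  interpret real_distribution "markov_kernel C x"
    using markov_kernel_facts(1)[OF is_markov_kernel_markov_kernel x] .
  show ?thesis
    unfolding cond_cdf_def using \<open>y \<le> y'\<close> by (intro finite_measure_mono) auto
qed

lemma cond_cdf_1: "x \<in> {0..1} \<Longrightarrow> cond_cdf C x 1 = 1"
  unfolding cond_cdf_def by (rule markov_kernel_facts(2)[OF is_markov_kernel_markov_kernel])

lemma set_integrable_cond_cdf: "A \<in> sets borel \<Longrightarrow> A \<subseteq> {0..1} \<Longrightarrow> set_integrable lborel A (\<lambda>x. cond_cdf C x y)"
proof -
  assume [measurable]: "A \<in> sets borel" and A: "A \<subseteq> {0..1}"
  note [measurable] = cond_cdf_measurable
  have "integrable lborel (\<lambda>x. indicator A x * (indicator {0..1} x * cond_cdf C x y))"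
  proof (rule Bochner_Integration.integrable_bound)
    show "integrable lborel (\<lambda>x :: real. indicator {0..1} x :: real)"
      by (rule integrable_indicator_Icc)
    show "AE x in lborel. norm (indicator A x * (indicator {0..1} x * cond_cdf C x y)) \<le> norm (indicator {0..1} x :: real)"
      using cond_cdf_bounds[of _ y] by (intro AE_I2) (auto simp: indicator_def)
  qed measurable
  also have "(\<lambda>x. indicator A x * (indicator {0..1} x * cond_cdf C x y)) = (\<lambda>x. indicator A x *\<^sub>R cond_cdf C x y)"
    using A by (auto simp: fun_eq_iff indicator_def)
  finally show ?thesis
    by (simp add: set_integrable_def)
qed

lemma integral_cond_cdf:
  assumes "x \<in> {0..1}" "y \<in> {0..1}"
  shows "(LINT u:{0..x}|lborel. cond_cdf C u y) = C x y"
proof -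
  have i: "set_integrable lborel {0..x} (\<lambda>u. cond_cdf C u y)"
    using assms by (intro set_integrable_cond_cdf) auto
  have nn: "0 \<le> indicator {0..x} u *\<^sub>R cond_cdf C u y" for u
    by (simp add: cond_cdf_def)
  have "ennreal (LINT u:{0..x}|lborel. cond_cdf C u y) = (\<integral>\<^sup>+u. ennreal (indicator {0..x} u *\<^sub>R cond_cdf C u y) \<partial>lborel)"
    unfolding set_lebesgue_integral_def
    using i nn by (intro nn_integral_eq_integral[symmetric] AE_I2) (simp_all add: set_integrable_def)
  also have "\<dots> = (\<integral>\<^sup>+u. ennreal (measure (markov_kernel C u) {0..y}) * indicator {0..x} u \<partial>lborel)"
    by (intro nn_integral_cong) (simp add: cond_cdf_def indicator_def)
  also have "\<dots> = ennreal (C x y)"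
    using assms by (rule nn_integral_markov_kernel)
  finally show ?thesis
    using C_nonneg assms nn by (simp add: set_lebesgue_integral_def Bochner_Integration.integral_nonneg)
qed

text \<open>\<open>C x\<close> grows by the integral over \<open>{0..x}\<close> of a non-negative
  increment of conditional distribution functions. Enlarging the range to the whole unit interval
  gives the increment \<open>y' - y\<close> of the uniform marginal.\<close>

lemma C_mono_right:
  assumes "x \<in> {0..1}" "y \<in> {0..1}" "y' \<in> {0..1}" "y \<le> y'"
  shows "0 \<le> C x y' - C x y" "C x y' - C x y \<le> y' - y"
proof -
  have i: "set_integrable lborel {0..z} (\<lambda>u. cond_cdf C u v)" if "z \<in> {0..1}" for z v
    using that by (intro set_integrable_cond_cdf) auto
  have eq: "C z y' - C z y = (LINT u:{0..z}|lborel. cond_cdf C u y' - cond_cdf C u y)" if "z \<in> {0..1}" for z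
    using that assms by (subst set_integral_diff(2)[OF i i]) (simp_all add: integral_cond_cdf)
  show "0 \<le> C x y' - C x y"
    using assms cond_cdf_mono[OF _ \<open>y \<le> y'\<close>] unfolding eq[OF \<open>x \<in> {0..1}\<close>] set_lebesgue_integral_def
    by (intro Bochner_Integration.integral_nonneg) (auto simp: indicator_def)
  have "C x y' - C x y \<le> C 1 y' - C 1 y"
    unfolding eq[OF \<open>x \<in> {0..1}\<close>] eq[of 1, simplified] set_lebesgue_integral_def
  proof (rule Bochner_Integration.integral_mono)
    show "integrable lborel (\<lambda>u. indicator {0..x} u *\<^sub>R (cond_cdf C u y' - cond_cdf C u y))"
      "integrable lborel (\<lambda>u. indicator {0..1} u *\<^sub>R (cond_cdf C u y' - cond_cdf C u y))"
      using set_integral_diff(1)[OF i i] assms by (simp_all add: set_integrable_def)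
    show "indicator {0..x} u *\<^sub>R (cond_cdf C u y' - cond_cdf C u y)
        \<le> indicator {0..1} u *\<^sub>R (cond_cdf C u y' - cond_cdf C u y)" for u
      using assms cond_cdf_mono[OF _ \<open>y \<le> y'\<close>, of u] by (auto simp: indicator_def)
  qed
  then show "C x y' - C x y \<le> y' - y"
    using assms by (simp add: C_1_left)
qed

text \<open>The increment is the integral of a function with values in the unit interval over an
  interval of length \<open>x' - x\<close>.\<close>

lemma C_mono_left:
  assumes "y \<in> {0..1}" "x \<in> {0..1}" "x' \<in> {0..1}" "x \<le> x'"
  shows "0 \<le> C x' y - C x y" "C x' y - C x y \<le> x' - x"
proof -
  have i: "set_integrable lborel {0..z} (\<lambda>u. cond_cdf C u y)" if "z \<in> {0..1}" for z
    using that by (intro set_integrable_cond_cdf) auto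
  have lx: "(\<integral>u. indicator {0..z} u \<partial>lborel) = z" if "0 \<le> z" for z :: real
    using that by simp
  note eq = integral_cond_cdf[OF _ \<open>y \<in> {0..1}\<close>, symmetric, unfolded set_lebesgue_integral_def]
  show "0 \<le> C x' y - C x y"
    unfolding eq[OF assms(2)] eq[OF assms(3)] diff_ge_0_iff_ge
    using i assms cond_cdf_bounds
    by (intro Bochner_Integration.integral_mono) (auto simp: set_integrable_def indicator_def)
  have "C x' y - C x y = (\<integral>u. indicator {0..x'} u *\<^sub>R cond_cdf C u y - indicator {0..x} u *\<^sub>R cond_cdf C u y \<partial>lborel)"
    unfolding eq[OF assms(2)] eq[OF assms(3)]
    using i assms by (intro Bochner_Integration.integral_diff[symmetric]) (simp_all add: set_integrable_def)
  also have "\<dots> \<le> (\<integral>u. indicator {0..x'} u - indicator {0..x} u \<partial>lborel)"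
    using i assms cond_cdf_bounds
    by (intro Bochner_Integration.integral_mono Bochner_Integration.integrable_diff integrable_indicator_Icc)
       (auto simp: set_integrable_def indicator_def)
  also have "\<dots> = x' - x"
    using assms by (subst Bochner_Integration.integral_diff) (auto intro: integrable_indicator_Icc simp: lx)
  finally show "C x' y - C x y \<le> x' - x" .
qed

lemma C_le_1:
  assumes "x \<in> {0..1}" "y \<in> {0..1}"
  shows "C x y \<le> 1"
  using C_mono_left(2)[OF assms(2) _ assms(1), of 0] C_0_left[OF assms(2)] assms by simp

lemma C_Lipschitz:
  assumes "x \<in> {0..1}" "y \<in> {0..1}" "x' \<in> {0..1}" "y' \<in> {0..1}"
  shows "\<bar>C x y - C x' y'\<bar> \<le> \<bar>x - x'\<bar> + \<bar>y - y'\<bar>"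
proof -
  have "\<bar>C x y - C x' y\<bar> \<le> \<bar>x - x'\<bar>"
  proof (cases "x \<le> x'")
    case True
    with C_mono_left[OF assms(2,1,3)] show ?thesis by simp
  next
    case False
    with C_mono_left[OF assms(2,3,1)] show ?thesis by simp
  qed
  moreover have "\<bar>C x' y - C x' y'\<bar> \<le> \<bar>y - y'\<bar>"
  proof (cases "y \<le> y'")
    case True
    with C_mono_right[OF assms(3,2,4)] show ?thesis by simp
  next
    case False
    with C_mono_right[OF assms(3,4,2)] show ?thesis by simp
  qed
  ultimately show ?thesis by linarith
qed

text \<open>Integrated over \<open>x\<close>, the atoms at \<open>y\<close> have at most the mass of
  the strip between \<open>y'\<close> and \<open>y\<close>, which is \<open>y - y'\<close> and
  arbitrarily small. At \<open>y = 0\<close> there is no \<open>y'\<close> to the left inside the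
  unit interval, hence the half-open range.\<close>

lemma AE_kernel_no_atom:
  assumes "y \<in> {0<..1}"
  shows "AE x in lborel. x \<in> {0..1} \<longrightarrow> measure (markov_kernel C x) {y} = 0"
proof -
  let ?z = "\<lambda>x. indicator {0..1} x * measure (markov_kernel C x) {y}"
  have "(\<lambda>x. measure (markov_kernel C x) {y}) \<in> borel_measurable (restrict_space borel {0..1})"
    by (rule measurable_compose[OF measurable_prob_algebraD[OF kernel_measurable] measurable_measure_subprob_algebra]) simp
  then have [measurable]: "?z \<in> borel_measurable borel"
    by (subst (asm) borel_measurable_restrict_space_iff) simp_all
  have bound: "0 \<le> ?z x \<and> ?z x \<le> 1" for x
    using markov_kernel_facts(1)[OF is_markov_kernel_markov_kernel, of x]
    by (cases "x \<in> {0..1}") (auto simp: real_distribution_def intro: prob_space.prob_le_1)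
  have int: "integrable lborel ?z"
  proof (rule Bochner_Integration.integrable_bound)
    show "integrable lborel (\<lambda>x :: real. indicator {0..1} x :: real)"
      by (rule integrable_indicator_Icc)
    show "AE x in lborel. norm (?z x) \<le> norm (indicator {0..1} x :: real)"
    proof (rule AE_I2)
      show "norm (?z x) \<le> norm (indicator {0..1} x :: real)" for x
        using bound[of x] by (cases "x \<in> {0..1}") simp_all
    qed
  qed measurable
  have "(\<integral>x. ?z x \<partial>lborel) \<le> 0 + e" if "e > 0" for e
  proof -
    define y' where "y' = max 0 (y - e)"
    have y': "y' \<in> {0..1}" "y' < y" "y - y' \<le> e"
      using assms \<open>e > 0\<close> by (auto simp: y'_def)
    have le: "?z x \<le> indicator {0..1} x *\<^sub>R (cond_cdf C x y - cond_cdf C x y')" for x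
    proof (cases "x \<in> {0..1}")
      case True
      then interpret real_distribution "markov_kernel C x"
        by (rule markov_kernel_facts(1)[OF is_markov_kernel_markov_kernel])
      have "measure (markov_kernel C x) {y} + measure (markov_kernel C x) {0..y'} = measure (markov_kernel C x) ({y} \<union> {0..y'})"
        using y' by (intro finite_measure_Union[symmetric]) auto
      also have "\<dots> \<le> measure (markov_kernel C x) {0..y}"
        using y' assms by (intro finite_measure_mono) auto
      finally show ?thesis
        using True by (simp add: cond_cdf_def)
    qed simp
    have i: "set_integrable lborel {0..1} (\<lambda>u. cond_cdf C u v)" for v
      by (intro set_integrable_cond_cdf) auto
    have "(\<integral>x. ?z x \<partial>lborel) \<le> (LINT x:{0..1}|lborel. cond_cdf C x y - cond_cdf C x y')"
      unfolding set_lebesgue_integral_def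
      using int set_integral_diff(1)[OF i i] le by (intro Bochner_Integration.integral_mono) (simp_all add: set_integrable_def)
    also have "\<dots> = y - y'"
      using assms y' by (subst set_integral_diff(2)[OF i i]) (simp_all add: integral_cond_cdf C_1_left)
    finally show ?thesis using y' by simp
  qed
  then have "(\<integral>x. ?z x \<partial>lborel) \<le> 0"
    by (rule field_le_epsilon)
  moreover have "0 \<le> (\<integral>x. ?z x \<partial>lborel)"
    using bound by (intro Bochner_Integration.integral_nonneg) blast
  moreover have "(AE x in lborel. ?z x = 0) \<longleftrightarrow> (\<integral>x. ?z x \<partial>lborel) = 0"
    using bound by (intro integral_nonneg_eq_0_iff_AE[OF int, symmetric] AE_I2) blast
  ultimately have "AE x in lborel. ?z x = 0"
    by linarith
  then show ?thesis
    by eventually_elim (auto simp: indicator_def)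
qed

end

section \<open>The metrics and weak conditional convergence\<close>

text \<open>The common quantity behind all the metrics: \<open>D_inf\<close> is its supremum over
  \<open>y\<close>, and \<open>D_fin 1\<close> its mean.\<close>

definition kernel_dev :: "(real \<Rightarrow> real \<Rightarrow> real) \<Rightarrow> (real \<Rightarrow> real \<Rightarrow> real) \<Rightarrow> real \<Rightarrow> real" where
  "kernel_dev C1 C2 y = (LINT x:{0..1}|lborel. \<bar>cond_cdf C1 x y - cond_cdf C2 x y\<bar>)"

locale copula_kernel_pair = C1: copula_kernel C1 H1 Y1 + C2: copula_kernel C2 H2 Y2
  for C1 C2 H1 H2 :: "real \<Rightarrow> real \<Rightarrow> real" and Y1 Y2 :: "real set"
begin

lemma set_integrable_diff: "A \<in> sets borel \<Longrightarrow> A \<subseteq> {0..1} \<Longrightarrow> set_integrable lborel A (\<lambda>x. cond_cdf C1 x y - cond_cdf C2 x y)"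
  by (intro set_integral_diff(1) C1.set_integrable_cond_cdf C2.set_integrable_cond_cdf)

lemma set_integrable_dev: "set_integrable lborel {0..1} (\<lambda>x. \<bar>cond_cdf C1 x y - cond_cdf C2 x y\<bar>)"
  by (intro set_integrable_abs set_integrable_diff) auto

lemma dev_pointwise: "x \<in> {0..1} \<Longrightarrow> \<bar>cond_cdf C1 x y - cond_cdf C2 x y\<bar> \<le> 1"
  using C1.cond_cdf_bounds[of x y] C2.cond_cdf_bounds[of x y] by auto

lemma kernel_dev_nonneg: "0 \<le> kernel_dev C1 C2 y"
  unfolding kernel_dev_def set_lebesgue_integral_def by (intro Bochner_Integration.integral_nonneg) simp

lemma kernel_dev_le_1: "kernel_dev C1 C2 y \<le> 1"
proof -
  have "kernel_dev C1 C2 y \<le> (LINT x:{0..1::real}|lborel. (1::real))"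
    unfolding kernel_dev_def set_lebesgue_integral_def
  proof (rule Bochner_Integration.integral_mono)
    show "integrable lborel (\<lambda>x. indicator {0..1} x *\<^sub>R \<bar>cond_cdf C1 x y - cond_cdf C2 x y\<bar>)"
      using set_integrable_dev by (simp add: set_integrable_def)
    show "integrable lborel (\<lambda>x :: real. indicator {0..1} x *\<^sub>R (1::real))"
      using integrable_indicator_Icc[of 0 1] by simp
    show "indicator {0..1} x *\<^sub>R \<bar>cond_cdf C1 x y - cond_cdf C2 x y\<bar> \<le> indicator {0..1} x *\<^sub>R 1" for x
      using dev_pointwise[of x y] by (cases "x \<in> {0..1}") simp_all
  qed
  then show ?thesis
    by (simp add: set_lebesgue_integral_def)
qed

text \<open>Copula values are integrals of the conditional distribution functions over an initial
  interval, so their distance is dominated by the integral of the deviation over the whole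
  interval.\<close>

lemma abs_diff_le_kernel_dev:
  assumes "x \<in> {0..1}" "y \<in> {0..1}"
  shows "\<bar>C1 x y - C2 x y\<bar> \<le> kernel_dev C1 C2 y"
proof -
  have 1: "set_integrable lborel {0..x} (\<lambda>u. cond_cdf C1 u y)" and 2: "set_integrable lborel {0..x} (\<lambda>u. cond_cdf C2 u y)"
    using assms by (auto intro!: C1.set_integrable_cond_cdf C2.set_integrable_cond_cdf)
  have "C1 x y - C2 x y = (LINT u:{0..x}|lborel. cond_cdf C1 u y - cond_cdf C2 u y)"
    using assms by (subst set_integral_diff(2)[OF 1 2]) (simp add: C1.integral_cond_cdf C2.integral_cond_cdf)
  also have "\<bar>\<dots>\<bar> \<le> (\<integral>u. \<bar>indicator {0..x} u *\<^sub>R (cond_cdf C1 u y - cond_cdf C2 u y)\<bar> \<partial>lborel)"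
    unfolding set_lebesgue_integral_def by (rule integral_abs_bound)
  also have "\<dots> \<le> kernel_dev C1 C2 y"
    unfolding kernel_dev_def set_lebesgue_integral_def
  proof (rule Bochner_Integration.integral_mono)
    show "integrable lborel (\<lambda>u. \<bar>indicator {0..x} u *\<^sub>R (cond_cdf C1 u y - cond_cdf C2 u y)\<bar>)"
      using set_integral_diff(1)[OF 1 2] by (intro integrable_abs) (simp add: set_integrable_def)
    show "integrable lborel (\<lambda>u. indicator {0..1} u *\<^sub>R \<bar>cond_cdf C1 u y - cond_cdf C2 u y\<bar>)"
      using set_integrable_dev by (simp add: set_integrable_def)
  qed (use assms in \<open>auto simp: indicator_def\<close>)
  finally show ?thesis .
qed

text \<open>Conditional distribution functions increase in \<open>y\<close>, so moving the level
  changes each of the two by \<open>\<bar>y' - y\<bar>\<close> in mean; the triangle inequality adds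
  both.\<close>

lemma kernel_dev_Lipschitz:
  assumes "y \<in> {0..1}" "y' \<in> {0..1}"
  shows "kernel_dev C1 C2 y' \<le> kernel_dev C1 C2 y + 2 * \<bar>y' - y\<bar>"
proof -
  have i: "set_integrable lborel {0..1} (\<lambda>x. \<bar>cond_cdf C x y' - cond_cdf C x y\<bar>)"
      "(LINT x:{0..1}|lborel. \<bar>cond_cdf C x y' - cond_cdf C x y\<bar>) = \<bar>y' - y\<bar>"
    if "copula_kernel C H Y" for C H Y
  proof -
    interpret copula_kernel C H Y by fact
    have i: "set_integrable lborel {0..1} (\<lambda>u. cond_cdf C u v)" for v
      by (intro set_integrable_cond_cdf) auto
    show "set_integrable lborel {0..1} (\<lambda>x. \<bar>cond_cdf C x y' - cond_cdf C x y\<bar>)"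
      by (intro set_integrable_abs set_integral_diff(1) i)
    have *: "(LINT x:{0..1}|lborel. \<bar>cond_cdf C x b - cond_cdf C x a\<bar>) = b - a"
      if "a \<le> b" "a \<in> {0..1}" "b \<in> {0..1}" for a b
    proof -
      have "(LINT x:{0..1}|lborel. \<bar>cond_cdf C x b - cond_cdf C x a\<bar>) = (LINT x:{0..1}|lborel. cond_cdf C x b - cond_cdf C x a)"
        using cond_cdf_mono[OF _ \<open>a \<le> b\<close>] unfolding set_lebesgue_integral_def
        by (intro Bochner_Integration.integral_cong) (auto simp: indicator_def)
      also have "\<dots> = b - a"
        using that by (subst set_integral_diff(2)[OF i i]) (simp add: integral_cond_cdf C_1_left)
      finally show ?thesis .
    qed
    show "(LINT x:{0..1}|lborel. \<bar>cond_cdf C x y' - cond_cdf C x y\<bar>) = \<bar>y' - y\<bar>"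
      using *[of y y'] *[of y' y] assms by (cases "y \<le> y'") (simp_all add: abs_minus_commute)
  qed
  note i1 = i[OF C1.copula_kernel_axioms] and i2 = i[OF C2.copula_kernel_axioms]
  have "kernel_dev C1 C2 y' \<le> (LINT x:{0..1}|lborel. \<bar>cond_cdf C1 x y - cond_cdf C2 x y\<bar>
      + (\<bar>cond_cdf C1 x y' - cond_cdf C1 x y\<bar> + \<bar>cond_cdf C2 x y' - cond_cdf C2 x y\<bar>))"
    unfolding kernel_dev_def
    by (intro set_integral_mono set_integral_add(1) set_integrable_dev i1(1) i2(1)) auto
  also have "\<dots> = kernel_dev C1 C2 y + 2 * \<bar>y' - y\<bar>"
    by (subst set_integral_add(2)[OF set_integrable_dev set_integral_add(1)[OF i1(1) i2(1)]],
        subst set_integral_add(2)[OF i1(1) i2(1)]) (simp add: kernel_dev_def i1(2) i2(2))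
  finally show ?thesis .
qed

lemma D_inf_eq: "D_inf C1 C2 = (SUP y\<in>{0..1}. kernel_dev C1 C2 y)"
  by (simp add: D_inf_def kernel_dev_def cond_cdf_def)

lemma bdd_above_kernel_dev: "bdd_above (kernel_dev C1 C2 ` {0..1})"
  using kernel_dev_le_1 by (intro bdd_aboveI2[where M = 1])

lemma kernel_dev_le_D_inf: "y \<in> {0..1} \<Longrightarrow> kernel_dev C1 C2 y \<le> D_inf C1 C2"
  unfolding D_inf_eq by (rule cSUP_upper[OF _ bdd_above_kernel_dev])

lemma D_inf_nonneg: "0 \<le> D_inf C1 C2"
  using kernel_dev_le_D_inf[of 0] kernel_dev_nonneg[of 0] by simp

lemma abs_diff_le_d_sup:
  assumes "x \<in> {0..1}" "y \<in> {0..1}"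
  shows "\<bar>C1 x y - C2 x y\<bar> \<le> d_sup C1 C2"
proof -
  have "\<bar>C1 a b - C2 a b\<bar> \<le> 1" if "a \<in> {0..1}" "b \<in> {0..1}" for a b
    using abs_diff_le_kernel_dev[OF that] kernel_dev_le_1[of b] by linarith
  then have "bdd_above ((\<lambda>(x, y). \<bar>C1 x y - C2 x y\<bar>) ` ({0..1} \<times> {0..1}))"
    by (intro bdd_aboveI2[where M = 1]) auto
  from cSUP_upper[OF _ this, of "(x, y)"] show ?thesis
    using assms by (simp add: d_sup_def)
qed

lemma d_sup_le_D_inf: "d_sup C1 C2 \<le> D_inf C1 C2"
proof -
  have "\<bar>C1 a b - C2 a b\<bar> \<le> D_inf C1 C2" if "a \<in> {0..1}" "b \<in> {0..1}" for a b
    using abs_diff_le_kernel_dev[OF that] kernel_dev_le_D_inf[of b] that by linarith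
  then show ?thesis
    unfolding d_sup_def by (intro cSUP_least) auto
qed

lemma d_sup_nonneg: "0 \<le> d_sup C1 C2"
  using abs_diff_le_d_sup[of 0 0] by simp

text \<open>Deviations are at most 1, so their \<open>p\<close>-th powers do not exceed them; by
  Fubini the double integral is at most the mean of \<open>kernel_dev\<close> over \<open>y\<close>,
  hence at most \<open>D_inf\<close>.\<close>

lemma D_fin_le:
  assumes "1 \<le> p"
  shows "D_fin p C1 C2 \<le> D_inf C1 C2 powr (1 / p)"
proof -
  let ?d = "\<lambda>x y. \<bar>cond_cdf C1 x y - cond_cdf C2 x y\<bar>"
  \<comment> \<open>Cut off by indicators, since joint measurability of the conditional distribution
    functions is available only for \<open>x\<close> in the unit interval.\<close>
  define f where "f = (\<lambda>(x, y). indicator {0..1} x * (indicator {0..1} y * ?d x y))"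
  have f_eq: "f = (\<lambda>z. indicator {0..1} (snd z) *
      \<bar>(\<lambda>(x, y). indicator {0..1} x * cond_cdf C1 x y) z - (\<lambda>(x, y). indicator {0..1} x * cond_cdf C2 x y) z\<bar>)"
    by (auto simp: f_def fun_eq_iff indicator_def)
  have fm[measurable]: "f \<in> borel_measurable (borel \<Otimes>\<^sub>M borel)"
    unfolding f_eq
    by (intro borel_measurable_times borel_measurable_abs borel_measurable_diff
        C1.cond_cdf_measurable_pair C2.cond_cdf_measurable_pair) measurable
  have [measurable]: "f \<in> borel_measurable (lborel \<Otimes>\<^sub>M lborel)"
    using fm by (simp cong: measurable_cong_sets)
  have f_bounds: "0 \<le> f z \<and> f z \<le> 1" for z
    using dev_pointwise by (cases z) (auto simp: f_def indicator_def)
  have f_int: "integrable (lborel \<Otimes>\<^sub>M lborel) f"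
  proof (rule Bochner_Integration.integrable_bound)
    show "integrable (lborel \<Otimes>\<^sub>M lborel) (\<lambda>z :: real \<times> real. indicator ({0..1} \<times> {0..1}) z :: real)"
      by (intro integrable_real_indicator) (auto simp: lborel.emeasure_pair_measure_Times)
    show "AE z in lborel \<Otimes>\<^sub>M lborel. norm (f z) \<le> norm (indicator ({0..1} \<times> {0..1}) z :: real)"
      using dev_pointwise by (intro AE_I2) (auto simp: f_def indicator_def)
  qed measurable
  have "(LINT z:{0..1} \<times> {0..1}|lborel. ?d (fst z) (snd z) powr p) \<le> (\<integral>z. f z \<partial>lborel)"
    unfolding set_lebesgue_integral_def lborel_prod[symmetric]
  proof (rule Bochner_Integration.integral_mono)
    have eq: "(\<lambda>z. indicator ({0..1} \<times> {0..1}) z *\<^sub>R ?d (fst z) (snd z) powr p) = (\<lambda>z. f z powr p)"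
      using \<open>1 \<le> p\<close> by (auto simp: f_def fun_eq_iff indicator_def)
    have pw: "f z powr p \<le> f z" for z
      using f_bounds[of z] powr_mono'[of 1 p "f z"] \<open>1 \<le> p\<close> by (cases "f z = 0") auto
    show "integrable (lborel \<Otimes>\<^sub>M lborel) (\<lambda>z. indicator ({0..1} \<times> {0..1}) z *\<^sub>R ?d (fst z) (snd z) powr p)"
      unfolding eq by (rule Bochner_Integration.integrable_bound[OF f_int]) (use pw f_bounds in auto)
    show "indicator ({0..1} \<times> {0..1}) z *\<^sub>R ?d (fst z) (snd z) powr p \<le> f z" for z
      using pw[of z] fun_cong[OF eq, of z] by simp
  qed (rule f_int)
  also have "\<dots> = (\<integral>y. (\<integral>x. f (x, y) \<partial>lborel) \<partial>lborel)"
    unfolding lborel_prod[symmetric] using f_int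
    by (simp add: lborel_pair.integral_snd[of "\<lambda>x y. f (x, y)"])
  also have "\<dots> = (\<integral>y. indicator {0..1} y * kernel_dev C1 C2 y \<partial>lborel)"
    unfolding f_def kernel_dev_def set_lebesgue_integral_def
    by (intro Bochner_Integration.integral_cong refl)
       (simp add: integral_mult_right_zero[symmetric] mult.left_commute del: integral_mult_right_zero)
  also have "\<dots> \<le> (\<integral>y. indicator {0..1} (y :: real) * D_inf C1 C2 \<partial>lborel)"
  proof (rule Bochner_Integration.integral_mono')
    show "integrable lborel (\<lambda>y :: real. indicator {0..1} y * D_inf C1 C2)"
      by (intro integrable_mult_left integrable_real_indicator) simp_all
  qed (use kernel_dev_le_D_inf kernel_dev_nonneg D_inf_nonneg in \<open>auto simp: indicator_def\<close>)
  also have "\<dots> = D_inf C1 C2"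
    by simp
  finally have *: "(LINT z:{0..1} \<times> {0..1}|lborel. ?d (fst z) (snd z) powr p) \<le> D_inf C1 C2" .
  have "0 \<le> (LINT z:{0..1} \<times> {0..1}|lborel. ?d (fst z) (snd z) powr p)"
    unfolding set_lebesgue_integral_def by (intro Bochner_Integration.integral_nonneg) simp
  with * show ?thesis
    unfolding D_fin_def cond_cdf_def[symmetric] using \<open>1 \<le> p\<close> by (intro powr_mono2) auto
qed

end

lemma copula_kernel_pairI: "copula_kernel C1 H1 Y1 \<Longrightarrow> copula_kernel C2 H2 Y2 \<Longrightarrow> copula_kernel_pair C1 C2 H1 H2 Y1 Y2"
  by (simp add: copula_kernel_pair_def)

context
  fixes C H :: "real \<Rightarrow> real \<Rightarrow> real" and Y :: "real set"
    and Cs Hs :: "nat \<Rightarrow> real \<Rightarrow> real \<Rightarrow> real" and Ys :: "nat \<Rightarrow> real set"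
  assumes C: "copula_kernel C H Y" and Cs: "\<And>n. copula_kernel (Cs n) (Hs n) (Ys n)"
begin

text \<open>Weak convergence gives convergence of distribution functions at continuity points. A
  fixed positive \<open>y\<close> is one for almost every \<open>x\<close>, as the kernel has no
  atom there, and dominated convergence does the rest.\<close>

lemma weak_cond_conv_imp_kernel_dev:
  assumes "weak_cond_conv Cs C" and y: "y \<in> {0..1}"
  shows "(\<lambda>n. kernel_dev (Cs n) C y) \<longlonglongrightarrow> 0"
proof -
  interpret C: copula_kernel C H Y by (rule C)
  interpret Cs: copula_kernel "Cs n" "Hs n" "Ys n" for n by (rule Cs)
  obtain \<Lambda> where \<Lambda>: "\<Lambda> \<in> sets borel" "\<Lambda> \<subseteq> {0..1}" "emeasure lborel \<Lambda> = 1"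
    and conv: "\<And>x. x \<in> \<Lambda> \<Longrightarrow> weak_conv_m (\<lambda>n. markov_kernel (Cs n) x) (markov_kernel C x)"
    using assms by (auto simp: weak_cond_conv_def)
  have "emeasure lborel ({0..1} - \<Lambda>) = 0"
    using \<Lambda> by (subst emeasure_Diff) auto
  then have "{0..1} - \<Lambda> \<in> null_sets lborel"
    using \<Lambda>(1) by (auto simp: null_sets_def)
  then have AE\<Lambda>: "AE x in lborel. x \<notin> {0..1} - \<Lambda>"
    by (rule AE_not_in)
  have AEconv: "AE x in lborel. x \<in> {0..1} \<longrightarrow> (\<lambda>n. cond_cdf (Cs n) x y) \<longlonglongrightarrow> cond_cdf C x y"
  proof (cases "y = 0")
    \<comment> \<open>An atom at 0 cannot be excluded by comparison with smaller levels; instead all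
      the distribution functions vanish there almost everywhere because
      \<open>C x 0 = 0\<close>.\<close>
    case True
    have zero: "AE x in lborel. x \<in> {0..1} \<longrightarrow> cond_cdf D x 0 = 0" if "copula_kernel D H' Y'" for D H' Y'
    proof -
      interpret D: copula_kernel D H' Y' by fact
      have i: "integrable lborel (\<lambda>x. indicator {0..1} x *\<^sub>R cond_cdf D x 0)"
        using D.set_integrable_cond_cdf[of "{0..1}" 0] by (simp add: set_integrable_def)
      have "(\<integral>x. indicator {0..1} x *\<^sub>R cond_cdf D x 0 \<partial>lborel) = 0"
        using D.integral_cond_cdf[of 1 0] D.C_0_right[of 1] by (simp add: set_lebesgue_integral_def)
      then have "AE x in lborel. indicator {0..1} x *\<^sub>R cond_cdf D x 0 = 0"
        using i by (subst (asm) integral_nonneg_eq_0_iff_AE) (auto simp: cond_cdf_def)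
      then show ?thesis
        by eventually_elim (auto simp: indicator_def)
    qed
    have "AE x in lborel. \<forall>n. x \<in> {0..1} \<longrightarrow> cond_cdf (Cs n) x 0 = 0"
      unfolding AE_all_countable using zero[OF Cs] by blast
    with zero[OF C] show ?thesis
      by eventually_elim (simp add: True)
  next
    case False
    then have "y \<in> {0<..1}" using y by auto
    from C.AE_kernel_no_atom[OF this] AE\<Lambda> show ?thesis
    proof eventually_elim
      case (elim x)
      show ?case
      proof
        assume x: "x \<in> {0..1}"
        note facts = markov_kernel_facts[OF C.is_markov_kernel_markov_kernel x]
        note factss = markov_kernel_facts[OF Cs.is_markov_kernel_markov_kernel x]
        have "isCont (cdf (markov_kernel C x)) y"
          using facts(4)[of y] elim x y by simp
        then have "(\<lambda>n. cdf (markov_kernel (Cs n) x) y) \<longlonglongrightarrow> cdf (markov_kernel C x) y"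
          using conv[of x] elim x by (auto simp: weak_conv_m_def weak_conv_def)
        then show "(\<lambda>n. cond_cdf (Cs n) x y) \<longlonglongrightarrow> cond_cdf C x y"
          by (simp add: facts(3) factss(3) cond_cdf_def)
      qed
    qed
  qed
  have "(\<lambda>n. kernel_dev (Cs n) C y) \<longlonglongrightarrow> (\<integral>x. 0 \<partial>(lborel :: real measure))"
    unfolding kernel_dev_def set_lebesgue_integral_def
  proof (rule integral_dominated_convergence[where w = "indicator {0..1}"])
    interpret P: copula_kernel_pair "Cs n" C "Hs n" H "Ys n" Y for n
      by (intro copula_kernel_pairI C Cs)
    show "integrable lborel (indicator {0..1} :: real \<Rightarrow> real)"
      using integrable_indicator_Icc[of 0 1] by simp
    show "(\<lambda>x. indicator {0..1} x *\<^sub>R \<bar>cond_cdf (Cs n) x y - cond_cdf C x y\<bar>) \<in> borel_measurable lborel" for n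
      using P.set_integrable_dev[of n y] by (auto simp: set_integrable_def)
    show "AE x in lborel. norm (indicator {0..1} x *\<^sub>R \<bar>cond_cdf (Cs n) x y - cond_cdf C x y\<bar>) \<le> indicator {0..1} x" for n
      using P.dev_pointwise[of _ n y] by (intro AE_I2) (auto simp: indicator_def)
    show "AE x in lborel. (\<lambda>n. indicator {0..1} x *\<^sub>R \<bar>cond_cdf (Cs n) x y - cond_cdf C x y\<bar>) \<longlonglongrightarrow> 0"
      using AEconv
    proof eventually_elim
      case (elim x)
      show ?case
      proof (cases "x \<in> {0..1}")
        case True
        then have "(\<lambda>n. \<bar>cond_cdf (Cs n) x y - cond_cdf C x y\<bar>) \<longlonglongrightarrow> 0"
          using elim by (intro tendsto_rabs_zero LIM_zero) simp
        then show ?thesis using True by simp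
      qed simp
    qed
  qed simp
  then show ?thesis by simp
qed

text \<open>Uniformity in \<open>y\<close> comes from the common Lipschitz constant 2: smallness at
  finitely many grid levels controls all levels.\<close>

lemma kernel_dev_imp_D_inf:
  assumes "\<And>y. y \<in> {0..1} \<Longrightarrow> (\<lambda>n. kernel_dev (Cs n) C y) \<longlonglongrightarrow> 0"
  shows "(\<lambda>n. D_inf (Cs n) C) \<longlonglongrightarrow> 0"
proof (rule LIMSEQ_I)
  interpret P: copula_kernel_pair "Cs n" C "Hs n" H "Ys n" Y for n
    by (intro copula_kernel_pairI C Cs)
  fix e :: real assume "e > 0"
  \<comment> \<open>Grid width below \<open>e / 4\<close>: one grid value plus twice the distance is
    at most \<open>3 * e / 4\<close>.\<close>
  obtain N :: nat where N2: "4 / e < real N"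
    using reals_Archimedean2 by blast
  moreover have "0 < 4 / e"
    using \<open>e > 0\<close> by simp
  ultimately have "0 < real N"
    by (rule less_trans[rotated])
  with N2 have N: "N > 0" "4 / e < real N"
    by simp_all
  have "\<forall>\<^sub>F n in sequentially. \<forall>j\<in>{..N}. kernel_dev (Cs n) C (real j / real N) < e / 4"
  proof (rule eventually_ball_finite, simp, rule ballI)
    fix j assume "j \<in> {..N}"
    then have "real j / real N \<in> {0..1}"
      using N by auto
    then show "\<forall>\<^sub>F n in sequentially. kernel_dev (Cs n) C (real j / real N) < e / 4"
      using order_tendstoD(2)[OF assms, of _ "e / 4"] \<open>e > 0\<close> by simp
  qed
  then obtain n0 where n0: "\<And>n j. n \<ge> n0 \<Longrightarrow> j \<le> N \<Longrightarrow> kernel_dev (Cs n) C (real j / real N) < e / 4"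
    by (auto simp: eventually_sequentially)
  show "\<exists>no. \<forall>n\<ge>no. norm (D_inf (Cs n) C - 0) < e"
  proof (intro exI allI impI)
    fix n assume "n \<ge> n0"
    have "D_inf (Cs n) C \<le> 3 * e / 4"
      unfolding P.D_inf_eq
    proof (rule cSUP_least)
      fix y :: real assume y: "y \<in> {0..1}"
      define j where "j = nat \<lfloor>y * real N\<rfloor>"
      have j: "real j \<le> y * real N" "y * real N < real j + 1"
        using y N by (auto simp: j_def)
      have "real j \<le> real N"
        using order_trans[OF j(1) mult_right_mono[of y 1 "real N"]] y by simp
      then have "j \<le> N" by simp
      have d: "\<bar>y - real j / real N\<bar> \<le> 1 / real N"
      proof -
        have "real j / real N \<le> y" "y \<le> (real j + 1) / real N"
          using j N by (simp_all add: divide_le_eq le_divide_eq)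
        then show ?thesis
          by (simp add: add_divide_distrib abs_le_iff)
      qed
      have "1 / real N < e / 4"
        using N \<open>e > 0\<close> by (auto simp: field_simps)
      have "kernel_dev (Cs n) C y \<le> kernel_dev (Cs n) C (real j / real N) + 2 * \<bar>y - real j / real N\<bar>"
        using y \<open>j \<le> N\<close> N by (intro P.kernel_dev_Lipschitz) auto
      also have "\<dots> \<le> e / 4 + 2 * (e / 4)"
        using n0[OF \<open>n \<ge> n0\<close> \<open>j \<le> N\<close>] d \<open>1 / real N < e / 4\<close>
        by (intro add_mono mult_left_mono) simp_all
      finally show "kernel_dev (Cs n) C y \<le> 3 * e / 4"
        by simp
    qed simp
    then show "norm (D_inf (Cs n) C - 0) < e"
      using P.D_inf_nonneg[of n] \<open>e > 0\<close> by simp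
  qed
qed

text \<open>For finite \<open>p\<close> the distance is sandwiched between 0 and a positive power of
  \<open>D_inf\<close>.\<close>

lemma weak_cond_conv_imp_D_dist:
  assumes "weak_cond_conv Cs C" and "1 \<le> p"
  shows "(\<lambda>n. D_dist p (Cs n) C) \<longlonglongrightarrow> 0"
proof -
  interpret P: copula_kernel_pair "Cs n" C "Hs n" H "Ys n" Y for n
    by (intro copula_kernel_pairI C Cs)
  have D: "(\<lambda>n. D_inf (Cs n) C) \<longlonglongrightarrow> 0"
    by (intro kernel_dev_imp_D_inf weak_cond_conv_imp_kernel_dev assms)
  show ?thesis
  proof (cases p)
    case (real r)
    then have r: "1 \<le> r" using assms by simp
    have "(\<lambda>n. D_inf (Cs n) C powr (1 / r)) \<longlonglongrightarrow> 0"
      using tendsto_powr2[OF D tendsto_const[of "1 / r"]] P.D_inf_nonneg r by simp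
    then have "(\<lambda>n. D_fin r (Cs n) C) \<longlonglongrightarrow> 0"
      by (rule tendsto_sandwich[OF _ _ tendsto_const, rotated 2])
         (use P.D_fin_le[OF r] in \<open>auto simp: D_fin_def intro!: always_eventually\<close>)
    then show ?thesis by (simp add: D_dist_def real)
  qed (use D assms in \<open>auto simp: D_dist_def\<close>)
qed

lemma D_inf_imp_d_sup:
  assumes "(\<lambda>n. D_inf (Cs n) C) \<longlonglongrightarrow> 0"
  shows "(\<lambda>n. d_sup (Cs n) C) \<longlonglongrightarrow> 0"
proof -
  interpret P: copula_kernel_pair "Cs n" C "Hs n" H "Ys n" Y for n
    by (intro copula_kernel_pairI C Cs)
  show ?thesis
    by (rule tendsto_sandwich[OF _ _ tendsto_const assms])
       (auto intro!: always_eventually P.d_sup_nonneg P.d_sup_le_D_inf)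
qed

end

section \<open>Integration by parts against a copula\<close>

text \<open>Adds the partial derivative in \<open>y\<close>, which serves only as a density of
  \<open>C x\<close> along vertical lines.\<close>

locale copula_kernel2 = copula_kernel +
  fixes H2 :: "real \<Rightarrow> real \<Rightarrow> real" and X0 :: "real set"
  assumes C_measurable [measurable]: "case_prod C \<in> borel_measurable (borel \<Otimes>\<^sub>M borel)"
    and H2_measurable [measurable]: "case_prod H2 \<in> borel_measurable (borel \<Otimes>\<^sub>M borel)"
    and H2_bounds: "x \<in> {0<..<1} \<Longrightarrow> y \<in> {0<..<1} \<Longrightarrow> 0 \<le> H2 x y \<and> H2 x y \<le> 1"
    and countable_X0: "countable X0"
    and H2_deriv: "x \<in> {0<..<1} - X0 \<Longrightarrow>
      \<exists>S. countable S \<and> (\<forall>y\<in>{0<..<1} - S. (C x has_real_derivative H2 x y) (at y))"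
begin

lemma nn_integral_H2:
  assumes x: "x \<in> {0<..<1} - X0" and y: "0 \<le> y" "y \<le> b" "b \<le> 1"
  shows "(\<integral>\<^sup>+v. ennreal (H2 x v) * indicator {y..b} v \<partial>lborel) = ennreal (C x b - C x y)"
proof -
  obtain S where S: "countable S" "\<And>y. y \<in> {0<..<1} - S \<Longrightarrow> (C x has_real_derivative H2 x y) (at y)"
    using H2_deriv[OF x] by blast
  show ?thesis
  proof (rule nn_integral_FTC_countable[OF \<open>y \<le> b\<close> _ S(1)])
    show "continuous_on {y..b} (C x)"
      using x y by (intro continuous_on_subset[OF cont_right[of x]]) auto
    show "(C x has_real_derivative H2 x v) (at v)" if "v \<in> {y<..<b} - S" for v
      using that y by (intro S(2)) auto
    show "0 \<le> H2 x v \<and> H2 x v \<le> 1" if "v \<in> {y<..<b}" for v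
      using that x y by (intro H2_bounds) auto
  qed simp
qed

text \<open>As a function of \<open>v\<close>, \<open>min (C x v) z\<close> has derivative
  \<open>H2 x v\<close> as long as \<open>C x v < z\<close> and is constant afterwards; integrating
  from \<open>y\<close> to 1 leads from \<open>min (C x y) z\<close> to
  \<open>min x z\<close>.\<close>

lemma min_C_plus_integral:
  assumes x: "x \<in> {0<..<1} - X0" and y: "y \<in> {0..1}" and "0 < z"
  shows "ennreal (min (C x y) z) + (\<integral>\<^sup>+v. ennreal (H2 x v) * indicator {v. C x v < z} v * indicator {y..1} v \<partial>lborel)
    = ennreal (min x z)"
proof -
  have x01: "x \<in> {0..1}"
    using x by auto
  have mono: "C x v \<le> C x v'" if "v \<in> {0..1}" "v' \<in> {0..1}" "v \<le> v'" for v v'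
    using C_mono_right(1)[OF x01 that] by simp
  have C1: "C x 1 = x"
    using x01 by (rule C_1_right)
  have nonneg: "0 \<le> C x y"
    using x01 y by (rule C_nonneg)
  show ?thesis
  proof (cases "z \<le> C x y")
    case True
    have "z \<le> C x v" if "v \<in> {y..1}" for v
      using mono[of y v] that y True by auto
    then have "(\<integral>\<^sup>+v. ennreal (H2 x v) * indicator {v. C x v < z} v * indicator {y..1} v \<partial>lborel) = (\<integral>\<^sup>+v. 0 \<partial>(lborel :: real measure))"
      by (intro nn_integral_cong) (auto simp: indicator_def not_less)
    moreover have "z \<le> x"
      using mono[of y 1] y True by (simp add: C1)
    ultimately show ?thesis
      using True by (simp add: min_def)
  next
    case lt: False
    \<comment> \<open>\<open>b\<close> is the first point where \<open>C x\<close> reaches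
      \<open>z\<close>, or 1 if \<open>x < z\<close>; monotonicity keeps \<open>C x\<close> at or
      above \<open>z\<close> after the first hit.\<close>
    have "\<exists>b\<in>{y..1}. C x b = min x z \<and> (\<forall>v\<in>{y..1}. v < b \<longrightarrow> C x v < z) \<and>
        (b = 1 \<or> (\<forall>v\<in>{b..1}. z \<le> C x v))"
    proof (cases "x < z")
      case True
      have "C x v < z" if "v \<in> {y..1}" for v
        using mono[of v 1] that y True by (auto simp: C1)
      then show ?thesis
        using y True by (intro bexI[of _ 1]) (auto simp: C1)
    next
      case False
      define X where "X = {v \<in> {y..1}. C x v = z}"
      have cont: "continuous_on {y..1} (C x)"
        using y by (intro continuous_on_subset[OF cont_right[OF x01]]) auto
      have "\<exists>v\<ge>y. v \<le> 1 \<and> C x v = z"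
        using lt False y cont by (intro IVT') (auto simp: C1)
      then have "X \<noteq> {}"
        by (auto simp: X_def)
      moreover have "closed X"
        unfolding X_def using cont by (intro continuous_closed_preimage_constant) auto
      moreover have "bdd_below X"
        by (auto simp: X_def bdd_below_def)
      ultimately have b: "Inf X \<in> X" and lower: "\<And>v. v \<in> X \<Longrightarrow> Inf X \<le> v"
        by (auto intro: closed_contains_Inf cInf_lower)
      have "C x v < z" if "v \<in> {y..1}" "v < Inf X" for v
        using mono[of v "Inf X"] b lower[of v] that y by (force simp: X_def)
      moreover have "z \<le> C x v" if "v \<in> {Inf X..1}" for v
        using mono[of "Inf X" v] b that y by (auto simp: X_def)
      ultimately show ?thesis
        using b False by (intro bexI[of _ "Inf X"]) (auto simp: X_def)
    qed
    then obtain b where b: "b \<in> {y..1}" "C x b = min x z"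
        "\<And>v. v \<in> {y..1} \<Longrightarrow> v < b \<Longrightarrow> C x v < z" "b = 1 \<or> (\<forall>v\<in>{b..1}. z \<le> C x v)"
      by blast
    have "(\<integral>\<^sup>+v. ennreal (H2 x v) * indicator {v. C x v < z} v * indicator {y..1} v \<partial>lborel)
        = (\<integral>\<^sup>+v. ennreal (H2 x v) * indicator {y..b} v \<partial>lborel)"
    proof (rule nn_integral_cong_AE, rule AE_mp[OF AE_lborel_singleton[of b]], intro AE_I2 impI)
      fix v assume "v \<noteq> b"
      then show "ennreal (H2 x v) * indicator {v. C x v < z} v * indicator {y..1} v = ennreal (H2 x v) * indicator {y..b} v"
        using b(1) b(3)[of v] b(4) by (cases "v < b") (auto simp: indicator_def not_less)
    qed
    also have "\<dots> = ennreal (C x b - C x y)"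
      using y b(1) by (intro nn_integral_H2 x) auto
    finally show ?thesis
      using lt nonneg mono[of y b] y b(1,2) by (simp add: ennreal_plus[symmetric] min_def del: ennreal_plus)
  qed
qed

lemma G_measurable_pair [measurable]: "(\<lambda>(x, y). G x y) \<in> borel_measurable (borel \<Otimes>\<^sub>M borel)"
proof -
  have "(\<lambda>w. K (fst w)) \<in> borel \<Otimes>\<^sub>M borel \<rightarrow>\<^sub>M subprob_algebra borel"
    by (rule measurable_compose[OF measurable_fst kernel_subprob[OF K_measurable]])
  moreover have "(SIGMA w:space (borel \<Otimes>\<^sub>M borel :: (real \<times> real) measure). {..snd w}) \<in> sets ((borel \<Otimes>\<^sub>M borel) \<Otimes>\<^sub>M (borel :: real measure))"
  proof -
    have "(SIGMA w:space (borel \<Otimes>\<^sub>M borel :: (real \<times> real) measure). {..snd w})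
        = {u \<in> space ((borel \<Otimes>\<^sub>M borel) \<Otimes>\<^sub>M (borel :: real measure)). snd u \<le> snd (fst u)}"
      by (auto simp: space_pair_measure)
    then show ?thesis by simp
  qed
  ultimately have "(\<lambda>w. measure (K (fst w)) {..snd w}) \<in> borel_measurable (borel \<Otimes>\<^sub>M borel)"
    by (rule measure_measurable_subprob_algebra2[rotated])
  moreover have "measure (K x) {..y} = G x y" for x y
    by (simp add: measure_def emeasure_K_atMost G_nonneg)
  ultimately show ?thesis
    by (simp add: case_prod_beta)
qed

text \<open>Product of both partial derivatives over the sublevel set \<open>{C < z}\<close>. Only
  first derivatives occur, so a singular part of the copula measure is not lost.\<close>

definition kendall_integrand :: "real \<Rightarrow> real \<Rightarrow> real \<Rightarrow> ennreal" where
  "kendall_integrand z x y = ennreal (H x y) * ennreal (H2 x y) * indicator {..<z} (C x y)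
     * indicator {0<..<1} x * indicator {0<..<1} y"

text \<open>Integration by parts on vertical lines. The mass of \<open>K x\<close> up to
  \<open>v\<close> is \<open>G x v\<close>, so exchanging the order of integration turns the
  integral of \<open>G x v\<close> against the derivative of \<open>min (C x v) z\<close> into the
  mean over \<open>y\<close> of the increments \<open>min x z - min (C x y) z\<close>.\<close>

lemma kendall_identity:
  assumes "0 < z"
  shows "(\<integral>\<^sup>+w. ennreal (min (C (fst w) (snd w)) z) \<partial>copula_measure C)
      + (\<integral>\<^sup>+y. \<integral>\<^sup>+x. kendall_integrand z x y \<partial>lborel \<partial>lborel)
    = (\<integral>\<^sup>+x. ennreal (min x z) * indicator {0..1} x \<partial>lborel)"
proof -
  define g where "g = (\<lambda>x v. ennreal (H2 x v) * indicator {..<z} (C x v) * indicator {0<..<1} v)"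
  have [measurable]: "case_prod g \<in> borel_measurable (borel \<Otimes>\<^sub>M borel)"
    unfolding g_def by measurable
  then have [measurable]: "g x \<in> borel_measurable borel" for x
    using measurable_compose[of "\<lambda>y. (x, y)" borel "borel \<Otimes>\<^sub>M borel" "case_prod g" borel] by simp
  have AE01: "AE x in lborel. x \<notin> {0, 1 :: real} \<union> X0"
    using countable_X0 by (intro AE_not_in countable_imp_null_set_lborel) auto
  have inner: "(\<integral>\<^sup>+y. ennreal (min (C x y) z) \<partial>K x) + (\<integral>\<^sup>+v. g x v * ennreal (G x v) \<partial>lborel) = ennreal (min x z)"
    if x: "x \<in> {0<..<1} - X0" for x
  proof -
    interpret K: real_distribution "K x" by (rule real_distribution_K)
    interpret pair_sigma_finite "K x" lborel ..
    have AEy: "AE y in K x. y \<in> {0..1}"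
    proof -
      have "measure (K x) {0..1} = 1"
        by (simp add: measure_K G_def)
      then show ?thesis
        by (subst (asm) K.prob_eq_1) auto
    qed
    have sets_pair: "sets (K x \<Otimes>\<^sub>M lborel) = sets (borel \<Otimes>\<^sub>M borel)"
      by (intro sets_pair_measure_cong) simp_all
    have "(\<lambda>(y, v). g x v * indicator {w. fst w \<le> snd w} (y, v)) \<in> borel_measurable (borel \<Otimes>\<^sub>M borel)"
      by measurable
    then have gm: "(\<lambda>(y, v). g x v * indicator {w. fst w \<le> snd w} (y, v)) \<in> borel_measurable (K x \<Otimes>\<^sub>M lborel)"
      unfolding measurable_cong_sets[OF sets_pair refl] .
    have "(\<integral>\<^sup>+v. g x v * ennreal (G x v) \<partial>lborel) = (\<integral>\<^sup>+v. (\<integral>\<^sup>+y. g x v * indicator {w. fst w \<le> snd w} (y, v) \<partial>K x) \<partial>lborel)"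
    proof (rule nn_integral_cong)
      fix v
      have "(\<integral>\<^sup>+y. g x v * indicator {w. fst w \<le> snd w} (y, v) \<partial>K x) = (\<integral>\<^sup>+y. g x v * indicator {..v} y \<partial>K x)"
        by (intro nn_integral_cong) (simp add: indicator_def)
      also have "\<dots> = g x v * ennreal (G x v)"
        by (subst nn_integral_cmult_indicator) (simp_all add: emeasure_K_atMost)
      finally show "g x v * ennreal (G x v) = (\<integral>\<^sup>+y. g x v * indicator {w. fst w \<le> snd w} (y, v) \<partial>K x)" ..
    qed
    also have "\<dots> = (\<integral>\<^sup>+y. (\<integral>\<^sup>+v. g x v * indicator {w. fst w \<le> snd w} (y, v) \<partial>lborel) \<partial>K x)"
      by (rule Fubini'[OF gm])
    also have "\<dots> = (\<integral>\<^sup>+y. (\<integral>\<^sup>+v. ennreal (H2 x v) * indicator {v. C x v < z} v * indicator {y..1} v \<partial>lborel) \<partial>K x)"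
    proof (rule nn_integral_cong_AE, rule AE_mp[OF AEy], intro AE_I2 impI)
      fix y :: real assume y: "y \<in> {0..1}"
      show "(\<integral>\<^sup>+v. g x v * indicator {w. fst w \<le> snd w} (y, v) \<partial>lborel)
          = (\<integral>\<^sup>+v. ennreal (H2 x v) * indicator {v. C x v < z} v * indicator {y..1} v \<partial>lborel)"
        by (rule nn_integral_cong_AE, rule AE_mp[OF AE01]) (use y in \<open>auto simp: g_def indicator_def\<close>)
    qed
    finally have eq: "(\<integral>\<^sup>+v. g x v * ennreal (G x v) \<partial>lborel)
        = (\<integral>\<^sup>+y. (\<integral>\<^sup>+v. ennreal (H2 x v) * indicator {v. C x v < z} v * indicator {y..1} v \<partial>lborel) \<partial>K x)" .
    have "(\<lambda>w. ennreal (H2 x (snd w)) * indicator {v. C x v < z} (snd w) * indicator {w. fst w \<le> snd w \<and> snd w \<le> 1} w)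
        \<in> borel_measurable (borel \<Otimes>\<^sub>M lborel)"
      by measurable
    then have "(\<lambda>y. \<integral>\<^sup>+v. ennreal (H2 x v) * indicator {v. C x v < z} v * indicator {w. fst w \<le> snd w \<and> snd w \<le> 1} (y, v) \<partial>lborel) \<in> borel_measurable borel"
      by (intro lborel.borel_measurable_nn_integral) (simp add: case_prod_beta)
    then have m: "(\<lambda>y. \<integral>\<^sup>+v. ennreal (H2 x v) * indicator {v. C x v < z} v * indicator {y..1} v \<partial>lborel) \<in> borel_measurable (K x)"
      by (simp add: indicator_def cong: measurable_cong_sets)
    have "(\<integral>\<^sup>+y. ennreal (min (C x y) z) \<partial>K x) + (\<integral>\<^sup>+v. g x v * ennreal (G x v) \<partial>lborel)
        = (\<integral>\<^sup>+y. ennreal (min (C x y) z)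
            + (\<integral>\<^sup>+v. ennreal (H2 x v) * indicator {v. C x v < z} v * indicator {y..1} v \<partial>lborel) \<partial>K x)"
      unfolding eq by (rule nn_integral_add[symmetric, OF _ m]) simp
    also have "\<dots> = (\<integral>\<^sup>+y. ennreal (min x z) \<partial>K x)"
      by (rule nn_integral_cong_AE, rule AE_mp[OF AEy]) (simp add: min_C_plus_integral[OF x _ \<open>0 < z\<close>])
    finally show ?thesis
      using K.emeasure_space_1 by simp
  qed
  have "(\<integral>\<^sup>+w. ennreal (min (C (fst w) (snd w)) z) \<partial>copula_measure C)
      = (\<integral>\<^sup>+x. (\<integral>\<^sup>+y. ennreal (min (C x y) z) \<partial>K x) * indicator {0..1} x \<partial>lborel)"
    unfolding copula_measure_eq using C_measurable
    by (subst nn_integral_kernel_prod[OF K_measurable]) (simp_all add: borel_prod[symmetric] case_prod_beta)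
  moreover have "(\<integral>\<^sup>+y. \<integral>\<^sup>+x. kendall_integrand z x y \<partial>lborel \<partial>lborel)
      = (\<integral>\<^sup>+x. (\<integral>\<^sup>+v. g x v * ennreal (G x v) \<partial>lborel) * indicator {0..1} x \<partial>lborel)"
  proof -
    have "(\<integral>\<^sup>+y. \<integral>\<^sup>+x. kendall_integrand z x y \<partial>lborel \<partial>lborel)
        = (\<integral>\<^sup>+y. \<integral>\<^sup>+x. g x y * ennreal (G x y) * indicator {0..1} x \<partial>lborel \<partial>lborel)"
    \<comment> \<open>Levels in \<open>Y0\<close> form a null set; at the other levels
      \<open>H\<close> may be replaced by \<open>G\<close> for almost every
      \<open>x\<close>.\<close>
    proof (rule nn_integral_cong_AE, rule AE_mp[OF AE_not_in[OF countable_imp_null_set_lborel[OF countable_Y0]]],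
        intro AE_I2 impI)
      fix y assume y: "y \<notin> Y0"
      show "(\<integral>\<^sup>+x. kendall_integrand z x y \<partial>lborel) = (\<integral>\<^sup>+x. g x y * ennreal (G x y) * indicator {0..1} x \<partial>lborel)"
      proof (cases "y \<in> {0<..<1}")
        case True
        then have AE: "AE x in lborel. x \<in> {0<..<1} \<longrightarrow> G x y = H x y"
          using y by (intro G_eq_H) auto
        show ?thesis
          by (rule nn_integral_cong_AE, rule AE_mp[OF AE01], rule AE_mp[OF AE])
             (auto simp: kendall_integrand_def g_def indicator_def mult.commute)
      qed (simp add: kendall_integrand_def g_def)
    qed
    also have "\<dots> = (\<integral>\<^sup>+x. \<integral>\<^sup>+y. g x y * ennreal (G x y) * indicator {0..1} x \<partial>lborel \<partial>lborel)"
      by (rule lborel_pair.Fubini') measurable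
    finally show ?thesis
      by (simp add: nn_integral_multc)
  qed
  moreover have [measurable]: "(\<lambda>x. \<integral>\<^sup>+y. ennreal (min (C x y) z) \<partial>K x) \<in> borel_measurable borel"
    using measurable_nn_integral_kernel[OF K_measurable, of "\<lambda>w. ennreal (min (C (fst w) (snd w)) z)"] C_measurable
    by (simp add: borel_prod[symmetric] case_prod_beta)
  moreover have [measurable]: "(\<lambda>x. \<integral>\<^sup>+v. g x v * ennreal (G x v) \<partial>lborel) \<in> borel_measurable borel"
    by measurable
  ultimately have "(\<integral>\<^sup>+w. ennreal (min (C (fst w) (snd w)) z) \<partial>copula_measure C)
      + (\<integral>\<^sup>+y. \<integral>\<^sup>+x. kendall_integrand z x y \<partial>lborel \<partial>lborel)
    = (\<integral>\<^sup>+x. (\<integral>\<^sup>+y. ennreal (min (C x y) z) \<partial>K x) * indicator {0..1} x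
        + (\<integral>\<^sup>+v. g x v * ennreal (G x v) \<partial>lborel) * indicator {0..1} x \<partial>lborel)"
    by (subst nn_integral_add) simp_all
  also have "\<dots> = (\<integral>\<^sup>+x. ennreal (min x z) * indicator {0..1} x \<partial>lborel)"
    by (rule nn_integral_cong_AE, rule AE_mp[OF AE01]) (use inner in \<open>auto simp: indicator_def\<close>)
  finally show ?thesis .
qed

lemma nn_integral_min_01:
  assumes "0 < z" "z \<le> 1"
  shows "(\<integral>\<^sup>+x. ennreal (min x z) * indicator {0..1} x \<partial>lborel) = ennreal (z - z\<^sup>2 / 2)"
proof -
  let ?F = "\<lambda>x. if x \<le> z then x\<^sup>2 / 2 else z * x - z\<^sup>2 / 2"
  have "(\<integral>\<^sup>+x. ennreal (min x z) * indicator {0..1} x \<partial>lborel) = ennreal (?F 1 - ?F 0)"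
  proof (rule nn_integral_FTC_countable[where S = "{z}" and B = 1])
    have "continuous_on ({..z} \<union> {z..}) ?F"
      by (rule continuous_on_cases) (auto intro!: continuous_intros simp: power2_eq_square)
    then show "continuous_on {0..1} ?F"
      by (rule continuous_on_subset) auto
    fix x assume x: "x \<in> {0<..<1} - {z}"
    show "(?F has_real_derivative min x z) (at x)"
    proof (cases "x < z")
      case True
      have "((\<lambda>x. x\<^sup>2 / 2) has_real_derivative x) (at x)"
        by (auto intro!: derivative_eq_intros)
      then have "(?F has_real_derivative x) (at x)"
        by (rule has_field_derivative_transform_within_open[where S = "{..<z}"]) (use True in auto)
      then show ?thesis using True by (simp add: min_def)
    next
      case False
      have "((\<lambda>x. z * x - z\<^sup>2 / 2) has_real_derivative z) (at x)"
        by (auto intro!: derivative_eq_intros)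
      then have "(?F has_real_derivative z) (at x)"
        by (rule has_field_derivative_transform_within_open[where S = "{z<..}"]) (use False x in auto)
      then show ?thesis using False x by (simp add: min_def)
    qed
  qed (use assms in auto)
  also have "?F 1 - ?F 0 = z - z\<^sup>2 / 2"
    using assms by (auto simp: power2_eq_square)
  finally show ?thesis .
qed

lemma integrable_min_C:
  assumes "0 < z"
  shows "integrable (copula_measure C) (\<lambda>w. min (C (fst w) (snd w)) z)"
proof -
  interpret M: prob_space "copula_measure C" by (rule prob_space_copula_measure)
  show ?thesis
  proof (rule M.integrable_const_bound[where B = 1])
    show "AE w in copula_measure C. norm (min (C (fst w) (snd w)) z) \<le> 1"
      using AE_copula_measure
    proof eventually_elim
      case (elim w)
      then show ?case
        using C_nonneg[of "fst w" "snd w"] C_le_1[of "fst w" "snd w"] \<open>0 < z\<close> by (auto simp: mem_Times_iff)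
    qed
    show "(\<lambda>w. min (C (fst w) (snd w)) z) \<in> borel_measurable (copula_measure C)"
      using C_measurable
      by (simp add: sets_copula_measure borel_prod[symmetric] case_prod_beta cong: measurable_cong_sets)
  qed
qed

text \<open>The identity solved for the double integral, so that means of \<open>min C z\<close>
  determine an integral of partial derivatives; the subtraction is legitimate because everything is
  finite.\<close>

lemma nn_integral_kendall_integrand:
  assumes "0 < z" "z \<le> 1"
  shows "(\<integral>\<^sup>+y. \<integral>\<^sup>+x. kendall_integrand z x y \<partial>lborel \<partial>lborel)
    = ennreal (z - z\<^sup>2 / 2 - (\<integral>w. min (C (fst w) (snd w)) z \<partial>copula_measure C))"
proof -
  let ?I = "\<integral>w. min (C (fst w) (snd w)) z \<partial>copula_measure C"
  let ?W = "\<integral>\<^sup>+y. \<integral>\<^sup>+x. kendall_integrand z x y \<partial>lborel \<partial>lborel"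
  have AE: "AE w in copula_measure C. 0 \<le> min (C (fst w) (snd w)) z"
    using AE_copula_measure
  proof eventually_elim
    case (elim w)
    then show ?case
      using C_nonneg[of "fst w" "snd w"] \<open>0 < z\<close> by (auto simp: mem_Times_iff)
  qed
  have "ennreal ?I + ?W = ennreal (z - z\<^sup>2 / 2)"
    using kendall_identity[OF \<open>0 < z\<close>] nn_integral_min_01[OF assms]
    by (simp add: nn_integral_eq_integral[OF integrable_min_C[OF \<open>0 < z\<close>] AE])
  then have "?W = ennreal (z - z\<^sup>2 / 2) - ennreal ?I"
    by (metis ennreal_add_diff_cancel_left ennreal_neq_top)
  also have "\<dots> = ennreal (z - z\<^sup>2 / 2 - ?I)"
    by (rule ennreal_minus) (rule integral_nonneg_AE[OF AE])
  finally show ?thesis .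
qed

end

section \<open>Convergence of integrals against copulas\<close>

definition step_coeff :: "nat \<Rightarrow> (real \<Rightarrow> real) \<Rightarrow> nat \<Rightarrow> real" where
  "step_coeff N f i = (if i < N then f (real i / real N) - f (real (Suc i) / real N) else f 1)"

text \<open>Summation by parts writes the step function \<open>x \<mapsto> f (\<lceil>N x\<rceil> / N)\<close> in terms of the
  indicators of the intervals \<open>[0, i / N]\<close>, whose products have the values of a copula as integrals.\<close>

lemma step_coeff_sum:
  assumes "x \<in> {0..1}" "0 < N"
  obtains r where "r \<in> {0..1}" "\<bar>r - x\<bar> \<le> 1 / real N"
    "\<forall>f. (\<Sum>i\<le>N. step_coeff N f i * indicator {0..real i / real N} x) = f r"
proof
  define k where "k = nat \<lceil>real N * x\<rceil>"
  have "0 \<le> real N * x"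
    using assms by simp
  then have k: "real N * x \<le> real k" "real k < real N * x + 1"
    using ceiling_correct[of "real N * x"] by (auto simp: k_def)
  have k_le_iff: "k \<le> i \<longleftrightarrow> x \<le> real i / real N" for i
    using \<open>0 < N\<close> by (simp add: k_def ceiling_le_iff le_divide_eq mult.commute)
  have "k \<le> N"
    unfolding k_le_iff using assms by simp
  then show "real k / real N \<in> {0..1}"
    using \<open>0 < N\<close> by simp
  have "x \<le> real k / real N" "real k / real N \<le> x + 1 / real N"
    using k \<open>0 < N\<close> by (simp_all add: le_divide_eq divide_le_eq algebra_simps)
  then show "\<bar>real k / real N - x\<bar> \<le> 1 / real N"
    by simp
  have "(\<Sum>i\<le>N. step_coeff N f i * indicator {0..real i / real N} x) = f (real k / real N)" for f
  proof -
  have "(\<Sum>i\<le>N. step_coeff N f i * indicator {0..real i / real N} x) = (\<Sum>i\<in>{k..N}. step_coeff N f i)"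
    using \<open>x \<in> {0..1}\<close> by (intro sum.mono_neutral_cong_right) (auto simp: k_le_iff[symmetric] indicator_def)
  also have "{k..N} = insert N {k..<N}"
    using \<open>k \<le> N\<close> by auto
  also have "(\<Sum>i\<in>insert N {k..<N}. step_coeff N f i) = f 1 + (\<Sum>i=k..<N. step_coeff N f i)"
    by (simp add: step_coeff_def)
  also have "(\<Sum>i=k..<N. step_coeff N f i) = - (\<Sum>i=k..<N. f (real (Suc i) / real N) - f (real i / real N))"
    unfolding sum_negf[symmetric] by (intro sum.cong) (auto simp: step_coeff_def)
  also have "(\<Sum>i=k..<N. f (real (Suc i) / real N) - f (real i / real N)) = f (real N / real N) - f (real k / real N)"
    using \<open>k \<le> N\<close> by (rule sum_Suc_diff'[of k N "\<lambda>i. f (real i / real N)"])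
  finally show ?thesis
    using \<open>0 < N\<close> by simp
  qed
  then show "\<forall>f. (\<Sum>i\<le>N. step_coeff N f i * indicator {0..real i / real N} x) = f (real k / real N)"
    by blast
qed

context copula_kernel
begin

lemma integral_indicator_rectangle:
  assumes "x \<in> {0..1}" "y \<in> {0..1}"
  shows "integrable (copula_measure C) (\<lambda>w. indicator {0..x} (fst w) * indicator {0..y} (snd w) :: real)"
    and "(\<integral>w. indicator {0..x} (fst w) * indicator {0..y} (snd w) \<partial>copula_measure C) = C x y"
proof -
  interpret M: prob_space "copula_measure C" by (rule prob_space_copula_measure)
  have R: "{0..x} \<times> {0..y} \<in> sets (copula_measure C)"
    unfolding sets_copula_measure by (simp add: borel_prod[symmetric])
  have eq: "(\<lambda>w. indicator {0..x} (fst w) * indicator {0..y} (snd w) :: real) = indicator ({0..x} \<times> {0..y})"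
    by (auto simp: fun_eq_iff indicator_def)
  show "integrable (copula_measure C) (\<lambda>w. indicator {0..x} (fst w) * indicator {0..y} (snd w) :: real)"
    unfolding eq using R by (intro integrable_real_indicator) (simp_all add: M.emeasure_eq_measure)
  have "{0..x} \<times> {0..y} \<inter> space (copula_measure C) = {0..x} \<times> {0..y}"
    using sets.sets_into_space[OF R] by blast
  then show "(\<integral>w. indicator {0..x} (fst w) * indicator {0..y} (snd w) \<partial>copula_measure C) = C x y"
    unfolding eq using measure_kernel_prod_rectangle[OF assms] by (simp add: copula_measure_eq)
qed

text \<open>The integral of a step function on the grid is a finite combination of values of
  \<open>C\<close>. The error \<open>2 / N\<close>, one \<open>1 / N\<close> per coordinate, does
  not depend on the copula and can be used along a sequence.\<close>

lemma integral_step_approx: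
  fixes F :: "real \<Rightarrow> real \<Rightarrow> real"
  assumes F: "case_prod F \<in> borel_measurable (borel \<Otimes>\<^sub>M borel)"
    and Lip: "\<And>x y x' y'. x \<in> {0..1} \<Longrightarrow> y \<in> {0..1} \<Longrightarrow> x' \<in> {0..1} \<Longrightarrow> y' \<in> {0..1} \<Longrightarrow>
      \<bar>F x y - F x' y'\<bar> \<le> \<bar>x - x'\<bar> + \<bar>y - y'\<bar>"
    and "0 < N"
  shows "\<bar>(\<integral>w. F (fst w) (snd w) \<partial>copula_measure C)
    - (\<Sum>i\<le>N. \<Sum>j\<le>N. step_coeff N (\<lambda>a. step_coeff N (F a) j) i * C (real i / real N) (real j / real N))\<bar>
    \<le> 2 / real N"
proof -
  interpret M: prob_space "copula_measure C" by (rule prob_space_copula_measure)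
  let ?e = "\<lambda>i j. step_coeff N (\<lambda>a. step_coeff N (F a) j) i"
  let ?I = "\<lambda>i j w. indicator {0..real i / real N} (fst w) * indicator {0..real j / real N} (snd w) :: real"
  define S where "S w = (\<Sum>i\<le>N. \<Sum>j\<le>N. ?e i j * ?I i j w)" for w
  have unit: "real i / real N \<in> {0..1}" if "i \<in> {..N}" for i
    using that \<open>0 < N\<close> by simp
  note rect = integral_indicator_rectangle[OF unit unit]
  have intS: "integrable (copula_measure C) S"
    unfolding S_def by (intro Bochner_Integration.integrable_sum integrable_mult_right rect(1))
  have integralS: "(\<integral>w. S w \<partial>copula_measure C) = (\<Sum>i\<le>N. \<Sum>j\<le>N. ?e i j * C (real i / real N) (real j / real N))"
  proof -
    have "(\<integral>w. S w \<partial>copula_measure C) = (\<Sum>i\<le>N. \<integral>w. (\<Sum>j\<le>N. ?e i j * ?I i j w) \<partial>copula_measure C)"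
      unfolding S_def
      by (intro Bochner_Integration.integral_sum Bochner_Integration.integrable_sum integrable_mult_right rect(1))
    also have "\<dots> = (\<Sum>i\<le>N. \<Sum>j\<le>N. \<integral>w. ?e i j * ?I i j w \<partial>copula_measure C)"
      by (intro sum.cong refl Bochner_Integration.integral_sum integrable_mult_right rect(1))
    also have "\<dots> = (\<Sum>i\<le>N. \<Sum>j\<le>N. ?e i j * C (real i / real N) (real j / real N))"
      by (intro sum.cong refl) (simp only: integral_mult_right_zero rect(2))
    finally show ?thesis .
  qed
  have close: "\<bar>F (fst w) (snd w) - S w\<bar> \<le> 2 / real N" if w: "w \<in> {0..1} \<times> {0..1}" for w
  proof -
    have w01: "fst w \<in> {0..1}" "snd w \<in> {0..1}"
      using w by (simp_all add: mem_Times_iff)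
    obtain r where r: "r \<in> {0..1}" "\<bar>r - fst w\<bar> \<le> 1 / real N"
        "\<forall>f. (\<Sum>i\<le>N. step_coeff N f i * indicator {0..real i / real N} (fst w)) = f r"
      by (rule step_coeff_sum[OF w01(1) \<open>0 < N\<close>])
    obtain q where q: "q \<in> {0..1}" "\<bar>q - snd w\<bar> \<le> 1 / real N"
        "\<forall>f. (\<Sum>i\<le>N. step_coeff N f i * indicator {0..real i / real N} (snd w)) = f q"
      by (rule step_coeff_sum[OF w01(2) \<open>0 < N\<close>])
    \<comment> \<open>The outer coefficient is the one in \<open>i\<close>; summing over
      \<open>i\<close> first leaves \<open>step_coeff N (F r) j\<close>.\<close>
    have "S w = (\<Sum>j\<le>N. \<Sum>i\<le>N. ?e i j * ?I i j w)"
      unfolding S_def by (rule sum.swap)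
    also have "\<dots> = (\<Sum>j\<le>N. (\<Sum>i\<le>N. ?e i j * indicator {0..real i / real N} (fst w)) * indicator {0..real j / real N} (snd w))"
      by (simp only: sum_distrib_right mult.assoc)
    also have "\<dots> = F r q"
      by (simp only: r(3)[rule_format] q(3)[rule_format])
    finally have "\<bar>F (fst w) (snd w) - S w\<bar> \<le> \<bar>fst w - r\<bar> + \<bar>snd w - q\<bar>"
      using Lip[of "fst w" "snd w" r q] w r(1) q(1) by (auto simp: mem_Times_iff)
    then show ?thesis
      using r(2) q(2) by (simp add: abs_minus_commute)
  qed
  have Fm: "(\<lambda>w. F (fst w) (snd w)) \<in> borel_measurable (copula_measure C)"
    using F by (simp add: sets_copula_measure borel_prod[symmetric] case_prod_beta cong: measurable_cong_sets)
  have intF: "integrable (copula_measure C) (\<lambda>w. F (fst w) (snd w))"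
  proof (rule M.integrable_const_bound[where B = "\<bar>F 0 0\<bar> + 2"])
    show "AE w in copula_measure C. norm (F (fst w) (snd w)) \<le> \<bar>F 0 0\<bar> + 2"
      using AE_copula_measure
    proof eventually_elim
      case (elim w)
      then have "\<bar>F (fst w) (snd w) - F 0 0\<bar> \<le> \<bar>fst w - 0\<bar> + \<bar>snd w - 0\<bar>"
        by (intro Lip) (auto simp: mem_Times_iff)
      then show ?case using elim by (auto simp: mem_Times_iff)
    qed
  qed (rule Fm)
  have "\<bar>(\<integral>w. F (fst w) (snd w) \<partial>copula_measure C) - (\<integral>w. S w \<partial>copula_measure C)\<bar>
      = \<bar>\<integral>w. F (fst w) (snd w) - S w \<partial>copula_measure C\<bar>"
    by (simp add: Bochner_Integration.integral_diff[OF intF intS])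
  also have "\<dots> \<le> (\<integral>w. \<bar>F (fst w) (snd w) - S w\<bar> \<partial>copula_measure C)"
    by (rule integral_abs_bound)
  also have "\<dots> \<le> (\<integral>w. 2 / real N \<partial>copula_measure C)"
    using AE_copula_measure close
    by (intro integral_mono_AE integrable_abs Bochner_Integration.integrable_diff intF intS) (auto elim: eventually_mono)
  also have "\<dots> = 2 / real N"
    by (simp add: M.prob_space)
  finally show ?thesis
    unfolding integralS .
qed

end

text \<open>Up to an error uniform in \<open>n\<close>, the integrals are the same finite
  combination of copula values, to which pointwise convergence applies.\<close>

lemma integral_copula_converge:
  fixes F :: "real \<Rightarrow> real \<Rightarrow> real"
  assumes C: "copula_kernel C H Y" and Cs: "\<And>n. copula_kernel (Cs n) (Hs n) (Ys n)"
    and conv: "\<And>x y. x \<in> {0..1} \<Longrightarrow> y \<in> {0..1} \<Longrightarrow> (\<lambda>n. Cs n x y) \<longlonglongrightarrow> C x y"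
    and F: "case_prod F \<in> borel_measurable (borel \<Otimes>\<^sub>M borel)"
    and Lip: "\<And>x y x' y'. x \<in> {0..1} \<Longrightarrow> y \<in> {0..1} \<Longrightarrow> x' \<in> {0..1} \<Longrightarrow> y' \<in> {0..1} \<Longrightarrow>
      \<bar>F x y - F x' y'\<bar> \<le> \<bar>x - x'\<bar> + \<bar>y - y'\<bar>"
  shows "(\<lambda>n. \<integral>w. F (fst w) (snd w) \<partial>copula_measure (Cs n)) \<longlonglongrightarrow> (\<integral>w. F (fst w) (snd w) \<partial>copula_measure C)"
proof (rule LIMSEQ_I)
  fix e :: real assume "e > 0"
  \<comment> \<open>Then \<open>2 / N < e / 4\<close>, so two approximation errors and the
    difference of the finite sums stay below \<open>e\<close>.\<close>
  obtain N :: nat where N: "N > 0" "inverse (real N) < e / 8"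
    using reals_Archimedean[of "e / 8"] \<open>e > 0\<close> by (metis divide_pos_pos zero_less_Suc zero_less_numeral)
  let ?S = "\<lambda>C. \<Sum>i\<le>N. \<Sum>j\<le>N. step_coeff N (\<lambda>a. step_coeff N (F a) j) i * C (real i / real N) (real j / real N)"
  have "(\<lambda>n. ?S (Cs n)) \<longlonglongrightarrow> ?S C"
    using N by (intro tendsto_sum tendsto_mult tendsto_const conv) auto
  then obtain n0 where n0: "\<And>n. n \<ge> n0 \<Longrightarrow> \<bar>?S (Cs n) - ?S C\<bar> < e / 4"
    using LIMSEQ_D[of _ _ "e / 4"] \<open>e > 0\<close> by force
  have arith: "\<bar>a' - a\<bar> < e" if "d < e / 4" "\<bar>a - b\<bar> \<le> d" "\<bar>a' - b'\<bar> \<le> d" "\<bar>b' - b\<bar> < e / 4" for a a' b b' d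
    using that \<open>e > 0\<close> by linarith
  have "2 / real N < e / 4"
    using N(2) by (simp add: inverse_eq_divide)
  moreover have "\<bar>(\<integral>w. F (fst w) (snd w) \<partial>copula_measure D) - ?S D\<bar> \<le> 2 / real N"
    if "copula_kernel D H' Y'" for D H' Y'
    by (rule copula_kernel.integral_step_approx[OF that F Lip \<open>N > 0\<close>])
  note this[OF C] this[OF Cs]
  ultimately have "\<bar>(\<integral>w. F (fst w) (snd w) \<partial>copula_measure (Cs n)) - (\<integral>w. F (fst w) (snd w) \<partial>copula_measure C)\<bar> < e"
    if "n \<ge> n0" for n
    using n0[OF that] arith by blast
  then show "\<exists>no. \<forall>n\<ge>no. norm ((\<integral>w. F (fst w) (snd w) \<partial>copula_measure (Cs n)) - (\<integral>w. F (fst w) (snd w) \<partial>copula_measure C)) < e"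
    by auto
qed

text \<open>Integrand and measure both vary. Replacing \<open>Cs n\<close> by \<open>C\<close> in
  the integrand costs at most \<open>d_sup\<close>, since the measures are probabilities; the
  remaining integrand is Lipschitz and independent of \<open>n\<close>.\<close>

lemma integral_min_copula_converge:
  assumes C: "copula_kernel2 C H Y H2 X" and Cs: "\<And>n. copula_kernel2 (Cs n) (Hs n) (Ys n) (H2s n) (Xs n)"
    and conv: "(\<lambda>n. d_sup (Cs n) C) \<longlonglongrightarrow> 0" and "0 < z"
  shows "(\<lambda>n. \<integral>w. min (Cs n (fst w) (snd w)) z \<partial>copula_measure (Cs n))
    \<longlonglongrightarrow> (\<integral>w. min (C (fst w) (snd w)) z \<partial>copula_measure C)"
proof -
  interpret C: copula_kernel2 C H Y H2 X by (rule C)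
  interpret Cs: copula_kernel2 "Cs n" "Hs n" "Ys n" "H2s n" "Xs n" for n by (rule Cs)
  interpret P: copula_kernel_pair "Cs n" C "Hs n" H "Ys n" Y for n
    by (intro copula_kernel_pairI C.copula_kernel_axioms Cs.copula_kernel_axioms)
  have pw: "(\<lambda>n. Cs n x y) \<longlonglongrightarrow> C x y" if "x \<in> {0..1}" "y \<in> {0..1}" for x y
  proof -
    have "(\<lambda>n. Cs n x y - C x y) \<longlonglongrightarrow> 0"
      using P.abs_diff_le_d_sup[OF that]
      by (intro Lim_null_comparison[OF _ conv] always_eventually) auto
    then show ?thesis by (rule LIM_zero_cancel)
  qed
  have lim1: "(\<lambda>n. \<integral>w. min (C (fst w) (snd w)) z \<partial>copula_measure (Cs n)) \<longlonglongrightarrow> (\<integral>w. min (C (fst w) (snd w)) z \<partial>copula_measure C)"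
  proof (rule integral_copula_converge[OF C.copula_kernel_axioms Cs.copula_kernel_axioms pw])
    show "(\<lambda>(x, y). min (C x y) z) \<in> borel_measurable (borel \<Otimes>\<^sub>M borel)"
      by measurable
    show "\<bar>min (C x y) z - min (C x' y') z\<bar> \<le> \<bar>x - x'\<bar> + \<bar>y - y'\<bar>"
      if "x \<in> {0..1}" "y \<in> {0..1}" "x' \<in> {0..1}" "y' \<in> {0..1}" for x y x' y'
      using C.C_Lipschitz[OF that] by linarith
  qed
  have "\<bar>(\<integral>w. min (Cs n (fst w) (snd w)) z \<partial>copula_measure (Cs n)) - (\<integral>w. min (C (fst w) (snd w)) z \<partial>copula_measure (Cs n))\<bar>
      \<le> d_sup (Cs n) C" for n
  proof -
    interpret M: prob_space "copula_measure (Cs n)" by (rule Cs.prob_space_copula_measure)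
    have i1: "integrable (copula_measure (Cs n)) (\<lambda>w. min (Cs n (fst w) (snd w)) z)"
      by (rule Cs.integrable_min_C[OF \<open>0 < z\<close>])
    have i2: "integrable (copula_measure (Cs n)) (\<lambda>w. min (C (fst w) (snd w)) z)"
    proof (rule M.integrable_const_bound[where B = 1])
      show "AE w in copula_measure (Cs n). norm (min (C (fst w) (snd w)) z) \<le> 1"
        using Cs.AE_copula_measure[of n]
      proof eventually_elim
        case (elim w)
        then show ?case
          using C.C_nonneg[of "fst w" "snd w"] C.C_le_1[of "fst w" "snd w"] \<open>0 < z\<close> by (auto simp: mem_Times_iff)
      qed
      show "(\<lambda>w. min (C (fst w) (snd w)) z) \<in> borel_measurable (copula_measure (Cs n))"
        using C.C_measurable
        by (simp add: Cs.sets_copula_measure borel_prod[symmetric] case_prod_beta cong: measurable_cong_sets)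
    qed
    have "\<bar>(\<integral>w. min (Cs n (fst w) (snd w)) z \<partial>copula_measure (Cs n)) - (\<integral>w. min (C (fst w) (snd w)) z \<partial>copula_measure (Cs n))\<bar>
        = \<bar>\<integral>w. min (Cs n (fst w) (snd w)) z - min (C (fst w) (snd w)) z \<partial>copula_measure (Cs n)\<bar>"
      by (simp add: Bochner_Integration.integral_diff[OF i1 i2])
    also have "\<dots> \<le> (\<integral>w. \<bar>min (Cs n (fst w) (snd w)) z - min (C (fst w) (snd w)) z\<bar> \<partial>copula_measure (Cs n))"
      by (rule integral_abs_bound)
    also have "\<dots> \<le> (\<integral>w. d_sup (Cs n) C \<partial>copula_measure (Cs n))"
    proof (rule integral_mono_AE)
      show "AE w in copula_measure (Cs n). \<bar>min (Cs n (fst w) (snd w)) z - min (C (fst w) (snd w)) z\<bar> \<le> d_sup (Cs n) C"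
        using Cs.AE_copula_measure[of n]
      proof eventually_elim
        case (elim w)
        then have "\<bar>Cs n (fst w) (snd w) - C (fst w) (snd w)\<bar> \<le> d_sup (Cs n) C"
          by (intro P.abs_diff_le_d_sup) (auto simp: mem_Times_iff)
        then show ?case by linarith
      qed
    qed (intro integrable_abs Bochner_Integration.integrable_diff i1 i2, simp)
    also have "\<dots> = d_sup (Cs n) C"
      by (simp add: M.prob_space)
    finally show ?thesis .
  qed
  then have "(\<lambda>n. (\<integral>w. min (Cs n (fst w) (snd w)) z \<partial>copula_measure (Cs n)) - (\<integral>w. min (C (fst w) (snd w)) z \<partial>copula_measure (Cs n))) \<longlonglongrightarrow> 0"
    by (intro Lim_null_comparison[OF _ conv] always_eventually) auto
  from tendsto_add[OF this lim1] show ?thesis by simp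
qed

section \<open>Slopes of convex functions\<close>

text \<open>One fixed measurable selection of subgradients. For a convex function it agrees with the
  derivative at every positive argument where that exists; only values at positive arguments are
  meaningful.\<close>

definition slope :: "(real \<Rightarrow> real) \<Rightarrow> real \<Rightarrow> real" where
  "slope f = (SOME c. subgrad {0<..} {0..} f c \<and> c \<in> borel_measurable borel)"

lemma slope:
  assumes "convex_on {0..} f"
  shows subgrad_slope: "subgrad {0<..} {0..} f (slope f)"
    and measurable_slope: "slope f \<in> borel_measurable borel"
proof -
  obtain c where c: "subgrad {0<..} {0..} f c"
    using convex_on_subgrad[OF assms] by blast
  have "mono_on {0<..} c"
    by (rule subgrad_mono[OF subgrad_subset[OF c]]) auto
  then have "c \<in> borel_measurable (restrict_space borel {0<..})"
    by (rule borel_measurable_mono_on_fnc)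
  then have "(\<lambda>x. indicator {0<..} x *\<^sub>R c x) \<in> borel_measurable borel"
    by (subst (asm) borel_measurable_restrict_space_iff) simp_all
  moreover have "subgrad {0<..} {0..} f (\<lambda>x. indicator {0<..} x *\<^sub>R c x)"
    using c by (simp add: subgrad_def)
  ultimately have "subgrad {0<..} {0..} f (slope f) \<and> slope f \<in> borel_measurable borel"
    unfolding slope_def by (intro someI[of "\<lambda>c. subgrad {0<..} {0..} f c \<and> c \<in> borel_measurable borel"] conjI)
  then show "subgrad {0<..} {0..} f (slope f)" "slope f \<in> borel_measurable borel"
    by blast+
qed

lemma slope_ineq:
  assumes "convex_on {0..} f" "0 < x" "0 \<le> y"
  shows "f x + slope f x * (y - x) \<le> f y"
  using subgradD[OF subgrad_slope[OF assms(1)], of x y] assms by simp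

lemma slope_mono:
  assumes "convex_on {0..} f" "0 < x" "x \<le> y"
  shows "slope f x \<le> slope f y"
proof -
  have "mono_on {0<..} (slope f)"
    by (rule subgrad_mono[OF subgrad_subset[OF subgrad_slope[OF assms(1)]]]) auto
  from mono_onD[OF this, of x y] show ?thesis
    using assms by simp
qed

lemma slope_deriv_countable:
  assumes "convex_on {0..} f"
  shows "\<exists>S. countable S \<and> S \<subseteq> {0<..} \<and> (\<forall>x\<in>{0<..} - S. (f has_real_derivative slope f x) (at x))"
proof (rule subgrad_deriv_countable)
  show "subgrad {0<..} {0<..} f (slope f)"
    by (rule subgrad_subset[OF subgrad_slope[OF assms]]) auto
qed simp

lemma convex_ge_0_mono:
  fixes k :: "real \<Rightarrow> real"
  assumes "convex_on {0..} k" "\<And>s. 0 \<le> s \<Longrightarrow> k 0 \<le> k s" "0 \<le> s" "s \<le> s'"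
  shows "k s \<le> k s'"
proof (cases "s = 0 \<or> s = s'")
  case False
  then have "0 < s" "s < s'" using assms by auto
  have "k s + slope k s * (0 - s) \<le> k 0" "k s + slope k s * (s' - s) \<le> k s'"
    using slope_ineq[OF assms(1) \<open>0 < s\<close>, of 0] slope_ineq[OF assms(1) \<open>0 < s\<close>, of s'] assms by simp_all
  moreover have "0 \<le> slope k s"
  proof -
    have "0 \<le> slope k s * s"
      using calculation(1) assms(2)[of s] \<open>0 < s\<close> by simp
    then show ?thesis using \<open>0 < s\<close> by (simp add: zero_le_mult_iff)
  qed
  moreover have "0 \<le> slope k s * (s' - s)"
    using calculation(3) \<open>s < s'\<close> by (intro mult_nonneg_nonneg) auto
  ultimately show ?thesis
    by linarith
qed (use assms in auto)

text \<open>A supporting line at \<open>s\<close> that does not rise to the right forces the minimum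
  at \<open>s\<close>. So a level above the minimum is taken at most once at positive arguments,
  which keeps preimages of kinks countable.\<close>

lemma convex_level_unique:
  fixes k :: "real \<Rightarrow> real"
  assumes "convex_on {0..} k" "\<And>s. 0 \<le> s \<Longrightarrow> k 0 \<le> k s"
    and "0 < s" "s < s'" "k s = k s'"
  shows "k s = k 0"
proof -
  have 1: "k s + slope k s * (0 - s) \<le> k 0" "k s + slope k s * (s' - s) \<le> k s'"
    using slope_ineq[OF assms(1) \<open>0 < s\<close>, of 0] slope_ineq[OF assms(1) \<open>0 < s\<close>, of s'] assms by simp_all
  then have "slope k s * (s' - s) \<le> 0"
    using assms by simp
  then have "slope k s \<le> 0"
    using \<open>s < s'\<close> by (simp add: mult_le_0_iff)
  then have "k s \<le> k 0"
    using 1(1) \<open>0 < s\<close> mult_nonpos_nonneg[of "slope k s" s] by simp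
  then show ?thesis
    using assms(2)[of s] assms(3) by simp
qed

text \<open>The limit is above \<open>x\<close> before \<open>z\<close> and below \<open>x\<close>
  after it. At any fixed \<open>a\<close> on either side this strict inequality survives for large
  \<open>n\<close>, and antitonicity of \<open>fs n\<close> then confines
  \<open>zs n\<close>.\<close>

lemma inverse_converge:
  fixes fs :: "nat \<Rightarrow> real \<Rightarrow> real"
  assumes conv: "\<And>w. 0 \<le> w \<Longrightarrow> (\<lambda>n. fs n w) \<longlonglongrightarrow> f w"
    and anti: "\<And>n. antimono_on {0..} (fs n)"
    and zs: "\<And>n. 0 \<le> zs n" "\<And>n. fs n (zs n) = xs n" and xs: "xs \<longlonglongrightarrow> x"
    and z: "0 \<le> z" "\<And>w. z < w \<Longrightarrow> f w < x" "\<And>w. 0 \<le> w \<Longrightarrow> w < z \<Longrightarrow> x < f w"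
  shows "zs \<longlonglongrightarrow> z"
proof (rule order_tendstoI)
  fix a assume "a < z"
  show "\<forall>\<^sub>F n in sequentially. a < zs n"
  proof (cases "0 \<le> a")
    case True
    have "\<forall>\<^sub>F n in sequentially. 0 < fs n a - xs n"
      using z(3)[OF True \<open>a < z\<close>] by (intro order_tendstoD(1)[OF tendsto_diff[OF conv[OF True] xs]]) simp
    then show ?thesis
    proof eventually_elim
      case (elim n)
      show ?case
      proof (rule ccontr)
        assume "\<not> a < zs n"
        then have "fs n a \<le> fs n (zs n)"
          using anti[of n] zs(1)[of n] True by (auto simp: monotone_on_def)
        then show False using elim zs(2)[of n] by simp
      qed
    qed
  next
    case False
    then show ?thesis
      using zs(1) by (intro always_eventually allI) (meson le_less_trans not_le order_less_le_trans)
  qed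
next
  fix a assume "z < a"
  then have "0 \<le> a" using z(1) by simp
  have "\<forall>\<^sub>F n in sequentially. fs n a - xs n < 0"
    using z(2)[OF \<open>z < a\<close>] by (intro order_tendstoD(2)[OF tendsto_diff[OF conv[OF \<open>0 \<le> a\<close>] xs]]) simp
  then show "\<forall>\<^sub>F n in sequentially. zs n < a"
  proof eventually_elim
    case (elim n)
    show ?case
    proof (rule ccontr)
      assume "\<not> zs n < a"
      then have "fs n (zs n) \<le> fs n a"
        using anti[of n] \<open>0 \<le> a\<close> by (auto simp: monotone_on_def)
      then show False using elim zs(2)[of n] by simp
    qed
  qed
qed

section \<open>Generators\<close>

text \<open>Real-valued form of the pseudo-inverse. For a generator, the infinite value that is
  turned into 0 occurs only outside \<open>{0<..1}\<close>.\<close>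

definition phi :: "(real \<Rightarrow> real) \<Rightarrow> real \<Rightarrow> real" where
  "phi \<psi> x = enn2real (pseudo_inv \<psi> x)"

context
  fixes \<psi> :: "real \<Rightarrow> real"
  assumes gen: "generator \<psi>"
begin

lemma gen_cont: "continuous_on {0..} \<psi>"
  and gen_antimono: "antimono_on {0..} \<psi>"
  and gen_convex: "convex_on {0..} \<psi>"
  and gen_0: "\<psi> 0 = 1"
  and gen_lim: "(\<psi> \<longlongrightarrow> 0) at_top"
  and gen_1: "\<psi> 1 = 1 / 2"
  using gen by (simp_all add: generator_def)

lemma gen_bounds: "0 \<le> z \<Longrightarrow> 0 \<le> \<psi> z \<and> \<psi> z \<le> 1"
  using gen by (force simp: generator_def)

lemma gen_antimonoD: "0 \<le> u \<Longrightarrow> u \<le> v \<Longrightarrow> \<psi> v \<le> \<psi> u"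
  using gen_antimono by (auto simp: monotone_on_def)

lemma gen_slope_nonpos: "0 < s \<Longrightarrow> slope \<psi> s \<le> 0"
  using slope_ineq[OF gen_convex, of s "s + 1"] gen_antimonoD[of s "s + 1"] by simp

text \<open>With a non-negative slope the supporting line at \<open>s\<close> would keep
  \<open>\<psi>\<close> at or above \<open>\<psi> s > 0\<close> to the right, against the limit
  0.\<close>

lemma gen_slope_neg:
  assumes "0 < s" "0 < \<psi> s"
  shows "slope \<psi> s < 0"
proof (rule ccontr)
  assume "\<not> slope \<psi> s < 0"
  then have "0 \<le> slope \<psi> s" by simp
  have "\<forall>\<^sub>F w in at_top. \<psi> w < \<psi> s \<and> s < w"
    using order_tendstoD(2)[OF gen_lim \<open>0 < \<psi> s\<close>] eventually_gt_at_top[of s] by (rule eventually_conj)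
  then obtain w where w: "\<psi> w < \<psi> s" "s < w"
    by (auto dest: eventually_happens)
  have "0 \<le> slope \<psi> s * (w - s)"
    using w \<open>0 \<le> slope \<psi> s\<close> by (intro mult_nonneg_nonneg) auto
  then show False
    using slope_ineq[OF gen_convex \<open>0 < s\<close>, of w] w \<open>0 < s\<close> by linarith
qed

lemma gen_strict: "0 \<le> u \<Longrightarrow> u < v \<Longrightarrow> 0 < \<psi> u \<Longrightarrow> \<psi> v < \<psi> u"
proof (cases "\<psi> v = 0")
  case False
  assume uv: "0 \<le> u" "u < v"
  then have "0 < \<psi> v"
    using gen_bounds[of v] False by simp
  then have "slope \<psi> v * (u - v) > 0"
    using uv gen_slope_neg[of v] by (simp add: mult_neg_neg)
  then show ?thesis
    using slope_ineq[OF gen_convex, of v u] uv by simp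
qed simp

text \<open>At the first zero of \<open>\<psi>\<close> the selected slope may still be negative; a
  strictly smaller zero \<open>u\<close> rules this out.\<close>

lemma gen_slope_eq_0: "0 \<le> u \<Longrightarrow> u < s \<Longrightarrow> \<psi> u = 0 \<Longrightarrow> slope \<psi> s = 0"
proof -
  assume u: "0 \<le> u" "u < s" "\<psi> u = 0"
  have "\<psi> s = 0"
    using gen_antimonoD[of u s] gen_bounds[of s] u by simp
  then have "slope \<psi> s * (u - s) \<le> 0"
    using slope_ineq[OF gen_convex, of s u] u by simp
  then have "0 \<le> slope \<psi> s"
    using u by (auto simp: mult_le_0_iff)
  then show ?thesis
    using gen_slope_nonpos[of s] u by simp
qed

lemma gen_surj:
  assumes "0 < x" "x \<le> 1"
  shows "\<exists>z\<ge>0. \<psi> z = x"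
proof -
  have "\<forall>\<^sub>F w in at_top. \<psi> w < x \<and> 0 \<le> w"
    using order_tendstoD(2)[OF gen_lim \<open>0 < x\<close>] eventually_ge_at_top[of 0] by (rule eventually_conj)
  then obtain w where w: "\<psi> w < x" "0 \<le> w"
    by (auto dest: eventually_happens)
  have "\<exists>z\<ge>0. z \<le> w \<and> \<psi> z = x"
    using w assms by (intro IVT2') (auto simp: gen_0 intro: continuous_on_subset[OF gen_cont])
  then show ?thesis by blast
qed

lemma pseudo_inv_gen:
  assumes "0 \<le> z" "0 < \<psi> z"
  shows "pseudo_inv \<psi> (\<psi> z) = ennreal z"
proof -
  have "w = ennreal z" if "gen_ext \<psi> w = \<psi> z" for w
  proof (cases w)
    case (real r)
    then have "\<psi> r = \<psi> z"
      using that by (simp add: gen_ext_def)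
    then have "r = z"
      using gen_strict[of r z] gen_strict[of z r] real assms by (cases r z rule: linorder_cases) auto
    then show ?thesis using real by simp
  qed (use that assms in \<open>simp add: gen_ext_def\<close>)
  moreover have "gen_ext \<psi> (ennreal z) = \<psi> z"
    using assms by (simp add: gen_ext_def)
  ultimately have "{w. gen_ext \<psi> w = \<psi> z} = {ennreal z}"
    unfolding set_eq_iff mem_Collect_eq singleton_iff by blast
  then show ?thesis
    by (simp add: pseudo_inv_def)
qed

lemma phi_gen: "0 \<le> z \<Longrightarrow> 0 < \<psi> z \<Longrightarrow> phi \<psi> (\<psi> z) = z"
  by (simp add: phi_def pseudo_inv_gen)

lemma phi_nonneg [simp]: "0 \<le> phi \<psi> x"
  by (simp add: phi_def)

lemma gen_phi: "0 < x \<Longrightarrow> x \<le> 1 \<Longrightarrow> \<psi> (phi \<psi> x) = x"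
  using gen_surj[of x] phi_gen by auto

lemma pseudo_inv_eq_phi: "0 < x \<Longrightarrow> x \<le> 1 \<Longrightarrow> pseudo_inv \<psi> x = ennreal (phi \<psi> x)"
  using gen_surj[of x] phi_gen pseudo_inv_gen by auto

lemma phi_1: "phi \<psi> 1 = 0"
  using phi_gen[of 0] by (simp add: gen_0)

lemma phi_half: "phi \<psi> (1 / 2) = 1"
  using phi_gen[of 1] by (simp add: gen_1)

lemma phi_strict: "0 < x \<Longrightarrow> x < y \<Longrightarrow> y \<le> 1 \<Longrightarrow> phi \<psi> y < phi \<psi> x"
proof (rule ccontr)
  assume "0 < x" "x < y" "y \<le> 1" "\<not> phi \<psi> y < phi \<psi> x"
  then show False
    using gen_antimonoD[of "phi \<psi> x" "phi \<psi> y"] gen_phi[of x] gen_phi[of y] by simp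
qed

lemma phi_antimono: "0 < x \<Longrightarrow> x \<le> y \<Longrightarrow> y \<le> 1 \<Longrightarrow> phi \<psi> y \<le> phi \<psi> x"
  using phi_strict[of x y] by (cases "x = y") auto

lemma phi_pos: "0 < x \<Longrightarrow> x < 1 \<Longrightarrow> 0 < phi \<psi> x"
  using phi_strict[of x 1] by (simp add: phi_1)

text \<open>No argument is mapped to such \<open>y\<close>; the infimum of the empty set is infinite
  and becomes 0. Knowing \<open>phi\<close> there makes it Borel on the whole line.\<close>

lemma phi_outside: "y < 0 \<or> 1 < y \<Longrightarrow> phi \<psi> y = 0"
proof -
  assume y: "y < 0 \<or> 1 < y"
  have "0 \<le> gen_ext \<psi> z \<and> gen_ext \<psi> z \<le> 1" for z
    using gen_bounds[of "enn2real z"] by (simp add: gen_ext_def)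
  then have "{z. gen_ext \<psi> z = y} = {}"
    using y by (metis (mono_tags, lifting) Collect_empty_eq leD)
  then show ?thesis
    by (simp add: phi_def pseudo_inv_def)
qed

lemma phi_measurable [measurable]: "phi \<psi> \<in> borel_measurable borel"
proof -
  have "mono_on {0<..1} (\<lambda>x. - phi \<psi> x)"
    by (rule mono_onI) (auto intro: phi_antimono)
  then have "(\<lambda>x. - phi \<psi> x) \<in> borel_measurable (restrict_space borel {0<..1})"
    by (rule borel_measurable_mono_on_fnc)
  then have "(\<lambda>x. indicator {0<..1} x *\<^sub>R (- phi \<psi> x)) \<in> borel_measurable borel"
    by (subst (asm) borel_measurable_restrict_space_iff) simp_all
  then have "(\<lambda>x. if x = 0 then phi \<psi> 0 else - (indicator {0<..1} x *\<^sub>R (- phi \<psi> x))) \<in> borel_measurable borel"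
    by measurable
  also have "(\<lambda>x. if x = 0 then phi \<psi> 0 else - (indicator {0<..1} x *\<^sub>R (- phi \<psi> x))) = phi \<psi>"
  proof
    fix x
    show "(if x = 0 then phi \<psi> 0 else - (indicator {0<..1} x *\<^sub>R (- phi \<psi> x))) = phi \<psi> x"
      using phi_outside[of x] by (cases "x = 0 \<or> x \<in> {0<..1}") auto
  qed
  finally show ?thesis .
qed

text \<open>Continuity of the inverse, obtained from \<open>inverse_converge\<close> with a constant
  sequence of functions.\<close>

lemma phi_tendsto:
  assumes "\<And>n. 0 < xs n" "\<And>n. xs n \<le> 1" "xs \<longlonglongrightarrow> x" "0 < x" "x \<le> 1"
  shows "(\<lambda>n. phi \<psi> (xs n)) \<longlonglongrightarrow> phi \<psi> x"
proof (rule inverse_converge[where fs = "\<lambda>_. \<psi>" and f = \<psi>])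
  show "\<psi> w < x" if "phi \<psi> x < w" for w
    using gen_strict[OF _ that] assms gen_phi[of x] by simp
  show "x < \<psi> w" if "0 \<le> w" "w < phi \<psi> x" for w
    using gen_strict[OF that] gen_antimonoD[of w "phi \<psi> x"] that assms gen_phi[of x] by simp
qed (use assms gen_antimono in \<open>auto simp: gen_phi\<close>)

text \<open>Reflecting a supporting line of \<open>\<psi>\<close> in the diagonal gives one of the
  inverse; dividing by the negative slope keeps it below the graph.\<close>

lemma phi_subgrad: "subgrad {0<..<1} {0<..1} (phi \<psi>) (\<lambda>x. 1 / slope \<psi> (phi \<psi> x))"
  unfolding subgrad_def
proof (intro ballI)
  fix x y :: real assume xy: "x \<in> {0<..<1}" "y \<in> {0<..1}"
  have neg: "slope \<psi> (phi \<psi> x) < 0"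
    using xy by (intro gen_slope_neg) (auto simp: phi_pos gen_phi)
  have "x + slope \<psi> (phi \<psi> x) * (phi \<psi> y - phi \<psi> x) \<le> y"
    using slope_ineq[OF gen_convex, of "phi \<psi> x" "phi \<psi> y"] xy by (simp add: phi_pos gen_phi)
  then have "slope \<psi> (phi \<psi> x) * (phi \<psi> y - phi \<psi> x) \<le> y - x"
    by simp
  then have "(y - x) / slope \<psi> (phi \<psi> x) \<le> phi \<psi> y - phi \<psi> x"
    using neg by (simp add: neg_divide_le_eq mult.commute)
  then show "phi \<psi> x + 1 / slope \<psi> (phi \<psi> x) * (y - x) \<le> phi \<psi> y"
    by simp
qed

lemma phi_deriv_countable:
  "\<exists>S. countable S \<and> S \<subseteq> {0<..<1} \<and>
    (\<forall>x\<in>{0<..<1} - S. (phi \<psi> has_real_derivative 1 / slope \<psi> (phi \<psi> x)) (at x))"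
proof (rule subgrad_deriv_countable)
  show "subgrad {0<..<1} {0<..<1} (phi \<psi>) (\<lambda>x. 1 / slope \<psi> (phi \<psi> x))"
    by (rule subgrad_subset[OF phi_subgrad]) auto
qed simp

text \<open>Exceptional \<open>x\<close> come from kinks of \<open>phi\<close>, from
  \<open>T\<close>, and from kinks \<open>b\<close> of \<open>\<psi>\<close> that \<open>k\<close>
  hits. A level above \<open>k 0\<close> is hit at most once at positive arguments, but the level
  \<open>k 0\<close> may be hit on a whole interval, so differentiability of \<open>\<psi>\<close>
  there is a hypothesis.\<close>

lemma section_regular:
  assumes k: "convex_on {0..} k" "\<And>s. 0 \<le> s \<Longrightarrow> k 0 \<le> k s" "0 < k 0"
    and T: "countable T"
    and \<psi>c: "(\<psi> has_real_derivative slope \<psi> (k 0)) (at (k 0))"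
  shows "\<exists>S. countable S \<and> (\<forall>x\<in>{0<..<1} - S. phi \<psi> x \<notin> T \<and>
    (\<psi> has_real_derivative slope \<psi> (k (phi \<psi> x))) (at (k (phi \<psi> x))) \<and>
    (phi \<psi> has_real_derivative 1 / slope \<psi> (phi \<psi> x)) (at x))"
proof -
  obtain B where B: "countable B" "B \<subseteq> {0<..}" "\<forall>x\<in>{0<..} - B. (\<psi> has_real_derivative slope \<psi> x) (at x)"
    using slope_deriv_countable[OF gen_convex] by blast
  obtain P where P: "countable P" "\<forall>x\<in>{0<..<1} - P. (phi \<psi> has_real_derivative 1 / slope \<psi> (phi \<psi> x)) (at x)"
    using phi_deriv_countable by blast
  define L where "L b = {s. 0 < s \<and> k s = b \<and> b \<noteq> k 0}" for b
  have "countable (L b)" for b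
  proof -
    have uniq: "s = s'" if "s \<in> L b" "s' \<in> L b" for s s'
    proof (rule ccontr)
      assume "s \<noteq> s'"
      then consider "s < s'" | "s' < s" by linarith
      then show False
        using convex_level_unique[OF k(1,2), of s s'] convex_level_unique[OF k(1,2), of s' s] that
        by cases (simp_all add: L_def)
    qed
    show ?thesis
    proof (cases "L b = {}")
      case False
      then obtain s where "s \<in> L b" by blast
      then have "L b \<subseteq> {s}"
        using uniq by blast
      then show ?thesis
        by (rule countable_subset) simp
    qed simp
  qed
  then have "countable (P \<union> \<psi> ` (T \<union> (\<Union>b\<in>B. L b)))"
    using P(1) T(1) B(1) by auto
  moreover have "phi \<psi> x \<notin> T \<and> (\<psi> has_real_derivative slope \<psi> (k (phi \<psi> x))) (at (k (phi \<psi> x))) \<and>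
      (phi \<psi> has_real_derivative 1 / slope \<psi> (phi \<psi> x)) (at x)"
    if x: "x \<in> {0<..<1} - (P \<union> \<psi> ` (T \<union> (\<Union>b\<in>B. L b)))" for x
  proof -
    have s: "0 < phi \<psi> x" "\<psi> (phi \<psi> x) = x"
      using x by (auto simp: phi_pos gen_phi)
    have "phi \<psi> x \<notin> T \<union> (\<Union>b\<in>B. L b)"
      using x image_eqI[where f = \<psi> and b = x and x = "phi \<psi> x", OF s(2)[symmetric]] by blast
    then have notin: "phi \<psi> x \<notin> T" "phi \<psi> x \<notin> (\<Union>b\<in>B. L b)"
      by simp_all
    have "(\<psi> has_real_derivative slope \<psi> (k (phi \<psi> x))) (at (k (phi \<psi> x)))"
    proof (cases "k (phi \<psi> x) = k 0")
      case False
      then have "k (phi \<psi> x) \<notin> B"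
        using notin(2) s by (auto simp: L_def)
      then show ?thesis
        using B(3) k(2)[of "phi \<psi> x"] k(3) by (simp add: less_le_trans)
    qed (use \<psi>c in simp)
    then show ?thesis
      using notin(1) P(2) x by auto
  qed
  ultimately show ?thesis by blast
qed

lemma section_deriv:
  assumes k: "convex_on {0..} k" "\<And>s. 0 \<le> s \<Longrightarrow> k 0 \<le> k s" "0 < k 0"
    and T: "countable T" "\<And>s. 0 < s \<Longrightarrow> s \<notin> T \<Longrightarrow> (k has_real_derivative kd s) (at s)"
    and \<psi>c: "(\<psi> has_real_derivative slope \<psi> (k 0)) (at (k 0))"
  shows "\<exists>S. countable S \<and> (\<forall>x\<in>{0<..<1} - S. ((\<lambda>x. \<psi> (k (phi \<psi> x))) has_real_derivative
    slope \<psi> (k (phi \<psi> x)) * kd (phi \<psi> x) / slope \<psi> (phi \<psi> x)) (at x))"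
proof -
  obtain S where S: "countable S" "\<forall>x\<in>{0<..<1} - S. phi \<psi> x \<notin> T \<and>
      (\<psi> has_real_derivative slope \<psi> (k (phi \<psi> x))) (at (k (phi \<psi> x))) \<and>
      (phi \<psi> has_real_derivative 1 / slope \<psi> (phi \<psi> x)) (at x)"
    using section_regular[OF k T(1) \<psi>c] by blast
  have "((\<lambda>x. \<psi> (k (phi \<psi> x))) has_real_derivative
      slope \<psi> (k (phi \<psi> x)) * kd (phi \<psi> x) / slope \<psi> (phi \<psi> x)) (at x)" if x: "x \<in> {0<..<1} - S" for x
  proof -
    have d: "phi \<psi> x \<notin> T" "(\<psi> has_real_derivative slope \<psi> (k (phi \<psi> x))) (at (k (phi \<psi> x)))"
        "(phi \<psi> has_real_derivative 1 / slope \<psi> (phi \<psi> x)) (at x)" "0 < phi \<psi> x"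
      using S(2) x phi_pos[of x] by auto
    from DERIV_chain2[OF d(2) DERIV_chain2[OF T(2)[OF d(4,1)] d(3)]]
    show ?thesis by simp
  qed
  then show ?thesis
    using S(1) by blast
qed

end

section \<open>Pickands dependence functions\<close>

text \<open>The stable tail dependence function of \<open>A\<close>, homogeneous of degree 1. At the
  origin the division by zero is harmless because of the factor \<open>s + t\<close>.\<close>

definition ell :: "(real \<Rightarrow> real) \<Rightarrow> real \<Rightarrow> real \<Rightarrow> real" where
  "ell A s t = (s + t) * A (s / (s + t))"

text \<open>By homogeneity the section \<open>t = 1\<close> carries all the information; its
  argument is the ratio \<open>s / t\<close>.\<close>

abbreviation ell1 :: "(real \<Rightarrow> real) \<Rightarrow> real \<Rightarrow> real" where
  "ell1 A \<equiv> (\<lambda>m. ell A m 1)"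

context
  fixes A :: "real \<Rightarrow> real"
  assumes A: "pickands A"
begin

lemma pick_bounds: "0 \<le> t \<Longrightarrow> t \<le> 1 \<Longrightarrow> t \<le> A t \<and> 1 - t \<le> A t \<and> A t \<le> 1"
  using A by (auto simp: pickands_def)

lemma ell_bounds:
  assumes "0 \<le> s" "0 \<le> t"
  shows "s \<le> ell A s t" "t \<le> ell A s t" "ell A s t \<le> s + t"
proof -
  have "s \<le> ell A s t \<and> t \<le> ell A s t \<and> ell A s t \<le> s + t"
  proof (cases "s + t = 0")
    case False
    then have pos: "0 < s + t" using assms by simp
    have b: "s / (s + t) \<le> A (s / (s + t))" "1 - s / (s + t) \<le> A (s / (s + t))" "A (s / (s + t)) \<le> 1"
      using pick_bounds[of "s / (s + t)"] assms pos by auto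
    have "1 - s / (s + t) = t / (s + t)"
      using pos by (simp add: field_simps)
    with b have "s \<le> A (s / (s + t)) * (s + t)" "t \<le> A (s / (s + t)) * (s + t)"
      using pos by (simp_all add: divide_le_eq)
    moreover have "(s + t) * A (s / (s + t)) \<le> (s + t) * 1"
      using b(3) pos by (intro mult_left_mono) auto
    ultimately show ?thesis
      by (simp add: ell_def mult.commute)
  qed (use assms in \<open>simp add: ell_def add_nonneg_eq_0_iff\<close>)
  then show "s \<le> ell A s t" "t \<le> ell A s t" "ell A s t \<le> s + t" by blast+
qed

lemma ell_0_left: "0 \<le> t \<Longrightarrow> ell A 0 t = t"
  using ell_bounds[of 0 t] by simp

lemma ell_0_right: "0 \<le> s \<Longrightarrow> ell A s 0 = s"
  using ell_bounds[of s 0] by simp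

lemma ell_scale: "ell A (c * s) (c * t) = c * ell A s t"
proof (cases "c = 0")
  case False
  have "c * s / (c * s + c * t) = s / (s + t)"
    using False by (simp add: distrib_left[symmetric])
  then show ?thesis
    by (simp add: ell_def distrib_left[symmetric])
qed (simp add: ell_def)

lemma ell_eq_ell1: "0 < t \<Longrightarrow> ell A s t = t * ell1 A (s / t)"
  using ell_scale[of t "s / t" 1] by simp

text \<open>Convexity of \<open>A\<close> at \<open>s / a\<close> and \<open>s' / b\<close> with
  weights proportional to \<open>a = s + t\<close> and \<open>b = s' + t'\<close>, multiplied by
  \<open>a + b\<close>.\<close>

lemma ell_subadd:
  assumes "0 \<le> s" "0 \<le> t" "0 \<le> s'" "0 \<le> t'"
  shows "ell A (s + s') (t + t') \<le> ell A s t + ell A s' t'"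
proof (cases "s + t = 0 \<or> s' + t' = 0")
  case True
  then show ?thesis
    using assms by (auto simp: add_nonneg_eq_0_iff ell_def)
next
  case False
  define a b where "a = s + t" and "b = s' + t'"
  have ab: "0 < a" "0 < b"
    using False assms by (auto simp: a_def b_def)
  have "convex_on {0..1} A"
    using A by (simp add: pickands_def)
  from convex_onD[OF this, of "b / (a + b)" "s / a" "s' / b"]
  have *: "A ((1 - b / (a + b)) * (s / a) + b / (a + b) * (s' / b)) \<le> (1 - b / (a + b)) * A (s / a) + b / (a + b) * A (s' / b)"
    using ab assms by (auto simp: a_def b_def)
  have c: "1 - b / (a + b) = a / (a + b)"
    using ab by (simp add: field_simps)
  have "a / (a + b) * (s / a) + b / (a + b) * (s' / b) = (s + s') / (a + b)"
    using ab by (simp add: add_divide_distrib)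
  with * have "A ((s + s') / (a + b)) \<le> a / (a + b) * A (s / a) + b / (a + b) * A (s' / b)"
    unfolding c by simp
  then have "(a + b) * A ((s + s') / (a + b)) \<le> (a + b) * (a / (a + b) * A (s / a) + b / (a + b) * A (s' / b))"
    using ab by (intro mult_left_mono) auto
  also have "\<dots> = a * A (s / a) + b * A (s' / b)"
    using ab by (simp add: distrib_left)
  finally show ?thesis
    by (simp add: ell_def a_def b_def algebra_simps)
qed

text \<open>Homogeneity and subadditivity give joint convexity; the fixed argument is split as
  \<open>(1 - u) * t + u * t\<close>.\<close>

lemma ell_convex_left: "0 \<le> t \<Longrightarrow> convex_on {0..} (\<lambda>s. ell A s t)"
proof (rule convex_onI)
  fix u s s' :: real assume t: "0 \<le> t" and u: "0 < u" "u < 1" and s: "s \<in> {0..}" "s' \<in> {0..}"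
  have "ell A ((1 - u) * s + u * s') ((1 - u) * t + u * t) \<le> ell A ((1 - u) * s) ((1 - u) * t) + ell A (u * s') (u * t)"
    using u s t by (intro ell_subadd) auto
  then show "ell A ((1 - u) *\<^sub>R s + u *\<^sub>R s') t \<le> (1 - u) * ell A s t + u * ell A s' t"
    by (simp add: ell_scale distrib_right[symmetric])
qed auto

lemma ell_convex_right: "0 \<le> s \<Longrightarrow> convex_on {0..} (\<lambda>t. ell A s t)"
proof (rule convex_onI)
  fix u t t' :: real assume s: "0 \<le> s" and u: "0 < u" "u < 1" and t: "t \<in> {0..}" "t' \<in> {0..}"
  have "ell A ((1 - u) * s + u * s) ((1 - u) * t + u * t') \<le> ell A ((1 - u) * s) ((1 - u) * t) + ell A (u * s) (u * t')"
    using u s t by (intro ell_subadd) auto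
  then show "ell A s ((1 - u) *\<^sub>R t + u *\<^sub>R t') \<le> (1 - u) * ell A s t + u * ell A s t'"
    by (simp add: ell_scale distrib_right[symmetric])
qed auto

lemma ell_mono_left: "0 \<le> s \<Longrightarrow> s \<le> s' \<Longrightarrow> 0 \<le> t \<Longrightarrow> ell A s t \<le> ell A s' t"
  using convex_ge_0_mono[OF ell_convex_left, of t s s'] ell_bounds(2) by (simp add: ell_0_left)

lemma ell_mono_right: "0 \<le> t \<Longrightarrow> t \<le> t' \<Longrightarrow> 0 \<le> s \<Longrightarrow> ell A s t \<le> ell A s t'"
  using convex_ge_0_mono[OF ell_convex_right, of s t t'] ell_bounds(1) by (simp add: ell_0_right)

text \<open>Subadditivity with the increment \<open>(s' - s, 0)\<close>, where \<open>ell\<close>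
  has the value \<open>s' - s\<close>.\<close>

lemma ell_Lipschitz_left: "0 \<le> s \<Longrightarrow> 0 \<le> s' \<Longrightarrow> 0 \<le> t \<Longrightarrow> \<bar>ell A s t - ell A s' t\<bar> \<le> \<bar>s - s'\<bar>"
proof -
  have *: "\<bar>ell A s t - ell A s' t\<bar> \<le> \<bar>s - s'\<bar>" if "0 \<le> s" "s \<le> s'" "0 \<le> t" for s s'
    using ell_subadd[of s t "s' - s" 0] ell_mono_left[of s s' t] that by (simp add: ell_0_right)
  assume "0 \<le> s" "0 \<le> s'" "0 \<le> t"
  then show ?thesis
    using *[of s s'] *[of s' s] by (cases "s \<le> s'") (auto simp: abs_minus_commute)
qed

lemma ell_Lipschitz_right: "0 \<le> t \<Longrightarrow> 0 \<le> t' \<Longrightarrow> 0 \<le> s \<Longrightarrow> \<bar>ell A s t - ell A s t'\<bar> \<le> \<bar>t - t'\<bar>"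
proof -
  have *: "\<bar>ell A s t - ell A s t'\<bar> \<le> \<bar>t - t'\<bar>" if "0 \<le> t" "t \<le> t'" "0 \<le> s" for t t'
    using ell_subadd[of s t 0 "t' - t"] ell_mono_right[of t t' s] that by (simp add: ell_0_left)
  assume "0 \<le> t" "0 \<le> t'" "0 \<le> s"
  then show ?thesis
    using *[of t t'] *[of t' t] by (cases "t \<le> t'") (auto simp: abs_minus_commute)
qed

lemma ell_tendsto:
  assumes "ss \<longlonglongrightarrow> s" "ts \<longlonglongrightarrow> t" "\<And>n. 0 \<le> ss n" "\<And>n. 0 \<le> ts n"
  shows "(\<lambda>n. ell A (ss n) (ts n)) \<longlonglongrightarrow> ell A s t"
proof -
  have st: "0 \<le> s" "0 \<le> t"
    using LIMSEQ_le_const[OF assms(1)] LIMSEQ_le_const[OF assms(2)] assms(3,4) by blast+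
  have bound: "\<bar>ell A (ss n) (ts n) - ell A s t\<bar> \<le> \<bar>ss n - s\<bar> + \<bar>ts n - t\<bar>" for n
    using ell_Lipschitz_left[of "ss n" s "ts n"] ell_Lipschitz_right[of "ts n" t s] assms(3,4)[of n] st by linarith
  have lim: "(\<lambda>n. \<bar>ss n - s\<bar> + \<bar>ts n - t\<bar>) \<longlonglongrightarrow> 0"
    using tendsto_add[OF tendsto_rabs_zero[OF LIM_zero[OF assms(1)]] tendsto_rabs_zero[OF LIM_zero[OF assms(2)]]] by simp
  have "(\<lambda>n. ell A (ss n) (ts n) - ell A s t) \<longlonglongrightarrow> 0"
    by (rule Lim_null_comparison[OF always_eventually lim]) (simp add: bound)
  then show ?thesis by (rule LIM_zero_cancel)
qed

lemma convex_ell1: "convex_on {0..} (ell1 A)"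
  by (rule ell_convex_left) simp

text \<open>Clipping at 0 keeps the ratio inside the interval where \<open>A\<close> is
  controlled.\<close>

lemma ell1_measurable [measurable]: "(\<lambda>m. ell1 A (max 0 m)) \<in> borel_measurable borel"
proof (rule borel_measurable_continuous_onI, rule continuous_on_sequentiallyI)
  fix u :: "nat \<Rightarrow> real" and a assume "u \<longlonglongrightarrow> a"
  then show "(\<lambda>n. ell1 A (max 0 (u n))) \<longlonglongrightarrow> ell1 A (max 0 a)"
    by (intro ell_tendsto tendsto_max tendsto_const) auto
qed

text \<open>\<open>slope (ell1 A) m\<close> and \<open>ell1 A m - m * slope (ell1 A) m\<close> play
  the role of the two partial derivatives of \<open>ell\<close> at \<open>(m, 1)\<close>. The bounds
  come from \<open>ell\<close> lying between the maximum and the sum of its arguments.\<close>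

lemma ell1_slope_bounds:
  assumes "0 < m"
  shows "0 \<le> slope (ell1 A) m" "slope (ell1 A) m \<le> 1"
    and "0 \<le> ell1 A m - m * slope (ell1 A) m" "ell1 A m - m * slope (ell1 A) m \<le> 1"
proof -
  have ineq: "ell1 A m + slope (ell1 A) m * (y - m) \<le> ell1 A y" if "0 \<le> y" for y
    using assms that by (rule slope_ineq[OF convex_ell1])
  have "1 \<le> ell1 A m" "m \<le> ell1 A m"
    using ell_bounds[of m 1] assms by auto
  have 0: "ell1 A m - m * slope (ell1 A) m \<le> 1"
    using ineq[of 0] by (simp add: ell_0_left mult.commute)
  then show "ell1 A m - m * slope (ell1 A) m \<le> 1" .
  have "0 \<le> m * slope (ell1 A) m"
    using 0 \<open>1 \<le> ell1 A m\<close> by simp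
  then show "0 \<le> slope (ell1 A) m"
    using assms by (simp add: zero_le_mult_iff)
  show le1: "slope (ell1 A) m \<le> 1"
  proof (rule ccontr)
    assume "\<not> slope (ell1 A) m \<le> 1"
    then have d: "0 < slope (ell1 A) m - 1" by simp
    \<comment> \<open>At this \<open>y\<close> a line of slope above 1 has risen by
      \<open>y + 2\<close>, more than \<open>ell1 A y \<le> y + 1\<close> permits.\<close>
    define y where "y = m + (m + 2) / (slope (ell1 A) m - 1)"
    have "m \<le> y"
      using assms d by (simp add: y_def)
    have "ell1 A m + slope (ell1 A) m * (y - m) \<le> y + 1"
      using ineq[of y] ell_bounds(3)[of y 1] \<open>m \<le> y\<close> assms by simp
    moreover have "(slope (ell1 A) m - 1) * (y - m) = m + 2"
      using d by (simp add: y_def)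
    then have "slope (ell1 A) m * (y - m) = y + 2"
      by (simp add: algebra_simps)
    ultimately show False
      using \<open>1 \<le> ell1 A m\<close> by simp
  qed
  have "m * slope (ell1 A) m \<le> m * 1"
    using le1 assms by (intro mult_left_mono) auto
  then show "0 \<le> ell1 A m - m * slope (ell1 A) m"
    using \<open>m \<le> ell1 A m\<close> by simp
qed

lemma ell_deriv_left:
  assumes "0 < t" "(ell1 A has_real_derivative d) (at (s / t))"
  shows "((\<lambda>s. ell A s t) has_real_derivative d) (at s)"
proof -
  have "((\<lambda>s. t * ell1 A (s / t)) has_real_derivative t * (d * (1 / t))) (at s)"
    by (rule DERIV_cmult, rule DERIV_chain2[where f = "ell1 A" and g = "\<lambda>s. s / t", OF assms(2)], rule DERIV_cdivide[OF DERIV_ident])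
  then show ?thesis
    using assms(1) by (simp add: ell_eq_ell1[symmetric])
qed

lemma ell_deriv_right:
  assumes "0 < t" "(ell1 A has_real_derivative d) (at (s / t))"
  shows "((\<lambda>t. ell A s t) has_real_derivative ell1 A (s / t) - s / t * d) (at t)"
proof (rule has_field_derivative_transform_within_open[where S = "{0<..}"])
  have "((\<lambda>t. s * inverse t) has_real_derivative s * - (inverse t ^ Suc (Suc 0))) (at t)"
    using assms(1) by (intro DERIV_cmult DERIV_inverse) simp
  then have "((\<lambda>t. s / t) has_real_derivative - s / t\<^sup>2) (at t)"
    by (simp add: divide_inverse power2_eq_square)
  from DERIV_mult[OF DERIV_ident DERIV_chain2[where f = "ell1 A" and g = "\<lambda>t. s / t", OF assms(2) this]]
  show "((\<lambda>t. t * ell1 A (s / t)) has_real_derivative ell1 A (s / t) - s / t * d) (at t)"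
    using assms(1) by (simp add: power2_eq_square divide_simps mult.commute)
qed (use assms in \<open>auto simp: ell_eq_ell1[symmetric]\<close>)

end

section \<open>Archimax copulas\<close>

text \<open>\<open>am_left\<close> and \<open>am_right\<close> are the chain rule expressions for
  the two partial derivatives, with \<open>slope\<close> in place of derivatives and the inverse
  function rule for \<open>phi\<close>. This makes them defined and bounded everywhere, and correct
  outside exceptional sets.\<close>

definition am_left :: "(real \<Rightarrow> real) \<Rightarrow> (real \<Rightarrow> real) \<Rightarrow> real \<Rightarrow> real \<Rightarrow> real" where
  "am_left \<psi> A x y = (if x \<in> {0<..<1} \<and> y \<in> {0<..<1}
    then slope \<psi> (ell A (phi \<psi> x) (phi \<psi> y)) * slope (ell1 A) (phi \<psi> x / phi \<psi> y) / slope \<psi> (phi \<psi> x) else 0)"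

definition am_right :: "(real \<Rightarrow> real) \<Rightarrow> (real \<Rightarrow> real) \<Rightarrow> real \<Rightarrow> real \<Rightarrow> real" where
  "am_right \<psi> A x y = (if x \<in> {0<..<1} \<and> y \<in> {0<..<1}
    then slope \<psi> (ell A (phi \<psi> x) (phi \<psi> y))
      * (ell1 A (phi \<psi> x / phi \<psi> y) - phi \<psi> x / phi \<psi> y * slope (ell1 A) (phi \<psi> x / phi \<psi> y))
      / slope \<psi> (phi \<psi> y) else 0)"

text \<open>Levels \<open>y\<close> at which \<open>phi \<psi> y\<close> is a kink of
  \<open>\<psi>\<close>. While \<open>ell A s t = t\<close>, the section does not leave this kink,
  so it can be met by a whole interval of \<open>x\<close>; such \<open>y\<close> are
  discarded.\<close>

definition gen_bad :: "(real \<Rightarrow> real) \<Rightarrow> real set" where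
  "gen_bad \<psi> = {y \<in> {0<..<1}. \<not> (\<psi> has_real_derivative slope \<psi> (phi \<psi> y)) (at (phi \<psi> y))}"

context
  fixes \<psi> A :: "real \<Rightarrow> real"
  assumes gen: "generator \<psi>" and A: "pickands A"
begin

lemma countable_gen_bad: "countable (gen_bad \<psi>)"
proof -
  obtain B where B: "countable B" "\<forall>x\<in>{0<..} - B. (\<psi> has_real_derivative slope \<psi> x) (at x)"
    using slope_deriv_countable[OF gen_convex[OF gen]] by blast
  have "gen_bad \<psi> \<subseteq> \<psi> ` B"
  proof
    fix y assume y: "y \<in> gen_bad \<psi>"
    then have "phi \<psi> y \<in> B"
      using B(2) phi_pos[OF gen, of y] by (auto simp: gen_bad_def)
    moreover have "y = \<psi> (phi \<psi> y)"
      using y gen_phi[OF gen, of y] by (auto simp: gen_bad_def)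
    ultimately show "y \<in> \<psi> ` B" by blast
  qed
  then show ?thesis
    using B(1) countable_subset by blast
qed

text \<open>On the upper edges the formula returns the other variable because
  \<open>phi \<psi> 1 = 0\<close>, so it covers more than the open square.\<close>

lemma archimax_eq:
  assumes "0 < x" "x \<le> 1" "0 < y" "y \<le> 1"
  shows "archimax \<psi> A x y = \<psi> (ell A (phi \<psi> x) (phi \<psi> y))"
proof (cases "x < 1 \<and> y < 1")
  case True
  then show ?thesis
    using assms by (simp add: archimax_def Let_def ell_def phi_def)
next
  case False
  then consider "x = 1" | "y = 1" using assms by linarith
  then show ?thesis
    by cases (use assms in \<open>simp_all add: archimax_def phi_1[OF gen] ell_0_left[OF A] ell_0_right[OF A]
      phi_nonneg[OF gen] gen_phi[OF gen]\<close>)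
qed

lemma archimax_bounds:
  assumes "x \<in> {0..1}" "y \<in> {0..1}"
  shows "0 \<le> archimax \<psi> A x y" "archimax \<psi> A x y \<le> x" "archimax \<psi> A x y \<le> y"
proof -
  have "0 \<le> archimax \<psi> A x y \<and> archimax \<psi> A x y \<le> x \<and> archimax \<psi> A x y \<le> y"
  proof (cases "0 < x \<and> 0 < y")
    case True
    have ge: "phi \<psi> x \<le> ell A (phi \<psi> x) (phi \<psi> y)" "phi \<psi> y \<le> ell A (phi \<psi> x) (phi \<psi> y)"
      by (intro ell_bounds[OF A] phi_nonneg[OF gen])+
    then have "\<psi> (ell A (phi \<psi> x) (phi \<psi> y)) \<le> \<psi> (phi \<psi> x)" "\<psi> (ell A (phi \<psi> x) (phi \<psi> y)) \<le> \<psi> (phi \<psi> y)"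
      by (intro gen_antimonoD[OF gen] phi_nonneg[OF gen] ge)+
    moreover have "0 \<le> \<psi> (ell A (phi \<psi> x) (phi \<psi> y))"
      using gen_bounds[OF gen] order_trans[OF phi_nonneg[OF gen] ge(1)] by blast
    ultimately show ?thesis
      using True assms by (simp add: archimax_eq gen_phi[OF gen])
  qed (use assms in \<open>auto simp: archimax_def\<close>)
  then show "0 \<le> archimax \<psi> A x y" "archimax \<psi> A x y \<le> x" "archimax \<psi> A x y \<le> y"
    by blast+
qed

lemma gen_ell_tendsto:
  assumes "ss \<longlonglongrightarrow> s" "ts \<longlonglongrightarrow> t" "\<And>n. 0 \<le> ss n" "\<And>n. 0 \<le> ts n"
  shows "(\<lambda>n. \<psi> (ell A (ss n) (ts n))) \<longlonglongrightarrow> \<psi> (ell A s t)"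
proof (rule continuous_on_tendsto_compose[OF gen_cont[OF gen] ell_tendsto[OF A assms]])
  have "0 \<le> s" "0 \<le> t"
    using LIMSEQ_le_const[OF assms(1)] LIMSEQ_le_const[OF assms(2)] assms(3,4) by blast+
  then show "ell A s t \<in> {0..}"
    using ell_bounds(1)[OF A, of s t] by simp
  show "\<forall>\<^sub>F n in sequentially. ell A (ss n) (ts n) \<in> {0..}"
    using ell_bounds(1)[OF A assms(3,4)] assms(3)
    by (intro always_eventually allI) (auto intro: order_trans)
qed

text \<open>On the lower edges the bounds \<open>0 \<le> C\<close>, \<open>C \<le> x\<close> and
  \<open>C \<le> y\<close> suffice; elsewhere \<open>phi\<close>, \<open>ell\<close> and
  \<open>\<psi>\<close> are continuous.\<close>

lemma archimax_tendsto:
  assumes xs: "xs \<longlonglongrightarrow> a" "\<And>n. xs n \<in> {0..1}" and ys: "ys \<longlonglongrightarrow> b" "\<And>n. ys n \<in> {0..1}"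
  shows "(\<lambda>n. archimax \<psi> A (xs n) (ys n)) \<longlonglongrightarrow> archimax \<psi> A a b"
proof -
  have ab: "a \<in> {0..1}" "b \<in> {0..1}"
    using LIMSEQ_le_const[OF xs(1), of 0] LIMSEQ_le_const2[OF xs(1), of 1]
      LIMSEQ_le_const[OF ys(1), of 0] LIMSEQ_le_const2[OF ys(1), of 1] xs(2) ys(2) by simp_all
  consider "a = 0" | "b = 0" | "0 < a" "0 < b"
    using ab by (auto simp: less_le)
  then show ?thesis
  proof cases
    case 1
    have "xs \<longlonglongrightarrow> 0" using xs(1) 1 by simp
    then have "(\<lambda>n. archimax \<psi> A (xs n) (ys n)) \<longlonglongrightarrow> 0"
      by (rule tendsto_sandwich[OF always_eventually always_eventually tendsto_const, rotated 2])
         (simp_all add: archimax_bounds[OF xs(2) ys(2)])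
    then show ?thesis using 1 ab by (simp add: archimax_def)
  next
    case 2
    have "ys \<longlonglongrightarrow> 0" using ys(1) 2 by simp
    then have "(\<lambda>n. archimax \<psi> A (xs n) (ys n)) \<longlonglongrightarrow> 0"
      by (rule tendsto_sandwich[OF always_eventually always_eventually tendsto_const, rotated 2])
         (simp_all add: archimax_bounds[OF xs(2) ys(2)])
    then show ?thesis using 2 ab by (simp add: archimax_def)
  next
    case 3
    \<comment> \<open>Keeping the sequences away from 0 keeps them where \<open>phi\<close> is
      continuous; only finitely many terms change.\<close>
    define xs' ys' where "xs' n = max (xs n) (a / 2)" and "ys' n = max (ys n) (b / 2)" for n
    have lims: "xs' \<longlonglongrightarrow> a" "ys' \<longlonglongrightarrow> b"
      using tendsto_max[OF xs(1) tendsto_const[of "a / 2"]] tendsto_max[OF ys(1) tendsto_const[of "b / 2"]] 3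
      by (simp_all add: xs'_def[abs_def] ys'_def[abs_def])
    have pos: "0 < xs' n" "xs' n \<le> 1" "0 < ys' n" "ys' n \<le> 1" for n
      using 3 ab xs(2)[of n] ys(2)[of n] by (auto simp: xs'_def ys'_def max_def)
    have "(\<lambda>n. \<psi> (ell A (phi \<psi> (xs' n)) (phi \<psi> (ys' n)))) \<longlonglongrightarrow> \<psi> (ell A (phi \<psi> a) (phi \<psi> b))"
      using 3 ab pos lims by (intro gen_ell_tendsto phi_tendsto[OF gen] phi_nonneg[OF gen]) auto
    then have "(\<lambda>n. archimax \<psi> A (xs' n) (ys' n)) \<longlonglongrightarrow> archimax \<psi> A a b"
      using 3 ab pos by (simp add: archimax_eq)
    moreover have "\<forall>\<^sub>F n in sequentially. a / 2 < xs n" "\<forall>\<^sub>F n in sequentially. b / 2 < ys n"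
      using order_tendstoD(1)[OF xs(1), of "a / 2"] order_tendstoD(1)[OF ys(1), of "b / 2"] 3 by simp_all
    then have "\<forall>\<^sub>F n in sequentially. archimax \<psi> A (xs' n) (ys' n) = archimax \<psi> A (xs n) (ys n)"
      by eventually_elim (simp add: xs'_def ys'_def max_def)
    ultimately show ?thesis
      by (rule Lim_transform_eventually)
  qed
qed

text \<open>Written through the ratio as
  \<open>phi \<psi> y * ell1 A (phi \<psi> x / phi \<psi> y)\<close>, so that measurability in one
  variable is enough.\<close>

lemma ell_phi_measurable:
  "(\<lambda>(x, y). if x \<in> {0<..<1} \<and> y \<in> {0<..<1} then f (ell A (phi \<psi> x) (phi \<psi> y)) else 0) \<in> borel_measurable (borel \<Otimes>\<^sub>M borel)"
  if [measurable]: "f \<in> borel_measurable borel" for f :: "real \<Rightarrow> real"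
proof -
  note [measurable] = phi_measurable[OF gen] ell1_measurable[OF A]
  have "(\<lambda>(x, y). if x \<in> {0<..<1} \<and> y \<in> {0<..<1} then f (phi \<psi> y * ell1 A (max 0 (phi \<psi> x / phi \<psi> y))) else 0)
      \<in> borel_measurable (borel \<Otimes>\<^sub>M borel)"
    by measurable
  also have "(\<lambda>(x, y). if x \<in> {0<..<1} \<and> y \<in> {0<..<1} then f (phi \<psi> y * ell1 A (max 0 (phi \<psi> x / phi \<psi> y))) else 0)
      = (\<lambda>(x, y). if x \<in> {0<..<1} \<and> y \<in> {0<..<1} then f (ell A (phi \<psi> x) (phi \<psi> y)) else 0)"
    using phi_pos[OF gen] phi_nonneg[OF gen]
    by (auto simp: fun_eq_iff ell_eq_ell1[OF A, symmetric] max_def intro!: arg_cong[where f = f])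
  finally show ?thesis .
qed

lemma archimax_measurable: "case_prod (archimax \<psi> A) \<in> borel_measurable (borel \<Otimes>\<^sub>M borel)"
proof -
  have "(\<lambda>z. \<psi> (max 0 z)) \<in> borel_measurable borel"
    by (intro borel_measurable_continuous_onI continuous_on_compose2[OF gen_cont[OF gen]] continuous_intros) auto
  from ell_phi_measurable[OF this]
  have [measurable]: "(\<lambda>(x, y). if x \<in> {0<..<1} \<and> y \<in> {0<..<1} then \<psi> (max 0 (ell A (phi \<psi> x) (phi \<psi> y))) else 0)
    \<in> borel_measurable (borel \<Otimes>\<^sub>M borel)" .
  have "(\<lambda>w. if fst w \<in> {0<..<1} \<and> snd w \<in> {0<..<1}
      then (\<lambda>(x, y). if x \<in> {0<..<1} \<and> y \<in> {0<..<1} then \<psi> (max 0 (ell A (phi \<psi> x) (phi \<psi> y))) else 0) w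
      else min (fst w) (snd w)) \<in> borel_measurable (borel \<Otimes>\<^sub>M borel)"
    by measurable
  also have "(\<lambda>w. if fst w \<in> {0<..<1} \<and> snd w \<in> {0<..<1}
      then (\<lambda>(x, y). if x \<in> {0<..<1} \<and> y \<in> {0<..<1} then \<psi> (max 0 (ell A (phi \<psi> x) (phi \<psi> y))) else 0) w
      else min (fst w) (snd w)) = case_prod (archimax \<psi> A)"
  proof
    fix w :: "real \<times> real"
    have "0 \<le> ell A (phi \<psi> (fst w)) (phi \<psi> (snd w))"
      using ell_bounds(1)[OF A, of "phi \<psi> (fst w)" "phi \<psi> (snd w)"] phi_nonneg[OF gen, of "fst w"] phi_nonneg[OF gen, of "snd w"]
      by linarith
    then show "(if fst w \<in> {0<..<1} \<and> snd w \<in> {0<..<1}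
      then (\<lambda>(x, y). if x \<in> {0<..<1} \<and> y \<in> {0<..<1} then \<psi> (max 0 (ell A (phi \<psi> x) (phi \<psi> y))) else 0) w
      else min (fst w) (snd w)) = case_prod (archimax \<psi> A) w"
      by (cases w) (auto simp: archimax_eq, auto simp: archimax_def)
  qed
  finally show ?thesis .
qed

lemma am_left_measurable: "case_prod (am_left \<psi> A) \<in> borel_measurable (borel \<Otimes>\<^sub>M borel)"
proof -
  note [measurable] = phi_measurable[OF gen] measurable_slope[OF gen_convex[OF gen]] measurable_slope[OF convex_ell1[OF A]]
    ell_phi_measurable[OF measurable_slope[OF gen_convex[OF gen]]]
  have "(\<lambda>w. (\<lambda>(x, y). if x \<in> {0<..<1} \<and> y \<in> {0<..<1} then slope \<psi> (ell A (phi \<psi> x) (phi \<psi> y)) else 0) w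
      * slope (ell1 A) (phi \<psi> (fst w) / phi \<psi> (snd w)) / slope \<psi> (phi \<psi> (fst w))) \<in> borel_measurable (borel \<Otimes>\<^sub>M borel)"
    by measurable
  also have "(\<lambda>w. (\<lambda>(x, y). if x \<in> {0<..<1} \<and> y \<in> {0<..<1} then slope \<psi> (ell A (phi \<psi> x) (phi \<psi> y)) else 0) w
      * slope (ell1 A) (phi \<psi> (fst w) / phi \<psi> (snd w)) / slope \<psi> (phi \<psi> (fst w))) = case_prod (am_left \<psi> A)"
    by (auto simp: fun_eq_iff am_left_def)
  finally show ?thesis .
qed

lemma am_right_measurable: "case_prod (am_right \<psi> A) \<in> borel_measurable (borel \<Otimes>\<^sub>M borel)"
proof -
  note [measurable] = phi_measurable[OF gen] measurable_slope[OF gen_convex[OF gen]] measurable_slope[OF convex_ell1[OF A]]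
    ell1_measurable[OF A] ell_phi_measurable[OF measurable_slope[OF gen_convex[OF gen]]]
  let ?m = "\<lambda>w. phi \<psi> (fst w) / phi \<psi> (snd w)"
  let ?f = "\<lambda>w. (\<lambda>(x, y). if x \<in> {0<..<1} \<and> y \<in> {0<..<1} then slope \<psi> (ell A (phi \<psi> x) (phi \<psi> y)) else 0) w
      * (ell1 A (max 0 (?m w)) - ?m w * slope (ell1 A) (?m w)) / slope \<psi> (phi \<psi> (snd w))"
  have "?f \<in> borel_measurable (borel \<Otimes>\<^sub>M borel)"
    by measurable
  also have "?f = case_prod (am_right \<psi> A)"
    using phi_nonneg[OF gen] by (auto simp: fun_eq_iff am_right_def max_def)
  finally show ?thesis .
qed

lemma ratio_bounds:
  assumes "0 < s" "s \<le> r" "slope \<psi> s < 0"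
  shows "0 \<le> slope \<psi> r / slope \<psi> s" "slope \<psi> r / slope \<psi> s \<le> 1"
  using gen_slope_nonpos[OF gen, of r] slope_mono[OF gen_convex[OF gen], of s r] assms
  by (simp_all add: divide_nonpos_neg divide_le_eq)

lemma slope_phi_neg: "x \<in> {0<..<1} \<Longrightarrow> slope \<psi> (phi \<psi> x) < 0"
  by (intro gen_slope_neg[OF gen]) (auto simp: phi_pos[OF gen] gen_phi[OF gen])

lemma am_left_bounds:
  assumes "x \<in> {0<..<1}" "y \<in> {0<..<1}"
  shows "0 \<le> am_left \<psi> A x y \<and> am_left \<psi> A x y \<le> 1"
proof -
  define s t where "s = phi \<psi> x" and "t = phi \<psi> y"
  have st: "0 < s" "0 < t"
    using assms by (simp_all add: s_def t_def phi_pos[OF gen])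
  have "s \<le> ell A s t" "slope \<psi> s < 0"
    using st ell_bounds(1)[OF A, of s t] slope_phi_neg[OF assms(1)] by (simp_all add: s_def)
  note r = ratio_bounds[OF st(1) this]
  have g: "0 \<le> slope (ell1 A) (s / t)" "slope (ell1 A) (s / t) \<le> 1"
    using ell1_slope_bounds[OF A divide_pos_pos[OF st]] by simp_all
  have "am_left \<psi> A x y = slope \<psi> (ell A s t) / slope \<psi> s * slope (ell1 A) (s / t)"
    using assms by (simp add: am_left_def s_def t_def)
  then show ?thesis
    using mult_nonneg_nonneg[OF r(1) g(1)] mult_mono[OF r(2) g(2)] g(1) by simp
qed

lemma am_right_bounds:
  assumes "x \<in> {0<..<1}" "y \<in> {0<..<1}"
  shows "0 \<le> am_right \<psi> A x y \<and> am_right \<psi> A x y \<le> 1"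
proof -
  define s t where "s = phi \<psi> x" and "t = phi \<psi> y"
  have st: "0 < s" "0 < t"
    using assms by (simp_all add: s_def t_def phi_pos[OF gen])
  have "t \<le> ell A s t" "slope \<psi> t < 0"
    using st ell_bounds(2)[OF A, of s t] slope_phi_neg[OF assms(2)] by (simp_all add: t_def)
  note r = ratio_bounds[OF st(2) this]
  have g: "0 \<le> ell1 A (s / t) - s / t * slope (ell1 A) (s / t)" "ell1 A (s / t) - s / t * slope (ell1 A) (s / t) \<le> 1"
    using ell1_slope_bounds[OF A divide_pos_pos[OF st]] by simp_all
  have "am_right \<psi> A x y = slope \<psi> (ell A s t) / slope \<psi> t * (ell1 A (s / t) - s / t * slope (ell1 A) (s / t))"
    using assms by (simp add: am_right_def s_def t_def)
  then show ?thesis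
    using mult_nonneg_nonneg[OF r(1) g(1)] mult_mono[OF r(2) g(2)] g(1) by simp
qed

text \<open>As \<open>y\<close> grows, \<open>t = phi \<psi> y\<close> falls. Then
  \<open>ell\<close> falls, so the quotient of slopes of \<open>\<psi>\<close> grows, and the ratio
  \<open>s / t\<close> grows, so the slope of \<open>ell1\<close> grows. Both factors are
  non-negative.\<close>

lemma am_left_mono:
  assumes "x \<in> {0<..<1}"
  shows "mono_on {0<..<1} (am_left \<psi> A x)"
proof (rule mono_onI)
  fix y y' :: real assume y: "y \<in> {0<..<1}" "y' \<in> {0<..<1}" "y \<le> y'"
  define s t t' where "s = phi \<psi> x" and "t = phi \<psi> y" and "t' = phi \<psi> y'"
  have st: "0 < s" "0 < t" "0 < t'" "t' \<le> t"
    using assms y by (simp_all add: s_def t_def t'_def phi_pos[OF gen] phi_antimono[OF gen])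
  have neg: "slope \<psi> s < 0"
    using slope_phi_neg[OF assms] by (simp add: s_def)
  have pos: "0 < ell A s t'" "ell A s t' \<le> ell A s t"
    using st ell_bounds(1)[OF A, of s t'] ell_mono_right[OF A, of t' t s] by auto
  have 1: "slope \<psi> (ell A s t) / slope \<psi> s \<le> slope \<psi> (ell A s t') / slope \<psi> s"
    using slope_mono[OF gen_convex[OF gen] pos] neg by (intro divide_right_mono_neg) auto
  have 2: "slope (ell1 A) (s / t) \<le> slope (ell1 A) (s / t')"
    using st by (intro slope_mono[OF convex_ell1[OF A]]) (auto intro: divide_left_mono)
  have 3: "0 \<le> slope (ell1 A) (s / t)"
    using st by (auto intro!: ell1_slope_bounds[OF A])
  have 4: "0 \<le> slope \<psi> (ell A s t') / slope \<psi> s"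
    using st neg ell_bounds(1)[OF A, of s t'] by (intro ratio_bounds) auto
  have "slope \<psi> (ell A s t) / slope \<psi> s * slope (ell1 A) (s / t) \<le> slope \<psi> (ell A s t') / slope \<psi> s * slope (ell1 A) (s / t')"
    by (rule mult_mono[OF 1 2 4 3])
  then show "am_left \<psi> A x y \<le> am_left \<psi> A x y'"
    using assms y by (simp add: am_left_def s_def t_def t'_def)
qed

text \<open>The section of \<open>ell\<close> in its first argument starts at the level
  \<open>t\<close>, so avoiding \<open>gen_bad\<close> supplies the differentiability that
  \<open>section_deriv\<close> asks for at \<open>k 0\<close>; kinks of \<open>ell1\<close> enter
  scaled by \<open>t\<close>.\<close>

lemma am_left_deriv:
  assumes y: "y \<in> {0<..<1} - gen_bad \<psi>"
  shows "\<exists>S. countable S \<and> (\<forall>x\<in>{0<..<1} - S. ((\<lambda>x. archimax \<psi> A x y) has_real_derivative am_left \<psi> A x y) (at x))"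
proof -
  define t where "t = phi \<psi> y"
  have t: "0 < t" using y by (simp add: t_def phi_pos[OF gen])
  obtain B where B: "countable B" "\<forall>m\<in>{0<..} - B. (ell1 A has_real_derivative slope (ell1 A) m) (at m)"
    using slope_deriv_countable[OF convex_ell1[OF A]] by blast
  have "\<exists>S. countable S \<and> (\<forall>x\<in>{0<..<1} - S. ((\<lambda>x. \<psi> (ell A (phi \<psi> x) t)) has_real_derivative
      slope \<psi> (ell A (phi \<psi> x) t) * slope (ell1 A) (phi \<psi> x / t) / slope \<psi> (phi \<psi> x)) (at x))"
  proof (rule section_deriv[OF gen, where T = "(\<lambda>m. m * t) ` B"])
    show "convex_on {0..} (\<lambda>s. ell A s t)"
      using t by (intro ell_convex_left[OF A]) simp
    show "ell A 0 t \<le> ell A s t" if "0 \<le> s" for s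
      using t that by (intro ell_mono_left[OF A]) auto
    show "0 < ell A 0 t"
      using t by (simp add: ell_0_left[OF A])
    show "countable ((\<lambda>m. m * t) ` B)"
      using B(1) by simp
    show "((\<lambda>s. ell A s t) has_real_derivative slope (ell1 A) (s / t)) (at s)"
      if "0 < s" "s \<notin> (\<lambda>m. m * t) ` B" for s
    proof (rule ell_deriv_left[OF A t])
      have "s / t \<notin> B"
        using that(2) t image_eqI[of s "\<lambda>m. m * t" "s / t" B] by auto
      then show "(ell1 A has_real_derivative slope (ell1 A) (s / t)) (at (s / t))"
        using B(2) that(1) t by simp
    qed
    show "(\<psi> has_real_derivative slope \<psi> (ell A 0 t)) (at (ell A 0 t))"
      using y t by (simp add: ell_0_left[OF A]) (simp add: gen_bad_def t_def)
  qed
  then obtain S where S: "countable S" "\<forall>x\<in>{0<..<1} - S. ((\<lambda>x. \<psi> (ell A (phi \<psi> x) t)) has_real_derivative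
      slope \<psi> (ell A (phi \<psi> x) t) * slope (ell1 A) (phi \<psi> x / t) / slope \<psi> (phi \<psi> x)) (at x)"
    by blast
  have "((\<lambda>x. archimax \<psi> A x y) has_real_derivative am_left \<psi> A x y) (at x)" if x: "x \<in> {0<..<1} - S" for x
  proof (rule has_field_derivative_transform_within_open[where S = "{0<..<1}"])
    show "((\<lambda>x. \<psi> (ell A (phi \<psi> x) t)) has_real_derivative am_left \<psi> A x y) (at x)"
      using S(2) x y by (simp add: am_left_def t_def)
  qed (use x y in \<open>auto simp: archimax_eq t_def\<close>)
  then show ?thesis
    using S(1) by blast
qed

lemma am_right_deriv:
  assumes x: "x \<in> {0<..<1} - gen_bad \<psi>"
  shows "\<exists>S. countable S \<and> (\<forall>y\<in>{0<..<1} - S. (archimax \<psi> A x has_real_derivative am_right \<psi> A x y) (at y))"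
proof -
  define s where "s = phi \<psi> x"
  have s: "0 < s" using x by (simp add: s_def phi_pos[OF gen])
  obtain B where B: "countable B" "\<forall>m\<in>{0<..} - B. (ell1 A has_real_derivative slope (ell1 A) m) (at m)"
    using slope_deriv_countable[OF convex_ell1[OF A]] by blast
  have "\<exists>S. countable S \<and> (\<forall>y\<in>{0<..<1} - S. ((\<lambda>y. \<psi> (ell A s (phi \<psi> y))) has_real_derivative
      slope \<psi> (ell A s (phi \<psi> y)) * (ell1 A (s / phi \<psi> y) - s / phi \<psi> y * slope (ell1 A) (s / phi \<psi> y)) / slope \<psi> (phi \<psi> y)) (at y))"
  proof (rule section_deriv[OF gen, where T = "(\<lambda>m. s / m) ` B" and k = "\<lambda>t. ell A s t"
      and kd = "\<lambda>t. ell1 A (s / t) - s / t * slope (ell1 A) (s / t)"])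
    show "convex_on {0..} (\<lambda>t. ell A s t)"
      using s by (intro ell_convex_right[OF A]) simp
    show "ell A s 0 \<le> ell A s t" if "0 \<le> t" for t
      using s that by (intro ell_mono_right[OF A]) auto
    show "0 < ell A s 0"
      using s by (simp add: ell_0_right[OF A])
    show "countable ((\<lambda>m. s / m) ` B)"
      using B(1) by simp
    show "((\<lambda>t. ell A s t) has_real_derivative ell1 A (s / t) - s / t * slope (ell1 A) (s / t)) (at t)"
      if "0 < t" "t \<notin> (\<lambda>m. s / m) ` B" for t
    proof (rule ell_deriv_right[OF A that(1)])
      have "s / t \<notin> B"
        using that s image_eqI[of t "\<lambda>m. s / m" "s / t" B] by auto
      then show "(ell1 A has_real_derivative slope (ell1 A) (s / t)) (at (s / t))"
        using B(2) that(1) s by simp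
    qed
    show "(\<psi> has_real_derivative slope \<psi> (ell A s 0)) (at (ell A s 0))"
      using x s by (simp add: ell_0_right[OF A]) (simp add: gen_bad_def s_def)
  qed
  then obtain S where S: "countable S" "\<forall>y\<in>{0<..<1} - S. ((\<lambda>y. \<psi> (ell A s (phi \<psi> y))) has_real_derivative
      slope \<psi> (ell A s (phi \<psi> y)) * (ell1 A (s / phi \<psi> y) - s / phi \<psi> y * slope (ell1 A) (s / phi \<psi> y)) / slope \<psi> (phi \<psi> y)) (at y)"
    by blast
  have "(archimax \<psi> A x has_real_derivative am_right \<psi> A x y) (at y)" if y: "y \<in> {0<..<1} - S" for y
  proof (rule has_field_derivative_transform_within_open[where S = "{0<..<1}"])
    show "((\<lambda>y. \<psi> (ell A s (phi \<psi> y))) has_real_derivative am_right \<psi> A x y) (at y)"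
      using S(2) x y by (simp add: am_right_def s_def)
  qed (use x y in \<open>auto simp: archimax_eq s_def\<close>)
  then show ?thesis
    using S(1) by blast
qed

text \<open>By the symmetry of the construction the same countable set of levels serves as
  exceptional set for both variables.\<close>

lemma archimax_copula_kernel2:
  "copula_kernel2 (archimax \<psi> A) (am_left \<psi> A) (gen_bad \<psi>) (am_right \<psi> A) (gen_bad \<psi>)"
proof unfold_locales
  show "continuous_on {0..1} (\<lambda>x. archimax \<psi> A x y)" if "y \<in> {0..1}" for y
    using that by (intro continuous_on_sequentiallyI archimax_tendsto) auto
  show "continuous_on {0..1} (archimax \<psi> A x)" if "x \<in> {0..1}" for x
    using that by (intro continuous_on_sequentiallyI archimax_tendsto) auto
qed (simp_all add: archimax_bounds am_left_measurable am_left_bounds am_left_mono countable_gen_bad am_left_deriv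
    archimax_measurable am_right_measurable am_right_bounds am_right_deriv, simp_all add: archimax_def)

end

section \<open>Substitution of a generator in integrals\<close>

context
  fixes \<psi> :: "real \<Rightarrow> real"
  assumes gen: "generator \<psi>"
begin

lemma gen_max_measurable [measurable]: "(\<lambda>s. \<psi> (max 0 s)) \<in> borel_measurable borel"
  by (intro borel_measurable_continuous_onI continuous_on_compose2[OF gen_cont[OF gen]] continuous_intros) auto

lemma nn_integral_slope_Icc:
  assumes "0 < u" "u \<le> v"
  shows "(\<integral>\<^sup>+s. ennreal (- slope \<psi> s) * indicator {u..v} s \<partial>lborel) = ennreal (\<psi> u - \<psi> v)"
proof -
  obtain B where B: "countable B" "\<forall>x\<in>{0<..} - B. (\<psi> has_real_derivative slope \<psi> x) (at x)"
    using slope_deriv_countable[OF gen_convex[OF gen]] by blast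
  have "(\<integral>\<^sup>+s. ennreal (- slope \<psi> s) * indicator {u..v} s \<partial>lborel) = ennreal (- \<psi> v - (- \<psi> u))"
  proof (rule nn_integral_FTC_countable[OF \<open>u \<le> v\<close> _ B(1)])
    show "continuous_on {u..v} (\<lambda>s. - \<psi> s)"
      using assms by (intro continuous_on_minus continuous_on_subset[OF gen_cont[OF gen]]) auto
    show "((\<lambda>s. - \<psi> s) has_real_derivative - slope \<psi> s) (at s)" if "s \<in> {u<..<v} - B" for s
      using that B(2) assms by (intro DERIV_minus) auto
    show "0 \<le> - slope \<psi> s \<and> - slope \<psi> s \<le> - slope \<psi> u" if "s \<in> {u<..<v}" for s
      using that assms gen_slope_nonpos[OF gen, of s] slope_mono[OF gen_convex[OF gen], of u s] by simp
    show "(\<lambda>s. - slope \<psi> s) \<in> borel_measurable borel"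
      using measurable_slope[OF gen_convex[OF gen]] by simp
  qed
  then show ?thesis by simp
qed

text \<open>Image under \<open>\<psi>\<close> of the density \<open>- slope \<psi>\<close>. Showing
  that it is Lebesgue measure on the open unit interval yields the substitution
  \<open>x = \<psi> s\<close> without smoothness of \<open>\<psi>\<close>.\<close>

definition gen_measure :: "real measure" where
  "gen_measure = distr (density lborel (\<lambda>s. ennreal (- slope \<psi> s) * indicator {0<..} s)) borel (\<lambda>s. \<psi> (max 0 s))"

lemma sets_gen_measure [simp]: "sets gen_measure = sets borel"
  by (simp add: gen_measure_def)

lemma slope_density_measurable: "(\<lambda>s. ennreal (- slope \<psi> s) * indicator {0<..} s) \<in> borel_measurable lborel"
  using measurable_slope[OF gen_convex[OF gen]] by measurable

lemma nn_integral_gen_measure: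
  assumes [measurable]: "f \<in> borel_measurable borel"
  shows "(\<integral>\<^sup>+x. f x \<partial>gen_measure) = (\<integral>\<^sup>+s. f (\<psi> s) * ennreal (- slope \<psi> s) * indicator {0<..} s \<partial>lborel)"
proof -
  have "(\<integral>\<^sup>+x. f x \<partial>gen_measure) = (\<integral>\<^sup>+s. f (\<psi> (max 0 s)) \<partial>density lborel (\<lambda>s. ennreal (- slope \<psi> s) * indicator {0<..} s))"
    unfolding gen_measure_def by (rule nn_integral_distr) simp_all
  also have "\<dots> = (\<integral>\<^sup>+s. (ennreal (- slope \<psi> s) * indicator {0<..} s) * f (\<psi> (max 0 s)) \<partial>lborel)"
    using slope_density_measurable by (subst nn_integral_density) simp_all
  also have "\<dots> = (\<integral>\<^sup>+s. f (\<psi> s) * ennreal (- slope \<psi> s) * indicator {0<..} s \<partial>lborel)"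
    by (intro nn_integral_cong) (simp add: indicator_def mult.commute)
  finally show ?thesis .
qed

lemma emeasure_gen_measure:
  assumes "A \<in> sets borel"
  shows "emeasure gen_measure A = (\<integral>\<^sup>+s. indicator A (\<psi> s) * ennreal (- slope \<psi> s) * indicator {0<..} s \<partial>lborel)"
  using nn_integral_gen_measure[of "indicator A"] assms by (simp add: nn_integral_indicator)

text \<open>Only the first zero \<open>b\<close> can violate the claim, and it is a single
  point.\<close>

lemma AE_slope_eq_0: "AE s in lborel. 0 < s \<longrightarrow> \<psi> s = 0 \<longrightarrow> (\<forall>r\<ge>s. slope \<psi> r = 0)"
proof -
  define b where "b = Inf {s. 0 < s \<and> \<psi> s = 0}"
  show ?thesis
  proof (rule AE_mp[OF AE_lborel_singleton[of b]], intro AE_I2 impI allI)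
    fix s r assume s: "s \<noteq> b" "0 < s" "\<psi> s = 0" "s \<le> r"
    have bdd: "bdd_below {s. 0 < s \<and> \<psi> s = 0}"
      by (auto simp: bdd_below_def intro!: exI[of _ 0])
    have "b \<le> s"
      unfolding b_def using s bdd by (intro cInf_lower) auto
    then have "b < s" using s by simp
    then obtain u where "u \<in> {s. 0 < s \<and> \<psi> s = 0}" "u < s"
      unfolding b_def using cInf_lessD[of "{s. 0 < s \<and> \<psi> s = 0}" s] s by blast
    then show "slope \<psi> r = 0"
      using gen_slope_eq_0[OF gen, of u r] s by simp
  qed
qed

lemma gen_less_1: "0 < s \<Longrightarrow> \<psi> s < 1"
  using gen_strict[OF gen, of 0 s] by (simp add: gen_0[OF gen])

lemma emeasure_gen_measure_Icc:
  assumes "0 < a" "a \<le> b" "b < 1"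
  shows "emeasure gen_measure {a..b} = ennreal (b - a)"
proof -
  have pos: "0 < phi \<psi> b" "phi \<psi> b \<le> phi \<psi> a"
    using assms by (simp_all add: phi_pos[OF gen] phi_antimono[OF gen])
  have iff: "\<psi> s \<in> {a..b} \<longleftrightarrow> s \<in> {phi \<psi> b..phi \<psi> a}" if "0 < s" for s
  proof
    assume s: "\<psi> s \<in> {a..b}"
    then have "phi \<psi> (\<psi> s) = s"
      using that assms by (intro phi_gen[OF gen]) auto
    then show "s \<in> {phi \<psi> b..phi \<psi> a}"
      using phi_antimono[OF gen, of a "\<psi> s"] phi_antimono[OF gen, of "\<psi> s" b] s assms by simp
  next
    assume s: "s \<in> {phi \<psi> b..phi \<psi> a}"
    then have "\<psi> (phi \<psi> a) \<le> \<psi> s" "\<psi> s \<le> \<psi> (phi \<psi> b)"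
      using that phi_nonneg[OF gen, of b] by (auto intro!: gen_antimonoD[OF gen])
    then show "\<psi> s \<in> {a..b}"
      using assms by (simp add: gen_phi[OF gen])
  qed
  have "emeasure gen_measure {a..b} = (\<integral>\<^sup>+s. ennreal (- slope \<psi> s) * indicator {phi \<psi> b..phi \<psi> a} s \<partial>lborel)"
    using iff pos(1)
    by (subst emeasure_gen_measure, simp) (intro nn_integral_cong, auto simp: indicator_def)
  also have "\<dots> = ennreal (b - a)"
    using assms pos by (simp add: nn_integral_slope_Icc gen_phi[OF gen])
  finally show ?thesis .
qed

text \<open>Where \<open>\<psi> s = 0\<close> the density vanishes almost everywhere, and positive
  \<open>s\<close> never reach the value 1.\<close>

lemma emeasure_gen_measure_outside: "A \<in> sets borel \<Longrightarrow> A \<inter> {0<..<1} = {} \<Longrightarrow> emeasure gen_measure A = 0"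
proof -
  assume A: "A \<in> sets borel" "A \<inter> {0<..<1} = {}"
  have "(\<integral>\<^sup>+s. indicator A (\<psi> s) * ennreal (- slope \<psi> s) * indicator {0<..} s \<partial>lborel) = (\<integral>\<^sup>+s. 0 \<partial>(lborel :: real measure))"
  proof (rule nn_integral_cong_AE, rule AE_mp[OF AE_slope_eq_0], intro AE_I2 impI)
    fix s :: real assume s: "0 < s \<longrightarrow> \<psi> s = 0 \<longrightarrow> (\<forall>r\<ge>s. slope \<psi> r = 0)"
    show "indicator A (\<psi> s) * ennreal (- slope \<psi> s) * indicator {0<..} s = 0"
    proof (cases "0 < s \<and> \<psi> s \<in> A")
      case True
      then have "\<psi> s = 0"
        using A(2) gen_less_1[of s] gen_bounds[OF gen, of s] by (auto simp: less_le)
      then show ?thesis using s True by simp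
    qed auto
  qed
  then show ?thesis
    using A(1) by (simp add: emeasure_gen_measure)
qed

text \<open>Both measures agree on compact subintervals of the open unit interval and vanish outside
  it; exhausting by such intervals gives equal distribution functions.\<close>

lemma gen_measure_eq: "gen_measure = density lborel (indicator {0<..<1})"
proof (rule cdf_unique')
  let ?N = "density lborel (indicator {0<..<1}) :: real measure"
  have em: "emeasure ?N A = emeasure lborel ({0<..<1} \<inter> A)" if "A \<in> sets borel" for A
    using that by (subst emeasure_density) (simp_all add: indicator_inter_arith[symmetric] del: indicator_inter_arith)
  show "finite_borel_measure ?N"
    by (intro finite_borel_measure.intro finite_measureI finite_borel_measure_axioms.intro) (simp_all add: em)
  have total: "emeasure gen_measure {0<..<1} = 1"
  proof -
    \<comment> \<open>The offset 2 keeps \<open>1 / (n + 2)\<close> at most \<open>1 / 2\<close>, so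
      these intervals are never empty.\<close>
    let ?A = "\<lambda>n::nat. {1 / (real n + 2)..1 - 1 / (real n + 2)}"
    have "(\<lambda>n. emeasure gen_measure (?A n)) \<longlonglongrightarrow> emeasure gen_measure (\<Union>n. ?A n)"
    proof (rule Lim_emeasure_incseq)
      have "1 / (real n + 2) \<le> 1 / (real m + 2)" if "m \<le> n" for m n
        using that by (intro divide_left_mono) auto
      then show "incseq ?A"
        unfolding incseq_def by fastforce
    qed auto
    moreover have "emeasure gen_measure (?A n) = ennreal (1 - 2 / (real n + 2))" for n
    proof -
      have "1 / (real n + 2) \<le> 1 / 2"
        by (simp add: divide_le_eq)
      then show ?thesis
        by (subst emeasure_gen_measure_Icc) simp_all
    qed
    moreover have "(\<lambda>n. ennreal (1 - 2 / (real n + 2))) \<longlonglongrightarrow> ennreal 1"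
      by (intro tendsto_ennrealI) real_asymp
    moreover have "(\<Union>n. ?A n) = {0<..<1}"
    proof (intro set_eqI iffI)
      fix x :: real assume "x \<in> {0<..<1}"
      then obtain n :: nat where n: "inverse (real (Suc n)) < min x (1 - x)"
        using reals_Archimedean[of "min x (1 - x)"] by auto
      have "1 / (real n + 2) \<le> inverse (real (Suc n))"
        by (simp add: inverse_eq_divide field_simps)
      then show "x \<in> (\<Union>n. ?A n)"
        using n by (intro UN_I[of n]) auto
    next
      fix x :: real assume "x \<in> (\<Union>n. ?A n)"
      then obtain n :: nat where n: "1 / (real n + 2) \<le> x" "x \<le> 1 - 1 / (real n + 2)"
        by auto
      moreover have "0 < 1 / (real n + 2)" by simp
      ultimately show "x \<in> {0<..<1}"
        by (simp only: greaterThanLessThan_iff) linarith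
    qed
    ultimately show ?thesis
      using LIMSEQ_unique by fastforce
  qed
  have "emeasure gen_measure UNIV = emeasure gen_measure {0<..<1} + emeasure gen_measure (- {0<..<1})"
    by (subst plus_emeasure) (auto simp: gen_measure_def)
  then have "emeasure gen_measure UNIV = 1"
    using total by (simp add: emeasure_gen_measure_outside)
  then show "finite_borel_measure gen_measure"
    by (intro finite_borel_measure.intro finite_measureI finite_borel_measure_axioms.intro) (simp_all add: gen_measure_def)
  have "emeasure gen_measure {..c} = emeasure ?N {..c}" for c
  proof -
    consider "c \<le> 0" | "1 \<le> c" | "0 < c" "c < 1" by linarith
    then show ?thesis
    proof cases
      case 1
      then have "{0<..<1} \<inter> {..c} = {}" by auto
      then show ?thesis
        by (simp add: em emeasure_gen_measure_outside inf_commute)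
    next
      case 2
      have "{..c} = {0<..<1} \<union> ({..0} \<union> {1..c})"
        using 2 by auto
      then have "emeasure gen_measure {..c} = emeasure gen_measure {0<..<1} + emeasure gen_measure ({..0} \<union> {1..c})"
        by (simp only:) (subst plus_emeasure, auto)
      also have "\<dots> = 1"
        using total by (subst emeasure_gen_measure_outside) auto
      finally have "emeasure gen_measure {..c} = 1" .
      moreover have "{0<..<1} \<inter> {..c} = {0<..<1}" using 2 by auto
      ultimately show ?thesis
        by (simp add: em)
    next
      case 3
      let ?A = "\<lambda>n::nat. {c / (real n + 1)..c}"
      have "(\<lambda>n. emeasure gen_measure (?A n)) \<longlonglongrightarrow> emeasure gen_measure (\<Union>n. ?A n)"
      proof (rule Lim_emeasure_incseq)
        have "c / (real n + 1) \<le> c / (real m + 1)" if "m \<le> n" for m n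
          using that 3 by (intro divide_left_mono) auto
        then show "incseq ?A"
          unfolding incseq_def by fastforce
      qed auto
      moreover have "emeasure gen_measure (?A n) = ennreal (c - c / (real n + 1))" for n
        using 3 by (subst emeasure_gen_measure_Icc) (auto simp: field_simps)
      moreover have "(\<lambda>n. ennreal (c - c / (real n + 1))) \<longlonglongrightarrow> ennreal c"
        by (intro tendsto_ennrealI) real_asymp
      moreover have "(\<Union>n. ?A n) = {0<..c}"
      proof (intro set_eqI iffI)
        fix x :: real assume x: "x \<in> {0<..c}"
        then obtain n :: nat where n: "inverse (real (Suc n)) < x / c"
          using reals_Archimedean[of "x / c"] 3 by auto
        then have "c / (real n + 1) \<le> x"
          using 3 by (simp add: field_simps inverse_eq_divide)
        then show "x \<in> (\<Union>n. ?A n)"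
          using x by (intro UN_I[of n]) auto
      next
        fix x :: real assume "x \<in> (\<Union>n. ?A n)"
        then obtain n :: nat where n: "c / (real n + 1) \<le> x" "x \<le> c"
          by auto
        moreover have "0 < c / (real n + 1)" using 3 by simp
        ultimately show "x \<in> {0<..c}"
          by (auto intro: less_le_trans)
      qed
      ultimately have c: "emeasure gen_measure {0<..c} = ennreal c"
        using LIMSEQ_unique by fastforce
      have "{..c} = {0<..c} \<union> {..0}"
        using 3 by auto
      then have "emeasure gen_measure {..c} = emeasure gen_measure {0<..c} + emeasure gen_measure {..0}"
        by (simp only:) (subst plus_emeasure, auto)
      moreover have "{..0} \<inter> {0<..<1} = ({} :: real set)"
        by auto
      then have "emeasure gen_measure {..0} = 0"
        by (intro emeasure_gen_measure_outside) auto
      ultimately have "emeasure gen_measure {..c} = ennreal c"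
        using c by simp
      moreover have "{0<..<1} \<inter> {..c} = {0<..c}" using 3 by auto
      ultimately show ?thesis
        using 3 by (simp add: em)
    qed
  qed
  then show "cdf gen_measure = cdf ?N"
    by (simp add: cdf_def fun_eq_iff measure_def)
qed

lemma nn_integral_gen_substitution:
  assumes [measurable]: "f \<in> borel_measurable borel"
  shows "(\<integral>\<^sup>+x. f x * indicator {0<..<1} x \<partial>lborel)
    = (\<integral>\<^sup>+s. f (\<psi> s) * ennreal (- slope \<psi> s) * indicator {0<..} s \<partial>lborel)"
  unfolding nn_integral_gen_measure[OF assms, symmetric] gen_measure_eq
  by (subst nn_integral_density) (simp_all add: mult.commute)

end

section \<open>The Kendall distribution\<close>

text \<open>Product of the two partial derivatives of \<open>ell\<close> at \<open>(m, 1)\<close>,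
  with the inverse square that polar coordinates produce.\<close>

definition pick_density :: "(real \<Rightarrow> real) \<Rightarrow> real \<Rightarrow> real" where
  "pick_density A m = slope (ell1 A) m * (ell1 A m - m * slope (ell1 A) m) / (ell1 A m)\<^sup>2"

text \<open>Turns out to be \<open>1 - \<tau>\<close> of the extreme-value copula of
  \<open>A\<close>, see \<open>kendall_tau_ev_copula\<close>.\<close>

definition pick_alpha :: "(real \<Rightarrow> real) \<Rightarrow> real" where
  "pick_alpha A = enn2real (\<integral>\<^sup>+m. ennreal (pick_density A m) * indicator {0<..} m \<partial>lborel)"

context
  fixes A :: "real \<Rightarrow> real"
  assumes A: "pickands A"
begin

lemma ell1_ge_1: "0 \<le> m \<Longrightarrow> 1 \<le> ell1 A m"
  using ell_bounds(2)[OF A, of m 1] by simp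

lemma ell1_deriv_countable:
  "\<exists>B. countable B \<and> (\<forall>m\<in>{0<..} - B. (ell1 A has_real_derivative slope (ell1 A) m) (at m))"
  using slope_deriv_countable[OF convex_ell1[OF A]] by blast

lemma continuous_on_ell1: "continuous_on {0..} (ell1 A)"
  by (rule continuous_on_sequentiallyI) (intro ell_tendsto[OF A] tendsto_const, auto)

lemma pick_density_le:
  assumes "0 < m"
  shows "pick_density A m \<le> (ell1 A m - m * slope (ell1 A) m) / (ell1 A m)\<^sup>2"
  unfolding pick_density_def using ell1_slope_bounds[OF A assms]
  by (intro divide_right_mono) (auto intro: mult_left_le_one_le)

lemma slope_measurable [measurable]: "slope (ell1 A) \<in> borel_measurable borel"
  by (rule measurable_slope[OF convex_ell1[OF A]])

lemma pick_density_measurable: "(\<lambda>m. ennreal (pick_density A m) * indicator {0<..} m) \<in> borel_measurable borel"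
proof -
  note [measurable] = ell1_measurable[OF A]
  have "(\<lambda>m. ennreal (slope (ell1 A) m * (ell1 A (max 0 m) - m * slope (ell1 A) m) / (ell1 A (max 0 m))\<^sup>2) * indicator {0<..} m)
      \<in> borel_measurable borel"
    by measurable
  also have "(\<lambda>m. ennreal (slope (ell1 A) m * (ell1 A (max 0 m) - m * slope (ell1 A) m) / (ell1 A (max 0 m))\<^sup>2) * indicator {0<..} m)
      = (\<lambda>m. ennreal (pick_density A m) * indicator {0<..} m)"
    by (auto simp: fun_eq_iff pick_density_def indicator_def)
  finally show ?thesis .
qed

text \<open>The density is at most the derivative of \<open>m / ell1 A m\<close>, a function that
  starts at 0 and stays at most 1 because \<open>m \<le> ell1 A m\<close>.\<close>

lemma nn_integral_pick_density_le_1: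
  "(\<integral>\<^sup>+m. ennreal (pick_density A m) * indicator {0<..} m \<partial>lborel) \<le> 1"
proof -
  note [measurable] = ell1_measurable[OF A] pick_density_measurable
  define h where "h m = (ell1 A (max 0 m) - m * slope (ell1 A) m) / (ell1 A (max 0 m))\<^sup>2" for m
  have [measurable]: "h \<in> borel_measurable borel"
    unfolding h_def by measurable
  obtain B where B: "countable B" "\<forall>m\<in>{0<..} - B. (ell1 A has_real_derivative slope (ell1 A) m) (at m)"
    using ell1_deriv_countable by blast
  have le: "(\<integral>\<^sup>+m. ennreal (h m) * indicator {0..real n} m \<partial>lborel) \<le> 1" for n
  proof -
    have "(\<integral>\<^sup>+m. ennreal (h m) * indicator {0..real n} m \<partial>lborel)
        = ennreal (real n / ell1 A (real n) - 0 / ell1 A 0)"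
    proof (rule nn_integral_FTC_countable[OF _ _ B(1)])
      have "ell1 A x \<noteq> 0" if "x \<in> {0..real n}" for x
        using ell1_ge_1[of x] that by auto
      then show "continuous_on {0..real n} (\<lambda>m. m / ell1 A m)"
        by (intro continuous_on_divide continuous_on_id continuous_on_subset[OF continuous_on_ell1]) auto
      fix m assume m: "m \<in> {0<..<real n}"
      have g: "1 \<le> ell1 A m" using ell1_ge_1[of m] m by simp
      have b: "0 \<le> ell1 A m - m * slope (ell1 A) m" "ell1 A m - m * slope (ell1 A) m \<le> 1"
        using ell1_slope_bounds[OF A, of m] m by simp_all
      have "1 \<le> (ell1 A m)\<^sup>2"
        using g by simp
      then show "0 \<le> h m \<and> h m \<le> 1"
        using b m by (auto simp: h_def divide_le_eq)
    next
      fix m assume m: "m \<in> {0<..<real n} - B"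
      have g: "1 \<le> ell1 A m" using ell1_ge_1[of m] m by simp
      from B(2) m have "(ell1 A has_real_derivative slope (ell1 A) m) (at m)" by simp
      from DERIV_divide[OF DERIV_ident this] g
      show "((\<lambda>m. m / ell1 A m) has_real_derivative h m) (at m)"
        using m by (simp add: h_def power2_eq_square)
    qed simp_all
    also have "\<dots> \<le> 1"
      using ell_bounds(1)[OF A, of "real n" 1] ell1_ge_1[of "real n"] by (simp add: divide_le_eq)
    finally show ?thesis .
  qed
  have "(\<lambda>n. emeasure (density lborel (\<lambda>m. ennreal (h m))) {0..real n})
      \<longlonglongrightarrow> emeasure (density lborel (\<lambda>m. ennreal (h m))) (\<Union>n. {0..real n})"
    by (rule Lim_emeasure_incseq) (auto simp: incseq_def)
  moreover have "emeasure (density lborel (\<lambda>m. ennreal (h m))) {0..real n} \<le> 1" for n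
    using le[of n] by (simp add: emeasure_density)
  ultimately have "emeasure (density lborel (\<lambda>m. ennreal (h m))) (\<Union>n. {0..real n}) \<le> 1"
    by (intro LIMSEQ_le_const2) auto
  also have "(\<Union>n. {0..real n}) = {0..}"
    using real_arch_simple by auto
  finally have "(\<integral>\<^sup>+m. ennreal (h m) * indicator {0..} m \<partial>lborel) \<le> 1"
    by (simp add: emeasure_density)
  moreover have "(\<integral>\<^sup>+m. ennreal (pick_density A m) * indicator {0<..} m \<partial>lborel)
      \<le> (\<integral>\<^sup>+m. ennreal (h m) * indicator {0..} m \<partial>lborel)"
  proof (rule nn_integral_mono)
    show "ennreal (pick_density A m) * indicator {0<..} m \<le> ennreal (h m) * indicator {0..} m" for m
      using pick_density_le[of m] by (auto simp: h_def indicator_def intro!: ennreal_leI)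
  qed
  ultimately show ?thesis by (rule order_trans[rotated])
qed

lemma ennreal_pick_alpha:
  "ennreal (pick_alpha A) = (\<integral>\<^sup>+m. ennreal (pick_density A m) * indicator {0<..} m \<partial>lborel)"
  unfolding pick_alpha_def
  using nn_integral_pick_density_le_1 by (intro ennreal_enn2real) (auto simp: less_top[symmetric] top_unique)

lemma pick_alpha_le_1: "pick_alpha A \<le> 1"
  using nn_integral_pick_density_le_1 by (simp add: ennreal_pick_alpha[symmetric])

text \<open>\<open>ell1 A 1 = 1\<close> would force \<open>A\<close> to be
  \<open>pickands_M\<close>. Otherwise both partial derivatives of \<open>ell\<close> are positive
  for ratios in an interval to the right of 1.\<close>

lemma pick_alpha_pos:
  assumes "\<exists>t\<in>{0..1}. A t \<noteq> pickands_M t"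
  shows "0 < pick_alpha A"
proof -
  note [measurable] = ell1_measurable[OF A] pick_density_measurable
  have "1 < ell1 A 1"
  proof (rule ccontr)
    assume "\<not> 1 < ell1 A 1"
    \<comment> \<open>Convexity between 0, \<open>1 / 2\<close> and 1 then presses \<open>A\<close>
      down onto its lower bound.\<close>
    then have half: "A (1 / 2) = 1 / 2"
      using ell1_ge_1[of 1] by (simp add: ell_def)
    have conv: "convex_on {0..1} A"
      using A by (simp add: pickands_def)
    have A01: "A 0 = 1" "A 1 = 1"
      using pick_bounds[OF A, of 0] pick_bounds[OF A, of 1] by auto
    have "A t = pickands_M t" if t: "t \<in> {0..1}" for t
    proof (cases "t \<le> 1 / 2")
      case True
      have "A ((1 - 2 * t) *\<^sub>R 0 + (2 * t) *\<^sub>R (1 / 2)) \<le> (1 - 2 * t) * A 0 + (2 * t) * A (1 / 2)"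
        using True t by (intro convex_onD[OF conv]) auto
      then have "A t \<le> 1 - t"
        by (simp add: half A01)
      then show ?thesis
        using pick_bounds[OF A, of t] t True by (simp add: pickands_M_def)
    next
      case False
      have "A ((1 - (2 * t - 1)) *\<^sub>R (1 / 2) + (2 * t - 1) *\<^sub>R 1) \<le> (1 - (2 * t - 1)) * A (1 / 2) + (2 * t - 1) * A 1"
        using False t by (intro convex_onD[OF conv]) auto
      then have "A t \<le> t"
        by (simp add: half A01 algebra_simps)
      then show ?thesis
        using pick_bounds[OF A, of t] t False by (simp add: pickands_M_def)
    qed
    with assms show False by blast
  qed
  have "isCont (\<lambda>m. ell1 A m - m) 1"
    using continuous_on_interior[OF continuous_on_ell1, of 1] by (intro continuous_intros) auto
  then have "\<forall>\<^sub>F m in at 1. 0 < ell1 A m - m"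
    using \<open>1 < ell1 A 1\<close> by (intro order_tendstoD(1)[of _ "ell1 A 1 - 1"]) (auto simp: isCont_def)
  then obtain d where d: "0 < d" "\<And>m. m \<noteq> 1 \<Longrightarrow> dist m 1 < d \<Longrightarrow> 0 < ell1 A m - m"
    by (auto simp: eventually_at)
  \<comment> \<open>The factor \<open>ell1 A m - m * slope\<close> is positive since
    \<open>m * slope \<le> m < ell1 A m\<close> near 1; the slope is positive since
    \<open>ell1\<close> has already risen between 0 and 1.\<close>
  have pos: "0 < pick_density A m" if m: "1 < m" "m < 1 + d" for m
  proof -
    have "0 < ell1 A m - m"
      using m by (intro d(2)) (auto simp: dist_real_def)
    moreover have "m * slope (ell1 A) m \<le> m * 1"
      using m ell1_slope_bounds(2)[OF A, of m] by (intro mult_left_mono) auto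
    ultimately have 1: "0 < ell1 A m - m * slope (ell1 A) m" by simp
    have "ell1 A 1 + slope (ell1 A) 1 * (0 - 1) \<le> ell1 A 0"
      by (intro slope_ineq[OF convex_ell1[OF A]]) auto
    then have "0 < slope (ell1 A) 1"
      using \<open>1 < ell1 A 1\<close> by (simp add: ell_0_left[OF A])
    then have "0 < slope (ell1 A) m"
      using slope_mono[OF convex_ell1[OF A], of 1 m] m by simp
    with 1 show ?thesis
      using ell1_ge_1[of m] m by (simp add: pick_density_def)
  qed
  show ?thesis
  proof (rule ccontr)
    assume "\<not> 0 < pick_alpha A"
    then have "(\<integral>\<^sup>+m. ennreal (pick_density A m) * indicator {0<..} m \<partial>lborel) = 0"
      unfolding ennreal_pick_alpha[symmetric] by (simp add: ennreal_neg)
    then have "AE m in lborel. ennreal (pick_density A m) * indicator {0<..} m = 0"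
      by (subst (asm) nn_integral_0_iff_AE) simp_all
    then have "AE m in lborel. m \<notin> {1<..<1 + d}"
    proof eventually_elim
      case (elim m)
      show ?case
        using pos[of m] elim by (auto simp: indicator_def)
    qed
    then have "{1<..<1 + d} \<in> null_sets lborel"
      by (subst (asm) AE_iff_null_sets[symmetric]) auto
    then show False
      using \<open>0 < d\<close> by (simp add: null_sets_def)
  qed
qed

text \<open>Passing to polar coordinates \<open>s = t m\<close>, \<open>t = \<rho> / ell1 A m\<close> splits the integral into a factor that depends
  only on \<open>A\<close> and one that depends only on the generator.\<close>

lemma polar_integral:
  fixes F :: "real \<Rightarrow> ennreal"
  assumes F[measurable]: "F \<in> borel_measurable borel"
  shows "(\<integral>\<^sup>+t. \<integral>\<^sup>+s. F (ell A s t) * ennreal (slope (ell1 A) (s / t) * (ell1 A (s / t) - s / t * slope (ell1 A) (s / t)))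
      * indicator {0<..} s * indicator {0<..} t \<partial>lborel \<partial>lborel)
    = (\<integral>\<^sup>+m. ennreal (pick_density A m) * indicator {0<..} m \<partial>lborel) * (\<integral>\<^sup>+r. F r * ennreal r * indicator {0<..} r \<partial>lborel)"
proof -
  note [measurable] = ell1_measurable[OF A] pick_density_measurable
  define k where "k m = slope (ell1 A) m * (ell1 A (max 0 m) - m * slope (ell1 A) m)" for m
  have [measurable]: "k \<in> borel_measurable borel"
    unfolding k_def by measurable
  have k_nonneg: "0 \<le> k m" if "0 < m" for m
    using ell1_slope_bounds[OF A that] that by (simp add: k_def)
  define E where "E = (\<lambda>t m. F (t * ell1 A (max 0 m)) * ennreal (k m) * ennreal t * indicator {0<..} m * indicator {0<..} t)"
  have E_measurable [measurable]: "case_prod E \<in> borel_measurable (borel \<Otimes>\<^sub>M borel)"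
    unfolding E_def by measurable
  have inner: "(\<integral>\<^sup>+s. F (ell A s t) * ennreal (slope (ell1 A) (s / t) * (ell1 A (s / t) - s / t * slope (ell1 A) (s / t)))
      * indicator {0<..} s * indicator {0<..} t \<partial>lborel) = (\<integral>\<^sup>+m. E t m \<partial>lborel)" for t
  proof (cases "0 < t")
    case True
    let ?f = "\<lambda>s. F (t * ell1 A (max 0 (s / t))) * ennreal (k (s / t)) * indicator {0<..} s"
    have "(\<integral>\<^sup>+s. F (ell A s t) * ennreal (slope (ell1 A) (s / t) * (ell1 A (s / t) - s / t * slope (ell1 A) (s / t)))
        * indicator {0<..} s * indicator {0<..} t \<partial>lborel) = (\<integral>\<^sup>+s. ?f s \<partial>lborel)"
      using True by (intro nn_integral_cong) (auto simp: indicator_def k_def ell_eq_ell1[OF A True, symmetric])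
    also have "\<dots> = ennreal \<bar>t\<bar> * (\<integral>\<^sup>+m. ?f (0 + t * m) \<partial>lborel)"
      using True by (intro nn_integral_real_affine) simp_all
    also have "(\<integral>\<^sup>+m. ?f (0 + t * m) \<partial>lborel) = (\<integral>\<^sup>+m. F (t * ell1 A (max 0 m)) * ennreal (k m) * indicator {0<..} m \<partial>lborel)"
      using True by (intro nn_integral_cong) (auto simp: indicator_def zero_less_mult_iff)
    also have "ennreal \<bar>t\<bar> * \<dots> = (\<integral>\<^sup>+m. ennreal t * (F (t * ell1 A (max 0 m)) * ennreal (k m) * indicator {0<..} m) \<partial>lborel)"
      using True by (subst nn_integral_cmult) simp_all
    also have "\<dots> = (\<integral>\<^sup>+m. E t m \<partial>lborel)"
      using True by (intro nn_integral_cong) (simp add: E_def mult_ac)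
    finally show ?thesis .
  qed (simp add: E_def)
  \<comment> \<open>With \<open>r = t * ell1 A m\<close>, both \<open>t\<close> and its differential
    contribute a factor \<open>1 / ell1 A m\<close>, whence the square in
    \<open>pick_density\<close>.\<close>
  have outer: "(\<integral>\<^sup>+t. E t m \<partial>lborel) = ennreal (pick_density A m) * indicator {0<..} m * (\<integral>\<^sup>+r. F r * ennreal r * indicator {0<..} r \<partial>lborel)" for m
  proof (cases "0 < m")
    case True
    let ?g = "ell1 A m"
    have g: "1 \<le> ?g" using ell1_ge_1[of m] True by simp
    have "(\<integral>\<^sup>+t. E t m \<partial>lborel) = (\<integral>\<^sup>+t. ennreal (k m) * (F (t * ?g) * ennreal t * indicator {0<..} t) \<partial>lborel)"
      using True by (intro nn_integral_cong) (simp add: E_def mult_ac)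
    also have "\<dots> = ennreal (k m) * (\<integral>\<^sup>+t. F (t * ?g) * ennreal t * indicator {0<..} t \<partial>lborel)"
      by (rule nn_integral_cmult) simp
    also have "(\<integral>\<^sup>+t. F (t * ?g) * ennreal t * indicator {0<..} t \<partial>lborel)
        = ennreal \<bar>1 / ?g\<bar> * (\<integral>\<^sup>+r. F ((0 + 1 / ?g * r) * ?g) * ennreal (0 + 1 / ?g * r) * indicator {0<..} (0 + 1 / ?g * r) \<partial>lborel)"
      using g by (intro nn_integral_real_affine[where f = "\<lambda>t. F (t * ?g) * ennreal t * indicator {0<..} t"]) simp_all
    also have "(\<integral>\<^sup>+r. F ((0 + 1 / ?g * r) * ?g) * ennreal (0 + 1 / ?g * r) * indicator {0<..} (0 + 1 / ?g * r) \<partial>lborel)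
        = (\<integral>\<^sup>+r. ennreal (1 / ?g) * (F r * ennreal r * indicator {0<..} r) \<partial>lborel)"
    proof (rule nn_integral_cong)
      fix r :: real
      have "0 < r / ?g \<longleftrightarrow> 0 < r"
        using g by (simp add: zero_less_divide_iff)
      moreover have "ennreal (r / ?g) = ennreal (1 / ?g) * ennreal r" if "0 < r"
        using that g by (subst ennreal_mult[symmetric]) simp_all
      ultimately show "F ((0 + 1 / ?g * r) * ?g) * ennreal (0 + 1 / ?g * r) * indicator {0<..} (0 + 1 / ?g * r)
          = ennreal (1 / ?g) * (F r * ennreal r * indicator {0<..} r)"
        using g by (auto simp: indicator_def mult_ac)
    qed
    also have "\<dots> = ennreal (1 / ?g) * (\<integral>\<^sup>+r. F r * ennreal r * indicator {0<..} r \<partial>lborel)"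
      by (rule nn_integral_cmult) simp
    also have "ennreal (k m) * (ennreal \<bar>1 / ?g\<bar> * (ennreal (1 / ?g) * (\<integral>\<^sup>+r. F r * ennreal r * indicator {0<..} r \<partial>lborel)))
        = ennreal (k m * (1 / ?g) * (1 / ?g)) * (\<integral>\<^sup>+r. F r * ennreal r * indicator {0<..} r \<partial>lborel)"
    proof -
      have "ennreal (a * b * b) = ennreal a * ennreal b * ennreal b" if "0 \<le> a" "0 \<le> b" for a b
        using that by (simp add: ennreal_mult)
      from this[of "k m" "1 / ?g"] show ?thesis
        using g k_nonneg[OF True] by (simp add: mult.assoc)
    qed
    also have "k m * (1 / ?g) * (1 / ?g) = pick_density A m"
      using True by (simp add: k_def pick_density_def power2_eq_square)
    finally show ?thesis using True by simp
  qed (simp add: E_def)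
  have "(\<integral>\<^sup>+t. \<integral>\<^sup>+s. F (ell A s t) * ennreal (slope (ell1 A) (s / t) * (ell1 A (s / t) - s / t * slope (ell1 A) (s / t)))
      * indicator {0<..} s * indicator {0<..} t \<partial>lborel \<partial>lborel) = (\<integral>\<^sup>+t. \<integral>\<^sup>+m. E t m \<partial>lborel \<partial>lborel)"
    by (simp only: inner)
  also have "\<dots> = (\<integral>\<^sup>+m. \<integral>\<^sup>+t. E t m \<partial>lborel \<partial>lborel)"
    by (rule lborel_pair.Fubini'[symmetric]) (use E_measurable in \<open>simp add: case_prod_beta\<close>)
  also have "\<dots> = (\<integral>\<^sup>+m. ennreal (pick_density A m) * indicator {0<..} m \<partial>lborel) * (\<integral>\<^sup>+r. F r * ennreal r * indicator {0<..} r \<partial>lborel)"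
    unfolding outer by (rule nn_integral_multc) simp
  finally show ?thesis .
qed

end

context
  fixes \<psi> A :: "real \<Rightarrow> real"
  assumes gen: "generator \<psi>" and A: "pickands A"
begin

interpretation am: copula_kernel2 "archimax \<psi> A" "am_left \<psi> A" "gen_bad \<psi>" "am_right \<psi> A" "gen_bad \<psi>"
  by (rule archimax_copula_kernel2[OF gen A])

lemma kendall_integrand_measurable: "(\<lambda>(x, y). am.kendall_integrand z x y) \<in> borel_measurable (borel \<Otimes>\<^sub>M borel)"
  unfolding am.kendall_integrand_def
  using am.H_measurable am.H2_measurable am.C_measurable by measurable

text \<open>Substituting \<open>x = \<psi> s\<close> and \<open>y = \<psi> t\<close> cancels the
  denominators of \<open>am_left\<close> and \<open>am_right\<close> against the Jacobians. What
  remains is the squared slope at \<open>ell A s t\<close> times both partial derivatives of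
  \<open>ell\<close>, which is the form of \<open>polar_integral\<close>.\<close>

lemma nn_integral_kendall_archimax:
  "(\<integral>\<^sup>+y. \<integral>\<^sup>+x. am.kendall_integrand z x y \<partial>lborel \<partial>lborel)
    = ennreal (pick_alpha A) * (\<integral>\<^sup>+c. ennreal (- (phi \<psi> c * slope \<psi> (phi \<psi> c))) * indicator {..<z} c * indicator {0<..<1} c \<partial>lborel)"
proof -
  note [measurable] = kendall_integrand_measurable gen_max_measurable[OF gen] phi_measurable[OF gen]
    measurable_slope[OF gen_convex[OF gen]]
  have [measurable]: "(\<lambda>x. am.kendall_integrand z x y) \<in> borel_measurable borel" for y
    using measurable_compose[OF _ kendall_integrand_measurable, of "\<lambda>x. (x, y)" borel z] by simp
  let ?p = "slope \<psi>"
  define F where "F r = ennreal ((?p r)\<^sup>2) * indicator {..<z} (\<psi> (max 0 r))" for r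
  have [measurable]: "F \<in> borel_measurable borel"
    unfolding F_def by measurable
  let ?k = "\<lambda>m. slope (ell1 A) m * (ell1 A m - m * slope (ell1 A) m)"
  have support: "am.kendall_integrand z x y = am.kendall_integrand z x y * indicator {0<..<1} x"
    "am.kendall_integrand z x y = am.kendall_integrand z x y * indicator {0<..<1} y" for x y
    by (auto simp: am.kendall_integrand_def indicator_def)
  have null: "AE s in lborel. 0 < s \<longrightarrow> \<psi> s = 0 \<longrightarrow> (\<forall>r\<ge>s. ?p r = 0)"
    by (rule AE_slope_eq_0[OF gen])
  \<comment> \<open>If \<open>\<psi>\<close> vanishes at \<open>s\<close> or \<open>t\<close>, the
    left side is 0 by definition of the integrand and the right side because
    \<open>ell A s t\<close> is not smaller than that zero.\<close>
  have pointwise: "am.kendall_integrand z (\<psi> s) (\<psi> t) * ennreal (- ?p s) * ennreal (- ?p t)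
      = F (ell A s t) * ennreal (?k (s / t))"
    if s: "0 < s" "\<psi> s = 0 \<longrightarrow> (\<forall>r\<ge>s. ?p r = 0)" and t: "0 < t" "\<psi> t = 0 \<longrightarrow> (\<forall>r\<ge>t. ?p r = 0)" for s t
  proof -
    have ge: "s \<le> ell A s t" "t \<le> ell A s t"
      using ell_bounds[OF A, of s t] s t by auto
    show ?thesis
    proof (cases "\<psi> s = 0 \<or> \<psi> t = 0")
      case True
      then have "?p (ell A s t) = 0"
        using s t ge by auto
      moreover have "am.kendall_integrand z (\<psi> s) (\<psi> t) = 0"
        using True by (auto simp: am.kendall_integrand_def)
      ultimately show ?thesis
        by (simp add: F_def)
    next
      case False
      then have pos: "0 < \<psi> s" "0 < \<psi> t"
        using gen_bounds[OF gen, of s] gen_bounds[OF gen, of t] s t by auto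
      have less: "\<psi> s < 1" "\<psi> t < 1"
        using gen_less_1[OF gen] s t by auto
      have phi: "phi \<psi> (\<psi> s) = s" "phi \<psi> (\<psi> t) = t"
        using pos s t by (auto intro: phi_gen[OF gen])
      have neg: "?p s < 0" "?p t < 0"
        using gen_slope_neg[OF gen] pos s t by auto
      have C: "archimax \<psi> A (\<psi> s) (\<psi> t) = \<psi> (max 0 (ell A s t))"
        using pos less phi ge s by (simp add: archimax_eq[OF gen A])
      have H: "am_left \<psi> A (\<psi> s) (\<psi> t) = ?p (ell A s t) * slope (ell1 A) (s / t) / ?p s"
        "am_right \<psi> A (\<psi> s) (\<psi> t) = ?p (ell A s t) * (ell1 A (s / t) - s / t * slope (ell1 A) (s / t)) / ?p t"
        using pos less phi by (simp_all add: am_left_def am_right_def)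
      have Hnn: "0 \<le> am_left \<psi> A (\<psi> s) (\<psi> t)" "0 \<le> am_right \<psi> A (\<psi> s) (\<psi> t)"
        using am_left_bounds[OF gen A] am_right_bounds[OF gen A] pos less by auto
      have kn: "0 \<le> ?k (s / t)"
        using ell1_slope_bounds[OF A, of "s / t"] s t by simp
      have "am.kendall_integrand z (\<psi> s) (\<psi> t) * ennreal (- ?p s) * ennreal (- ?p t)
          = ennreal (am_left \<psi> A (\<psi> s) (\<psi> t) * am_right \<psi> A (\<psi> s) (\<psi> t) * (- ?p s) * (- ?p t))
            * indicator {..<z} (\<psi> (max 0 (ell A s t)))"
      proof -
        have "ennreal (a * b * c * d) = ennreal a * ennreal b * ennreal c * ennreal d"
          if "0 \<le> a" "0 \<le> b" "0 \<le> c" "0 \<le> d" for a b c d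
          using that by (simp add: ennreal_mult)
        from this[of _ _ "- ?p s" "- ?p t", OF Hnn] show ?thesis
          using pos less neg by (simp only: am.kendall_integrand_def C) (simp add: mult_ac)
      qed
      also have "am_left \<psi> A (\<psi> s) (\<psi> t) * am_right \<psi> A (\<psi> s) (\<psi> t) * (- ?p s) * (- ?p t)
          = (?p (ell A s t))\<^sup>2 * ?k (s / t)"
        using neg unfolding H by (simp add: power2_eq_square)
      also have "ennreal ((?p (ell A s t))\<^sup>2 * ?k (s / t)) = ennreal ((?p (ell A s t))\<^sup>2) * ennreal (?k (s / t))"
        by (rule ennreal_mult[OF zero_le_power2 kn])
      finally show ?thesis
        by (rule trans) (simp only: F_def mult.assoc mult.commute)
    qed
  qed
  have inner: "(\<integral>\<^sup>+x. am.kendall_integrand z x y \<partial>lborel)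
      = (\<integral>\<^sup>+s. am.kendall_integrand z (\<psi> s) y * ennreal (- ?p s) * indicator {0<..} s \<partial>lborel)" for y
    using nn_integral_gen_substitution[OF gen, of "\<lambda>x. am.kendall_integrand z x y"]
    by (simp flip: support(1))
  have Q_measurable [measurable]: "(\<lambda>y. \<integral>\<^sup>+x. am.kendall_integrand z x y \<partial>lborel) \<in> borel_measurable borel"
    by measurable
  have "(\<integral>\<^sup>+y. \<integral>\<^sup>+x. am.kendall_integrand z x y \<partial>lborel \<partial>lborel)
      = (\<integral>\<^sup>+y. (\<integral>\<^sup>+x. am.kendall_integrand z x y \<partial>lborel) * indicator {0<..<1} y \<partial>lborel)"
  proof (rule nn_integral_cong)
    fix y
    show "(\<integral>\<^sup>+x. am.kendall_integrand z x y \<partial>lborel) = (\<integral>\<^sup>+x. am.kendall_integrand z x y \<partial>lborel) * indicator {0<..<1} y"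
      by (cases "y \<in> {0<..<1}") (simp_all add: am.kendall_integrand_def)
  qed
  also have "\<dots> = (\<integral>\<^sup>+t. (\<integral>\<^sup>+x. am.kendall_integrand z x (\<psi> t) \<partial>lborel) * ennreal (- ?p t) * indicator {0<..} t \<partial>lborel)"
    by (rule nn_integral_gen_substitution[OF gen Q_measurable])
  also have "\<dots> = (\<integral>\<^sup>+t. \<integral>\<^sup>+s. F (ell A s t) * ennreal (?k (s / t)) * indicator {0<..} s * indicator {0<..} t \<partial>lborel \<partial>lborel)"
  proof (rule nn_integral_cong_AE, rule AE_mp[OF null], intro AE_I2 impI)
    fix t :: real assume t: "0 < t \<longrightarrow> \<psi> t = 0 \<longrightarrow> (\<forall>r\<ge>t. ?p r = 0)"
    show "(\<integral>\<^sup>+x. am.kendall_integrand z x (\<psi> t) \<partial>lborel) * ennreal (- ?p t) * indicator {0<..} t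
        = (\<integral>\<^sup>+s. F (ell A s t) * ennreal (?k (s / t)) * indicator {0<..} s * indicator {0<..} t \<partial>lborel)"
    proof (cases "0 < t")
      case True
      have m: "(\<lambda>s. am.kendall_integrand z (\<psi> s) (\<psi> t) * ennreal (- ?p s) * indicator {0<..} s) \<in> borel_measurable lborel"
      proof -
        have "(\<lambda>s. am.kendall_integrand z (\<psi> (max 0 s)) (\<psi> t) * ennreal (- ?p s) * indicator {0<..} s) \<in> borel_measurable lborel"
          by measurable
        also have "(\<lambda>s. am.kendall_integrand z (\<psi> (max 0 s)) (\<psi> t) * ennreal (- ?p s) * indicator {0<..} s)
            = (\<lambda>s. am.kendall_integrand z (\<psi> s) (\<psi> t) * ennreal (- ?p s) * indicator {0<..} s)"
          by (auto simp: fun_eq_iff indicator_def)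
        finally show ?thesis .
      qed
      have "(\<integral>\<^sup>+x. am.kendall_integrand z x (\<psi> t) \<partial>lborel) * ennreal (- ?p t) * indicator {0<..} t
          = (\<integral>\<^sup>+s. am.kendall_integrand z (\<psi> s) (\<psi> t) * ennreal (- ?p s) * indicator {0<..} s * ennreal (- ?p t) \<partial>lborel)"
        using True unfolding inner by (subst nn_integral_multc[OF m]) simp
      also have "\<dots> = (\<integral>\<^sup>+s. F (ell A s t) * ennreal (?k (s / t)) * indicator {0<..} s * indicator {0<..} t \<partial>lborel)"
      proof (rule nn_integral_cong_AE, rule AE_mp[OF null], intro AE_I2 impI)
        fix s :: real assume s: "0 < s \<longrightarrow> \<psi> s = 0 \<longrightarrow> (\<forall>r\<ge>s. ?p r = 0)"
        show "am.kendall_integrand z (\<psi> s) (\<psi> t) * ennreal (- ?p s) * indicator {0<..} s * ennreal (- ?p t)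
            = F (ell A s t) * ennreal (?k (s / t)) * indicator {0<..} s * indicator {0<..} t"
          using pointwise[of s t] s t True by (cases "0 < s") (simp_all add: mult_ac)
      qed
      finally show ?thesis .
    qed simp
  qed
  also have "\<dots> = ennreal (pick_alpha A) * (\<integral>\<^sup>+r. F r * ennreal r * indicator {0<..} r \<partial>lborel)"
    unfolding ennreal_pick_alpha[OF A] by (rule polar_integral[OF A]) measurable
  \<comment> \<open>Back to \<open>c = \<psi> r\<close>: of the squared slope one factor is the
    density of the substitution, the other stays in the integrand.\<close>
  also have "(\<integral>\<^sup>+r. F r * ennreal r * indicator {0<..} r \<partial>lborel)
      = (\<integral>\<^sup>+s. (ennreal (- (phi \<psi> (\<psi> s) * ?p (phi \<psi> (\<psi> s)))) * indicator {..<z} (\<psi> s)) * ennreal (- ?p s) * indicator {0<..} s \<partial>lborel)"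
  proof (rule nn_integral_cong_AE, rule AE_mp[OF null], intro AE_I2 impI)
    fix s :: real assume s: "0 < s \<longrightarrow> \<psi> s = 0 \<longrightarrow> (\<forall>r\<ge>s. ?p r = 0)"
    show "F s * ennreal s * indicator {0<..} s
        = (ennreal (- (phi \<psi> (\<psi> s) * ?p (phi \<psi> (\<psi> s)))) * indicator {..<z} (\<psi> s)) * ennreal (- ?p s) * indicator {0<..} s"
    proof (cases "0 < s \<and> \<psi> s \<noteq> 0")
      case True
      then have "phi \<psi> (\<psi> s) = s" "?p s \<le> 0"
        using gen_bounds[OF gen, of s] by (auto intro!: phi_gen[OF gen] gen_slope_nonpos[OF gen] simp: less_le)
      moreover have "(?p s)\<^sup>2 * s = - (s * ?p s) * (- ?p s)"
        by (simp add: power2_eq_square)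
      ultimately show ?thesis
        using True by (simp add: F_def indicator_def ennreal_mult[symmetric] mult_nonneg_nonpos mult_ac)
    qed (use s in \<open>auto simp: F_def indicator_def\<close>)
  qed
  also have "\<dots> = (\<integral>\<^sup>+c. ennreal (- (phi \<psi> c * ?p (phi \<psi> c))) * indicator {..<z} c * indicator {0<..<1} c \<partial>lborel)"
    by (rule nn_integral_gen_substitution[OF gen, symmetric]) measurable
  finally show ?thesis .
qed

lemma kendall_archimax:
  assumes "0 < z" "z \<le> 1"
  shows "ennreal (pick_alpha A) * (\<integral>\<^sup>+c. ennreal (- (phi \<psi> c * slope \<psi> (phi \<psi> c))) * indicator {..<z} c * indicator {0<..<1} c \<partial>lborel)
    = ennreal (z - z\<^sup>2 / 2 - (\<integral>w. min (archimax \<psi> A (fst w) (snd w)) z \<partial>copula_measure (archimax \<psi> A)))"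
  using am.nn_integral_kendall_integrand[OF assms] by (simp add: nn_integral_kendall_archimax)

end

section \<open>Extreme-value copulas and Kendall's tau\<close>

text \<open>\<open>exp (- z)\<close> rescaled to satisfy the normalisation
  \<open>\<psi> 1 = 1 / 2\<close>; by homogeneity of \<open>ell\<close> the base does not affect the
  copula.\<close>

definition ev_gen :: "real \<Rightarrow> real" where
  "ev_gen z = 2 powr (- z)"

lemma ev_gen_deriv: "(ev_gen has_real_derivative - (ln 2 * 2 powr (- z))) (at z)"
  unfolding ev_gen_def by (auto intro!: derivative_eq_intros)

lemma ev_gen_strict: "u < v \<Longrightarrow> ev_gen v < ev_gen u"
  by (simp add: ev_gen_def)

lemma generator_ev_gen: "generator ev_gen"
  unfolding generator_def
proof (intro conjI)
  show "ev_gen ` {0..} \<subseteq> {0..1}"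
    by (auto simp: ev_gen_def powr_minus_divide ge_one_powr_ge_zero)
  show "continuous_on {0..} ev_gen"
    using ev_gen_deriv by (intro continuous_at_imp_continuous_on ballI DERIV_isCont) blast
  show "antimono_on {0..} ev_gen"
    by (auto simp: monotone_on_def ev_gen_def)
  show "convex_on {0..} ev_gen"
    by (rule convex_on_realI[OF _ ev_gen_deriv]) (auto simp: is_interval_ci is_interval_connected)
  show "ev_gen 0 = 1" "ev_gen 1 = 1 / 2"
    by (simp_all add: ev_gen_def powr_minus_divide)
  show "(ev_gen \<longlongrightarrow> 0) at_top"
    unfolding ev_gen_def by real_asymp
  show "strict_antimono_on {z. 0 \<le> z \<and> ereal z < Inf (ereal ` {x. 0 \<le> x \<and> ev_gen x = 0})} ev_gen"
    by (auto simp: monotone_on_def ev_gen_strict)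
qed

lemma phi_ev_gen: "0 < x \<Longrightarrow> x \<le> 1 \<Longrightarrow> phi ev_gen x = - log 2 x"
proof -
  assume x: "0 < x" "x \<le> 1"
  then have "ev_gen (- log 2 x) = x"
    by (simp add: ev_gen_def)
  moreover have "0 \<le> - log 2 x"
    using x by simp
  ultimately show ?thesis
    using phi_gen[OF generator_ev_gen, of "- log 2 x"] x by simp
qed

lemma slope_ev_gen:
  assumes "0 < z"
  shows "slope ev_gen z = - (ln 2 * 2 powr (- z))"
proof -
  have "subgrad {0<..} {0<..} ev_gen (slope ev_gen)"
    by (rule subgrad_subset[OF subgrad_slope[OF gen_convex[OF generator_ev_gen]]]) auto
  from subgrad_eq_deriv[OF this open_greaterThan _ ev_gen_deriv] show ?thesis
    using assms by simp
qed

lemma ev_copula_eq_archimax: "ev_copula A = archimax ev_gen A"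
proof (intro ext)
  fix x y
  show "ev_copula A x y = archimax ev_gen A x y"
  proof (cases "0 < x \<and> x < 1 \<and> 0 < y \<and> y < 1")
    case True
    have sum: "- log 2 x + - log 2 y = - log 2 (x * y)"
      using True by (simp add: log_mult)
    have "x * y < 1 * 1"
      using True by (intro mult_strict_mono) auto
    then have "ln (x * y) < 0"
      using True by simp
    then have ratio: "- log 2 x / - log 2 (x * y) = ln x / ln (x * y)"
      by (simp add: log_def)
    have "archimax ev_gen A x y = 2 powr (log 2 (x * y) * A (ln x / ln (x * y)))"
      using True phi_ev_gen[of x] phi_ev_gen[of y]
      by (simp add: archimax_def Let_def phi_def[symmetric] sum[simplified] ratio[simplified] ev_gen_def)
    also have "\<dots> = (x * y) powr A (ln x / ln (x * y))"
      using True by (simp add: powr_powr[symmetric])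
    finally show ?thesis
      using True by (simp add: ev_copula_def)
  qed (auto simp: ev_copula_def archimax_def)
qed

text \<open>The integrand is the value of \<open>- (phi * slope)\<close> for
  \<open>ev_gen\<close>.\<close>

lemma nn_integral_entropy: "(\<integral>\<^sup>+c. ennreal (- (c * ln c)) * indicator {0<..<1} c \<partial>lborel) = ennreal (1 / 4)"
proof -
  let ?f = "\<lambda>c::real. c\<^sup>2 / 4 - c\<^sup>2 * ln c / 2"
  have "(\<integral>\<^sup>+c. ennreal (- (c * ln c)) * indicator {0..1} c \<partial>lborel) = ennreal (?f 1 - ?f 0)"
  proof (rule nn_integral_FTC_countable[where S = "{}" and B = 1])
    show "continuous_on {0..1} ?f"
    proof (rule continuous_on_IccI)
      have "(?f \<longlongrightarrow> 0) (at_right 0)"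
        by real_asymp
      then show "(?f \<longlongrightarrow> ?f 0) (at_right 0)" by simp
      have "isCont ?f x" if "0 < x" for x
        using that by (intro continuous_intros) auto
      then show "(?f \<longlongrightarrow> ?f x) (at x)" if "0 < x" "x < 1" for x
        using that by (simp add: isCont_def)
      show "(?f \<longlongrightarrow> ?f 1) (at_left 1)"
        using \<open>\<And>x. 0 < x \<Longrightarrow> isCont ?f x\<close>[of 1] by (auto simp: isCont_def filterlim_at_split)
    qed simp
    show "(?f has_real_derivative - (c * ln c)) (at c)" if "c \<in> {0<..<1} - {}" for c
      using that by (auto intro!: derivative_eq_intros simp: power2_eq_square field_simps)
    show "0 \<le> - (c * ln c) \<and> - (c * ln c) \<le> 1" if c: "c \<in> {0<..<1}" for c :: real
    proof
      show "0 \<le> - (c * ln c)"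
        using c mult_nonneg_nonpos[of c "ln c"] by simp
      have "ln (1 / c) \<le> 1 / c - 1"
        using c by (intro ln_le_minus_one) simp
      then have "c * ln (1 / c) \<le> c * (1 / c - 1)"
        using c by (intro mult_left_mono) auto
      then show "- (c * ln c) \<le> 1"
        using c by (simp add: ln_div algebra_simps)
    qed
  qed simp_all
  moreover have "(\<integral>\<^sup>+c. ennreal (- (c * ln c)) * indicator {0..1} c \<partial>lborel) = (\<integral>\<^sup>+c. ennreal (- (c * ln c)) * indicator {0<..<1} c \<partial>lborel)"
    by (intro nn_integral_cong) (auto simp: indicator_def)
  ultimately show ?thesis by simp
qed

text \<open>At \<open>z = 1\<close> the general identity for \<open>ev_gen\<close> says that
  \<open>pick_alpha A / 4\<close> is \<open>1 / 2\<close> minus the mean of \<open>C\<close> under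
  its own measure, and that mean is \<open>(\<tau> + 1) / 4\<close>.\<close>

lemma kendall_tau_ev_copula:
  assumes A: "pickands A" and M: "\<exists>t\<in>{0..1}. A t \<noteq> pickands_M t"
  shows "1 - kendall_tau (ev_copula A) = pick_alpha A"
proof -
  let ?C = "archimax ev_gen A"
  interpret am: copula_kernel2 ?C "am_left ev_gen A" "gen_bad ev_gen" "am_right ev_gen A" "gen_bad ev_gen"
    by (rule archimax_copula_kernel2[OF generator_ev_gen A])
  have "(\<integral>\<^sup>+c. ennreal (- (phi ev_gen c * slope ev_gen (phi ev_gen c))) * indicator {..<1} c * indicator {0<..<1} c \<partial>lborel)
      = (\<integral>\<^sup>+c. ennreal (- (c * ln c)) * indicator {0<..<1} c \<partial>lborel)"
  proof (rule nn_integral_cong)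
    fix c :: real
    have "- (phi ev_gen c * slope ev_gen (phi ev_gen c)) = - (c * ln c)" if c: "c \<in> {0<..<1}"
    proof -
      have "phi ev_gen c * slope ev_gen (phi ev_gen c) = (log 2 c * ln 2) * 2 powr log 2 c"
        using c phi_pos[OF generator_ev_gen, of c] by (simp add: phi_ev_gen slope_ev_gen)
      moreover have "log 2 c * ln 2 = ln c"
        by (simp add: log_def)
      ultimately show ?thesis
        using c by simp
    qed
    then show "ennreal (- (phi ev_gen c * slope ev_gen (phi ev_gen c))) * indicator {..<1} c * indicator {0<..<1} c
        = ennreal (- (c * ln c)) * indicator {0<..<1} c"
      by (auto simp: indicator_def)
  qed
  then have "ennreal (pick_alpha A * (1 / 4)) = ennreal (1 / 2 - (\<integral>w. min (?C (fst w) (snd w)) 1 \<partial>copula_measure ?C))"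
    using kendall_archimax[OF generator_ev_gen A, of 1] pick_alpha_pos[OF A M]
      ennreal_mult[of "pick_alpha A" "1 / 4"]
    by (simp add: nn_integral_entropy)
  then have int: "pick_alpha A * (1 / 4) = 1 / 2 - (\<integral>w. min (?C (fst w) (snd w)) 1 \<partial>copula_measure ?C)"
    using pick_alpha_pos[OF A M]
    by (metis ennreal_eq_0_iff ennreal_inj le_cases mult_pos_pos not_le zero_less_divide_1_iff zero_less_numeral less_eq_real_def)
  have "(LINT w:{0..1} \<times> {0..1}|copula_measure ?C. ?C (fst w) (snd w)) = (\<integral>w. min (?C (fst w) (snd w)) 1 \<partial>copula_measure ?C)"
    unfolding set_lebesgue_integral_def
  proof (rule integral_cong_AE)
    show "AE w in copula_measure ?C. indicator ({0..1} \<times> {0..1}) w *\<^sub>R ?C (fst w) (snd w) = min (?C (fst w) (snd w)) 1"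
      using am.AE_copula_measure
    proof eventually_elim
      case (elim w)
      then show ?case
        using am.C_le_1[of "fst w" "snd w"] by (auto simp: mem_Times_iff)
    qed
    have "(\<lambda>w. ?C (fst w) (snd w)) \<in> borel_measurable borel"
      using am.C_measurable by (simp add: borel_prod case_prod_beta')
    moreover have "{0..1} \<times> {0..1} \<in> sets (borel :: (real \<times> real) measure)"
      by (simp add: borel_prod[symmetric])
    ultimately show "(\<lambda>w. indicator ({0..1} \<times> {0..1}) w *\<^sub>R ?C (fst w) (snd w)) \<in> borel_measurable (copula_measure ?C)"
      "(\<lambda>w. min (?C (fst w) (snd w)) 1) \<in> borel_measurable (copula_measure ?C)"
      by (simp_all add: measurable_cong_sets[OF am.sets_copula_measure refl])
  qed
  then show ?thesis
    using int by (simp add: kendall_tau_def ev_copula_eq_archimax)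
qed

section \<open>Convergence of the normalised generators\<close>

text \<open>Up to the choice of slopes at kinks, \<open>kend \<psi> A c + c\<close> is the
  distribution function of \<open>C(X, Y)\<close>; subtracting \<open>c\<close> isolates the
  generator term.\<close>

definition kend :: "(real \<Rightarrow> real) \<Rightarrow> (real \<Rightarrow> real) \<Rightarrow> real \<Rightarrow> real" where
  "kend \<psi> A c = - (pick_alpha A * (phi \<psi> c * slope \<psi> (phi \<psi> c)))"

text \<open>Expressible through means of \<open>min C z\<close>, hence convergent along with the
  copulas, whereas \<open>kend\<close> itself is reached only by differentiation.\<close>

definition kend_int :: "(real \<Rightarrow> real) \<Rightarrow> (real \<Rightarrow> real) \<Rightarrow> real \<Rightarrow> real" where
  "kend_int \<psi> A z = (\<integral>c. kend \<psi> A c * indicator {0<..<z} c \<partial>lborel)"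

context
  fixes \<psi> A :: "real \<Rightarrow> real"
  assumes gen: "generator \<psi>" and A: "pickands A" and M: "\<exists>t\<in>{0..1}. A t \<noteq> pickands_M t"
begin

lemma kend_measurable: "kend \<psi> A \<in> borel_measurable borel"
  unfolding kend_def
  using phi_measurable[OF gen] measurable_slope[OF gen_convex[OF gen]] by measurable

lemma kend_pos: "c \<in> {0<..<1} \<Longrightarrow> 0 < kend \<psi> A c"
proof -
  assume c: "c \<in> {0<..<1}"
  then have "phi \<psi> c * slope \<psi> (phi \<psi> c) < 0"
    using slope_phi_neg[OF gen A c] phi_pos[OF gen, of c] by (intro mult_pos_neg) auto
  then show ?thesis
    using pick_alpha_pos[OF A M] by (simp add: kend_def mult_pos_neg)
qed

text \<open>\<open>\<psi> r - r * slope \<psi> r\<close> is the intercept of the supporting line at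
  \<open>r\<close>, which grows as \<open>r\<close> falls. It has the weight
  \<open>pick_alpha A\<close>, and \<open>c\<close> enters with the remaining weight
  \<open>1 - pick_alpha A\<close>, which is non-negative.\<close>

lemma kend_mono:
  assumes "c \<in> {0<..<1}" "d \<in> {0<..<1}" "c \<le> d"
  shows "kend \<psi> A c + c \<le> kend \<psi> A d + d"
proof -
  let ?\<alpha> = "pick_alpha A"
  define r s where "r = phi \<psi> c" and "s = phi \<psi> d"
  have rs: "0 < s" "s \<le> r" "\<psi> r = c" "\<psi> s = d"
    using assms by (auto simp: r_def s_def phi_pos[OF gen] phi_antimono[OF gen] gen_phi[OF gen])
  have "\<psi> r + slope \<psi> r * (s - r) \<le> \<psi> s"
    using rs by (intro slope_ineq[OF gen_convex[OF gen]]) auto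
  moreover have "s * slope \<psi> s \<le> s * slope \<psi> r"
    using rs slope_mono[OF gen_convex[OF gen], of s r] by (intro mult_left_mono) auto
  ultimately have "\<psi> r - r * slope \<psi> r \<le> \<psi> s - s * slope \<psi> s"
    by (simp add: algebra_simps)
  then have "?\<alpha> * (\<psi> r - r * slope \<psi> r) \<le> ?\<alpha> * (\<psi> s - s * slope \<psi> s)"
    using pick_alpha_pos[OF A M] by (intro mult_left_mono) auto
  moreover have "(1 - ?\<alpha>) * \<psi> r \<le> (1 - ?\<alpha>) * \<psi> s"
    using pick_alpha_le_1[OF A] assms rs by (intro mult_left_mono) auto
  ultimately show ?thesis
    using rs by (simp add: kend_def r_def[symmetric] s_def[symmetric] algebra_simps)
qed

lemma nn_integral_kend:
  assumes "0 < z" "z \<le> 1"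
  shows "(\<integral>\<^sup>+c. ennreal (kend \<psi> A c * indicator {0<..<z} c) \<partial>lborel)
    = ennreal (z - z\<^sup>2 / 2 - (\<integral>w. min (archimax \<psi> A (fst w) (snd w)) z \<partial>copula_measure (archimax \<psi> A)))"
proof -
  note [measurable] = phi_measurable[OF gen] measurable_slope[OF gen_convex[OF gen]]
  have "(\<integral>\<^sup>+c. ennreal (kend \<psi> A c * indicator {0<..<z} c) \<partial>lborel)
      = (\<integral>\<^sup>+c. ennreal (pick_alpha A) * (ennreal (- (phi \<psi> c * slope \<psi> (phi \<psi> c))) * indicator {..<z} c * indicator {0<..<1} c) \<partial>lborel)"
  proof (rule nn_integral_cong)
    fix c :: real
    show "ennreal (kend \<psi> A c * indicator {0<..<z} c)
        = ennreal (pick_alpha A) * (ennreal (- (phi \<psi> c * slope \<psi> (phi \<psi> c))) * indicator {..<z} c * indicator {0<..<1} c)"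
    proof (cases "c \<in> {0<..<z}")
      case True
      then have "0 \<le> - (phi \<psi> c * slope \<psi> (phi \<psi> c))"
        using slope_phi_neg[OF gen A, of c] phi_pos[OF gen, of c] assms by (simp add: mult_nonneg_nonpos)
      then have "ennreal (kend \<psi> A c) = ennreal (pick_alpha A) * ennreal (- (phi \<psi> c * slope \<psi> (phi \<psi> c)))"
        using pick_alpha_pos[OF A M] by (subst ennreal_mult[symmetric]) (auto simp: kend_def)
      then show ?thesis using True assms by simp
    qed (use assms in \<open>auto simp: indicator_def\<close>)
  qed
  also have "\<dots> = ennreal (pick_alpha A) * (\<integral>\<^sup>+c. ennreal (- (phi \<psi> c * slope \<psi> (phi \<psi> c))) * indicator {..<z} c * indicator {0<..<1} c \<partial>lborel)"
    by (rule nn_integral_cmult) measurable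
  finally show ?thesis
    using kendall_archimax[OF gen A assms] by simp
qed

lemma integrable_kend: "z \<le> 1 \<Longrightarrow> integrable lborel (\<lambda>c. kend \<psi> A c * indicator {0<..<z} c)"
proof -
  assume "z \<le> 1"
  note [measurable] = kend_measurable
  show ?thesis
  proof (rule integrableI_nonneg)
    show "AE c in lborel. 0 \<le> kend \<psi> A c * indicator {0<..<z} c"
      using kend_pos \<open>z \<le> 1\<close> by (intro AE_I2) (auto simp: indicator_def less_imp_le)
    show "(\<integral>\<^sup>+c. ennreal (kend \<psi> A c * indicator {0<..<z} c) \<partial>lborel) < \<infinity>"
      using nn_integral_kend[of z] \<open>z \<le> 1\<close> by (cases "0 < z") simp_all
  qed measurable
qed

text \<open>The maximum with 0 absorbs the conversion from \<open>ennreal\<close> and keeps the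
  right side a continuous function of the mean.\<close>

lemma kend_int_eq:
  assumes "0 < z" "z \<le> 1"
  shows "kend_int \<psi> A z
    = max 0 (z - z\<^sup>2 / 2 - (\<integral>w. min (archimax \<psi> A (fst w) (snd w)) z \<partial>copula_measure (archimax \<psi> A)))"
proof -
  have "kend_int \<psi> A z = enn2real (\<integral>\<^sup>+c. ennreal (kend \<psi> A c * indicator {0<..<z} c) \<partial>lborel)"
    unfolding kend_int_def using kend_measurable kend_pos assms
    by (intro integral_eq_nn_integral AE_I2) (auto simp: indicator_def less_imp_le)
  then show ?thesis
    unfolding nn_integral_kend[OF assms] by (simp add: max_def ennreal_neg)
qed

lemma kend_int_diff:
  assumes "0 < a" "a \<le> b" "b \<le> 1"
  shows "integrable lborel (\<lambda>c. kend \<psi> A c * indicator {a..<b} c)"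
    and "kend_int \<psi> A b - kend_int \<psi> A a = (\<integral>c. kend \<psi> A c * indicator {a..<b} c \<partial>lborel)"
proof -
  have eq: "(\<lambda>c. kend \<psi> A c * indicator {0<..<b} c - kend \<psi> A c * indicator {0<..<a} c) = (\<lambda>c. kend \<psi> A c * indicator {a..<b} c)"
    using assms by (auto simp: fun_eq_iff indicator_def)
  have i: "integrable lborel (\<lambda>c. kend \<psi> A c * indicator {0<..<b} c)" "integrable lborel (\<lambda>c. kend \<psi> A c * indicator {0<..<a} c)"
    using assms by (auto intro: integrable_kend)
  show "integrable lborel (\<lambda>c. kend \<psi> A c * indicator {a..<b} c)"
    using Bochner_Integration.integrable_diff[OF i] by (simp only: eq)
  show "kend_int \<psi> A b - kend_int \<psi> A a = (\<integral>c. kend \<psi> A c * indicator {a..<b} c \<partial>lborel)"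
    using Bochner_Integration.integral_diff[OF i] by (simp only: eq kend_int_def)
qed

text \<open>Adding \<open>z\<^sup>2 / 2\<close> turns the integrand into the monotone
  \<open>kend \<psi> A c + c\<close>, so that the primitive becomes convex.\<close>

lemma kend_int_subgrad: "subgrad {0<..<1} {0<..<1} (\<lambda>z. kend_int \<psi> A z + z\<^sup>2 / 2) (\<lambda>z. kend \<psi> A z + z)"
  unfolding subgrad_def
proof (intro ballI)
  have int: "integrable lborel (\<lambda>c. (k - c) * indicator {a..<b} c)"
    "(\<integral>c. (k - c) * indicator {a..<b} c \<partial>lborel) = k * (b - a) - (b\<^sup>2 / 2 - a\<^sup>2 / 2)" if "a \<le> b" for a b k :: real
  proof -
    have 1: "has_bochner_integral lborel (\<lambda>c. (k - c) * indicator {a..b} c) ((k * b - b\<^sup>2 / 2) - (k * a - a\<^sup>2 / 2))"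
      using that
      by (intro has_bochner_integral_FTC_Icc_real[where F = "\<lambda>c. k * c - c\<^sup>2 / 2"])
         (auto intro!: derivative_eq_intros continuous_intros)
    have "has_bochner_integral lborel (\<lambda>c. (k - c) * indicator {a..<b} c) ((k * b - b\<^sup>2 / 2) - (k * a - a\<^sup>2 / 2))"
    proof (rule has_bochner_integral_cong_AE[THEN iffD1, OF _ _ _ 1])
      show "AE c in lborel. (k - c) * indicator {a..b} c = (k - c) * indicator {a..<b} c"
        by (rule AE_mp[OF AE_lborel_singleton[of b]]) (auto simp: indicator_def)
    qed measurable
    then show "integrable lborel (\<lambda>c. (k - c) * indicator {a..<b} c)"
      "(\<integral>c. (k - c) * indicator {a..<b} c \<partial>lborel) = k * (b - a) - (b\<^sup>2 / 2 - a\<^sup>2 / 2)"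
      by (auto simp: has_bochner_integral_iff algebra_simps)
  qed
  fix x y :: real assume xy: "x \<in> {0<..<1}" "y \<in> {0<..<1}"
  let ?k = "kend \<psi> A x + x"
  show "kend_int \<psi> A x + x\<^sup>2 / 2 + ?k * (y - x) \<le> kend_int \<psi> A y + y\<^sup>2 / 2"
  proof (cases "x \<le> y")
    case True
    have "(\<integral>c. (?k - c) * indicator {x..<y} c \<partial>lborel) \<le> (\<integral>c. kend \<psi> A c * indicator {x..<y} c \<partial>lborel)"
    proof (rule Bochner_Integration.integral_mono)
      show "(?k - c) * indicator {x..<y} c \<le> kend \<psi> A c * indicator {x..<y} c" for c
        using kend_mono[of x c] xy by (auto simp: indicator_def)
    qed (use int(1)[OF True] kend_int_diff(1)[of x y] xy True in auto)
    then show ?thesis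
      using kend_int_diff(2)[of x y] xy True unfolding int(2)[OF True] by simp
  next
    case False
    then have le: "y \<le> x" by simp
    have "(\<integral>c. kend \<psi> A c * indicator {y..<x} c \<partial>lborel) \<le> (\<integral>c. (?k - c) * indicator {y..<x} c \<partial>lborel)"
    proof (rule Bochner_Integration.integral_mono)
      show "kend \<psi> A c * indicator {y..<x} c \<le> (?k - c) * indicator {y..<x} c" for c
        using kend_mono[of c x] xy by (auto simp: indicator_def)
    qed (use int(1)[OF le] kend_int_diff(1)[of y x] xy le in auto)
    then have "kend_int \<psi> A x - kend_int \<psi> A y \<le> ?k * (x - y) - (x\<^sup>2 / 2 - y\<^sup>2 / 2)"
      using kend_int_diff(2)[of y x] xy le unfolding int(2)[OF le] by simp
    moreover have "?k * (y - x) = - (?k * (x - y))"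
      by (simp only: minus_diff_eq[symmetric, of x y] mult_minus_right)
    ultimately show ?thesis
      by linarith
  qed
qed

text \<open>On the interval \<open>phi\<close> is smallest at \<open>y\<close>, and
  \<open>\<psi>\<close> is flattest at \<open>phi \<psi> x\<close>.\<close>

lemma kend_lower_bound:
  assumes "0 < x" "x \<le> y" "y < 1"
  obtains \<delta> where "0 < \<delta>" "\<forall>c\<in>{x..y}. \<delta> \<le> kend \<psi> A c"
proof
  let ?\<delta> = "pick_alpha A * (phi \<psi> y * - slope \<psi> (phi \<psi> x))"
  have neg: "slope \<psi> (phi \<psi> x) < 0"
    using assms by (intro slope_phi_neg[OF gen A]) auto
  have py: "0 < phi \<psi> y"
    using assms by (intro phi_pos[OF gen]) auto
  show "0 < ?\<delta>"
    using neg py pick_alpha_pos[OF A M] by (intro mult_pos_pos) auto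
  show "\<forall>c\<in>{x..y}. ?\<delta> \<le> kend \<psi> A c"
  proof
    fix c assume c: "c \<in> {x..y}"
    then have "phi \<psi> y \<le> phi \<psi> c" "phi \<psi> c \<le> phi \<psi> x"
      using assms by (auto intro!: phi_antimono[OF gen])
    moreover have "slope \<psi> (phi \<psi> c) \<le> slope \<psi> (phi \<psi> x)"
      using calculation py by (intro slope_mono[OF gen_convex[OF gen]]) auto
    ultimately have "phi \<psi> y * - slope \<psi> (phi \<psi> x) \<le> phi \<psi> c * - slope \<psi> (phi \<psi> c)"
      using neg py by (intro mult_mono) auto
    then have "?\<delta> \<le> pick_alpha A * (phi \<psi> c * - slope \<psi> (phi \<psi> c))"
      using pick_alpha_pos[OF A M] by (intro mult_left_mono) auto
    then show "?\<delta> \<le> kend \<psi> A c"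
      by (simp add: kend_def)
  qed
qed

lemma continuous_on_phi: "continuous_on {0<..1} (phi \<psi>)"
  by (intro continuous_on_sequentiallyI phi_tendsto[OF gen]) auto

text \<open>\<open>1 / kend\<close> is the derivative of \<open>- ln phi / pick_alpha A\<close>,
  because the slope of \<open>\<psi>\<close> in \<open>kend\<close> is the reciprocal of the
  derivative of \<open>phi\<close>.\<close>

lemma integral_inverse_kend:
  assumes "0 < x" "x \<le> y" "y < 1"
  shows "(\<integral>c. 1 / kend \<psi> A c * indicator {x..y} c \<partial>lborel) = (ln (phi \<psi> x) - ln (phi \<psi> y)) / pick_alpha A"
proof -
  note [measurable] = kend_measurable
  let ?\<alpha> = "pick_alpha A"
  have \<alpha>: "0 < ?\<alpha>" by (rule pick_alpha_pos[OF A M])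
  obtain \<delta> where \<delta>: "0 < \<delta>" "\<forall>c\<in>{x..y}. \<delta> \<le> kend \<psi> A c"
    using kend_lower_bound[OF assms] by blast
  obtain S where S: "countable S" "\<forall>x\<in>{0<..<1} - S. (phi \<psi> has_real_derivative 1 / slope \<psi> (phi \<psi> x)) (at x)"
    using phi_deriv_countable[OF gen] by blast
  have nn: "(\<integral>\<^sup>+c. ennreal (1 / kend \<psi> A c) * indicator {x..y} c \<partial>lborel)
      = ennreal (- ln (phi \<psi> y) / ?\<alpha> - (- ln (phi \<psi> x) / ?\<alpha>))"
  proof (rule nn_integral_FTC_countable[OF \<open>x \<le> y\<close> _ S(1), where B = "1 / \<delta>"])
    have "phi \<psi> c \<noteq> 0" if "c \<in> {x..y}" for c
      using phi_pos[OF gen, of c] that assms by auto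
    then show "continuous_on {x..y} (\<lambda>c. - ln (phi \<psi> c) / ?\<alpha>)"
      using assms \<alpha> by (intro continuous_intros continuous_on_subset[OF continuous_on_phi]) auto
    show "0 \<le> 1 / kend \<psi> A c \<and> 1 / kend \<psi> A c \<le> 1 / \<delta>" if "c \<in> {x<..<y}" for c
      using \<delta> that kend_pos[of c] assms by (auto intro!: divide_left_mono simp: less_imp_le)
    show "((\<lambda>c. - ln (phi \<psi> c) / ?\<alpha>) has_real_derivative 1 / kend \<psi> A c) (at c)" if c: "c \<in> {x<..<y} - S" for c
    proof -
      have "(phi \<psi> has_real_derivative 1 / slope \<psi> (phi \<psi> c)) (at c)"
        using S(2) c assms by auto
      moreover have "0 < phi \<psi> c"
        using phi_pos[OF gen, of c] c assms by auto
      ultimately have "((\<lambda>c. ln (phi \<psi> c)) has_real_derivative 1 / phi \<psi> c * (1 / slope \<psi> (phi \<psi> c))) (at c)"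
        by (intro DERIV_chain2[OF DERIV_ln_divide])
      from DERIV_cdivide[OF DERIV_minus[OF this], of ?\<alpha>] show ?thesis
        by (simp add: kend_def mult_ac)
    qed
  qed measurable
  have "(\<integral>c. 1 / kend \<psi> A c * indicator {x..y} c \<partial>lborel) = enn2real (\<integral>\<^sup>+c. ennreal (1 / kend \<psi> A c * indicator {x..y} c) \<partial>lborel)"
    using kend_pos assms by (intro integral_eq_nn_integral AE_I2) (auto simp: indicator_def less_imp_le)
  also have "(\<integral>\<^sup>+c. ennreal (1 / kend \<psi> A c * indicator {x..y} c) \<partial>lborel) = (\<integral>\<^sup>+c. ennreal (1 / kend \<psi> A c) * indicator {x..y} c \<partial>lborel)"
    by (intro nn_integral_cong) (simp add: indicator_def)
  also have "enn2real \<dots> = (ln (phi \<psi> x) - ln (phi \<psi> y)) / ?\<alpha>"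
  proof -
    have "ln (phi \<psi> y) \<le> ln (phi \<psi> x)"
      using assms by (simp add: phi_pos[OF gen] phi_antimono[OF gen])
    then have "0 \<le> (ln (phi \<psi> x) - ln (phi \<psi> y)) / ?\<alpha>"
      using \<alpha> by simp
    then show ?thesis
      unfolding nn by (simp add: diff_divide_distrib)
  qed
  finally show ?thesis .
qed

end

text \<open>Passing to the limit in the integral of \<open>1 / kend\<close> needs a lower bound
  uniform in \<open>n\<close> and \<open>c\<close>, although convergence is only pointwise.
  Monotonicity of \<open>kend + c\<close> spreads a bound from one point to the right, and
  compactness makes finitely many points enough.\<close>

lemma kend_tendsto_imp_phi_tendsto:
  fixes \<psi> A :: "real \<Rightarrow> real" and \<psi>s As :: "nat \<Rightarrow> real \<Rightarrow> real"
  assumes gen: "generator \<psi>" "\<And>n. generator (\<psi>s n)" and A: "pickands A" "\<And>n. pickands (As n)"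
    and M: "\<exists>t\<in>{0..1}. A t \<noteq> pickands_M t" "\<And>n. \<exists>t\<in>{0..1}. As n t \<noteq> pickands_M t"
    and S: "countable S" "\<And>c. c \<in> {0<..<1} - S \<Longrightarrow> (\<lambda>n. kend (\<psi>s n) (As n) c) \<longlonglongrightarrow> kend \<psi> A c"
    and xy: "0 < x" "x \<le> y" "y < 1"
  shows "(\<lambda>n. (ln (phi (\<psi>s n) x) - ln (phi (\<psi>s n) y)) / pick_alpha (As n))
    \<longlonglongrightarrow> (ln (phi \<psi> x) - ln (phi \<psi> y)) / pick_alpha A"
proof -
  let ?k = "kend \<psi> A" and ?ks = "\<lambda>n. kend (\<psi>s n) (As n)"
  have [measurable]: "?k \<in> borel_measurable borel" "?ks n \<in> borel_measurable borel" for n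
    by (intro kend_measurable gen A M)+
  \<comment> \<open>The interval is widened to \<open>x / 2\<close> because the test points
    \<open>d\<close> lie to the left of \<open>c\<close>, possibly also of \<open>x\<close>.\<close>
  obtain \<delta> where \<delta>: "0 < \<delta>" "\<forall>c\<in>{x / 2..y}. \<delta> \<le> ?k c"
    by (rule kend_lower_bound[OF gen(1) A(1) M(1), of "x / 2" y]) (use xy in auto)
  have local: "\<exists>U. open U \<and> c \<in> U \<and> (\<forall>\<^sub>F n in sequentially. \<forall>c'\<in>U \<inter> {x..y}. \<delta> / 2 \<le> ?ks n c')"
    if c: "c \<in> {x..y}" for c
  proof -
    \<comment> \<open>Every point of the neighbourhood is less than \<open>\<delta> / 4\<close> to
      the right of \<open>d\<close>, so a value above \<open>3 * \<delta> / 4\<close> at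
      \<open>d\<close> leaves at least \<open>\<delta> / 2\<close>.\<close>
    obtain d where d: "max (x / 2) (c - \<delta> / 8) < d" "d < c" "d \<notin> S"
      using ex_between_not_in_countable[OF _ S(1), of "max (x / 2) (c - \<delta> / 8)" c] c xy \<delta>(1) by auto
    have d01: "d \<in> {0<..<1}"
      using d c xy by auto
    have "\<delta> \<le> ?k d"
      using \<delta>(2) d c by auto
    then have "\<forall>\<^sub>F n in sequentially. 3 * \<delta> / 4 < ?ks n d"
      using d01 d(3) \<delta>(1) by (intro order_tendstoD(1)[OF S(2)]) auto
    then have "\<forall>\<^sub>F n in sequentially. \<forall>c'\<in>{d<..<c + \<delta> / 8} \<inter> {x..y}. \<delta> / 2 \<le> ?ks n c'"
    proof eventually_elim
      case (elim n)
      show ?case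
      proof
        fix c' assume c': "c' \<in> {d<..<c + \<delta> / 8} \<inter> {x..y}"
        then have "?ks n d + d \<le> ?ks n c' + c'"
          using d01 xy by (intro kend_mono gen A M) auto
        then show "\<delta> / 2 \<le> ?ks n c'"
          using elim c' d(1) by auto
      qed
    qed
    then show ?thesis
      using d(2) \<delta>(1) by (intro exI[of _ "{d<..<c + \<delta> / 8}"]) auto
  qed
  then have "\<forall>c\<in>{x..y}. \<exists>U. open U \<and> c \<in> U \<and> (\<forall>\<^sub>F n in sequentially. \<forall>c'\<in>U \<inter> {x..y}. \<delta> / 2 \<le> ?ks n c')"
    by blast
  from bchoice[OF this] obtain U where U: "\<forall>c\<in>{x..y}. open (U c) \<and> c \<in> U c \<and>
      (\<forall>\<^sub>F n in sequentially. \<forall>c'\<in>U c \<inter> {x..y}. \<delta> / 2 \<le> ?ks n c')"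
    by blast
  obtain D where D: "D \<subseteq> {x..y}" "finite D" "{x..y} \<subseteq> (\<Union>c\<in>D. U c)"
  proof (rule compactE_image[OF compact_Icc[of x y], of "{x..y}" U])
    show "open (U c)" if "c \<in> {x..y}" for c
      using U that by blast
    show "{x..y} \<subseteq> (\<Union>c\<in>{x..y}. U c)"
      using U by blast
  qed
  have "\<forall>\<^sub>F n in sequentially. \<forall>c\<in>D. \<forall>c'\<in>U c \<inter> {x..y}. \<delta> / 2 \<le> ?ks n c'"
    using D(1,2) U by (intro eventually_ball_finite) blast+
  then have ev: "\<forall>\<^sub>F n in sequentially. \<forall>c\<in>{x..y}. \<delta> / 2 \<le> ?ks n c"
    by eventually_elim (use D(3) in blast)
  have "(\<lambda>n. \<integral>c. 1 / ?ks n c * indicator {x..y} c \<partial>lborel) \<longlonglongrightarrow> (\<integral>c. 1 / ?k c * indicator {x..y} c \<partial>lborel)"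
  proof -
    obtain n0 where n0: "\<And>n c. n \<ge> n0 \<Longrightarrow> c \<in> {x..y} \<Longrightarrow> \<delta> / 2 \<le> ?ks n c"
      using ev unfolding eventually_sequentially by blast
    \<comment> \<open>The bound holds from \<open>n0\<close> on; shifting the sequence makes
      domination hold for every index.\<close>
    have "(\<lambda>n. \<integral>c. 1 / ?ks (n + n0) c * indicator {x..y} c \<partial>lborel) \<longlonglongrightarrow> (\<integral>c. 1 / ?k c * indicator {x..y} c \<partial>lborel)"
    proof (rule integral_dominated_convergence[where w = "\<lambda>c. 2 / \<delta> * indicator {x..y} c"])
      show "integrable lborel (\<lambda>c. 2 / \<delta> * indicator {x..y} c)"
        by (intro integrable_mult_right integrable_indicator_Icc)
      show "AE c in lborel. (\<lambda>n. 1 / ?ks (n + n0) c * indicator {x..y} c) \<longlonglongrightarrow> 1 / ?k c * indicator {x..y} c"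
      proof (rule AE_mp[OF AE_not_in[OF countable_imp_null_set_lborel[OF S(1)]]], intro AE_I2 impI)
        fix c assume c: "c \<notin> S"
        show "(\<lambda>n. 1 / ?ks (n + n0) c * indicator {x..y} c) \<longlonglongrightarrow> 1 / ?k c * indicator {x..y} c"
        proof (cases "c \<in> {x..y}")
          case True
          then have c01: "c \<in> {0<..<1}" using xy by auto
          have "0 < ?k c"
            using c01 by (rule kend_pos[OF gen(1) A(1) M(1)])
          then show ?thesis
            using c c01 by (intro tendsto_intros LIMSEQ_ignore_initial_segment[OF S(2)]) auto
        qed simp
      qed
      show "AE c in lborel. norm (1 / ?ks (n + n0) c * indicator {x..y} c) \<le> 2 / \<delta> * indicator {x..y} c" for n
      proof (rule AE_I2)
        fix c
        show "norm (1 / ?ks (n + n0) c * indicator {x..y} c) \<le> 2 / \<delta> * indicator {x..y} c"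
        proof (cases "c \<in> {x..y}")
          case True
          then have "\<delta> / 2 \<le> ?ks (n + n0) c" by (intro n0) simp_all
          then have "1 / ?ks (n + n0) c \<le> 1 / (\<delta> / 2)" "0 < ?ks (n + n0) c"
            using \<delta>(1) frac_le[of 1 1 "\<delta> / 2" "?ks (n + n0) c"] by simp_all
          then show ?thesis using True by simp
        qed simp
      qed
    qed measurable
    then show ?thesis by (rule LIMSEQ_offset)
  qed
  then show ?thesis
    by (simp only: integral_inverse_kend[OF gen(1) A(1) M(1) xy] integral_inverse_kend[OF gen(2) A(2) M(2) xy])
qed

text \<open>Means of \<open>min C z\<close> converge, hence so do the convex primitives of
  \<open>kend + c\<close>, hence their slopes wherever the limit is differentiable. This yields
  \<open>kend\<close> off a countable set and with it all log ratios of \<open>phi\<close>.\<close>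

lemma d_sup_imp_phi_tendsto:
  fixes \<psi> A :: "real \<Rightarrow> real" and \<psi>s As :: "nat \<Rightarrow> real \<Rightarrow> real"
  assumes gen: "generator \<psi>" "\<And>n. generator (\<psi>s n)" and A: "pickands A" "\<And>n. pickands (As n)"
    and M: "\<exists>t\<in>{0..1}. A t \<noteq> pickands_M t" "\<And>n. \<exists>t\<in>{0..1}. As n t \<noteq> pickands_M t"
    and conv: "(\<lambda>n. d_sup (archimax (\<psi>s n) (As n)) (archimax \<psi> A)) \<longlonglongrightarrow> 0"
    and x: "x \<in> {0<..<1}"
  shows "(\<lambda>n. ln (phi (\<psi>s n) x) / pick_alpha (As n)) \<longlonglongrightarrow> ln (phi \<psi> x) / pick_alpha A"
proof -
  have lim: "(\<lambda>n. kend_int (\<psi>s n) (As n) z) \<longlonglongrightarrow> kend_int \<psi> A z" if z: "z \<in> {0<..<1}" for z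
  proof -
    have "(\<lambda>n. \<integral>w. min (archimax (\<psi>s n) (As n) (fst w) (snd w)) z \<partial>copula_measure (archimax (\<psi>s n) (As n)))
        \<longlonglongrightarrow> (\<integral>w. min (archimax \<psi> A (fst w) (snd w)) z \<partial>copula_measure (archimax \<psi> A))"
      using z by (intro integral_min_copula_converge[OF archimax_copula_kernel2[OF gen(1) A(1)]
            archimax_copula_kernel2[OF gen(2) A(2)] conv]) auto
    then have "(\<lambda>n. max 0 (z - z\<^sup>2 / 2 - (\<integral>w. min (archimax (\<psi>s n) (As n) (fst w) (snd w)) z \<partial>copula_measure (archimax (\<psi>s n) (As n)))))
        \<longlonglongrightarrow> max 0 (z - z\<^sup>2 / 2 - (\<integral>w. min (archimax \<psi> A (fst w) (snd w)) z \<partial>copula_measure (archimax \<psi> A)))"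
      by (intro tendsto_max tendsto_diff tendsto_const)
    then show ?thesis
      using z by (simp add: kend_int_eq[OF gen(1) A(1) M(1)] kend_int_eq[OF gen(2) A(2) M(2)])
  qed
  let ?N = "\<lambda>\<psi> A z. kend_int \<psi> A z + z\<^sup>2 / 2"
  obtain S where S: "countable S" "\<forall>z\<in>{0<..<1} - S. (?N \<psi> A has_real_derivative kend \<psi> A z + z) (at z)"
    using subgrad_deriv_countable[OF kend_int_subgrad[OF gen(1) A(1) M(1)]] by auto
  have k: "(\<lambda>n. kend (\<psi>s n) (As n) c) \<longlonglongrightarrow> kend \<psi> A c" if c: "c \<in> {0<..<1} - S" for c
  proof -
    have "(\<lambda>n. kend (\<psi>s n) (As n) c + c) \<longlonglongrightarrow> kend \<psi> A c + c"
    proof (rule subgrad_converge[where I = "{0<..<1}" and x = c and f = "?N \<psi> A" and fs = "\<lambda>n. ?N (\<psi>s n) (As n)" and xs = "\<lambda>_. c"])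
      show "(?N \<psi> A has_real_derivative kend \<psi> A c + c) (at c)"
        using S(2) c by blast
      show "(\<lambda>n. ?N (\<psi>s n) (As n) z) \<longlonglongrightarrow> ?N \<psi> A z" if "z \<in> {0<..<1}" for z
        by (intro tendsto_add tendsto_const lim that)
      then show "(\<lambda>n. ?N (\<psi>s n) (As n) c) \<longlonglongrightarrow> ?N \<psi> A c"
        using c by blast
      show "\<forall>\<^sub>F n in sequentially. \<forall>y\<in>{0<..<1}. ?N (\<psi>s n) (As n) c + (kend (\<psi>s n) (As n) c + c) * (y - c) \<le> ?N (\<psi>s n) (As n) y"
        using subgradD[OF kend_int_subgrad[OF gen(2) A(2) M(2)]] c by (intro always_eventually allI ballI) blast
    qed (use c in auto)
    from tendsto_diff[OF this tendsto_const[of c]] show ?thesis by simp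
  qed
  note main = kend_tendsto_imp_phi_tendsto[OF gen A M S(1) k]
  \<comment> \<open>The normalisation \<open>\<psi> 1 = 1 / 2\<close> makes \<open>phi\<close> equal
    to 1 at \<open>1 / 2\<close>, so a log ratio against this point is the logarithm itself.\<close>
  have half: "ln (phi \<psi> (1 / 2)) = 0" "ln (phi (\<psi>s n) (1 / 2)) = 0" for n
    by (simp_all add: phi_half[OF gen(1)] phi_half[OF gen(2)])
  show ?thesis
  proof (cases "x \<le> 1 / 2")
    case True
    then show ?thesis
      using main[of x "1 / 2"] x by (simp add: half)
  next
    case False
    then have "(\<lambda>n. - ((ln (phi (\<psi>s n) (1 / 2)) - ln (phi (\<psi>s n) x)) / pick_alpha (As n)))
        \<longlonglongrightarrow> - ((ln (phi \<psi> (1 / 2)) - ln (phi \<psi> x)) / pick_alpha A)"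
      using x by (intro tendsto_minus main) auto
    then show ?thesis
      by (simp only: half) simp
  qed
qed

section \<open>Normalised generators and Pickands functions\<close>

text \<open>Real form of \<open>inv_pow\<close>, whose values are extended reals.\<close>

definition nphi :: "real \<Rightarrow> (real \<Rightarrow> real) \<Rightarrow> real \<Rightarrow> real" where
  "nphi \<alpha> \<psi> x = phi \<psi> x powr (1 / \<alpha>)"

text \<open>Restricted to \<open>s + t = 1\<close> this is \<open>pick_pow\<close>. Two separate
  arguments keep monotonicity, which \<open>pick_pow\<close> lacks.\<close>

definition nell :: "real \<Rightarrow> (real \<Rightarrow> real) \<Rightarrow> real \<Rightarrow> real \<Rightarrow> real" where
  "nell \<alpha> A s t = ell A (s powr \<alpha>) (t powr \<alpha>) powr (1 / \<alpha>)"

text \<open>In logarithmic coordinates the stable tail dependence function stays convex under every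
  power normalisation, although the normalised Pickands function itself need not be convex.\<close>

definition log_ell :: "real \<Rightarrow> (real \<Rightarrow> real) \<Rightarrow> real \<Rightarrow> real" where
  "log_ell \<alpha> A u = ln (ell1 A (exp (\<alpha> * u))) / \<alpha>"

text \<open>Elasticity of \<open>ell1\<close>, that is its slope in doubly logarithmic coordinates;
  at \<open>m = exp (\<alpha> * u)\<close> it is the slope of \<open>log_ell\<close> at
  \<open>u\<close>, for every \<open>\<alpha>\<close>.\<close>

definition elast :: "(real \<Rightarrow> real) \<Rightarrow> real \<Rightarrow> real" where
  "elast A m = m * slope (ell1 A) m / ell1 A m"

context
  fixes \<psi> :: "real \<Rightarrow> real" and \<alpha> :: real
  assumes gen: "generator \<psi>" and \<alpha>: "0 < \<alpha>"
begin

lemma nphi_nonneg: "0 \<le> nphi \<alpha> \<psi> x"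
  by (simp add: nphi_def)

lemma nphi_pos: "0 < x \<Longrightarrow> x < 1 \<Longrightarrow> 0 < nphi \<alpha> \<psi> x"
  using phi_pos[OF gen, of x] by (simp add: nphi_def)

lemma nphi_1: "nphi \<alpha> \<psi> 1 = 0"
  by (simp add: nphi_def phi_1[OF gen])

lemma nphi_powr: "nphi \<alpha> \<psi> x powr \<alpha> = phi \<psi> x"
  using \<alpha> phi_nonneg[OF gen, of x] by (simp add: nphi_def powr_powr)

lemma gen_pow_nphi: "0 < x \<Longrightarrow> x \<le> 1 \<Longrightarrow> gen_pow \<alpha> \<psi> (nphi \<alpha> \<psi> x) = x"
  by (simp add: gen_pow_def nphi_powr gen_phi[OF gen])

lemma ln_nphi: "0 < x \<Longrightarrow> x < 1 \<Longrightarrow> ln (nphi \<alpha> \<psi> x) = ln (phi \<psi> x) / \<alpha>"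
  using phi_pos[OF gen, of x] by (simp add: nphi_def ln_powr)

lemma inv_pow_eq: "0 < x \<Longrightarrow> x \<le> 1 \<Longrightarrow> inv_pow \<alpha> (pseudo_inv \<psi>) x = ennreal (nphi \<alpha> \<psi> x)"
  by (simp add: inv_pow_def pseudo_inv_eq_phi[OF gen] nphi_def phi_nonneg[OF gen])

lemma gen_pow_bounds: "0 \<le> gen_pow \<alpha> \<psi> z \<and> gen_pow \<alpha> \<psi> z \<le> 1"
  unfolding gen_pow_def by (rule gen_bounds[OF gen]) simp

lemma gen_pow_antimono: "antimono_on {0..} (gen_pow \<alpha> \<psi>)"
  unfolding monotone_on_def gen_pow_def
  using \<alpha> by (auto intro!: gen_antimonoD[OF gen] powr_mono2)

lemma gen_pow_less: "0 < x \<Longrightarrow> x \<le> 1 \<Longrightarrow> nphi \<alpha> \<psi> x < w \<Longrightarrow> gen_pow \<alpha> \<psi> w < x"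
proof -
  assume x: "0 < x" "x \<le> 1" and w: "nphi \<alpha> \<psi> x < w"
  then have "phi \<psi> x < w powr \<alpha>"
    using powr_less_mono2[OF \<alpha> nphi_nonneg w] by (simp add: nphi_powr)
  then show ?thesis
    using gen_strict[OF gen phi_nonneg[OF gen], of x "w powr \<alpha>"] x by (simp add: gen_pow_def gen_phi[OF gen])
qed

lemma gen_pow_greater: "0 < x \<Longrightarrow> x \<le> 1 \<Longrightarrow> 0 \<le> w \<Longrightarrow> w < nphi \<alpha> \<psi> x \<Longrightarrow> x < gen_pow \<alpha> \<psi> w"
proof -
  assume x: "0 < x" "x \<le> 1" and w: "0 \<le> w" "w < nphi \<alpha> \<psi> x"
  then have less: "w powr \<alpha> < phi \<psi> x"
    using powr_less_mono2[OF \<alpha> w] by (simp add: nphi_powr)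
  then have "0 < \<psi> (w powr \<alpha>)"
    using gen_antimonoD[OF gen, of "w powr \<alpha>" "phi \<psi> x"] x by (simp add: gen_phi[OF gen])
  then show ?thesis
    using gen_strict[OF gen _ less] x by (simp add: gen_pow_def gen_phi[OF gen])
qed

lemma gen_pow_cont: "continuous_on {0..} (gen_pow \<alpha> \<psi>)"
  unfolding gen_pow_def using \<alpha>
  by (intro continuous_on_compose2[OF gen_cont[OF gen]] continuous_on_powr') (auto intro: continuous_intros)

text \<open>For \<open>\<alpha> \<le> 1\<close> the power \<open>z powr \<alpha>\<close> lies below
  its tangent; multiplying by the non-positive slope of \<open>\<psi>\<close> turns this into a
  lower bound.\<close>

lemma gen_pow_slope:
  assumes "\<alpha> \<le> 1" "0 < z" "0 \<le> y"
  shows "gen_pow \<alpha> \<psi> z + slope \<psi> (z powr \<alpha>) * (\<alpha> * z powr (\<alpha> - 1)) * (y - z) \<le> gen_pow \<alpha> \<psi> y"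
proof -
  have conc: "y powr \<alpha> - z powr \<alpha> \<le> \<alpha> * z powr (\<alpha> - 1) * (y - z)"
  proof -
    \<comment> \<open>Bernoulli's inequality, from convexity of \<open>exp\<close> with weights
      \<open>1 - \<alpha>\<close> and \<open>\<alpha>\<close>.\<close>
    have "(y / z) powr \<alpha> \<le> 1 + \<alpha> * (y / z - 1)"
    proof (cases "y = 0")
      case False
      then have q: "0 < y / z" using assms by simp
      have "exp ((1 - \<alpha>) *\<^sub>R 0 + \<alpha> *\<^sub>R ln (y / z)) \<le> (1 - \<alpha>) * exp 0 + \<alpha> * exp (ln (y / z))"
        using \<alpha> assms by (intro convex_onD[OF exp_convex]) auto
      then show ?thesis
        using q False assms by (auto simp: powr_def algebra_simps)
    qed (use assms in simp)
    then have "z powr \<alpha> * (y / z) powr \<alpha> \<le> z powr \<alpha> * (1 + \<alpha> * (y / z - 1))"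
      by (intro mult_left_mono) auto
    moreover have "z powr \<alpha> * (y / z) powr \<alpha> = y powr \<alpha>"
      using assms by (simp add: powr_divide)
    moreover have eq: "z powr \<alpha> * (1 + \<alpha> * (y / z - 1)) = z powr \<alpha> + \<alpha> * z powr (\<alpha> - 1) * (y - z)"
      using assms by (simp add: powr_diff field_simps)
    ultimately show ?thesis
      by linarith
  qed
  have "slope \<psi> (z powr \<alpha>) * (\<alpha> * z powr (\<alpha> - 1) * (y - z)) \<le> slope \<psi> (z powr \<alpha>) * (y powr \<alpha> - z powr \<alpha>)"
    using conc gen_slope_nonpos[OF gen, of "z powr \<alpha>"] assms by (intro mult_left_mono_neg) auto
  moreover have "\<psi> (z powr \<alpha>) + slope \<psi> (z powr \<alpha>) * (y powr \<alpha> - z powr \<alpha>) \<le> \<psi> (y powr \<alpha>)"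
    using assms by (intro slope_ineq[OF gen_convex[OF gen]]) auto
  ultimately show ?thesis
    by (simp add: gen_pow_def mult.assoc)
qed

text \<open>A power with exponent \<open>1 / \<alpha> \<ge> 1\<close> is convex and increasing, so
  supporting lines of \<open>phi\<close> pass to its power.\<close>

lemma nphi_slope:
  assumes "\<alpha> \<le> 1" "x \<in> {0<..<1}" "y \<in> {0<..<1}"
  shows "nphi \<alpha> \<psi> x + 1 / \<alpha> * phi \<psi> x powr (1 / \<alpha> - 1) / slope \<psi> (phi \<psi> x) * (y - x) \<le> nphi \<alpha> \<psi> y"
proof -
  define r q where "r = phi \<psi> x" and "q = phi \<psi> y"
  have rq: "0 < r" "0 < q"
    using assms by (simp_all add: r_def q_def phi_pos[OF gen])
  define \<beta> where "\<beta> = 1 / \<alpha>"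
  have \<beta>: "1 \<le> \<beta>" using \<alpha> assms(1) by (simp add: \<beta>_def)
  have conv: "\<beta> * r powr (\<beta> - 1) * (q - r) \<le> q powr \<beta> - r powr \<beta>"
  proof -
    have "convex_on {0<..} (\<lambda>z. z powr \<beta>)"
    proof (rule convex_on_realI)
      show "((\<lambda>z. z powr \<beta>) has_real_derivative \<beta> * z powr (\<beta> - 1)) (at z)" if "z \<in> {0<..}" for z
        using that by (auto intro!: derivative_eq_intros)
      show "\<beta> * z powr (\<beta> - 1) \<le> \<beta> * w powr (\<beta> - 1)" if "z \<in> {0<..}" "w \<in> {0<..}" "z \<le> w" for z w
        using that \<beta> by (intro mult_left_mono powr_mono2) auto
    qed auto
    moreover have "((\<lambda>z. z powr \<beta>) has_real_derivative \<beta> * r powr (\<beta> - 1)) (at r within {0<..})"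
      using rq by (intro has_field_derivative_at_within[OF has_real_derivative_powr])
    ultimately show ?thesis
      using rq convex_on_imp_above_tangent[of "{0<..}" "\<lambda>z. z powr \<beta>" r q "\<beta> * r powr (\<beta> - 1)"]
      by (simp add: interior_open)
  qed
  have "phi \<psi> x + 1 / slope \<psi> (phi \<psi> x) * (y - x) \<le> phi \<psi> y"
    using subgradD[OF phi_subgrad[OF gen], of x y] assms by auto
  then have "\<beta> * r powr (\<beta> - 1) * (1 / slope \<psi> r * (y - x)) \<le> \<beta> * r powr (\<beta> - 1) * (q - r)"
    using \<beta> by (intro mult_left_mono) (auto simp: r_def q_def)
  with conv show ?thesis
    by (simp add: nphi_def r_def[symmetric] q_def[symmetric] \<beta>_def[symmetric] mult.assoc)
qed

end

context
  fixes A :: "real \<Rightarrow> real" and \<alpha> :: real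
  assumes A: "pickands A" and \<alpha>: "0 < \<alpha>"
begin

lemma nell_nonneg: "0 \<le> nell \<alpha> A s t"
  by (simp add: nell_def)

lemma nell_powr: "nell \<alpha> A s t powr \<alpha> = ell A (s powr \<alpha>) (t powr \<alpha>)"
  using \<alpha> order_trans[OF powr_ge_zero ell_bounds(1)[OF A powr_ge_zero powr_ge_zero], of s \<alpha> t \<alpha>]
  by (simp add: nell_def powr_powr)

lemma nell_0_left: "0 \<le> t \<Longrightarrow> nell \<alpha> A 0 t = t"
  using \<alpha> by (simp add: nell_def ell_0_left[OF A] powr_powr)

lemma nell_0_right: "0 \<le> s \<Longrightarrow> nell \<alpha> A s 0 = s"
  using \<alpha> by (simp add: nell_def ell_0_right[OF A] powr_powr)

lemma nell_mono: "0 \<le> s \<Longrightarrow> s \<le> s' \<Longrightarrow> 0 \<le> t \<Longrightarrow> t \<le> t' \<Longrightarrow> nell \<alpha> A s t \<le> nell \<alpha> A s' t'"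
proof -
  assume "0 \<le> s" "s \<le> s'" "0 \<le> t" "t \<le> t'"
  then have le: "s powr \<alpha> \<le> s' powr \<alpha>" "t powr \<alpha> \<le> t' powr \<alpha>"
    using \<alpha> by (auto intro: powr_mono2)
  have "ell A (s powr \<alpha>) (t powr \<alpha>) \<le> ell A (s' powr \<alpha>) (t' powr \<alpha>)"
    by (rule order_trans[OF ell_mono_left[OF A _ le(1)] ell_mono_right[OF A _ le(2)]]) simp_all
  moreover have "0 \<le> ell A (s powr \<alpha>) (t powr \<alpha>)"
    by (rule order_trans[OF powr_ge_zero ell_bounds(1)[OF A powr_ge_zero powr_ge_zero]])
  ultimately show ?thesis
    unfolding nell_def using \<alpha> by (intro powr_mono2) auto
qed

lemma ell1_pos: "0 \<le> m \<Longrightarrow> 0 < ell1 A m"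
  using ell1_ge_1[OF A, of m] by simp

lemma nell_eq: "0 < s \<Longrightarrow> 0 < t \<Longrightarrow> nell \<alpha> A s t = t * exp (log_ell \<alpha> A (ln s - ln t))"
proof -
  assume st: "0 < s" "0 < t"
  have "s powr \<alpha> / t powr \<alpha> = exp (\<alpha> * (ln s - ln t))"
    using st by (simp add: powr_def exp_diff right_diff_distrib)
  then have "ell A (s powr \<alpha>) (t powr \<alpha>) = t powr \<alpha> * ell1 A (exp (\<alpha> * (ln s - ln t)))"
    using ell_eq_ell1[OF A, of "t powr \<alpha>" "s powr \<alpha>"] st by simp
  moreover have "ell1 A (exp (\<alpha> * (ln s - ln t))) powr (1 / \<alpha>) = exp (log_ell \<alpha> A (ln s - ln t))"
    using ell1_pos[of "exp (\<alpha> * (ln s - ln t))"] by (simp add: powr_def log_ell_def)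
  ultimately show ?thesis
    using st \<alpha> ell1_pos[of "exp (\<alpha> * (ln s - ln t))"] by (simp add: nell_def powr_mult powr_powr)
qed

lemma pick_pow_eq_nell: "t \<in> {0..1} \<Longrightarrow> pick_pow \<alpha> A t = nell \<alpha> A t (1 - t)"
proof -
  assume t: "t \<in> {0..1}"
  let ?a = "t powr \<alpha>" and ?b = "(1 - t) powr \<alpha>"
  have "0 \<le> ?a / (?a + ?b)" "?a / (?a + ?b) \<le> 1"
    by (simp_all add: divide_le_eq_1) (auto simp: less_le)
  then have "0 \<le> A (?a / (?a + ?b))"
    using pick_bounds[OF A, of "?a / (?a + ?b)"] by linarith
  then show ?thesis
    by (simp add: pick_pow_def nell_def ell_def powr_mult)
qed

text \<open>For the upper bound, \<open>ell A (c * m) 1 \<le> ell A (c * m) c = c * ell1 A m\<close>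
  with \<open>c = exp (\<alpha> * (u' - u))\<close>; the division by \<open>\<alpha>\<close> makes
  the Lipschitz constant 1 for every \<open>\<alpha>\<close>.\<close>

lemma log_ell_increment:
  assumes "u \<le> u'"
  shows "log_ell \<alpha> A u \<le> log_ell \<alpha> A u'" "log_ell \<alpha> A u' \<le> log_ell \<alpha> A u + (u' - u)"
proof -
  let ?m = "exp (\<alpha> * u)" and ?c = "exp (\<alpha> * (u' - u))"
  have eq: "exp (\<alpha> * u') = ?c * ?m"
    by (simp add: exp_add[symmetric] algebra_simps)
  have c: "1 \<le> ?c"
    using assms \<alpha> by simp
  have "ell1 A ?m \<le> ell1 A (exp (\<alpha> * u'))"
    using assms \<alpha> by (intro ell_mono_left[OF A]) auto
  then show "log_ell \<alpha> A u \<le> log_ell \<alpha> A u'"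
    unfolding log_ell_def using \<alpha> ell1_pos[of ?m] ell1_pos[of "exp (\<alpha> * u')"]
    by (intro divide_right_mono) auto
  have "ell A (?c * ?m) 1 \<le> ell A (?c * ?m) (?c * 1)"
    using c by (intro ell_mono_right[OF A]) auto
  also have "\<dots> = ?c * ell1 A ?m"
    by (rule ell_scale[OF A])
  finally have "ln (ell1 A (exp (\<alpha> * u'))) \<le> ln (?c * ell1 A ?m)"
    unfolding eq using ell1_pos[of "?c * ?m"] ell1_pos[of ?m] by simp
  also have "\<dots> = \<alpha> * (u' - u) + ln (ell1 A ?m)"
    using ell1_pos[of ?m] by (simp add: ln_mult)
  finally have "ln (ell1 A (exp (\<alpha> * u'))) / \<alpha> \<le> (\<alpha> * (u' - u) + ln (ell1 A ?m)) / \<alpha>"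
    using \<alpha> by (intro divide_right_mono) auto
  then show "log_ell \<alpha> A u' \<le> log_ell \<alpha> A u + (u' - u)"
    using \<alpha> by (simp add: log_ell_def add_divide_distrib)
qed

lemma log_ell_Lipschitz: "\<bar>log_ell \<alpha> A u - log_ell \<alpha> A v\<bar> \<le> \<bar>u - v\<bar>"
  using log_ell_increment[of u v] log_ell_increment[of v u] by (cases "u \<le> v") auto

lemma log_ell_nonneg: "0 \<le> log_ell \<alpha> A u"
  unfolding log_ell_def using \<alpha> ell1_ge_1[OF A, of "exp (\<alpha> * u)"] by simp

lemma log_ell_ge: "u \<le> log_ell \<alpha> A u"
proof -
  have "exp (\<alpha> * u) \<le> ell1 A (exp (\<alpha> * u))"
    by (intro ell_bounds[OF A]) auto
  then have "\<alpha> * u \<le> ln (ell1 A (exp (\<alpha> * u)))"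
    using ell1_pos[of "exp (\<alpha> * u)"] by (simp add: ln_ge_iff)
  then show ?thesis
    using \<alpha> by (simp add: log_ell_def le_divide_eq mult.commute)
qed

text \<open>The elasticity \<open>e\<close> lies in the unit interval, so
  \<open>r powr e \<le> 1 - e + e * r\<close> for \<open>r = exp (\<alpha> * (v - u))\<close>. The
  right side times \<open>ell1 A m\<close> is the supporting line of \<open>ell1\<close> at
  \<open>m\<close>, evaluated at \<open>r * m\<close>.\<close>

lemma log_ell_slope:
  "log_ell \<alpha> A u + elast A (exp (\<alpha> * u)) * (v - u) \<le> log_ell \<alpha> A v"
proof -
  define m e r where "m = exp (\<alpha> * u)" and "e = elast A m" and "r = exp (\<alpha> * (v - u))"
  have m: "0 < m" and r: "0 < r" by (simp_all add: m_def r_def)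
  have g: "0 < ell1 A m" using ell1_pos[of m] m by simp
  have e: "0 \<le> e" "e \<le> 1"
    using ell1_slope_bounds[OF A m] m g by (simp_all add: e_def elast_def)
  have rm: "exp (\<alpha> * v) = r * m"
    by (simp add: r_def m_def exp_add[symmetric] algebra_simps)
  have "exp ((1 - e) *\<^sub>R 0 + e *\<^sub>R (\<alpha> * (v - u))) \<le> (1 - e) * exp 0 + e * exp (\<alpha> * (v - u))"
    using e by (intro convex_onD[OF exp_convex]) auto
  then have "exp (e * (\<alpha> * (v - u))) * ell1 A m \<le> (1 - e + e * r) * ell1 A m"
    using g by (intro mult_right_mono) (auto simp: r_def)
  also have "\<dots> = ell1 A m + slope (ell1 A) m * (r * m - m)"
    using g by (simp add: e_def elast_def field_simps)
  also have "\<dots> \<le> ell1 A (r * m)"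
    using m r by (intro slope_ineq[OF convex_ell1[OF A]]) auto
  finally have "ln (exp (e * (\<alpha> * (v - u))) * ell1 A m) \<le> ln (ell1 A (r * m))"
    using g ell1_pos[of "r * m"] m r by simp
  then have "e * (\<alpha> * (v - u)) + ln (ell1 A m) \<le> ln (ell1 A (r * m))"
    using g by (simp add: ln_mult)
  then have "(e * (\<alpha> * (v - u)) + ln (ell1 A m)) / \<alpha> \<le> ln (ell1 A (r * m)) / \<alpha>"
    using \<alpha> by (intro divide_right_mono) auto
  moreover have "(e * (\<alpha> * (v - u)) + ln (ell1 A m)) / \<alpha> = ln (ell1 A m) / \<alpha> + e * (v - u)"
    using \<alpha> by (simp add: add_divide_distrib)
  ultimately show ?thesis
    unfolding log_ell_def rm by (simp add: m_def e_def)
qed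

lemma nell_tendsto:
  assumes "ss \<longlonglongrightarrow> s" "ts \<longlonglongrightarrow> t" "\<And>n. 0 \<le> ss n" "\<And>n. 0 \<le> ts n"
  shows "(\<lambda>n. nell \<alpha> A (ss n) (ts n)) \<longlonglongrightarrow> nell \<alpha> A s t"
proof -
  have p: "(\<lambda>n. x n powr \<beta>) \<longlonglongrightarrow> y powr \<beta>" if "x \<longlonglongrightarrow> y" "\<And>n. 0 \<le> x n" "0 < \<beta>"
    for x :: "nat \<Rightarrow> real" and y \<beta> :: real
    using that by (intro tendsto_powr') auto
  show ?thesis
    unfolding nell_def
  proof (rule p)
    show "(\<lambda>n. ell A (ss n powr \<alpha>) (ts n powr \<alpha>)) \<longlonglongrightarrow> ell A (s powr \<alpha>) (t powr \<alpha>)"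
      using assms \<alpha> by (intro ell_tendsto[OF A] p) auto
    show "0 \<le> ell A (ss n powr \<alpha>) (ts n powr \<alpha>)" for n
      by (rule order_trans[OF powr_ge_zero ell_bounds(1)[OF A powr_ge_zero powr_ge_zero]])
  qed (use \<alpha> in simp)
qed

end

section \<open>Uniform convergence of the normalised data\<close>

lemma archimax_eq_normalised:
  assumes gen: "generator \<psi>" and A: "pickands A" and \<alpha>: "0 < \<alpha>" and xy: "0 < x" "x \<le> 1" "0 < y" "y \<le> 1"
  shows "archimax \<psi> A x y = gen_pow \<alpha> \<psi> (nell \<alpha> A (nphi \<alpha> \<psi> x) (nphi \<alpha> \<psi> y))"
  by (simp add: archimax_eq[OF gen A xy] gen_pow_def nell_powr[OF A \<alpha>] nphi_powr[OF gen \<alpha>])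

text \<open>A monotone version of Polya's theorem: the increments of the limit over a fine grid control the error.\<close>

lemma uniform_limit_gen_pow:
  assumes gen: "generator \<psi>" "\<And>n. generator (\<psi>s n)" and \<alpha>: "0 < \<alpha>" "\<And>n. 0 < \<alpha>s n"
    and conv: "\<And>x. x \<in> {0<..1} \<Longrightarrow> (\<lambda>n. nphi (\<alpha>s n) (\<psi>s n) x) \<longlonglongrightarrow> nphi \<alpha> \<psi> x"
  shows "uniform_limit {0..} (\<lambda>n. gen_pow (\<alpha>s n) (\<psi>s n)) (gen_pow \<alpha> \<psi>) sequentially"
proof (rule uniform_limitI)
  fix e :: real assume "0 < e"
  let ?f = "gen_pow \<alpha> \<psi>" and ?fs = "\<lambda>n. gen_pow (\<alpha>s n) (\<psi>s n)"
  \<comment> \<open>Levels of width \<open>1 / N\<close>; the comparison loses two of them, and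
    \<open>2 / N < e\<close>.\<close>
  obtain N :: nat where N: "3 / e < real N"
    using reals_Archimedean2 by blast
  moreover have "0 < 3 / e"
    using \<open>0 < e\<close> by simp
  ultimately have N0: "0 < real N" by linarith
  have step: "1 / real N < e / 3"
    using N N0 \<open>0 < e\<close> by (simp add: field_simps)
  have grid: "\<forall>\<^sub>F n in sequentially. nphi (\<alpha>s n) (\<psi>s n) (real (Suc j) / real N) < nphi \<alpha> \<psi> (real j / real N) \<and>
      nphi \<alpha> \<psi> (real (Suc j) / real N) < nphi (\<alpha>s n) (\<psi>s n) (real j / real N)"
    if j: "j \<in> {1..<N}" for j
  proof -
    have v: "real j / real N \<in> {0<..1}" "real (Suc j) / real N \<in> {0<..1}"
      using j N0 by auto
    have "phi \<psi> (real (Suc j) / real N) < phi \<psi> (real j / real N)"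
      using v N0 by (intro phi_strict[OF gen(1)]) (auto simp: divide_strict_right_mono)
    then have less: "nphi \<alpha> \<psi> (real (Suc j) / real N) < nphi \<alpha> \<psi> (real j / real N)"
      unfolding nphi_def using \<alpha>(1) by (intro powr_less_mono2) (auto simp: phi_nonneg[OF gen(1)])
    show ?thesis
      using order_tendstoD(2)[OF conv[OF v(2)] less] order_tendstoD(1)[OF conv[OF v(1)] less]
      by eventually_elim simp
  qed
  have "\<forall>\<^sub>F n in sequentially. \<forall>j\<in>{1..<N}. nphi (\<alpha>s n) (\<psi>s n) (real (Suc j) / real N) < nphi \<alpha> \<psi> (real j / real N) \<and>
      nphi \<alpha> \<psi> (real (Suc j) / real N) < nphi (\<alpha>s n) (\<psi>s n) (real j / real N)"
    using grid by (intro eventually_ball_finite) auto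
  then show "\<forall>\<^sub>F n in sequentially. \<forall>z\<in>{0..}. dist (?fs n z) (?f z) < e"
  proof eventually_elim
    case (elim n)
    \<comment> \<open>One-sided estimate, stated for an arbitrary pair so that it serves in both
      directions.\<close>
    have close: "f z \<le> g z + 2 / real N"
      if f: "generator f'" "0 < a" "f = gen_pow a f'" and g: "generator g'" "0 < b" "g = gen_pow b g'"
        and less: "\<forall>j\<in>{1..<N}. nphi a f' (real (Suc j) / real N) < nphi b g' (real j / real N)"
        and z: "0 \<le> z"
      for f g f' g' a b z
    proof -
      \<comment> \<open>\<open>j / N\<close> is the first grid level strictly above
        \<open>g z\<close>. The inverse of \<open>g\<close> at this level is at most
        \<open>z\<close>, so the inverse of \<open>f\<close> one level higher is below
        \<open>z\<close>, and \<open>f z\<close> is less than \<open>(j + 1) / N\<close>.\<close>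
      define j where "j = nat \<lfloor>g z * real N\<rfloor> + 1"
      have gz: "0 \<le> g z" "g z \<le> 1"
        using gen_pow_bounds[OF g(1,2)] g(3) by auto
      have j: "real j \<le> g z * real N + 1" "g z * real N < real j" "1 \<le> j"
        using gz N0 of_nat_floor[of "g z * real N"] real_of_int_floor_add_one_gt[of "g z * real N"]
        by (simp_all add: j_def add.commute)
      show ?thesis
      proof (cases "Suc j \<le> N")
        case False
        then have "real N < real j + 1" by simp
        then have "real N \<le> g z * real N + 2"
          using j(1) by linarith
        then have "1 \<le> g z + 2 / real N"
          using N0 by (simp add: field_simps)
        then show ?thesis
          using gen_pow_bounds[OF f(1,2), of z] f(3) by simp
      next
        case True
        then have J: "j \<in> {1..<N}" using j(3) by auto
        have v: "0 < real j / real N" "real j / real N \<le> 1" "0 < real (Suc j) / real N" "real (Suc j) / real N \<le> 1"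
          using J N0 by auto
        have "g z < real j / real N"
          using j(2) N0 by (simp add: less_divide_eq)
        then have "nphi b g' (real j / real N) \<le> z"
          using gen_pow_greater[OF g(1,2) v(1,2) z] g(3) by fastforce
        then have "nphi a f' (real (Suc j) / real N) < z"
          using less J by fastforce
        then have "f z < real (Suc j) / real N"
          using gen_pow_less[OF f(1,2) v(3,4)] f(3) by simp
        also have "real (Suc j) / real N \<le> (g z * real N + 2) / real N"
          using j(1) N0 by (intro divide_right_mono) auto
        also have "\<dots> = g z + 2 / real N"
          using N0 by (simp add: add_divide_distrib)
        finally show ?thesis by simp
      qed
    qed
    show ?case
    proof
      fix z :: real assume "z \<in> {0..}"
      then have z: "0 \<le> z" by simp
      have "?fs n z \<le> ?f z + 2 / real N"
        using elim by (intro close[OF gen(2) \<alpha>(2) refl gen(1) \<alpha>(1) refl _ z]) auto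
      moreover have "?f z \<le> ?fs n z + 2 / real N"
        using elim by (intro close[OF gen(1) \<alpha>(1) refl gen(2) \<alpha>(2) refl _ z]) auto
      ultimately show "dist (?fs n z) (?f z) < e"
        using step \<open>0 < e\<close> by (simp add: dist_real_def abs_le_iff abs_less_iff)
    qed
  qed
qed

text \<open>\<open>gen_pow\<close> passes strictly through every level in \<open>{0<..1}\<close>, so
  its inverse inherits the limit, even along moving levels.\<close>

lemma nphi_tendsto:
  assumes gen: "generator \<psi>" "\<And>n. generator (\<psi>s n)" and \<alpha>: "0 < \<alpha>" "\<And>n. 0 < \<alpha>s n"
    and conv: "\<And>z. 0 \<le> z \<Longrightarrow> (\<lambda>n. gen_pow (\<alpha>s n) (\<psi>s n) z) \<longlonglongrightarrow> gen_pow \<alpha> \<psi> z"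
    and xs: "xs \<longlonglongrightarrow> x" "\<And>n. 0 < xs n" "\<And>n. xs n \<le> 1" and x: "0 < x" "x \<le> 1"
  shows "(\<lambda>n. nphi (\<alpha>s n) (\<psi>s n) (xs n)) \<longlonglongrightarrow> nphi \<alpha> \<psi> x"
proof (rule inverse_converge[where fs = "\<lambda>n. gen_pow (\<alpha>s n) (\<psi>s n)" and f = "gen_pow \<alpha> \<psi>" and xs = xs and x = x])
  show "gen_pow \<alpha> \<psi> w < x" if "nphi \<alpha> \<psi> x < w" for w
    using gen_pow_less[OF gen(1) \<alpha>(1) x that] .
  show "x < gen_pow \<alpha> \<psi> w" if "0 \<le> w" "w < nphi \<alpha> \<psi> x" for w
    using gen_pow_greater[OF gen(1) \<alpha>(1) x that] .
  show "gen_pow (\<alpha>s n) (\<psi>s n) (nphi (\<alpha>s n) (\<psi>s n) (xs n)) = xs n" for n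
    by (intro gen_pow_nphi gen \<alpha> xs)
  show "antimono_on {0..} (gen_pow (\<alpha>s n) (\<psi>s n))" for n
    by (intro gen_pow_antimono gen \<alpha>)
qed (use conv xs in \<open>auto simp: nphi_nonneg[OF gen(1) \<alpha>(1)] nphi_nonneg[OF gen(2) \<alpha>(2)]\<close>)

text \<open>The Lipschitz constant 1 is common to all \<open>n\<close>, so the pointwise limit may
  be evaluated along a convergent sequence.\<close>

lemma nell_tendsto_seq:
  assumes A: "pickands A" "\<And>n. pickands (As n)" and \<alpha>: "0 < \<alpha>" "\<And>n. 0 < \<alpha>s n"
    and conv: "\<And>u. (\<lambda>n. log_ell (\<alpha>s n) (As n) u) \<longlonglongrightarrow> log_ell \<alpha> A u"
    and us: "us \<longlonglongrightarrow> u"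
  shows "(\<lambda>n. log_ell (\<alpha>s n) (As n) (us n)) \<longlonglongrightarrow> log_ell \<alpha> A u"
proof -
  have "(\<lambda>n. log_ell (\<alpha>s n) (As n) (us n) - log_ell (\<alpha>s n) (As n) u) \<longlonglongrightarrow> 0"
    by (rule Lim_null_comparison[OF always_eventually tendsto_rabs_zero[OF LIM_zero[OF us]]])
       (simp add: log_ell_Lipschitz[OF A(2) \<alpha>(2)])
  from tendsto_add[OF this conv[of u]] show ?thesis by simp
qed

text \<open>Monotonicity in each argument brackets \<open>nell\<close> at \<open>(t, 1 - t)\<close>
  between values at grid points, where finitely many pointwise limits suffice; uniform continuity of
  the limit makes the brackets narrow.\<close>

lemma uniform_limit_pick_pow:
  assumes A: "pickands A" "\<And>n. pickands (As n)" and \<alpha>: "0 < \<alpha>" "\<And>n. 0 < \<alpha>s n"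
    and conv: "\<And>u. (\<lambda>n. log_ell (\<alpha>s n) (As n) u) \<longlonglongrightarrow> log_ell \<alpha> A u"
  shows "uniform_limit {0..1} (\<lambda>n. pick_pow (\<alpha>s n) (As n)) (pick_pow \<alpha> A) sequentially"
proof (rule uniform_limitI)
  fix e :: real assume "0 < e"
  let ?f = "\<lambda>w. nell \<alpha> A (fst w) (snd w)" and ?fs = "\<lambda>n s t. nell (\<alpha>s n) (As n) s t"
  have pw: "(\<lambda>n. ?fs n s t) \<longlonglongrightarrow> nell \<alpha> A s t" if "0 \<le> s" "0 \<le> t" for s t
  proof (cases "s = 0 \<or> t = 0")
    case True
    then show ?thesis
      using that by (auto simp: nell_0_left[OF A(1) \<alpha>(1)] nell_0_left[OF A(2) \<alpha>(2)]
          nell_0_right[OF A(1) \<alpha>(1)] nell_0_right[OF A(2) \<alpha>(2)])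
  next
    case False
    then have "0 < s" "0 < t" using that by auto
    then show ?thesis
      by (simp add: nell_eq[OF A(1) \<alpha>(1)] nell_eq[OF A(2) \<alpha>(2)] tendsto_mult tendsto_exp conv)
  qed
  have "uniformly_continuous_on ({0..1} \<times> {0..1}) ?f"
  proof (rule compact_uniformly_continuous)
    show "continuous_on ({0..1} \<times> {0..1}) ?f"
    proof (rule continuous_on_sequentiallyI)
      fix u :: "nat \<Rightarrow> real \<times> real" and a
      assume u: "\<forall>n. u n \<in> {0..1} \<times> {0..1}" "u \<longlonglongrightarrow> a"
      then show "(\<lambda>n. ?f (u n)) \<longlonglongrightarrow> ?f a"
        by (intro nell_tendsto[OF A(1) \<alpha>(1)] tendsto_fst tendsto_snd) (auto simp: mem_Times_iff)
    qed
  qed (intro compact_Times compact_Icc)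
  then obtain \<delta> where \<delta>: "0 < \<delta>" "\<And>w w'. w \<in> {0..1} \<times> {0..1} \<Longrightarrow> w' \<in> {0..1} \<times> {0..1} \<Longrightarrow> dist w' w < \<delta> \<Longrightarrow> dist (?f w') (?f w) < e / 2"
    unfolding uniformly_continuous_on_def using \<open>0 < e\<close> by (metis half_gt_zero)
  obtain N :: nat where N: "2 / \<delta> < real N"
    using reals_Archimedean2 by blast
  moreover have "0 < 2 / \<delta>"
    using \<delta>(1) by simp
  ultimately have N0: "0 < real N" by linarith
  \<comment> \<open>Each of the two coordinates may be off by \<open>1 / N\<close>.\<close>
  have step: "2 / real N < \<delta>"
    using N N0 \<delta>(1) by (simp add: field_simps)
  have grid: "\<forall>\<^sub>F n in sequentially. \<forall>i\<in>{..N}. \<forall>j\<in>{..N}.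
      dist (?fs n (real i / real N) (real j / real N)) (nell \<alpha> A (real i / real N) (real j / real N)) < e / 2"
    using \<open>0 < e\<close> by (intro eventually_ball_finite ballI tendstoD[OF pw]) auto
  then show "\<forall>\<^sub>F n in sequentially. \<forall>t\<in>{0..1}. dist (pick_pow (\<alpha>s n) (As n) t) (pick_pow \<alpha> A t) < e"
  proof eventually_elim
    case (elim n)
    show ?case
    proof
      fix t :: real assume t: "t \<in> {0..1}"
      have cell: "\<exists>i\<le>N. \<exists>j\<le>N. real i / real N \<le> x \<and> x \<le> real j / real N \<and>
          x - real i / real N \<le> 1 / real N \<and> real j / real N - x \<le> 1 / real N" if x: "x \<in> {0..1}" for x
      proof (intro exI conjI)
        let ?i = "nat \<lfloor>x * real N\<rfloor>" and ?j = "nat \<lceil>x * real N\<rceil>"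
        have xN: "0 \<le> x * real N" "x * real N \<le> real N"
          using x N0 by (auto intro: mult_left_le_one_le)
        show "?i \<le> N" "?j \<le> N"
          using xN by (auto simp: nat_le_iff floor_le_iff ceiling_le_iff)
        have i: "real ?i \<le> x * real N" "x * real N \<le> real ?i + 1" and j: "x * real N \<le> real ?j" "real ?j \<le> x * real N + 1"
          using xN ceiling_correct[of "x * real N"] by auto
        show "real ?i / real N \<le> x" "x \<le> real ?j / real N"
          using i j N0 by (simp_all add: divide_le_eq le_divide_eq)
        have "x \<le> (real ?i + 1) / real N" "real ?j / real N \<le> (x * real N + 1) / real N"
          using i j N0 by (simp_all add: le_divide_eq divide_right_mono)
        then show "x - real ?i / real N \<le> 1 / real N" "real ?j / real N - x \<le> 1 / real N"
          using N0 by (simp_all add: add_divide_distrib)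
      qed
      obtain i j where ij: "i \<le> N" "j \<le> N" "real i / real N \<le> t" "t \<le> real j / real N"
          "t - real i / real N \<le> 1 / real N" "real j / real N - t \<le> 1 / real N"
        using cell[OF t] by blast
      \<comment> \<open>Both arguments are rounded down for the lower bound and up for the upper
        one, so \<open>1 - t\<close> needs grid points of its own.\<close>
      have "1 - t \<in> {0..1}" using t by auto
      from cell[OF this] obtain k l where kl: "k \<le> N" "l \<le> N" "real k / real N \<le> 1 - t" "1 - t \<le> real l / real N"
          "(1 - t) - real k / real N \<le> 1 / real N" "real l / real N - (1 - t) \<le> 1 / real N"
        by blast
      have unit: "real p / real N \<in> {0..1}" if "p \<le> N" for p
        using that N0 by simp
      have near: "dist (nell \<alpha> A s r) (nell \<alpha> A t (1 - t)) < e / 2"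
        if "s \<in> {0..1}" "r \<in> {0..1}" "\<bar>s - t\<bar> \<le> 1 / real N" "\<bar>r - (1 - t)\<bar> \<le> 1 / real N" for s r
      proof -
        have "dist (s, r) (t, 1 - t) \<le> dist s t + dist r (1 - t)"
          by (simp add: dist_Pair_Pair sqrt_sum_squares_le_sum)
        also have "\<dots> \<le> 2 / real N"
          using that by (simp add: dist_real_def)
        finally show ?thesis
          using \<delta>(2)[of "(t, 1 - t)" "(s, r)"] that t step by auto
      qed
      have low: "?fs n (real i / real N) (real k / real N) \<le> ?fs n t (1 - t)"
        and up: "?fs n t (1 - t) \<le> ?fs n (real j / real N) (real l / real N)"
        using ij kl t by (auto intro!: nell_mono[OF A(2) \<alpha>(2)])
      have "dist (nell \<alpha> A (real i / real N) (real k / real N)) (nell \<alpha> A t (1 - t)) < e / 2"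
        "dist (nell \<alpha> A (real j / real N) (real l / real N)) (nell \<alpha> A t (1 - t)) < e / 2"
        using ij kl by (intro near unit; simp add: abs_le_iff)+
      moreover have "dist (?fs n (real i / real N) (real k / real N)) (nell \<alpha> A (real i / real N) (real k / real N)) < e / 2"
        "dist (?fs n (real j / real N) (real l / real N)) (nell \<alpha> A (real j / real N) (real l / real N)) < e / 2"
        using elim ij kl by auto
      ultimately have "dist (?fs n t (1 - t)) (nell \<alpha> A t (1 - t)) < e"
        using low up unfolding dist_real_def by linarith
      then show "dist (pick_pow (\<alpha>s n) (As n) t) (pick_pow \<alpha> A t) < e"
        using t by (simp add: pick_pow_eq_nell[OF A(1) \<alpha>(1)] pick_pow_eq_nell[OF A(2) \<alpha>(2)])
    qed
  qed
qed

text \<open>Take \<open>t\<close> as the logistic transform of \<open>u\<close>: then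
  \<open>ln t - ln (1 - t) = u\<close>, and \<open>pick_pow\<close> at \<open>t\<close> determines
  \<open>log_ell\<close> at \<open>u\<close>.\<close>

lemma pick_pow_imp_log_ell:
  assumes A: "pickands A" "\<And>n. pickands (As n)" and \<alpha>: "0 < \<alpha>" "\<And>n. 0 < \<alpha>s n"
    and conv: "uniform_limit {0..1} (\<lambda>n. pick_pow (\<alpha>s n) (As n)) (pick_pow \<alpha> A) sequentially"
  shows "(\<lambda>n. log_ell (\<alpha>s n) (As n) u) \<longlonglongrightarrow> log_ell \<alpha> A u"
proof -
  define t where "t = exp u / (1 + exp u)"
  have e1: "0 < 1 + exp u"
    by (simp add: add_pos_pos)
  have t: "0 < t" "0 < 1 - t" "t \<in> {0..1}" and t1: "1 - t = 1 / (1 + exp u)"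
    using e1 by (simp_all add: t_def field_simps)
  have u: "ln t - ln (1 - t) = u"
    unfolding t1 using e1 by (simp add: t_def ln_div)
  have eq: "log_ell a B u = ln (pick_pow a B t / (1 - t))" if "pickands B" "0 < a" for a B
    using t u by (simp add: pick_pow_eq_nell[OF that] nell_eq[OF that])
  have "pick_pow \<alpha> A t / (1 - t) \<noteq> 0"
    using t by (simp add: pick_pow_eq_nell[OF A(1) \<alpha>(1)] nell_eq[OF A(1) \<alpha>(1)])
  then have "(\<lambda>n. ln (pick_pow (\<alpha>s n) (As n) t / (1 - t))) \<longlonglongrightarrow> ln (pick_pow \<alpha> A t / (1 - t))"
    using t by (intro tendsto_ln tendsto_divide tendsto_const tendsto_uniform_limitI[OF conv]) auto
  then show ?thesis
    by (simp add: eq A \<alpha>)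
qed

section \<open>Convergence of the kernels\<close>

text \<open>One avoiding point is chosen between any two rationals.\<close>

lemma countable_dense_avoiding:
  fixes N :: "real set"
  assumes "countable N"
  shows "\<exists>D. countable D \<and> D \<inter> N = {} \<and> (\<forall>a b. a < b \<longrightarrow> (\<exists>d\<in>D. a < d \<and> d < b))"
proof -
  have "\<exists>d. p < q \<longrightarrow> p < d \<and> d < q \<and> d \<notin> N" for p q :: real
    using ex_between_not_in_countable[OF _ assms, of p q] by metis
  then obtain d where d: "\<And>p q. p < q \<Longrightarrow> p < d p q \<and> d p q < q \<and> d p q \<notin> N"
    by metis
  show ?thesis
  proof (intro exI conjI allI impI)
    show "countable ((\<lambda>(p, q). d p q) ` {w \<in> \<rat> \<times> \<rat>. fst w < snd w})"
      by (intro countable_image countable_subset[OF _ countable_SIGMA[OF countable_rat countable_rat]]) auto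
    show "(\<lambda>(p, q). d p q) ` {w \<in> \<rat> \<times> \<rat>. fst w < snd w} \<inter> N = {}"
      using d by auto
    fix a b :: real assume "a < b"
    then obtain p where p: "p \<in> \<rat>" "a < p" "p < b"
      using Rats_dense_in_real by blast
    then obtain q where q: "q \<in> \<rat>" "p < q" "q < b"
      using Rats_dense_in_real by blast
    show "\<exists>c\<in>(\<lambda>(p, q). d p q) ` {w \<in> \<rat> \<times> \<rat>. fst w < snd w}. a < c \<and> c < b"
      using p q d[OF q(2)] by (intro bexI[of _ "d p q"] image_eqI[of _ _ "(p, q)"]) auto
  qed
qed

text \<open>Chain rule for the normalised data: the slope of \<open>gen_pow\<close> at
  \<open>r\<close>, the derivative \<open>elast * r / s\<close> of \<open>nell\<close> in its first
  argument, and the slope of \<open>nphi\<close>. These are the factors whose convergence can be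
  proved one by one.\<close>

lemma am_left_normalised:
  fixes \<psi> A :: "real \<Rightarrow> real"
  assumes gen: "generator \<psi>" and A: "pickands A" and \<alpha>: "0 < \<alpha>" and x: "x \<in> {0<..<1}" and y: "y \<in> {0<..<1}"
  defines "s \<equiv> nphi \<alpha> \<psi> x" and "t \<equiv> nphi \<alpha> \<psi> y"
  defines "r \<equiv> nell \<alpha> A s t"
  shows "am_left \<psi> A x y = slope \<psi> (r powr \<alpha>) * (\<alpha> * r powr (\<alpha> - 1)) * elast A (exp (\<alpha> * (ln s - ln t)))
    * (1 / \<alpha> * phi \<psi> x powr (1 / \<alpha> - 1) / slope \<psi> (phi \<psi> x)) * (r / s)"
proof -
  define a b m where "a = phi \<psi> x" and "b = phi \<psi> y" and "m = a / b"
  have ab: "0 < a" "0 < b" "0 < m"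
    using x y by (simp_all add: a_def b_def m_def phi_pos[OF gen])
  have st: "0 < s" "0 < t"
    using x y by (simp_all add: s_def t_def nphi_pos[OF gen \<alpha>])
  have sa: "s = a powr (1 / \<alpha>)"
    by (simp add: s_def a_def nphi_def)
  have m: "exp (\<alpha> * (ln s - ln t)) = m"
    using x y ab \<alpha> by (simp add: s_def t_def ln_nphi[OF gen \<alpha>] m_def a_def b_def diff_divide_distrib[symmetric] exp_diff)
  have r0: "0 < r"
    using st unfolding r_def by (subst nell_eq[OF A \<alpha>]) auto
  have ra: "r powr \<alpha> = ell A a b"
    by (simp add: r_def nell_powr[OF A \<alpha>] s_def t_def nphi_powr[OF gen \<alpha>] a_def b_def)
  also have "\<dots> = b * ell1 A m"
    unfolding m_def by (rule ell_eq_ell1[OF A ab(2)])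
  finally have rm: "r powr \<alpha> = b * ell1 A m" .
  have g: "0 < ell1 A m"
    using ell1_pos[OF A] ab by simp
  have "r powr (\<alpha> - 1) * r = r powr \<alpha>"
    using r0 by (simp add: powr_diff)
  moreover have "a powr (1 / \<alpha> - 1) / s = 1 / a"
    using ab by (simp add: sa powr_diff)
  \<comment> \<open>All powers introduced by the normalisation cancel.\<close>
  ultimately have "r powr (\<alpha> - 1) * r * (a powr (1 / \<alpha> - 1) / s) * (m / ell1 A m) = 1"
    using ab g by (simp add: rm m_def)
  note one = this
  have "slope \<psi> (r powr \<alpha>) * (\<alpha> * r powr (\<alpha> - 1)) * elast A m * (1 / \<alpha> * a powr (1 / \<alpha> - 1) / slope \<psi> a) * (r / s)
    = slope \<psi> (r powr \<alpha>) * slope (ell1 A) m / slope \<psi> a * (r powr (\<alpha> - 1) * r * (a powr (1 / \<alpha> - 1) / s) * (m / ell1 A m))"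
    using \<alpha> by (simp add: elast_def ac_simps)
  also have "\<dots> = am_left \<psi> A x y"
    unfolding one using x y by (simp add: am_left_def ra a_def b_def m_def)
  finally show ?thesis
    by (simp add: m a_def)
qed

text \<open>Data for the implication from (ii) to (v). \<open>\<alpha> \<le> 1\<close> makes the
  supporting lines of \<open>gen_pow\<close> and \<open>nphi\<close> available; convergence of the
  Pickands part is expressed through \<open>log_ell\<close>, which is convex.\<close>

locale normalised_convergence =
  fixes \<psi> A :: "real \<Rightarrow> real" and \<alpha> :: real
    and \<psi>s As :: "nat \<Rightarrow> real \<Rightarrow> real" and \<alpha>s :: "nat \<Rightarrow> real"
  assumes gen: "generator \<psi>" "\<And>n. generator (\<psi>s n)" and A: "pickands A" "\<And>n. pickands (As n)"
    and \<alpha>: "0 < \<alpha>" "\<And>n. 0 < \<alpha>s n" and \<alpha>1: "\<alpha> \<le> 1" "\<And>n. \<alpha>s n \<le> 1"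
    and nphi_conv: "\<And>x. x \<in> {0<..1} \<Longrightarrow> (\<lambda>n. nphi (\<alpha>s n) (\<psi>s n) x) \<longlonglongrightarrow> nphi \<alpha> \<psi> x"
    and log_ell_conv: "\<And>u. (\<lambda>n. log_ell (\<alpha>s n) (As n) u) \<longlonglongrightarrow> log_ell \<alpha> A u"
begin

text \<open>Convergence of \<open>gen_pow\<close> is automatically uniform, which allows the
  argument to move with \<open>n\<close>.\<close>

lemma gen_pow_conv_seq:
  assumes "zs \<longlonglongrightarrow> z" "\<And>n. 0 \<le> zs n"
  shows "(\<lambda>n. gen_pow (\<alpha>s n) (\<psi>s n) (zs n)) \<longlonglongrightarrow> gen_pow \<alpha> \<psi> z"
proof -
  have "(\<lambda>n. gen_pow (\<alpha>s n) (\<psi>s n) (zs n) - gen_pow \<alpha> \<psi> (zs n)) \<longlonglongrightarrow> 0"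
  proof (rule tendstoI)
    fix e :: real assume "0 < e"
    have "uniform_limit {0..} (\<lambda>n. gen_pow (\<alpha>s n) (\<psi>s n)) (gen_pow \<alpha> \<psi>) sequentially"
      by (intro uniform_limit_gen_pow gen \<alpha> nphi_conv)
    from uniform_limitD[OF this \<open>0 < e\<close>]
    show "\<forall>\<^sub>F n in sequentially. dist (gen_pow (\<alpha>s n) (\<psi>s n) (zs n) - gen_pow \<alpha> \<psi> (zs n)) 0 < e"
      by eventually_elim (use assms(2) in \<open>simp add: dist_real_def\<close>)
  qed
  moreover have "(\<lambda>n. gen_pow \<alpha> \<psi> (zs n)) \<longlonglongrightarrow> gen_pow \<alpha> \<psi> z"
    using assms LIMSEQ_le_const[OF assms(1), of 0]
    by (intro continuous_on_tendsto_compose[OF gen_pow_cont[OF gen(1) \<alpha>(1)] assms(1)]) auto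
  ultimately show ?thesis
    using tendsto_add by fastforce
qed

text \<open>Each of the three slope factors consists of supporting slopes of converging functions at
  converging points, so \<open>subgrad_converge\<close> applies wherever the limit is
  differentiable.\<close>

lemma am_left_conv:
  assumes x: "x \<in> {0<..<1}" and y: "y \<in> {0<..<1}"
    and d\<psi>: "(\<psi> has_real_derivative slope \<psi> (ell A (phi \<psi> x) (phi \<psi> y))) (at (ell A (phi \<psi> x) (phi \<psi> y)))"
    and dphi: "(phi \<psi> has_real_derivative 1 / slope \<psi> (phi \<psi> x)) (at x)"
    and dell: "(ell1 A has_real_derivative slope (ell1 A) (phi \<psi> x / phi \<psi> y)) (at (phi \<psi> x / phi \<psi> y))"
  shows "(\<lambda>n. am_left (\<psi>s n) (As n) x y) \<longlonglongrightarrow> am_left \<psi> A x y"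
proof -
  define s t u r where "s = nphi \<alpha> \<psi> x" and "t = nphi \<alpha> \<psi> y" and "u = ln s - ln t" and "r = nell \<alpha> A s t"
  define ss ts us rs where "ss n = nphi (\<alpha>s n) (\<psi>s n) x" and "ts n = nphi (\<alpha>s n) (\<psi>s n) y"
    and "us n = ln (ss n) - ln (ts n)" and "rs n = nell (\<alpha>s n) (As n) (ss n) (ts n)" for n
  have pos: "0 < s" "0 < t" "\<And>n. 0 < ss n" "\<And>n. 0 < ts n"
    using x y by (simp_all add: s_def t_def ss_def ts_def nphi_pos[OF gen(1) \<alpha>(1)] nphi_pos[OF gen(2) \<alpha>(2)])
  have ss: "ss \<longlonglongrightarrow> s" and ts: "ts \<longlonglongrightarrow> t"
    unfolding ss_def ts_def s_def t_def using x y by (auto intro!: nphi_conv)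
  have us: "us \<longlonglongrightarrow> u"
    unfolding us_def u_def using pos by (intro tendsto_diff tendsto_ln ss ts) auto
  note ls = nell_tendsto_seq[OF A \<alpha> log_ell_conv us]
  have r: "r = t * exp (log_ell \<alpha> A u)" "\<And>n. rs n = ts n * exp (log_ell (\<alpha>s n) (As n) (us n))"
    unfolding r_def rs_def u_def us_def using pos by (simp_all add: nell_eq[OF A(1) \<alpha>(1)] nell_eq[OF A(2) \<alpha>(2)])
  have r0: "0 < r" "\<And>n. 0 < rs n"
    using pos by (simp_all add: r)
  have rs: "rs \<longlonglongrightarrow> r"
    unfolding r by (intro tendsto_mult ts tendsto_exp ls)
  have ra: "r powr \<alpha> = ell A (phi \<psi> x) (phi \<psi> y)"
    by (simp add: r_def nell_powr[OF A(1) \<alpha>(1)] s_def t_def nphi_powr[OF gen(1) \<alpha>(1)])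
  have um: "exp (\<alpha> * u) = phi \<psi> x / phi \<psi> y"
    using x y \<alpha>(1) phi_pos[OF gen(1)]
    by (simp add: u_def s_def t_def ln_nphi[OF gen(1) \<alpha>(1)] diff_divide_distrib[symmetric] exp_diff)
  have p: "(\<lambda>n. slope (\<psi>s n) (rs n powr \<alpha>s n) * (\<alpha>s n * rs n powr (\<alpha>s n - 1))) \<longlonglongrightarrow> slope \<psi> (r powr \<alpha>) * (\<alpha> * r powr (\<alpha> - 1))"
  proof (rule subgrad_converge)
    show "open {0::real<..}" "r \<in> {0<..}"
      using r0 by auto
    have "(\<psi> has_real_derivative slope \<psi> (r powr \<alpha>)) (at (r powr \<alpha>))"
      using d\<psi> by (simp add: ra)
    from DERIV_chain2[OF this has_real_derivative_powr[OF r0(1), of \<alpha>]]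
    show "(gen_pow \<alpha> \<psi> has_real_derivative slope \<psi> (r powr \<alpha>) * (\<alpha> * r powr (\<alpha> - 1))) (at r)"
      by (simp add: gen_pow_def[abs_def])
    show "(\<lambda>n. gen_pow (\<alpha>s n) (\<psi>s n) z) \<longlonglongrightarrow> gen_pow \<alpha> \<psi> z" if "z \<in> {0<..}" for z
      using that by (intro gen_pow_conv_seq) auto
    show "(\<lambda>n. gen_pow (\<alpha>s n) (\<psi>s n) (rs n)) \<longlonglongrightarrow> gen_pow \<alpha> \<psi> r"
      using r0(2) by (intro gen_pow_conv_seq rs) (auto intro: less_imp_le)
    show "\<forall>\<^sub>F n in sequentially. \<forall>z\<in>{0<..}. gen_pow (\<alpha>s n) (\<psi>s n) (rs n)
        + slope (\<psi>s n) (rs n powr \<alpha>s n) * (\<alpha>s n * rs n powr (\<alpha>s n - 1)) * (z - rs n) \<le> gen_pow (\<alpha>s n) (\<psi>s n) z"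
      by (intro always_eventually allI ballI gen_pow_slope[OF gen(2) \<alpha>(2) \<alpha>1(2) r0(2)]) auto
  qed (rule rs)
  have e: "(\<lambda>n. elast (As n) (exp (\<alpha>s n * us n))) \<longlonglongrightarrow> elast A (exp (\<alpha> * u))"
  proof (rule subgrad_converge)
    show "open (UNIV :: real set)" "u \<in> UNIV" by auto
    have "(ell1 A has_real_derivative slope (ell1 A) (exp (\<alpha> * u))) (at (exp (\<alpha> * u)))"
      using dell by (simp only: um)
    moreover have "((\<lambda>u. exp (\<alpha> * u)) has_real_derivative exp (\<alpha> * u) * \<alpha>) (at u)"
      by (auto intro!: derivative_eq_intros)
    ultimately have "((\<lambda>u. ell1 A (exp (\<alpha> * u))) has_real_derivative slope (ell1 A) (exp (\<alpha> * u)) * (exp (\<alpha> * u) * \<alpha>)) (at u)"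
      by (rule DERIV_chain2)
    from DERIV_cdivide[OF DERIV_chain2[OF DERIV_ln_divide[OF ell1_pos[OF A(1), of "exp (\<alpha> * u)"]] this], of \<alpha>]
    show "(log_ell \<alpha> A has_real_derivative elast A (exp (\<alpha> * u))) (at u)"
      using \<alpha>(1) by (simp add: log_ell_def[abs_def] elast_def mult.commute)
    show "\<forall>\<^sub>F n in sequentially. \<forall>v\<in>UNIV. log_ell (\<alpha>s n) (As n) (us n) + elast (As n) (exp (\<alpha>s n * us n)) * (v - us n)
        \<le> log_ell (\<alpha>s n) (As n) v"
      by (intro always_eventually allI ballI log_ell_slope[OF A(2) \<alpha>(2)])
  qed (rule log_ell_conv us ls)+
  have q: "(\<lambda>n. 1 / \<alpha>s n * phi (\<psi>s n) x powr (1 / \<alpha>s n - 1) / slope (\<psi>s n) (phi (\<psi>s n) x))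
      \<longlonglongrightarrow> 1 / \<alpha> * phi \<psi> x powr (1 / \<alpha> - 1) / slope \<psi> (phi \<psi> x)"
  proof (rule subgrad_converge)
    show "open {0::real<..<1}" "x \<in> {0<..<1}"
      using x by auto
    have "0 < phi \<psi> x"
      using x by (simp add: phi_pos[OF gen(1)])
    from DERIV_chain2[OF has_real_derivative_powr[OF this, of "1 / \<alpha>"] dphi]
    show "(nphi \<alpha> \<psi> has_real_derivative 1 / \<alpha> * phi \<psi> x powr (1 / \<alpha> - 1) / slope \<psi> (phi \<psi> x)) (at x)"
      by (simp add: nphi_def[abs_def])
    show "(\<lambda>n. nphi (\<alpha>s n) (\<psi>s n) z) \<longlonglongrightarrow> nphi \<alpha> \<psi> z" if "z \<in> {0<..<1}" for z
      using that by (intro nphi_conv) auto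
    show "(\<lambda>n. nphi (\<alpha>s n) (\<psi>s n) x) \<longlonglongrightarrow> nphi \<alpha> \<psi> x"
      using x by (intro nphi_conv) auto
    show "\<forall>\<^sub>F n in sequentially. \<forall>z\<in>{0<..<1}. nphi (\<alpha>s n) (\<psi>s n) x
        + 1 / \<alpha>s n * phi (\<psi>s n) x powr (1 / \<alpha>s n - 1) / slope (\<psi>s n) (phi (\<psi>s n) x) * (z - x) \<le> nphi (\<alpha>s n) (\<psi>s n) z"
      by (intro always_eventually allI ballI nphi_slope[OF gen(2) \<alpha>(2) \<alpha>1(2) x])
  qed (rule tendsto_const)
  have "(\<lambda>n. rs n / ss n) \<longlonglongrightarrow> r / s"
    using pos by (intro tendsto_divide rs ss) auto
  moreover have "am_left (\<psi>s n) (As n) x y = slope (\<psi>s n) (rs n powr \<alpha>s n) * (\<alpha>s n * rs n powr (\<alpha>s n - 1))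
      * elast (As n) (exp (\<alpha>s n * us n))
      * (1 / \<alpha>s n * phi (\<psi>s n) x powr (1 / \<alpha>s n - 1) / slope (\<psi>s n) (phi (\<psi>s n) x)) * (rs n / ss n)" for n
    unfolding rs_def us_def ss_def ts_def by (rule am_left_normalised[OF gen(2) A(2) \<alpha>(2) x y])
  moreover have "am_left \<psi> A x y = slope \<psi> (r powr \<alpha>) * (\<alpha> * r powr (\<alpha> - 1)) * elast A (exp (\<alpha> * u))
      * (1 / \<alpha> * phi \<psi> x powr (1 / \<alpha> - 1) / slope \<psi> (phi \<psi> x)) * (r / s)"
    unfolding r_def(1) u_def s_def t_def by (rule am_left_normalised[OF gen(1) A(1) \<alpha>(1) x y])
  ultimately show ?thesis
    by (simp only:) (intro tendsto_mult p e q)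
qed

text \<open>The exceptional \<open>x\<close> are those of \<open>section_regular\<close>, with the
  kinks of \<open>ell1\<close> entering through the ratio \<open>phi \<psi> x / t\<close>.\<close>

lemma am_left_conv_countable:
  assumes y: "y \<in> {0<..<1} - gen_bad \<psi>"
  shows "\<exists>S. countable S \<and> (\<forall>x\<in>{0<..<1} - S. (\<lambda>n. am_left (\<psi>s n) (As n) x y) \<longlonglongrightarrow> am_left \<psi> A x y)"
proof -
  define t where "t = phi \<psi> y"
  have t: "0 < t" using y by (simp add: t_def phi_pos[OF gen(1)])
  obtain B where B: "countable B" "\<forall>m\<in>{0<..} - B. (ell1 A has_real_derivative slope (ell1 A) m) (at m)"
    using slope_deriv_countable[OF convex_ell1[OF A(1)]] by blast
  have "\<exists>S. countable S \<and> (\<forall>x\<in>{0<..<1} - S. phi \<psi> x \<notin> (\<lambda>m. m * t) ` B \<and>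
      (\<psi> has_real_derivative slope \<psi> (ell A (phi \<psi> x) t)) (at (ell A (phi \<psi> x) t)) \<and>
      (phi \<psi> has_real_derivative 1 / slope \<psi> (phi \<psi> x)) (at x))"
  proof (rule section_regular[OF gen(1), where k = "\<lambda>s. ell A s t"])
    show "convex_on {0..} (\<lambda>s. ell A s t)"
      using t by (intro ell_convex_left[OF A(1)]) simp
    show "ell A 0 t \<le> ell A s t" if "0 \<le> s" for s
      using t that by (intro ell_mono_left[OF A(1)]) auto
    show "0 < ell A 0 t"
      using t by (simp add: ell_0_left[OF A(1)])
    show "(\<psi> has_real_derivative slope \<psi> (ell A 0 t)) (at (ell A 0 t))"
      using y t by (simp add: ell_0_left[OF A(1)]) (simp add: gen_bad_def t_def)
  qed (use B(1) in simp)
  then obtain S where S: "countable S" "\<forall>x\<in>{0<..<1} - S. phi \<psi> x \<notin> (\<lambda>m. m * t) ` B \<and>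
      (\<psi> has_real_derivative slope \<psi> (ell A (phi \<psi> x) t)) (at (ell A (phi \<psi> x) t)) \<and>
      (phi \<psi> has_real_derivative 1 / slope \<psi> (phi \<psi> x)) (at x)"
    by blast
  have "(\<lambda>n. am_left (\<psi>s n) (As n) x y) \<longlonglongrightarrow> am_left \<psi> A x y" if x: "x \<in> {0<..<1} - S" for x
  proof (rule am_left_conv)
    have "phi \<psi> x / t \<notin> B"
      using S(2) x t image_eqI[of "phi \<psi> x" "\<lambda>m. m * t" "phi \<psi> x / t" B] by auto
    then show "(ell1 A has_real_derivative slope (ell1 A) (phi \<psi> x / phi \<psi> y)) (at (phi \<psi> x / phi \<psi> y))"
      using B(2) x t phi_pos[OF gen(1), of x] by (simp add: t_def)
  qed (use S(2) x y in \<open>auto simp: t_def\<close>)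
  with S(1) show ?thesis by blast
qed

text \<open>Identifying the kernels with \<open>am_left\<close> requires \<open>y\<close> to be a
  good level for the limit and for every member of the sequence; this still excludes only countably
  many levels.\<close>

lemma cond_cdf_conv:
  assumes y: "y \<in> {0<..<1} - gen_bad \<psi>" "\<And>n. y \<notin> gen_bad (\<psi>s n)"
  shows "AE x in lborel. x \<in> {0<..<1} \<longrightarrow>
    (\<lambda>n. cond_cdf (archimax (\<psi>s n) (As n)) x y) \<longlonglongrightarrow> cond_cdf (archimax \<psi> A) x y"
proof -
  interpret C: copula_kernel2 "archimax \<psi> A" "am_left \<psi> A" "gen_bad \<psi>" "am_right \<psi> A" "gen_bad \<psi>"
    by (rule archimax_copula_kernel2[OF gen(1) A(1)])
  interpret Cs: copula_kernel2 "archimax (\<psi>s n) (As n)" "am_left (\<psi>s n) (As n)" "gen_bad (\<psi>s n)"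
      "am_right (\<psi>s n) (As n)" "gen_bad (\<psi>s n)" for n
    by (rule archimax_copula_kernel2[OF gen(2) A(2)])
  obtain S where S: "countable S"
    "\<forall>x\<in>{0<..<1} - S. (\<lambda>n. am_left (\<psi>s n) (As n) x y) \<longlonglongrightarrow> am_left \<psi> A x y"
    using am_left_conv_countable[OF y(1)] by blast
  have "AE x in lborel. \<forall>n. x \<in> {0<..<1} \<longrightarrow> cond_cdf (archimax (\<psi>s n) (As n)) x y = am_left (\<psi>s n) (As n) x y"
    unfolding cond_cdf_def AE_all_countable using y by (intro allI Cs.markov_kernel_eq_H) auto
  moreover have "AE x in lborel. x \<in> {0<..<1} \<longrightarrow> cond_cdf (archimax \<psi> A) x y = am_left \<psi> A x y"
    unfolding cond_cdf_def using y by (intro C.markov_kernel_eq_H) auto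
  moreover have "AE x in lborel. x \<notin> S"
    by (rule AE_not_in[OF countable_imp_null_set_lborel[OF S(1)]])
  ultimately show ?thesis
    by eventually_elim (use S(2) in auto)
qed

text \<open>A single null set of \<open>x\<close> can be arranged for countably many levels. A
  countable dense set of good levels is enough, since monotone functions that converge on a dense
  set converge at every continuity point of the limit.\<close>

lemma weak_cond_conv_archimax: "weak_cond_conv (\<lambda>n. archimax (\<psi>s n) (As n)) (archimax \<psi> A)"
proof -
  interpret C: copula_kernel2 "archimax \<psi> A" "am_left \<psi> A" "gen_bad \<psi>" "am_right \<psi> A" "gen_bad \<psi>"
    by (rule archimax_copula_kernel2[OF gen(1) A(1)])
  interpret Cs: copula_kernel2 "archimax (\<psi>s n) (As n)" "am_left (\<psi>s n) (As n)" "gen_bad (\<psi>s n)"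
      "am_right (\<psi>s n) (As n)" "gen_bad (\<psi>s n)" for n
    by (rule archimax_copula_kernel2[OF gen(2) A(2)])
  let ?F = "cond_cdf (archimax \<psi> A)" and ?Fs = "\<lambda>n. cond_cdf (archimax (\<psi>s n) (As n))"
  have "countable (gen_bad \<psi> \<union> (\<Union>n. gen_bad (\<psi>s n)))"
    by (intro countable_Un countable_UN countable_gen_bad[OF gen(1) A(1)] countable_gen_bad[OF gen(2) A(2)]) auto
  then obtain D where D: "countable D" "D \<inter> (gen_bad \<psi> \<union> (\<Union>n. gen_bad (\<psi>s n))) = {}"
      "\<forall>a b. a < b \<longrightarrow> (\<exists>d\<in>D. a < d \<and> d < b)"
    using countable_dense_avoiding by metis
  have "AE x in lborel. \<forall>d\<in>D. x \<in> {0<..<1} \<longrightarrow> d \<in> {0<..<1} \<longrightarrow> (\<lambda>n. ?Fs n x d) \<longlonglongrightarrow> ?F x d"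
  proof (subst AE_ball_countable[OF D(1)], rule ballI)
    fix d assume d: "d \<in> D"
    show "AE x in lborel. x \<in> {0<..<1} \<longrightarrow> d \<in> {0<..<1} \<longrightarrow> (\<lambda>n. ?Fs n x d) \<longlonglongrightarrow> ?F x d"
    proof (cases "d \<in> {0<..<1}")
      case True
      have "AE x in lborel. x \<in> {0<..<1} \<longrightarrow> (\<lambda>n. ?Fs n x d) \<longlonglongrightarrow> ?F x d"
        using True d D(2) by (intro cond_cdf_conv) auto
      then show ?thesis by eventually_elim auto
    qed auto
  qed
  then obtain N where N: "N \<in> null_sets lborel"
    "{x. \<not> (\<forall>d\<in>D. x \<in> {0<..<1} \<longrightarrow> d \<in> {0<..<1} \<longrightarrow> (\<lambda>n. ?Fs n x d) \<longlonglongrightarrow> ?F x d)} \<subseteq> N"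
    unfolding eventually_ae_filter by auto
  show ?thesis
    unfolding weak_cond_conv_def
  proof (intro bexI[of _ "{0<..<1} - N"] conjI ballI)
    show "{0<..<1} - N \<in> sets borel"
      using N(1) by auto
    show "{0<..<1} - N \<subseteq> {0..1}"
      by auto
    show "emeasure lborel ({0<..<1} - N) = 1"
      using N(1) by (subst emeasure_Diff_null_set) auto
    fix x assume x: "x \<in> {0<..<1} - N"
    then have x01: "x \<in> {0..1}" by auto
    have conv: "(\<lambda>n. ?Fs n x d) \<longlonglongrightarrow> ?F x d" if "d \<in> D" "0 < d" "d < 1" for d
      using x that N(2) by auto
    note cdf = markov_kernel_facts(3)[OF C.is_markov_kernel_markov_kernel x01]
      and cdfs = markov_kernel_facts(3)[OF Cs.is_markov_kernel_markov_kernel x01]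
    show "weak_conv_m (\<lambda>n. markov_kernel (archimax (\<psi>s n) (As n)) x) (markov_kernel (archimax \<psi> A) x)"
      unfolding weak_conv_m_def weak_conv_def
    proof (intro allI impI)
      fix y assume cont: "isCont (cdf (markov_kernel (archimax \<psi> A) x)) y"
      then have cont: "isCont (?F x) y"
        unfolding cdf[abs_def] cond_cdf_def[abs_def] by (simp add: cdf cong: isCont_cong)
      consider "y < 0" | "1 \<le> y" | "0 \<le> y" "y < 1" by linarith
      then have "(\<lambda>n. ?Fs n x y) \<longlonglongrightarrow> ?F x y"
      proof cases
        case 1
        then show ?thesis by (simp add: cond_cdf_def)
      next
        case 2
        have "?F x y = 1" "?Fs n x y = 1" for n
          using C.cond_cdf_mono[OF x01 2] C.cond_cdf_bounds[OF x01, of y] C.cond_cdf_1[OF x01]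
            Cs.cond_cdf_mono[OF x01 2, of n] Cs.cond_cdf_bounds[OF x01, of n y] Cs.cond_cdf_1[OF x01, of n] by auto
        then show ?thesis by simp
      next
        case 3
        show ?thesis
        proof (rule order_tendstoI)
          fix a assume a: "?F x y < a"
          have "(?F x \<longlongrightarrow> ?F x y) (at_right y)"
            using cont by (simp add: isCont_def filterlim_at_split)
          from order_tendstoD(2)[OF this a] obtain b where b: "y < b" "\<forall>z>y. z < b \<longrightarrow> ?F x z < a"
            unfolding eventually_at_right_field by blast
          obtain d where d: "d \<in> D" "y < d" "d < min b 1"
            using D(3)[rule_format, of y "min b 1"] b(1) 3 by auto
          have "\<forall>\<^sub>F n in sequentially. ?Fs n x d < a"
            using d b 3 by (intro order_tendstoD(2)[OF conv]) auto
          then show "\<forall>\<^sub>F n in sequentially. ?Fs n x y < a"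
          proof eventually_elim
            case (elim n)
            then show ?case
              using Cs.cond_cdf_mono[OF x01 less_imp_le[OF d(2)], of n] by linarith
          qed
        next
          fix a assume a: "a < ?F x y"
          have "(?F x \<longlongrightarrow> ?F x y) (at_left y)"
            using cont by (simp add: isCont_def filterlim_at_split)
          from order_tendstoD(1)[OF this a] obtain b where b: "b < y" "\<forall>z>b. z < y \<longrightarrow> a < ?F x z"
            unfolding eventually_at_left_field by blast
          show "\<forall>\<^sub>F n in sequentially. a < ?Fs n x y"
          proof (cases "y = 0")
            \<comment> \<open>No level in the open unit interval lies to the left of 0. Continuity
              at 0 and the value 0 at negative levels force \<open>a < 0\<close>.\<close>
            case True
            obtain z where z: "b < z" "z < y"
              using dense[OF b(1)] by blast
            then have "a < 0"
              using b(2) True by (force simp: cond_cdf_def)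
            moreover have "0 \<le> ?Fs n x y" for n
              using Cs.cond_cdf_bounds[OF x01] by blast
            ultimately show ?thesis
              by (intro always_eventually allI) (meson less_le_trans)
          next
            case False
            then obtain d where d: "d \<in> D" "max b 0 < d" "d < y"
              using D(3)[rule_format, of "max b 0" y] b(1) 3 by auto
            have "\<forall>\<^sub>F n in sequentially. a < ?Fs n x d"
              using d b 3 by (intro order_tendstoD(1)[OF conv]) auto
            then show ?thesis
            proof eventually_elim
              case (elim n)
              then show ?case
                using Cs.cond_cdf_mono[OF x01 less_imp_le[OF d(3)], of n] by linarith
            qed
          qed
        qed
      qed
      then show "(\<lambda>n. cdf (markov_kernel (archimax (\<psi>s n) (As n)) x) y) \<longlonglongrightarrow> cdf (markov_kernel (archimax \<psi> A) x) y"
        by (simp only: cdf cdfs cond_cdf_def)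
    qed
  qed
qed

end

section \<open>Recovering the dependence function from the copula\<close>

lemma nphi_gen_pow:
  assumes "generator \<psi>" "0 < \<alpha>" "0 \<le> z" "0 < gen_pow \<alpha> \<psi> z"
  shows "nphi \<alpha> \<psi> (gen_pow \<alpha> \<psi> z) = z"
  using assms phi_gen[of \<psi> "z powr \<alpha>"] by (simp add: nphi_def gen_pow_def powr_powr)

text \<open>Where the limit copula is at least \<open>1 / 2\<close> the generators can be inverted
  in the limit, which turns convergence of copulas into convergence of \<open>nell\<close>; the
  point \<open>(x, y)\<close> is chosen to have the log ratio \<open>u\<close>.\<close>

lemma archimax_tendsto_imp_log_ell:
  assumes gen: "generator \<psi>" "\<And>n. generator (\<psi>s n)" and A: "pickands A" "\<And>n. pickands (As n)"
    and \<alpha>: "0 < \<alpha>" "\<And>n. 0 < \<alpha>s n"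
    and nphi: "\<And>x. x \<in> {0<..1} \<Longrightarrow> (\<lambda>n. nphi (\<alpha>s n) (\<psi>s n) x) \<longlonglongrightarrow> nphi \<alpha> \<psi> x"
    and conv: "\<And>x y. x \<in> {0<..<1} \<Longrightarrow> y \<in> {0<..<1} \<Longrightarrow> (\<lambda>n. archimax (\<psi>s n) (As n) x y) \<longlonglongrightarrow> archimax \<psi> A x y"
  shows "(\<lambda>n. log_ell (\<alpha>s n) (As n) u) \<longlonglongrightarrow> log_ell \<alpha> A u"
proof -
  \<comment> \<open>With this \<open>\<eta>\<close> the arguments \<open>\<eta> * exp u\<close> and
    \<open>\<eta>\<close> of \<open>nell\<close> and its value \<open>exp (- 1)\<close> are all at
    most 1, by \<open>0 \<le> L\<close> and \<open>u \<le> L\<close>; there the normalised generator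
    is at least \<open>1 / 2\<close>.\<close>
  define L \<eta> where "L = log_ell \<alpha> A u" and "\<eta> = exp (- L - 1)"
  have L: "0 \<le> L" "u \<le> L"
    unfolding L_def using log_ell_nonneg[OF A(1) \<alpha>(1)] log_ell_ge[OF A(1) \<alpha>(1)] by auto
  have range: "1 / 2 \<le> gen_pow \<alpha> \<psi> z \<and> gen_pow \<alpha> \<psi> z < 1" if "0 < z" "z \<le> 1" for z
  proof
    have "\<psi> 1 \<le> \<psi> (z powr \<alpha>)"
      using that \<alpha>(1) by (intro gen_antimonoD[OF gen(1)]) (auto intro: powr_le1)
    then show "1 / 2 \<le> gen_pow \<alpha> \<psi> z"
      by (simp add: gen_pow_def gen_1[OF gen(1)])
    show "gen_pow \<alpha> \<psi> z < 1"
      using gen_strict[OF gen(1), of 0 "z powr \<alpha>"] that by (simp add: gen_pow_def gen_0[OF gen(1)])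
  qed
  define s z x y where "s = \<eta> * exp u" and "z = \<eta> * exp L" and "x = gen_pow \<alpha> \<psi> s" and "y = gen_pow \<alpha> \<psi> \<eta>"
  have pos: "0 < s" "0 < \<eta>" "0 < z"
    by (simp_all add: s_def z_def \<eta>_def)
  have le: "s \<le> 1" "\<eta> \<le> 1" "z \<le> 1"
    using L by (simp_all add: s_def z_def \<eta>_def exp_add[symmetric])
  have xy: "x \<in> {0<..<1}" "y \<in> {0<..<1}"
    using range[OF pos(1) le(1)] range[OF pos(2) le(2)] by (auto simp: x_def y_def)
  have st: "nphi \<alpha> \<psi> x = s" "nphi \<alpha> \<psi> y = \<eta>"
    unfolding x_def y_def using xy pos by (auto simp: x_def y_def intro!: nphi_gen_pow gen \<alpha>)
  have u: "ln s - ln \<eta> = u"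
    using pos by (simp add: s_def ln_mult)
  define c where "c = gen_pow \<alpha> \<psi> z"
  have c: "1 / 2 \<le> c" "c < 1"
    using range[OF pos(3) le(3)] by (auto simp: c_def)
  have Cc: "archimax \<psi> A x y = c"
    using xy pos u by (subst archimax_eq_normalised[OF gen(1) A(1) \<alpha>(1)])
      (auto simp: st nell_eq[OF A(1) \<alpha>(1)] L_def[symmetric] c_def z_def)
  define cs ss ts where "cs n = archimax (\<psi>s n) (As n) x y"
    and "ss n = nphi (\<alpha>s n) (\<psi>s n) x" and "ts n = nphi (\<alpha>s n) (\<psi>s n) y" for n
  have cs: "cs \<longlonglongrightarrow> c"
    using conv[OF xy] by (simp add: cs_def[abs_def] Cc)
  have ss: "ss \<longlonglongrightarrow> s" and ts: "ts \<longlonglongrightarrow> \<eta>"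
    unfolding ss_def ts_def st[symmetric] using xy by (auto intro!: nphi)
  have stp: "0 < ss n" "0 < ts n" for n
    using xy by (simp_all add: ss_def ts_def nphi_pos[OF gen(2) \<alpha>(2)])
  have cs_eq: "cs n = gen_pow (\<alpha>s n) (\<psi>s n) (nell (\<alpha>s n) (As n) (ss n) (ts n))" for n
    using xy by (simp add: cs_def ss_def ts_def archimax_eq_normalised[OF gen(2) A(2) \<alpha>(2)])
  \<comment> \<open>The maximum keeps the argument in \<open>{0<..1}\<close> for all
    \<open>n\<close>; as the limit is at least \<open>1 / 2\<close>, it is eventually
    inactive.\<close>
  have "(\<lambda>n. nphi (\<alpha>s n) (\<psi>s n) (max (cs n) (1 / 4))) \<longlonglongrightarrow> nphi \<alpha> \<psi> c"
  proof (rule nphi_tendsto[OF gen \<alpha>])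
    show "(\<lambda>n. gen_pow (\<alpha>s n) (\<psi>s n) z) \<longlonglongrightarrow> gen_pow \<alpha> \<psi> z" if "0 \<le> z" for z
      by (rule tendsto_uniform_limitI[OF uniform_limit_gen_pow[OF gen \<alpha> nphi]]) (use that in auto)
    show "(\<lambda>n. max (cs n) (1 / 4)) \<longlonglongrightarrow> c"
      using tendsto_max[OF cs tendsto_const[of "1 / 4"]] c by (simp add: max_def)
    show "0 < max (cs n) (1 / 4)" for n
      by simp
    show "max (cs n) (1 / 4) \<le> 1" for n
      using gen_pow_bounds[OF gen(2) \<alpha>(2)] by (simp add: cs_eq)
  qed (use c in auto)
  moreover have "nphi \<alpha> \<psi> c = z"
    unfolding c_def using c pos by (intro nphi_gen_pow gen \<alpha>) (auto simp: c_def)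
  moreover have "\<forall>\<^sub>F n in sequentially. nphi (\<alpha>s n) (\<psi>s n) (max (cs n) (1 / 4)) = nell (\<alpha>s n) (As n) (ss n) (ts n)"
  proof -
    have "\<forall>\<^sub>F n in sequentially. 1 / 4 < cs n"
      using c by (intro order_tendstoD(1)[OF cs]) auto
    then show ?thesis
    proof eventually_elim
      case (elim n)
      then have "0 < gen_pow (\<alpha>s n) (\<psi>s n) (nell (\<alpha>s n) (As n) (ss n) (ts n))"
        by (simp add: cs_eq)
      from nphi_gen_pow[OF gen(2) \<alpha>(2) nell_nonneg[OF A(2) \<alpha>(2)] this] elim show ?case
        by (simp add: cs_eq max_def)
    qed
  qed
  ultimately have nell: "(\<lambda>n. nell (\<alpha>s n) (As n) (ss n) (ts n)) \<longlonglongrightarrow> z"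
    by (simp add: Lim_transform_eventually)
  define us where "us n = ln (ss n) - ln (ts n)" for n
  have us: "us \<longlonglongrightarrow> u"
    unfolding us_def u[symmetric] using pos by (intro tendsto_diff tendsto_ln ss ts) auto
  have "(\<lambda>n. ln (nell (\<alpha>s n) (As n) (ss n) (ts n)) - ln (ts n)) \<longlonglongrightarrow> ln z - ln \<eta>"
    using pos by (intro tendsto_diff tendsto_ln nell ts) auto
  moreover have "ln (nell (\<alpha>s n) (As n) (ss n) (ts n)) - ln (ts n) = log_ell (\<alpha>s n) (As n) (us n)" for n
    using stp[of n] by (simp add: nell_eq[OF A(2) \<alpha>(2)] us_def ln_mult)
  moreover have "ln z - ln \<eta> = L"
    using pos by (simp add: z_def ln_mult)
  ultimately have lim: "(\<lambda>n. log_ell (\<alpha>s n) (As n) (us n)) \<longlonglongrightarrow> L"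
    by simp
  \<comment> \<open>The log ratios \<open>us n\<close> only tend to \<open>u\<close>; the common
    Lipschitz bound moves the argument back to \<open>u\<close> itself.\<close>
  have "(\<lambda>n. log_ell (\<alpha>s n) (As n) u - log_ell (\<alpha>s n) (As n) (us n)) \<longlonglongrightarrow> 0"
  proof (rule Lim_null_comparison[OF always_eventually])
    show "\<forall>n. norm (log_ell (\<alpha>s n) (As n) u - log_ell (\<alpha>s n) (As n) (us n)) \<le> \<bar>us n - u\<bar>"
      using log_ell_Lipschitz[OF A(2) \<alpha>(2)] by (simp add: abs_minus_commute)
    show "(\<lambda>n. \<bar>us n - u\<bar>) \<longlonglongrightarrow> 0"
      by (rule tendsto_rabs_zero[OF LIM_zero[OF us]])
  qed
  from tendsto_add[OF this lim] show ?thesis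
    by (simp add: L_def)
qed

theorem theorem2:
  fixes \<psi> A :: "real \<Rightarrow> real"
    and \<psi>s As :: "nat \<Rightarrow> real \<Rightarrow> real"
  assumes "generator \<psi>" and "\<And>n. generator (\<psi>s n)"
    and "pickands A" and "\<exists>t\<in>{0..1}. A t \<noteq> pickands_M t"
    and "\<And>n. pickands (As n)" and "\<And>n. \<exists>t\<in>{0..1}. As n t \<noteq> pickands_M t"
  shows
    "let \<alpha> = 1 - kendall_tau (ev_copula A);
         \<alpha>s = (\<lambda>n. 1 - kendall_tau (ev_copula (As n)));
         C = archimax \<psi> A;
         Cs = (\<lambda>n. archimax (\<psi>s n) (As n));
         i = (uniform_limit {0..} (\<lambda>n. gen_pow (\<alpha>s n) (\<psi>s n)) (gen_pow \<alpha> \<psi>) sequentially \<and>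
              uniform_limit {0..1} (\<lambda>n. pick_pow (\<alpha>s n) (As n)) (pick_pow \<alpha> A) sequentially);
         ii = ((\<forall>x\<in>{0<..1}. (\<lambda>n. inv_pow (\<alpha>s n) (pseudo_inv (\<psi>s n)) x)
                              \<longlonglongrightarrow> inv_pow \<alpha> (pseudo_inv \<psi>) x) \<and>
               uniform_limit {0..1} (\<lambda>n. pick_pow (\<alpha>s n) (As n)) (pick_pow \<alpha> A) sequentially);
         iii = ((\<lambda>n. d_sup (Cs n) C) \<longlonglongrightarrow> 0);
         iv = (\<forall>p\<in>{1..\<infinity>}. (\<lambda>n. D_dist p (Cs n) C) \<longlonglongrightarrow> 0);
         v = weak_cond_conv Cs C
     in (i \<longleftrightarrow> ii) \<and> (ii \<longleftrightarrow> iii) \<and> (iii \<longleftrightarrow> iv) \<and> (iv \<longleftrightarrow> v)"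
proof -
  note gen = assms(1,2) and A = assms(3,5) and M = assms(4,6)
  define \<alpha> \<alpha>s where "\<alpha> = pick_alpha A" and "\<alpha>s n = pick_alpha (As n)" for n
  have \<alpha>_eq: "1 - kendall_tau (ev_copula A) = \<alpha>" "\<And>n. 1 - kendall_tau (ev_copula (As n)) = \<alpha>s n"
    unfolding \<alpha>_def \<alpha>s_def by (intro kendall_tau_ev_copula A M)+
  have \<alpha>: "0 < \<alpha>" "\<And>n. 0 < \<alpha>s n" and \<alpha>1: "\<alpha> \<le> 1" "\<And>n. \<alpha>s n \<le> 1"
    unfolding \<alpha>_def \<alpha>s_def by (intro pick_alpha_pos pick_alpha_le_1 A M)+
  let ?C = "archimax \<psi> A" and ?Cs = "\<lambda>n. archimax (\<psi>s n) (As n)"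
  interpret C: copula_kernel2 ?C "am_left \<psi> A" "gen_bad \<psi>" "am_right \<psi> A" "gen_bad \<psi>"
    by (rule archimax_copula_kernel2[OF gen(1) A(1)])
  interpret Cs: copula_kernel2 "?Cs n" "am_left (\<psi>s n) (As n)" "gen_bad (\<psi>s n)"
      "am_right (\<psi>s n) (As n)" "gen_bad (\<psi>s n)" for n
    by (rule archimax_copula_kernel2[OF gen(2) A(2)])
  let ?gen = "uniform_limit {0..} (\<lambda>n. gen_pow (\<alpha>s n) (\<psi>s n)) (gen_pow \<alpha> \<psi>) sequentially"
  let ?pick = "uniform_limit {0..1} (\<lambda>n. pick_pow (\<alpha>s n) (As n)) (pick_pow \<alpha> A) sequentially"
  let ?inv = "\<forall>x\<in>{0<..1}. (\<lambda>n. inv_pow (\<alpha>s n) (pseudo_inv (\<psi>s n)) x) \<longlonglongrightarrow> inv_pow \<alpha> (pseudo_inv \<psi>) x"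
  have inv_iff: "?inv \<longleftrightarrow> (\<forall>x\<in>{0<..1}. (\<lambda>n. nphi (\<alpha>s n) (\<psi>s n) x) \<longlonglongrightarrow> nphi \<alpha> \<psi> x)"
    by (intro ball_cong refl) (simp add: inv_pow_eq[OF gen(1) \<alpha>(1)] inv_pow_eq[OF gen(2) \<alpha>(2)]
        nphi_nonneg[OF gen(1) \<alpha>(1)] nphi_nonneg[OF gen(2) \<alpha>(2)])
  \<comment> \<open>(i) and (ii) differ only in their generator parts, and these are equivalent on
    their own.\<close>
  have i_ii: "?gen \<longleftrightarrow> ?inv"
  proof
    assume g: ?gen
    show ?inv
      unfolding inv_iff
    proof
      fix x :: real assume x: "x \<in> {0<..1}"
      show "(\<lambda>n. nphi (\<alpha>s n) (\<psi>s n) x) \<longlonglongrightarrow> nphi \<alpha> \<psi> x"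
      proof (rule nphi_tendsto[OF gen \<alpha>])
        show "(\<lambda>n. gen_pow (\<alpha>s n) (\<psi>s n) z) \<longlonglongrightarrow> gen_pow \<alpha> \<psi> z" if "0 \<le> z" for z
          using that by (intro tendsto_uniform_limitI[OF g]) auto
      qed (use x in auto)
    qed
  next
    assume ?inv
    then show ?gen
      unfolding inv_iff by (intro uniform_limit_gen_pow gen \<alpha>) auto
  qed
  have ii_v: "weak_cond_conv ?Cs ?C" if "?inv" "?pick"
  proof -
    interpret normalised_convergence \<psi> A \<alpha> \<psi>s As \<alpha>s
      by unfold_locales (use that in \<open>auto simp: inv_iff gen A \<alpha> \<alpha>1 intro: pick_pow_imp_log_ell[OF A \<alpha>]\<close>)
    show ?thesis by (rule weak_cond_conv_archimax)
  qed
  have v_iv: "(\<lambda>n. D_dist p (?Cs n) ?C) \<longlonglongrightarrow> 0" if "weak_cond_conv ?Cs ?C" "1 \<le> p" for p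
    by (rule weak_cond_conv_imp_D_dist[OF C.copula_kernel_axioms Cs.copula_kernel_axioms that])
  have iv_iii: "(\<lambda>n. d_sup (?Cs n) ?C) \<longlonglongrightarrow> 0" if "\<forall>p\<in>{1..\<infinity>}. (\<lambda>n. D_dist p (?Cs n) ?C) \<longlonglongrightarrow> 0"
  proof (rule D_inf_imp_d_sup[OF C.copula_kernel_axioms Cs.copula_kernel_axioms])
    have "(\<lambda>n. D_dist \<infinity> (?Cs n) ?C) \<longlonglongrightarrow> 0"
      using that by force
    then show "(\<lambda>n. D_inf (?Cs n) ?C) \<longlonglongrightarrow> 0"
      by (simp add: D_dist_def)
  qed
  have iii_ii: "?inv \<and> ?pick" if d: "(\<lambda>n. d_sup (?Cs n) ?C) \<longlonglongrightarrow> 0"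
  proof -
    have nphi: "(\<lambda>n. nphi (\<alpha>s n) (\<psi>s n) x) \<longlonglongrightarrow> nphi \<alpha> \<psi> x" if x: "x \<in> {0<..1}" for x
    proof (cases "x = 1")
      case True
      then show ?thesis
        by (simp add: nphi_1[OF gen(1) \<alpha>(1)] nphi_1[OF gen(2) \<alpha>(2)])
    next
      case False
      then have x: "0 < x" "x < 1" using x by auto
      \<comment> \<open>What converges is \<open>ln phi / \<alpha>\<close>, the logarithm of
        \<open>nphi\<close>; below 1 this is positive and can be recovered by
        \<open>exp\<close>.\<close>
      have "(\<lambda>n. exp (ln (nphi (\<alpha>s n) (\<psi>s n) x))) \<longlonglongrightarrow> exp (ln (nphi \<alpha> \<psi> x))"
        unfolding ln_nphi[OF gen(1) \<alpha>(1) x] ln_nphi[OF gen(2) \<alpha>(2) x] unfolding \<alpha>_def \<alpha>s_def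
        using x by (intro tendsto_exp d_sup_imp_phi_tendsto[OF gen A M d]) auto
      then show ?thesis
        using x by (simp add: nphi_pos[OF gen(1) \<alpha>(1)] nphi_pos[OF gen(2) \<alpha>(2)])
    qed
    have pw: "(\<lambda>n. ?Cs n x y) \<longlonglongrightarrow> ?C x y" if "x \<in> {0<..<1}" "y \<in> {0<..<1}" for x y
    proof -
      interpret P: copula_kernel_pair "?Cs n" ?C "am_left (\<psi>s n) (As n)" "am_left \<psi> A" "gen_bad (\<psi>s n)" "gen_bad \<psi>" for n
        by (intro copula_kernel_pairI C.copula_kernel_axioms Cs.copula_kernel_axioms)
      have "(\<lambda>n. ?Cs n x y - ?C x y) \<longlonglongrightarrow> 0"
        by (rule Lim_null_comparison[OF always_eventually d])
           (use that in \<open>auto intro!: P.abs_diff_le_d_sup\<close>)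
      then show ?thesis by (simp add: LIM_zero_iff)
    qed
    have "?pick"
      by (intro uniform_limit_pick_pow A \<alpha> archimax_tendsto_imp_log_ell[OF gen A \<alpha> nphi pw])
    with nphi show ?thesis by (simp add: inv_iff)
  qed
  \<comment> \<open>The implications form the cycle (ii), (v), (iv), (iii), (ii); with (i) attached
    to (ii) all the equivalences follow.\<close>
  show ?thesis
    unfolding Let_def \<alpha>_eq using i_ii ii_v v_iv iv_iii iii_ii by auto
qed

end
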